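(* For $j\in\{1,2\}$ let $M_j$ be a smooth manifold, let $E_r^j\to M_j$, $E_{p_i}^j\to M_j$, $E_{p_e}^j\to M_j$ be smooth vector bundles, let $\mathcal{D}_j\leq \big(\mathcal{T}M_j\oplus E_r^j\oplus E_{p_i}^j\oplus E_{p_e}^j\big)\oplus\big(\mathcal{T}^*M_j\oplus (E_r^j)^*\oplus (E_{p_i}^j)^*\oplus (E_{p_e}^j)^*\big)$ be a Dirac structure, let $\mathcal{R}_j\leq E_r^j\oplus (E_r^j)^*$ be a non-negative Lagrangian subbundle and let $H_j\in\mathcal{C}^\infty(M_j)$. Let $\mathcal{D}_{\mathrm{int}}\leq \big(E_{p_e}^1\times E_{p_e}^2\big)\oplus\big((E_{p_e}^1)^*\times (E_{p_e}^2)^*\big)$ be a Dirac structure over $M_1\times M_2$ which is an admissible interconnection constraint for $(\mathcal{D}_1,\mathcal{D}_2)$. If $(\mathcal{D}_1\times\mathcal{D}_2)\cap\mathcal{D}_{\mathrm{int}}$ has constant rank, then for $\mathfrak{t}\in\{\mathrm{c},\mathrm{w}\}$ and all real $t_0<t_1$, $$\big(\mathfrak{B}^{\mathfrak{t}}_{\mathcal{D}_1,\mathcal{R}_1,H_1}\Vert_{\mathcal{D}_{\mathrm{int}}}\mathfrak{B}^{\mathfrak{t}}_{\mathcal{D}_2,\mathcal{R}_2,H_2}\big)([t_0,t_1])=\mathfrak{B}^{\mathfrak{t}}_{\mathcal{D}_1\Vert_{\mathcal{D}_{\mathrm{int}}}\mathcal{D}_2,\ \mathcal{R}_1\boxplus\mathcal{R}_2,\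 H_1+H_2}([t_0,t_1]).$$
   Context: All manifolds and vector bundles are smooth and of finite dimension/rank; rank-zero bundles are allowed. \textbf{Geometry.} For a vector bundle $E\to M$, $E\oplus E^*$ carries fibrewise the forms $\langle\langle (f,e),(f',e')\rangle\rangle=\langle e',f\rangle+\langle e,f'\rangle$ and $\Omega((f,e),(f',e'))=\langle e',f\rangle-\langle e,f'\rangle$. A Dirac structure (Lagrangian subbundle) is a smooth subvector bundle of $E\oplus E^*$ of rank $\mathrm{rk}\,E$ that is isotropic with respect to $\langle\langle\cdot,\cdot\rangle\rangle$ (respectively $\Omega$). A subbundle is non-negative if $\langle\langle\cdot,\cdot\rangle\rangle$ restricted to it is positive semidefinite. For bundles $A\to M_1$, $B\to M_2$, $A\times B\to M_1\times M_2$ is the product bundle, with fibre $A_{x_1}\oplus B_{x_2}$ at $(x_1,x_2)$; $\mathcal{R}_1\boxplus\mathcal{R}_2$ is the bundle over $M_1\times M_2$ of all $(f_1,f_2,e_1,e_2)$ with $(f_j,e_j)\in(\mathcal{R}_j)_{x_j}$. \textbf{Function spaces.} The shadow of a curve in (the total space of) a vector bundle is its composition with the bundle projection. For a compact interval $I=[t_0,t_1]$ and a manifold $N$, $\mathcal{C}^k(I,N)$ is the set of continuous curves $I\to N$ that extend to a $\mathcal{C}^k$ curve on an open interval containing $I$. For a vector bundle $E\to M$, $\mathcal{L}^1_c(I,E)$ is the set of measurable curves $\xi:I\to E$ with continuous shadow such that $\sqrt{g(\xi,\xi)}$ is integrable for some (equivalently every) vector bundle metric $g$. A continuous curve $x:I\to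 M$ is weakly differentiable with weak derivative $X:I\to\mathcal{T}M$ (a curve over $x$) if for every chart $\varphi_U:U\to\mathbb{R}^n$ of an atlas, $\varphi_U\circ x$ is weakly differentiable on $x^{-1}(U)\cap(t_0,t_1)$ with weak derivative $\mathrm{d}\varphi_U X$; $(\mathcal{C}\cap W^{1,1})(I,M)$ is the set of such $x$ having a weak derivative in $\mathcal{L}^1_c(I,\mathcal{T}M)$; this weak derivative is denoted $\tfrac{\mathrm{d}}{\mathrm{d}t}x$. \textbf{Weak sense.} Let $(f,e)\in\mathcal{L}^1_c(I,E\oplus E^* )$ have shadow $x$. For a Dirac structure $\mathcal{D}\le E\oplus E^*$, $(f,e)\in\mathcal{D}$ in the weak sense means $\int_I\langle\varepsilon(t),f(t)\rangle+\langle e(t),\varphi(t)\rangle\,\mathrm{d}t=0$ for all continuous sections $(\varphi,\varepsilon)$ of $x^*\mathcal{D}$ with compact support in $(t_0,t_1)$. For a Lagrangian subbundle, the same with $+$ replaced by $-$. \textbf{Behaviours.} Let $E_r,E_p\to M$ be vector bundles, $\mathcal{D}\le(\mathcal{T}M\oplus E_r\oplus E_p)\oplus(\mathcal{T}^*M\oplus E_r^*\oplus E_p^* )$ a Dirac structure, $\mathcal{R}\le E_r\oplus E_r^*$ a non-negative Lagrangian subbundle, $H\in\mathcal{C}^\infty(M)$. The port-Hamiltonian system is $$\big(\tfrac{\mathrm{d}}{\mathrm{d}t}x,f,-y,\mathrm{d}H_x,e,u\big)\in\mathcal{D}_x,\qquad(f,e)\in\mathcal{R}_x.\qquad( * )$$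 The classical behaviour $\mathfrak{B}^{\mathrm{c}}_{\mathcal{D},\mathcal{R},H}(I)$ is the set of continuous curves $(f,y,e,u):I\to E_r\oplus E_p\oplus E_r^*\oplus E_p^*$ whose shadow $x$ is in $\mathcal{C}^1(I,M)$ and for which $( * )$ holds at every point of $I$. The weak behaviour $\mathfrak{B}^{\mathrm{w}}_{\mathcal{D},\mathcal{R},H}(I)$ is the set of $(f,y,e,u)\in\mathcal{L}^1_c(I,E_r\oplus E_p\oplus E_r^*\oplus E_p^* )$ whose shadow $x$ is in $(\mathcal{C}\cap W^{1,1})(I,M)$ and for which both relations in $( * )$ hold in the weak sense. \textbf{Interconnection.} $\mathcal{D}_1\Vert_{\mathcal{D}_{\mathrm{int}}}\mathcal{D}_2$ has as fibre over $(x_1,x_2)\in M_1\times M_2$ the set of all $(v_1,v_2,f_1,f_2,\eta_1,\eta_2,\alpha_1,\alpha_2,e_1,e_2,u_1,u_2)$ for which there is $(\zeta_1,\zeta_2,w_1,w_2)\in(\mathcal{D}_{\mathrm{int}})_{(x_1,x_2)}$ with $(v_j,f_j,\eta_j,\zeta_j,\alpha_j,e_j,u_j,w_j)\in(\mathcal{D}_j)_{x_j}$ for $j=1,2$. Each fibre is a (linear) Dirac structure; $\mathcal{D}_{\mathrm{int}}$ is an admissible interconnection constraint for $(\mathcal{D}_1,\mathcal{D}_2)$ if $\mathcal{D}_1\Vert_{\mathcal{D}_{\mathrm{int}}}\mathcal{D}_2$ is a smooth subvector bundle. $(\mathcal{D}_1\times\mathcal{D}_2)\cap\mathcal{D}_{\mathrm{int}}$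 has as fibre over $(x_1,x_2)$ the space of all $(\zeta_1,\zeta_2,w_1,w_2)\in(\mathcal{D}_{\mathrm{int}})_{(x_1,x_2)}$ with $(0,0,0,\zeta_j,0,0,0,w_j)\in(\mathcal{D}_j)_{x_j}$ for $j=1,2$; constant rank means that the dimension of this fibre does not depend on $(x_1,x_2)$. $\mathfrak{B}^{\mathfrak{t}}_{\mathcal{D}_1\Vert_{\mathcal{D}_{\mathrm{int}}}\mathcal{D}_2,\mathcal{R}_1\boxplus\mathcal{R}_2,H_1+H_2}$ is the behaviour over $M_1\times M_2$ with resistive bundle $E_r^1\times E_r^2$, external port bundle $E_{p_i}^1\times E_{p_i}^2$ and Hamiltonian $(x_1,x_2)\mapsto H_1(x_1)+H_2(x_2)$. In $\mathfrak{B}^{\mathfrak{t}}_{\mathcal{D}_j,\mathcal{R}_j,H_j}$ the external port bundle is $E_p=E_{p_i}^j\oplus E_{p_e}^j$. The behavioural interconnection $\big(\mathfrak{B}^{\mathfrak{t}}_{\mathcal{D}_1,\mathcal{R}_1,H_1}\Vert_{\mathcal{D}_{\mathrm{int}}}\mathfrak{B}^{\mathfrak{t}}_{\mathcal{D}_2,\mathcal{R}_2,H_2}\big)(I)$ is the set of curves $(f_1,f_2,y_1^1,y_2^1,e_1,e_2,u_1^1,u_2^1)$ on $I$ with values in $(E_r^1\times E_r^2)\oplus(E_{p_i}^1\times E_{p_i}^2)\oplus(E_r^1\times E_r^2)^*\oplus(E_{p_i}^1\times E_{p_i}^2)^*$ for which there exists a curve $(y_1^2,y_2^2,u_1^2,u_2^2):I\to\mathcal{D}_{\mathrm{int}}$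 (over the same base curve) with $(f_j,y_j^1,-y_j^2,e_j,u_j^1,u_j^2)\in\mathfrak{B}^{\mathfrak{t}}_{\mathcal{D}_j,\mathcal{R}_j,H_j}(I)$ for $j=1,2$. *)

theory Defs
  imports "HOL-Analysis.Analysis" "HOL-Library.Function_Algebras"
begin

section \<open>Functions into a real vector space as a real vector space\<close>

instantiation "fun" :: (type, real_vector) real_vector
begin

definition scaleR_fun :: "real \<Rightarrow> ('a \<Rightarrow> 'b) \<Rightarrow> 'a \<Rightarrow> 'b"
  where "scaleR_fun a f = (\<lambda>x. a *\<^sub>R f x)"

instance
  by standard (simp_all add: scaleR_fun_def fun_eq_iff algebra_simps)

end


section \<open>Smooth functions on open subsets of \<open>\<real>\<^sup>n\<close>\<close>

text \<open>
  Here \<open>\<real>\<^sup>n\<close> is \<^const>\<open>Euclidean_space\<close> \<open>n\<close>, the sequences vanishing from index \<open>n\<close> on. Unlike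
  a type of class \<open>euclidean_space\<close> it exists for \<open>n = 0\<close>, so that zero-dimensional manifolds
  and bundles of rank zero are covered.
\<close>

definition partial_deriv :: "nat \<Rightarrow> ((nat \<Rightarrow> real) \<Rightarrow> real) \<Rightarrow> (nat \<Rightarrow> real) \<Rightarrow> real" where
  "partial_deriv i f p = deriv (\<lambda>h. f (p(i := h))) (p i)"

fun Ck_on :: "nat \<Rightarrow> nat \<Rightarrow> (nat \<Rightarrow> real) set \<Rightarrow> ((nat \<Rightarrow> real) \<Rightarrow> real) \<Rightarrow> bool" where
  "Ck_on n 0 S f = continuous_on S f"
| "Ck_on n (Suc k) S f = (continuous_on S f \<and>
     (\<forall>i<n. (\<forall>p\<in>S. (\<lambda>h. f (p(i := h))) field_differentiable (at (p i))) \<and>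
            Ck_on n k S (partial_deriv i f)))"

definition smooth_on :: "nat \<Rightarrow> (nat \<Rightarrow> real) set \<Rightarrow> ((nat \<Rightarrow> real) \<Rightarrow> real) \<Rightarrow> bool" where
  "smooth_on n S f \<longleftrightarrow> (\<forall>k. Ck_on n k S f)"


section \<open>Smooth manifolds\<close>

type_synonym 'm chart = "'m set \<times> ('m \<Rightarrow> nat \<Rightarrow> real)"

record 'm manifold =
  mtop :: "'m topology"
  mdim :: nat
  atlas :: "'m chart set"

abbreviation points :: "'m manifold \<Rightarrow> 'm set" where
  "points M \<equiv> topspace (mtop M)"

definition smooth_fun_on :: "'m manifold \<Rightarrow> 'm set \<Rightarrow> ('m \<Rightarrow> real) \<Rightarrow> bool" where
  "smooth_fun_on M W f \<longleftrightarrow>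
     (\<forall>(U, \<phi>)\<in>atlas M. smooth_on (mdim M) (\<phi> ` (U \<inter> W)) (f \<circ> inv_into U \<phi>))"

definition smooth_manifold :: "'m manifold \<Rightarrow> bool" where
  "smooth_manifold M \<longleftrightarrow>
     Hausdorff_space (mtop M) \<and> second_countable (mtop M) \<and>
     (\<forall>(U, \<phi>)\<in>atlas M. openin (mtop M) U \<and> openin (Euclidean_space (mdim M)) (\<phi> ` U) \<and>
        homeomorphic_map (subtopology (mtop M) U)
          (subtopology (Euclidean_space (mdim M)) (\<phi> ` U)) \<phi>) \<and>
     (\<Union>(U, \<phi>)\<in>atlas M. U) = points M \<and>
     (\<forall>(V, \<psi>)\<in>atlas M. \<forall>i<mdim M. smooth_fun_on M V (\<lambda>x. \<psi> x i))"

definition prod_chart :: "nat \<Rightarrow> 'm chart \<Rightarrow> 'n chart \<Rightarrow> ('m \<times> 'n) chart" where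
  "prod_chart d c c' =
     (fst c \<times> fst c', \<lambda>(x, y) i. if i < d then snd c x i else snd c' y (i - d))"

definition prod_manifold :: "'m manifold \<Rightarrow> 'n manifold \<Rightarrow> ('m \<times> 'n) manifold" where
  "prod_manifold M N =
     \<lparr>mtop = prod_topology (mtop M) (mtop N), mdim = mdim M + mdim N,
      atlas = {prod_chart (mdim M) c c' |c c'. c \<in> atlas M \<and> c' \<in> atlas N}\<rparr>"


section \<open>Vector bundles\<close>

definition is_frame :: "nat \<Rightarrow> (nat \<Rightarrow> 'v::real_vector) \<Rightarrow> 'v set \<Rightarrow> bool" where
  "is_frame r b V \<longleftrightarrow>
     inj_on b {..<r} \<and> independent (b ` {..<r}) \<and> span (b ` {..<r}) = V"

definition frame_coord :: "nat \<Rightarrow> (nat \<Rightarrow> 'v::real_vector) \<Rightarrow> 'v \<Rightarrow> nat \<Rightarrow> real" where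
  "frame_coord r b v i = (if i < r then representation (b ` {..<r}) v (b i) else 0)"

text \<open>
  The fibres are linear subspaces of a fixed real vector space \<open>'v\<close>, which carries no topology and
  may have infinite dimension; a point of the total space is a pair of a base point and an element
  of the fibre over it. Up to isomorphism every vector bundle has this form. A frame \<open>(U, s)\<close>
  encodes the local trivialization \<open>U \<times> \<real>\<^sup>r \<rightarrow> E|U\<close>, \<open>(x, a) \<mapsto> (x, \<Sum>i<r. a i *\<^sub>R s i x)\<close>.
\<close>

record ('m, 'v) vbundle =
  fibre :: "'m \<Rightarrow> 'v set"
  vrank :: nat
  vframes :: "('m set \<times> (nat \<Rightarrow> 'm \<Rightarrow> 'v)) set"

definition total_space :: "'m manifold \<Rightarrow> ('m, 'v) vbundle \<Rightarrow> ('m \<times> 'v) set" where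
  "total_space M E = Sigma (points M) (fibre E)"

definition smooth_section_on ::
    "'m manifold \<Rightarrow> ('m, 'v::real_vector) vbundle \<Rightarrow> 'm set \<Rightarrow> ('m \<Rightarrow> 'v) \<Rightarrow> bool" where
  "smooth_section_on M E W \<sigma> \<longleftrightarrow>
     (\<forall>x\<in>W. \<sigma> x \<in> fibre E x) \<and>
     (\<forall>(U, s)\<in>vframes E. \<forall>i<vrank E.
        smooth_fun_on M (U \<inter> W) (\<lambda>x. frame_coord (vrank E) (\<lambda>k. s k x) (\<sigma> x) i))"

text \<open>
  The last conjunct says that the transition functions between the local trivializations are smooth.
\<close>

definition vector_bundle :: "'m manifold \<Rightarrow> ('m, 'v::real_vector) vbundle \<Rightarrow> bool" where
  "vector_bundle M E \<longleftrightarrow>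
     (\<Union>(U, s)\<in>vframes E. U) = points M \<and>
     (\<forall>(U, s)\<in>vframes E. openin (mtop M) U \<and>
        (\<forall>x\<in>U. is_frame (vrank E) (\<lambda>i. s i x) (fibre E x))) \<and>
     (\<forall>(U, s)\<in>vframes E. \<forall>j<vrank E. smooth_section_on M E U (s j))"

text \<open>
  The total space carries the topology for which the local trivializations are homeomorphisms onto
  open subsets.
\<close>

definition open_total :: "'m manifold \<Rightarrow> ('m, 'v::real_vector) vbundle \<Rightarrow> ('m \<times> 'v) set \<Rightarrow> bool" where
  "open_total M E W \<longleftrightarrow> W \<subseteq> total_space M E \<and>
     (\<forall>(U, s)\<in>vframes E.
        openin (prod_topology (subtopology (mtop M) U) (Euclidean_space (vrank E)))
          {(x, a). x \<in> U \<inter> points M \<and> a \<in> topspace (Euclidean_space (vrank E)) \<and>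
                   (x, \<Sum>i<vrank E. a i *\<^sub>R s i x) \<in> W})"

definition total_topology :: "'m manifold \<Rightarrow> ('m, 'v::real_vector) vbundle \<Rightarrow> ('m \<times> 'v) topology" where
  "total_topology M E = topology (open_total M E)"

lemma istopology_open_total: "istopology (open_total M E)"
proof -
  define r where "r = vrank E"
  define T where
    "T U = prod_topology (subtopology (mtop M) U) (Euclidean_space r)" for U :: "'a set"
  define P where
    "P U s W = {(x, a). x \<in> U \<inter> points M \<and> a \<in> topspace (Euclidean_space r) \<and>
                   (x, \<Sum>i<r. a i *\<^sub>R s i x) \<in> W}"
    for U :: "'a set" and s :: "nat \<Rightarrow> 'a \<Rightarrow> 'b" and W
  have eq: "open_total M E W \<longleftrightarrow>
      W \<subseteq> total_space M E \<and> (\<forall>(U, s)\<in>vframes E. openin (T U) (P U s W))" for W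
    by (simp add: open_total_def T_def P_def r_def)
  have int: "P U s (A \<inter> B) = P U s A \<inter> P U s B" for U s A B
    by (auto simp: P_def)
  have un: "P U s (\<Union>K) = (\<Union>W\<in>K. P U s W)" for U s K
    by (auto simp: P_def)
  show ?thesis
    unfolding istopology_def eq
  proof (intro conjI allI impI)
    fix A B
    assume "A \<subseteq> total_space M E \<and> (\<forall>(U, s)\<in>vframes E. openin (T U) (P U s A))"
      and "B \<subseteq> total_space M E \<and> (\<forall>(U, s)\<in>vframes E. openin (T U) (P U s B))"
    then show "A \<inter> B \<subseteq> total_space M E"
      and "\<forall>(U, s)\<in>vframes E. openin (T U) (P U s (A \<inter> B))"
      by (auto simp: int intro!: openin_Int)
  next
    fix K
    assume "\<forall>W\<in>K. W \<subseteq> total_space M E \<and> (\<forall>(U, s)\<in>vframes E. openin (T U) (P U s W))"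
    then show "\<Union>K \<subseteq> total_space M E"
      and "\<forall>(U, s)\<in>vframes E. openin (T U) (P U s (\<Union>K))"
      by (auto simp: un intro!: openin_Union)
  qed
qed

definition smooth_subbundle ::
    "'m manifold \<Rightarrow> ('m, 'v::real_vector) vbundle \<Rightarrow> nat \<Rightarrow> ('m \<Rightarrow> 'v set) \<Rightarrow> bool" where
  "smooth_subbundle M E k D \<longleftrightarrow>
     (\<forall>x\<in>points M. subspace (D x) \<and> D x \<subseteq> fibre E x) \<and>
     (\<forall>x\<in>points M. \<exists>U s. openin (mtop M) U \<and> x \<in> U \<and>
        (\<forall>i<k. smooth_section_on M E U (s i)) \<and>
        (\<forall>y\<in>U. is_frame k (\<lambda>i. s i y) (D y)))"

definition dsum ::
    "('m, 'v::real_vector) vbundle \<Rightarrow> ('m, 'w::real_vector) vbundle \<Rightarrow> ('m, 'v \<times> 'w) vbundle" where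
  "dsum E F =
     \<lparr>fibre = (\<lambda>x. fibre E x \<times> fibre F x), vrank = vrank E + vrank F,
      vframes = {(U \<inter> V, \<lambda>i x. if i < vrank E then (s i x, 0) else (0, t (i - vrank E) x)) |U s V t.
                  (U, s) \<in> vframes E \<and> (V, t) \<in> vframes F}\<rparr>"

definition ext_prod ::
    "('m, 'v::real_vector) vbundle \<Rightarrow> ('n, 'w::real_vector) vbundle \<Rightarrow> ('m \<times> 'n, 'v \<times> 'w) vbundle" where
  "ext_prod E F =
     \<lparr>fibre = (\<lambda>(x, y). fibre E x \<times> fibre F y), vrank = vrank E + vrank F,
      vframes = {(U \<times> V, \<lambda>i (x, y). if i < vrank E then (s i x, 0) else (0, t (i - vrank E) y)) |U s V t.
                  (U, s) \<in> vframes E \<and> (V, t) \<in> vframes F}\<rparr>"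

text \<open>
  A linear functional on a subspace \<open>V\<close> is represented by the function on all of \<open>'v\<close> that vanishes
  off \<open>V\<close>; it is linear on \<open>V\<close> only.
\<close>

definition dual_space :: "'v::real_vector set \<Rightarrow> ('v \<Rightarrow> real) set" where
  "dual_space V = {\<alpha>. (\<forall>v\<in>V. \<forall>w\<in>V. \<alpha> (v + w) = \<alpha> v + \<alpha> w) \<and>
                      (\<forall>a. \<forall>v\<in>V. \<alpha> (a *\<^sub>R v) = a * \<alpha> v) \<and> (\<forall>v. v \<notin> V \<longrightarrow> \<alpha> v = 0)}"

definition dual_bundle :: "('m, 'v::real_vector) vbundle \<Rightarrow> ('m, 'v \<Rightarrow> real) vbundle" where
  "dual_bundle E =
     \<lparr>fibre = (\<lambda>x. dual_space (fibre E x)), vrank = vrank E,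
      vframes = {(U, \<lambda>i x v. if v \<in> fibre E x then frame_coord (vrank E) (\<lambda>k. s k x) v i else 0) |U s.
                  (U, s) \<in> vframes E}\<rparr>"

text \<open>
  A bundle together with a realization of its dual and the duality pairing \<open>\<langle>e, f\<rangle>\<close>, \<open>e\<close> first. This
  makes the identifications \<open>(E \<oplus> F)\<^sup>* = E\<^sup>* \<oplus> F\<^sup>*\<close> and \<open>(E \<times> F)\<^sup>* = E\<^sup>* \<times> F\<^sup>*\<close> hold by construction.
\<close>

record ('m, 'v, 'w) paired =
  vb :: "('m, 'v) vbundle"
  dvb :: "('m, 'w) vbundle"
  pairing :: "'w \<Rightarrow> 'v \<Rightarrow> real"

definition with_dual :: "('m, 'v::real_vector) vbundle \<Rightarrow> ('m, 'v, 'v \<Rightarrow> real) paired" where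
  "with_dual E = \<lparr>vb = E, dvb = dual_bundle E, pairing = (\<lambda>e f. e f)\<rparr>"

definition psum ::
    "('m, 'v::real_vector, 'v'::real_vector) paired \<Rightarrow> ('m, 'w::real_vector, 'w'::real_vector) paired
      \<Rightarrow> ('m, 'v \<times> 'w, 'v' \<times> 'w') paired" where
  "psum E F = \<lparr>vb = dsum (vb E) (vb F), dvb = dsum (dvb E) (dvb F),
               pairing = (\<lambda>(a, b) (v, w). pairing E a v + pairing F b w)\<rparr>"

definition pprod ::
    "('m, 'v::real_vector, 'v'::real_vector) paired \<Rightarrow> ('n, 'w::real_vector, 'w'::real_vector) paired
      \<Rightarrow> ('m \<times> 'n, 'v \<times> 'w, 'v' \<times> 'w') paired" where
  "pprod E F = \<lparr>vb = ext_prod (vb E) (vb F), dvb = ext_prod (dvb E) (dvb F),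
                pairing = (\<lambda>(a, b) (v, w). pairing E a v + pairing F b w)\<rparr>"

definition dbl ::
    "('m, 'v::real_vector, 'v'::real_vector) paired \<Rightarrow> ('m, 'v \<times> 'v') vbundle" where
  "dbl E = dsum (vb E) (dvb E)"


section \<open>Tangent bundle\<close>

text \<open>
  A tangent vector at \<open>x\<close> is the family of its coordinate vectors in all charts of the atlas around
  \<open>x\<close>, these being related by the Jacobians of the coordinate changes; it is zero at all other charts.
\<close>

type_synonym 'm tvec = "'m chart \<Rightarrow> nat \<Rightarrow> real"

definition charts_at :: "'m manifold \<Rightarrow> 'm \<Rightarrow> 'm chart set" where
  "charts_at M x = {c \<in> atlas M. x \<in> fst c}"

definition chart_inv :: "'m chart \<Rightarrow> (nat \<Rightarrow> real) \<Rightarrow> 'm" where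
  "chart_inv c = inv_into (fst c) (snd c)"

definition jacobian :: "('m \<Rightarrow> 'n) \<Rightarrow> 'm chart \<Rightarrow> 'n chart \<Rightarrow> 'm \<Rightarrow> nat \<Rightarrow> nat \<Rightarrow> real" where
  "jacobian F c c' x i j = partial_deriv j (\<lambda>p. snd c' (F (chart_inv c p)) i) (snd c x)"

definition tangent_space :: "'m manifold \<Rightarrow> 'm \<Rightarrow> 'm tvec set" where
  "tangent_space M x = {v.
     (\<forall>c. c \<notin> charts_at M x \<longrightarrow> v c = 0) \<and>
     (\<forall>c\<in>charts_at M x. v c \<in> topspace (Euclidean_space (mdim M))) \<and>
     (\<forall>c\<in>charts_at M x. \<forall>c'\<in>charts_at M x. \<forall>i<mdim M.
        v c' i = (\<Sum>j<mdim M. jacobian id c c' x i j * v c j))}"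

definition coordinate_field :: "'m manifold \<Rightarrow> 'm chart \<Rightarrow> nat \<Rightarrow> 'm \<Rightarrow> 'm tvec" where
  "coordinate_field M c j x =
     (\<lambda>c' i. if c' \<in> charts_at M x \<and> i < mdim M then jacobian id c c' x i j else 0)"

definition tangent :: "'m manifold \<Rightarrow> ('m, 'm tvec) vbundle" where
  "tangent M = \<lparr>fibre = tangent_space M, vrank = mdim M,
                vframes = {(fst c, coordinate_field M c) |c. c \<in> atlas M}\<rparr>"

text \<open>The chart chosen in the next two definitions does not affect the result.\<close>

definition differential :: "'m manifold \<Rightarrow> ('m \<Rightarrow> real) \<Rightarrow> 'm \<Rightarrow> 'm tvec \<Rightarrow> real" where
  "differential M H x =
     (\<lambda>v. let c = (SOME c. c \<in> charts_at M x) in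
        if v \<in> tangent_space M x
        then \<Sum>j<mdim M. partial_deriv j (\<lambda>p. H (chart_inv c p)) (snd c x) * v c j else 0)"

definition tangent_map :: "'m manifold \<Rightarrow> 'n manifold \<Rightarrow> ('m \<Rightarrow> 'n) \<Rightarrow> 'm \<Rightarrow> 'm tvec \<Rightarrow> 'n tvec" where
  "tangent_map M N F x v =
     (let c = (SOME c. c \<in> charts_at M x) in
      (\<lambda>c' i. if c' \<in> charts_at N (F x) \<and> i < mdim N
              then \<Sum>j<mdim M. jacobian F c c' x i j * v c j else 0))"


section \<open>Dirac structures and Lagrangian subbundles\<close>

definition dirac_structure ::
    "'m manifold \<Rightarrow> ('m, 'v::real_vector, 'w::real_vector) paired \<Rightarrow> ('m \<Rightarrow> ('v \<times> 'w) set) \<Rightarrow> bool" where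
  "dirac_structure M E D \<longleftrightarrow>
     smooth_subbundle M (dbl E) (vrank (vb E)) D \<and>
     (\<forall>x\<in>points M. \<forall>(f, e)\<in>D x. \<forall>(f', e')\<in>D x. pairing E e' f + pairing E e f' = 0)"

definition lagrangian_subbundle ::
    "'m manifold \<Rightarrow> ('m, 'v::real_vector, 'w::real_vector) paired \<Rightarrow> ('m \<Rightarrow> ('v \<times> 'w) set) \<Rightarrow> bool" where
  "lagrangian_subbundle M E L \<longleftrightarrow>
     smooth_subbundle M (dbl E) (vrank (vb E)) L \<and>
     (\<forall>x\<in>points M. \<forall>(f, e)\<in>L x. \<forall>(f', e')\<in>L x. pairing E e' f - pairing E e f' = 0)"

definition non_negative ::
    "'m manifold \<Rightarrow> ('m, 'v, 'w) paired \<Rightarrow> ('m \<Rightarrow> ('v \<times> 'w) set) \<Rightarrow> bool" where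
  "non_negative M E L \<longleftrightarrow>
     (\<forall>x\<in>points M. \<forall>(f, e)\<in>L x. pairing E e f + pairing E e f \<ge> 0)"


section \<open>Curves\<close>

text \<open>
  A curve on \<open>{t0..t1}\<close> is a function on \<open>real\<close> whose values off the interval are irrelevant: no
  condition below depends on them. A curve in a bundle takes values in the total space and its
  shadow is \<open>fst \<circ> \<xi>\<close>.
\<close>

definition continuous_curve ::
    "'m manifold \<Rightarrow> ('m, 'v::real_vector) vbundle \<Rightarrow> real \<Rightarrow> real \<Rightarrow> (real \<Rightarrow> 'm \<times> 'v) \<Rightarrow> bool" where
  "continuous_curve M E t0 t1 \<xi> \<longleftrightarrow>
     continuous_map (top_of_set {t0..t1}) (total_topology M E) \<xi>"

definition C1_on_open_interval :: "'m manifold \<Rightarrow> real \<Rightarrow> real \<Rightarrow> (real \<Rightarrow> 'm) \<Rightarrow> bool" where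
  "C1_on_open_interval M a b x \<longleftrightarrow>
     continuous_map (top_of_set {a<..<b}) (mtop M) x \<and>
     (\<forall>(U, \<phi>)\<in>atlas M. \<forall>i<mdim M.
        (\<forall>t\<in>{t\<in>{a<..<b}. x t \<in> U}. (\<lambda>s. \<phi> (x s) i) field_differentiable (at t)) \<and>
        continuous_on {t\<in>{a<..<b}. x t \<in> U} (deriv (\<lambda>s. \<phi> (x s) i)))"

definition C1_curve :: "'m manifold \<Rightarrow> real \<Rightarrow> real \<Rightarrow> (real \<Rightarrow> 'm) \<Rightarrow> bool" where
  "C1_curve M t0 t1 x \<longleftrightarrow>
     (\<exists>a b z. a < t0 \<and> t1 < b \<and> C1_on_open_interval M a b z \<and> (\<forall>t\<in>{t0..t1}. z t = x t))"

definition velocity :: "'m manifold \<Rightarrow> real \<Rightarrow> real \<Rightarrow> (real \<Rightarrow> 'm) \<Rightarrow> real \<Rightarrow> 'm tvec" where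
  "velocity M t0 t1 x t =
     (\<lambda>c i. if c \<in> charts_at M (x t) \<and> i < mdim M
            then vector_derivative (\<lambda>s. snd c (x s) i) (at t within {t0..t1}) else 0)"

definition bundle_metric ::
    "'m manifold \<Rightarrow> ('m, 'v::real_vector) vbundle \<Rightarrow> ('m \<Rightarrow> 'v \<Rightarrow> 'v \<Rightarrow> real) \<Rightarrow> bool" where
  "bundle_metric M E g \<longleftrightarrow>
     (\<forall>x\<in>points M.
        (\<forall>u\<in>fibre E x. \<forall>v\<in>fibre E x. \<forall>w\<in>fibre E x. g x (u + v) w = g x u w + g x v w) \<and>
        (\<forall>a. \<forall>v\<in>fibre E x. \<forall>w\<in>fibre E x. g x (a *\<^sub>R v) w = a * g x v w) \<and>
        (\<forall>v\<in>fibre E x. \<forall>w\<in>fibre E x. g x v w = g x w v) \<and>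
        (\<forall>v\<in>fibre E x. v \<noteq> 0 \<longrightarrow> g x v v > 0)) \<and>
     (\<forall>(U, s)\<in>vframes E. \<forall>i<vrank E. \<forall>j<vrank E. smooth_fun_on M U (\<lambda>x. g x (s i x) (s j x)))"

text \<open>Measurability is meant with respect to the Lebesgue and the Borel sigma-algebra.\<close>

definition L1c ::
    "'m manifold \<Rightarrow> ('m, 'v::real_vector) vbundle \<Rightarrow> real \<Rightarrow> real \<Rightarrow> (real \<Rightarrow> 'm \<times> 'v) set" where
  "L1c M E t0 t1 = {\<xi>.
     \<xi> \<in> measurable (lebesgue_on {t0..t1})
           (sigma (total_space M E) {W. openin (total_topology M E) W}) \<and>
     continuous_map (top_of_set {t0..t1}) (mtop M) (fst \<circ> \<xi>) \<and>
     (\<exists>g. bundle_metric M E g \<and>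
        set_integrable lebesgue {t0..t1} (\<lambda>t. sqrt (g (fst (\<xi> t)) (snd (\<xi> t)) (snd (\<xi> t)))))}"

definition test_function :: "real set \<Rightarrow> (real \<Rightarrow> real) \<Rightarrow> bool" where
  "test_function S \<psi> \<longleftrightarrow>
     (\<forall>k t. ((deriv ^^ k) \<psi>) field_differentiable (at t)) \<and>
     (\<exists>K. compact K \<and> K \<subseteq> S \<and> (\<forall>t. t \<notin> K \<longrightarrow> \<psi> t = 0))"

definition locally_integrable_on :: "real set \<Rightarrow> (real \<Rightarrow> real) \<Rightarrow> bool" where
  "locally_integrable_on S u \<longleftrightarrow> (\<forall>K. compact K \<and> K \<subseteq> S \<longrightarrow> set_integrable lebesgue K u)"

definition weak_deriv_on :: "real set \<Rightarrow> (real \<Rightarrow> real) \<Rightarrow> (real \<Rightarrow> real) \<Rightarrow> bool" where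
  "weak_deriv_on S u w \<longleftrightarrow>
     locally_integrable_on S u \<and> locally_integrable_on S w \<and>
     (\<forall>\<psi>. test_function S \<psi> \<longrightarrow>
        (LINT t:S|lebesgue. u t * deriv \<psi> t) = - (LINT t:S|lebesgue. w t * \<psi> t))"

definition weak_derivative ::
    "'m manifold \<Rightarrow> real \<Rightarrow> real \<Rightarrow> (real \<Rightarrow> 'm) \<Rightarrow> (real \<Rightarrow> 'm \<times> 'm tvec) \<Rightarrow> bool" where
  "weak_derivative M t0 t1 x X \<longleftrightarrow>
     continuous_map (top_of_set {t0..t1}) (mtop M) x \<and>
     (\<forall>t\<in>{t0..t1}. fst (X t) = x t \<and> X t \<in> total_space M (tangent M)) \<and>
     (\<forall>c\<in>atlas M. \<forall>i<mdim M.
        weak_deriv_on {t\<in>{t0<..<t1}. x t \<in> fst c} (\<lambda>t. snd c (x t) i) (\<lambda>t. snd (X t) c i))"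


section \<open>Membership in the weak sense\<close>

definition test_section ::
    "'m manifold \<Rightarrow> ('m, 'v::real_vector) vbundle \<Rightarrow> ('m \<Rightarrow> 'v set) \<Rightarrow> real \<Rightarrow> real \<Rightarrow> (real \<Rightarrow> 'm)
      \<Rightarrow> (real \<Rightarrow> 'm \<times> 'v) \<Rightarrow> bool" where
  "test_section M E D t0 t1 x \<eta> \<longleftrightarrow>
     continuous_curve M E t0 t1 \<eta> \<and>
     (\<forall>t\<in>{t0..t1}. fst (\<eta> t) = x t \<and> snd (\<eta> t) \<in> D (x t)) \<and>
     (\<exists>K. compact K \<and> K \<subseteq> {t0<..<t1} \<and> (\<forall>t\<in>{t0..t1} - K. snd (\<eta> t) = 0))"

text \<open>
  The sign is \<open>1\<close> for Dirac structures and \<open>-1\<close> for Lagrangian subbundles.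
\<close>

definition weakly_in ::
    "real \<Rightarrow> 'm manifold \<Rightarrow> ('m, 'v::real_vector, 'w::real_vector) paired \<Rightarrow> ('m \<Rightarrow> ('v \<times> 'w) set)
      \<Rightarrow> real \<Rightarrow> real \<Rightarrow> (real \<Rightarrow> 'm \<times> 'v \<times> 'w) \<Rightarrow> bool" where
  "weakly_in sg M E D t0 t1 \<xi> \<longleftrightarrow>
     \<xi> \<in> L1c M (dbl E) t0 t1 \<and>
     (\<forall>\<eta>. test_section M (dbl E) D t0 t1 (fst \<circ> \<xi>) \<eta> \<longrightarrow>
        has_bochner_integral (lebesgue_on {t0..t1})
          (\<lambda>t. case (snd (\<xi> t), snd (\<eta> t)) of ((f, e), (\<phi>, \<epsilon>)) \<Rightarrow>
             pairing E \<epsilon> f + sg * pairing E e \<phi>) 0)"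


section \<open>Behaviours of port-Hamiltonian systems\<close>

definition phs_space ::
    "'m manifold \<Rightarrow> ('m, 'r::real_vector, 'rd::real_vector) paired
      \<Rightarrow> ('m, 'p::real_vector, 'pd::real_vector) paired
      \<Rightarrow> ('m, 'm tvec \<times> 'r \<times> 'p, ('m tvec \<Rightarrow> real) \<times> 'rd \<times> 'pd) paired" where
  "phs_space M Er Ep = psum (with_dual (tangent M)) (psum Er Ep)"

definition port_bundle ::
    "('m, 'r::real_vector, 'rd::real_vector) paired \<Rightarrow> ('m, 'p::real_vector, 'pd::real_vector) paired
      \<Rightarrow> ('m, 'r \<times> 'p \<times> 'rd \<times> 'pd) vbundle" where
  "port_bundle Er Ep = dsum (vb Er) (dsum (vb Ep) (dsum (dvb Er) (dvb Ep)))"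

definition classical_behaviour ::
    "'m manifold \<Rightarrow> ('m, 'r::real_vector, 'rd::real_vector) paired
      \<Rightarrow> ('m, 'p::real_vector, 'pd::real_vector) paired
      \<Rightarrow> ('m \<Rightarrow> (('m tvec \<times> 'r \<times> 'p) \<times> (('m tvec \<Rightarrow> real) \<times> 'rd \<times> 'pd)) set)
      \<Rightarrow> ('m \<Rightarrow> ('r \<times> 'rd) set) \<Rightarrow> ('m \<Rightarrow> real) \<Rightarrow> real \<Rightarrow> real
      \<Rightarrow> (real \<Rightarrow> 'm \<times> 'r \<times> 'p \<times> 'rd \<times> 'pd) set" where
  "classical_behaviour M Er Ep D R H t0 t1 = {\<xi>.
     continuous_curve M (port_bundle Er Ep) t0 t1 \<xi> \<and>
     C1_curve M t0 t1 (fst \<circ> \<xi>) \<and>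
     (\<forall>t\<in>{t0..t1}. case \<xi> t of (x, f, y, e, u) \<Rightarrow>
        ((velocity M t0 t1 (fst \<circ> \<xi>) t, f, - y), (differential M H x, e, u)) \<in> D x \<and>
        (f, e) \<in> R x)}"

definition weak_behaviour ::
    "'m manifold \<Rightarrow> ('m, 'r::real_vector, 'rd::real_vector) paired
      \<Rightarrow> ('m, 'p::real_vector, 'pd::real_vector) paired
      \<Rightarrow> ('m \<Rightarrow> (('m tvec \<times> 'r \<times> 'p) \<times> (('m tvec \<Rightarrow> real) \<times> 'rd \<times> 'pd)) set)
      \<Rightarrow> ('m \<Rightarrow> ('r \<times> 'rd) set) \<Rightarrow> ('m \<Rightarrow> real) \<Rightarrow> real \<Rightarrow> real
      \<Rightarrow> (real \<Rightarrow> 'm \<times> 'r \<times> 'p \<times> 'rd \<times> 'pd) set" where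
  "weak_behaviour M Er Ep D R H t0 t1 = {\<xi>.
     \<xi> \<in> L1c M (port_bundle Er Ep) t0 t1 \<and>
     (\<exists>X. X \<in> L1c M (tangent M) t0 t1 \<and> weak_derivative M t0 t1 (fst \<circ> \<xi>) X \<and>
        weakly_in 1 M (phs_space M Er Ep) D t0 t1
          (\<lambda>t. case \<xi> t of (x, f, y, e, u) \<Rightarrow>
             (x, (snd (X t), f, - y), (differential M H x, e, u)))) \<and>
     weakly_in (- 1) M Er R t0 t1 (\<lambda>t. case \<xi> t of (x, f, y, e, u) \<Rightarrow> (x, f, e))}"

datatype behaviour_type = Classical | Weak

fun behaviour ::
    "behaviour_type \<Rightarrow> 'm manifold \<Rightarrow> ('m, 'r::real_vector, 'rd::real_vector) paired
      \<Rightarrow> ('m, 'p::real_vector, 'pd::real_vector) paired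
      \<Rightarrow> ('m \<Rightarrow> (('m tvec \<times> 'r \<times> 'p) \<times> (('m tvec \<Rightarrow> real) \<times> 'rd \<times> 'pd)) set)
      \<Rightarrow> ('m \<Rightarrow> ('r \<times> 'rd) set) \<Rightarrow> ('m \<Rightarrow> real) \<Rightarrow> real \<Rightarrow> real
      \<Rightarrow> (real \<Rightarrow> 'm \<times> 'r \<times> 'p \<times> 'rd \<times> 'pd) set" where
  "behaviour Classical = classical_behaviour"
| "behaviour Weak = weak_behaviour"


section \<open>Interconnection\<close>

type_synonym ('m, 'r, 'pi, 'pe) split_dirac =
  "'m \<Rightarrow> (('m tvec \<times> 'r \<times> ('pi \<times> 'pe)) \<times>
         (('m tvec \<Rightarrow> real) \<times> ('r \<Rightarrow> real) \<times> (('pi \<Rightarrow> real) \<times> ('pe \<Rightarrow> real)))) set"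

type_synonym ('m1, 'm2, 'p1, 'p2) coupling =
  "'m1 \<times> 'm2 \<Rightarrow> (('p1 \<times> 'p2) \<times> (('p1 \<Rightarrow> real) \<times> ('p2 \<Rightarrow> real))) set"

text \<open>
  The tangent spaces of the product are identified with the products of the tangent spaces by the
  differentials of the two projections: \<open>v\<close> corresponds to \<open>(v\<^sub>1, v\<^sub>2)\<close>, and \<open>(\<alpha>\<^sub>1, \<alpha>\<^sub>2)\<close> to the
  covector \<open>v \<mapsto> \<alpha>\<^sub>1 v\<^sub>1 + \<alpha>\<^sub>2 v\<^sub>2\<close>.
\<close>

definition proj1 :: "'m manifold \<Rightarrow> 'n manifold \<Rightarrow> 'm \<times> 'n \<Rightarrow> ('m \<times> 'n) tvec \<Rightarrow> 'm tvec" where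
  "proj1 M N = tangent_map (prod_manifold M N) M fst"

definition proj2 :: "'m manifold \<Rightarrow> 'n manifold \<Rightarrow> 'm \<times> 'n \<Rightarrow> ('m \<times> 'n) tvec \<Rightarrow> 'n tvec" where
  "proj2 M N = tangent_map (prod_manifold M N) N snd"

definition covector_pair ::
    "'m manifold \<Rightarrow> 'n manifold \<Rightarrow> 'm \<times> 'n \<Rightarrow> ('m tvec \<Rightarrow> real) \<Rightarrow> ('n tvec \<Rightarrow> real)
      \<Rightarrow> ('m \<times> 'n) tvec \<Rightarrow> real" where
  "covector_pair M N x \<alpha>1 \<alpha>2 =
     (\<lambda>v. if v \<in> tangent_space (prod_manifold M N) x
          then \<alpha>1 (proj1 M N x v) + \<alpha>2 (proj2 M N x v) else 0)"

definition interconnection ::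
    "'m1 manifold \<Rightarrow> 'm2 manifold \<Rightarrow> ('m1, 'r1, 'pi1, 'pe1) split_dirac
      \<Rightarrow> ('m2, 'r2, 'pi2, 'pe2) split_dirac \<Rightarrow> ('m1, 'm2, 'pe1, 'pe2) coupling
      \<Rightarrow> 'm1 \<times> 'm2 \<Rightarrow>
        ((('m1 \<times> 'm2) tvec \<times> ('r1 \<times> 'r2) \<times> ('pi1 \<times> 'pi2)) \<times>
         ((('m1 \<times> 'm2) tvec \<Rightarrow> real) \<times> (('r1 \<Rightarrow> real) \<times> ('r2 \<Rightarrow> real)) \<times>
          (('pi1 \<Rightarrow> real) \<times> ('pi2 \<Rightarrow> real)))) set" where
  "interconnection M1 M2 D1 D2 Dint = (\<lambda>(x1, x2).
     {((v, (f1, f2), (\<eta>1, \<eta>2)), (covector_pair M1 M2 (x1, x2) \<alpha>1 \<alpha>2, (e1, e2), (u1, u2)))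
      |v f1 f2 \<eta>1 \<eta>2 \<alpha>1 \<alpha>2 e1 e2 u1 u2.
        v \<in> tangent_space (prod_manifold M1 M2) (x1, x2) \<and>
        (\<exists>\<zeta>1 \<zeta>2 w1 w2. ((\<zeta>1, \<zeta>2), (w1, w2)) \<in> Dint (x1, x2) \<and>
           ((proj1 M1 M2 (x1, x2) v, f1, (\<eta>1, \<zeta>1)), (\<alpha>1, e1, (u1, w1))) \<in> D1 x1 \<and>
           ((proj2 M1 M2 (x1, x2) v, f2, (\<eta>2, \<zeta>2)), (\<alpha>2, e2, (u2, w2))) \<in> D2 x2)})"

definition admissible ::
    "'m1 manifold \<Rightarrow> 'm2 manifold
      \<Rightarrow> ('m1, 'r1::real_vector) vbundle \<Rightarrow> ('m2, 'r2::real_vector) vbundle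
      \<Rightarrow> ('m1, 'pi1::real_vector) vbundle \<Rightarrow> ('m2, 'pi2::real_vector) vbundle
      \<Rightarrow> ('m1, 'r1, 'pi1, 'pe1) split_dirac \<Rightarrow> ('m2, 'r2, 'pi2, 'pe2) split_dirac
      \<Rightarrow> ('m1, 'm2, 'pe1, 'pe2) coupling \<Rightarrow> bool" where
  "admissible M1 M2 Er1 Er2 Epi1 Epi2 D1 D2 Dint \<longleftrightarrow>
     (\<exists>k. smooth_subbundle (prod_manifold M1 M2)
        (dbl (phs_space (prod_manifold M1 M2)
           (pprod (with_dual Er1) (with_dual Er2)) (pprod (with_dual Epi1) (with_dual Epi2))))
        k (interconnection M1 M2 D1 D2 Dint))"

definition coupling_kernel ::
    "('m1, 'r1::real_vector, 'pi1::real_vector, 'pe1::real_vector) split_dirac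
      \<Rightarrow> ('m2, 'r2::real_vector, 'pi2::real_vector, 'pe2::real_vector) split_dirac
      \<Rightarrow> ('m1, 'm2, 'pe1, 'pe2) coupling \<Rightarrow> ('m1, 'm2, 'pe1, 'pe2) coupling" where
  "coupling_kernel D1 D2 Dint = (\<lambda>(x1, x2).
     {((\<zeta>1, \<zeta>2), (w1, w2)) |\<zeta>1 \<zeta>2 w1 w2. ((\<zeta>1, \<zeta>2), (w1, w2)) \<in> Dint (x1, x2) \<and>
        ((0, 0, (0, \<zeta>1)), (0, 0, (0, w1))) \<in> D1 x1 \<and>
        ((0, 0, (0, \<zeta>2)), (0, 0, (0, w2))) \<in> D2 x2})"

definition constant_rank :: "'m manifold \<Rightarrow> ('m \<Rightarrow> 'v::real_vector set) \<Rightarrow> bool" where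
  "constant_rank M K \<longleftrightarrow> (\<exists>k. \<forall>x\<in>points M. dim (K x) = k)"

definition box_sum ::
    "('m1 \<Rightarrow> ('r1 \<times> 's1) set) \<Rightarrow> ('m2 \<Rightarrow> ('r2 \<times> 's2) set)
      \<Rightarrow> 'm1 \<times> 'm2 \<Rightarrow> (('r1 \<times> 'r2) \<times> ('s1 \<times> 's2)) set" where
  "box_sum R1 R2 = (\<lambda>(x1, x2).
     {((f1, f2), (e1, e2)) |f1 f2 e1 e2. (f1, e1) \<in> R1 x1 \<and> (f2, e2) \<in> R2 x2})"

definition behavioural_interconnection ::
    "real \<Rightarrow> real \<Rightarrow>
     (real \<Rightarrow> 'm1 \<times> 'r1 \<times> ('pi1 \<times> 'pe1) \<times> ('r1 \<Rightarrow> real) \<times> (('pi1 \<Rightarrow> real) \<times> ('pe1 \<Rightarrow> real))) set \<Rightarrow>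
     (real \<Rightarrow> 'm2 \<times> 'r2 \<times> ('pi2 \<times> 'pe2) \<times> ('r2 \<Rightarrow> real) \<times> (('pi2 \<Rightarrow> real) \<times> ('pe2 \<Rightarrow> real))) set \<Rightarrow>
     ('m1, 'm2, 'pe1::real_vector, 'pe2::real_vector) coupling \<Rightarrow>
     (real \<Rightarrow> ('m1 \<times> 'm2) \<times> ('r1 \<times> 'r2) \<times> ('pi1 \<times> 'pi2) \<times>
        (('r1 \<Rightarrow> real) \<times> ('r2 \<Rightarrow> real)) \<times> (('pi1 \<Rightarrow> real) \<times> ('pi2 \<Rightarrow> real))) set" where
  "behavioural_interconnection t0 t1 B1 B2 Dint = {\<xi>. \<exists>\<eta>.
     (\<forall>t\<in>{t0..t1}. \<eta> t \<in> Dint (fst (\<xi> t))) \<and>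
     (\<lambda>t. case (\<xi> t, \<eta> t) of
        (((x1, x2), (f1, f2), (y1, y2), (e1, e2), (u1, u2)), ((z1, z2), (w1, w2))) \<Rightarrow>
          (x1, f1, (y1, - z1), e1, (u1, w1))) \<in> B1 \<and>
     (\<lambda>t. case (\<xi> t, \<eta> t) of
        (((x1, x2), (f1, f2), (y1, y2), (e1, e2), (u1, u2)), ((z1, z2), (w1, w2))) \<Rightarrow>
          (x2, f2, (y2, - z2), e2, (u2, w2))) \<in> B2}"

end

theory Submission
  imports Defs
begin

text \<open>
  Along a curve of the interconnected system the internal port variables \<open>c = (\<zeta>\<^sub>1, \<zeta>\<^sub>2, w\<^sub>1, w\<^sub>2)\<close>
  have to solve, at (almost) every time, a linear problem \<open>\<beta> + j c \<in> D\<^sub>1 \<times> D\<^sub>2\<close>, \<open>c \<in> D\<^sub>i\<^sub>n\<^sub>t\<close>, whose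
  homogeneous solutions form the fibre of \<open>(D\<^sub>1 \<times> D\<^sub>2) \<inter> D\<^sub>i\<^sub>n\<^sub>t\<close>. As its dimension is constant,
  Gaussian elimination with locally fixed pivots gives solutions depending linearly and with
  continuous coefficients on \<open>\<beta>\<close>, hence as regular as \<open>\<beta>\<close>; since solution sets are convex, local
  solutions can be blended over the whole interval. In the weak case, a Dirac structure being its own
  orthogonal complement, testing against its continuous sections amounts to membership almost
  everywhere; this holds for the interconnection as well. Test sections of \<open>R\<^sub>1 \<boxplus> R\<^sub>2\<close> are pairs of
  test sections, so that no such argument is needed for the resistive relation.
\<close>

text \<open>Two obstacles shape the development. The fibres lie in vector spaces without topology,
  so continuity and integrability of a curve are first traded for regularity of its coordinates over
  local frames (\<open>creg\<close>, with the kind of regularity as a parameter); from there on both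
  behaviours are handled together. For integrability this needs a bundle metric to exist, hence bump
  functions and a locally finite family on the base. Secondly, the internal port variables are not
  determined by the external ones: two choices differ by an element of the kernel fibre, and where
  its dimension jumps no regular choice need exist. In the weak case the linear problem is solvable
  only almost everywhere, while the internal variables have to lie in \<open>Dint\<close> at every
  time; the solution is therefore built as an element of \<open>Dint\<close> whether or not the
  problem is solvable. Finally, admissibility asserts a smooth subbundle of some rank only; that
  each fibre of the interconnection is its own orthogonal complement is obtained from a linear
  duality argument, not by counting dimensions.\<close>

abbreviation (input) Rn :: "nat \<Rightarrow> (nat \<Rightarrow> real) set" where
  "Rn n \<equiv> topspace (Euclidean_space n)"

abbreviation (input) path_on :: "'m manifold \<Rightarrow> real \<Rightarrow> real \<Rightarrow> (real \<Rightarrow> 'm) \<Rightarrow> bool" where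
  "path_on M a b x \<equiv> continuous_map (top_of_set {a..b}) (mtop M) x"

abbreviation (input) vcoord :: "('m, 'w) vbundle \<Rightarrow> (nat \<Rightarrow> 'm \<Rightarrow> 'v::real_vector) \<Rightarrow> 'm \<Rightarrow> 'v \<Rightarrow> nat \<Rightarrow> real" where
  "vcoord E s x \<equiv> frame_coord (vrank E) (\<lambda>k. s k x)"

section \<open>Smooth functions on open subsets of Euclidean space\<close>

lemma Rn_iff: "p : Rn n \<longleftrightarrow> (ALL i>=n. p i = 0)"
 by (simp add: topspace_Euclidean_space)

lemma openin_Rn: "openin (Euclidean_space n) S \<longleftrightarrow> (EX T. open T & S = T \<inter> Rn n)"
 by (simp add: Euclidean_space_def euclidean_product_topology openin_subtopology)

text \<open>Points of \<open>Rn n\<close> agree from index \<open>n\<close> on, so of a basic open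
  box in the infinite product only the first \<open>n\<close> factors impose a condition, and
  finitely many factors admit a common radius.\<close>

lemma openin_Rn_iff:
 "openin (Euclidean_space n) S \<longleftrightarrow>
   S \<subseteq> Rn n &
   (ALL p:S. EX e>0. ALL q:Rn n. (ALL i<n. \<bar>q i - p i\<bar> < e) --> q : S)"
proof (intro iffI conjI ballI)
 assume S: "openin (Euclidean_space n) S"
 then show "S \<subseteq> Rn n" by (rule openin_subset)
 fix p assume p: "p : S"
 obtain T where T: "open T" "S = T \<inter> Rn n" using S by (auto simp: openin_Rn)
 then have "openin (product_topology (%i. euclidean) UNIV) T" by (simp add: euclidean_product_topology)
 from product_topology_open_contains_basis[OF this, of p] p T
 obtain V where V: "p : Pi\<^sub>E UNIV V" "!!i. open (V i)" "Pi\<^sub>E UNIV V \<subseteq> T" by auto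
 have "EX e>0. ALL i<k. ALL s::real. \<bar>s - p i\<bar> < e --> s : V i" for k :: nat
 proof (induction k)
  case 0 show ?case by (auto intro: exI[of _ 1])
 next
  case (Suc k)
  then obtain e where e: "e > 0" "ALL i<k. ALL s::real. \<bar>s - p i\<bar> < e --> s : V i" by blast
  have "p k : V k" using V(1) by auto
  then obtain d where d: "d > 0" "ball (p k) d \<subseteq> V k" using V(2) open_contains_ball by blast
  have "ALL i<Suc k. ALL s::real. \<bar>s - p i\<bar> < min e d --> s : V i"
   using e(2) d(2) by (auto simp: less_Suc_eq ball_def dist_real_def subset_iff abs_minus_commute)
  then show ?case using e(1) d(1) by (intro exI[of _ "min e d"]) auto
 qed
 then obtain e where e: "e > 0" "ALL i<n. ALL s::real. \<bar>s - p i\<bar> < e --> s : V i" by blast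
 have "q : S" if "q : Rn n" "ALL i<n. \<bar>q i - p i\<bar> < e" for q
 proof -
  have "q i : V i" for i
  proof (cases "i < n")
   case False
   then have "q i = p i" using that p T by (simp add: Rn_iff)
   then show ?thesis using V(1) by auto
  qed (use that e in auto)
  then have "q : T" using V(3) by auto
  then show ?thesis using T that by auto
 qed
 then show "EX e>0. ALL q:Rn n. (ALL i<n. \<bar>q i - p i\<bar> < e) --> q : S"
  using e(1) by blast
next
 assume S: "S \<subseteq> Rn n &
   (ALL p:S. EX e>0. ALL q:Rn n. (ALL i<n. \<bar>q i - p i\<bar> < e) --> q : S)"
 show "openin (Euclidean_space n) S"
 proof (subst openin_subopen, intro ballI)
  fix p assume p: "p : S"
  then obtain e where e: "e > 0"
   "ALL q:Rn n. (ALL i<n. \<bar>q i - p i\<bar> < e) --> q : S" using S by blast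
  define T where "T = (INT i:{..<n}. {q::nat=>real. \<bar>q i - p i\<bar> < e})"
  have "open {q::nat=>real. \<bar>q i - p i\<bar> < e}" for i
   by (intro open_Collect_less continuous_intros continuous_on_product_coordinates)
  then have "open T" unfolding T_def by (intro open_INT) auto
  then have "openin (Euclidean_space n) (T \<inter> Rn n)" by (auto simp: openin_Rn)
  moreover have "p : T \<inter> Rn n" using p S e(1) by (auto simp: T_def)
  moreover have "T \<inter> Rn n \<subseteq> S" using e(2) by (auto simp: T_def)
  ultimately show "EX T. openin (Euclidean_space n) T & p : T & T \<subseteq> S" by blast
 qed
qed

text \<open>This is what makes \<open>partial_deriv\<close> a local notion on an open set. Only an
  index below \<open>n\<close> may be varied, since changing any other coordinate leaves the
  space.\<close>

lemma openin_Rn_upd: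
 assumes "openin (Euclidean_space n) S" "p : S" "i < n"
 shows "\<forall>\<^sub>F h in nhds (p i). p(i := h) : S"
proof -
 obtain e where e: "e > 0"
  "ALL q:Rn n. (ALL i<n. \<bar>q i - p i\<bar> < e) --> q : S"
  using assms openin_Rn_iff by meson
 have "p : Rn n" using assms openin_subset by blast
 then have "p(i := h) : S" if "dist h (p i) < e" for h
  using that assms(3) e by (intro e(2)[rule_format]) (auto simp: Rn_iff dist_real_def)
 then show ?thesis using e(1) eventually_nhds_metric by blast
qed

lemma continuous_on_Rn_box:
 fixes f :: "(nat => real) => real"
 assumes S: "openin (Euclidean_space n) S" and f: "continuous_on S f" and p: "p : S" and e: "e > 0"
 obtains d where "d > 0"
  "!!q. q : Rn n ==> (!!i. i < n ==> \<bar>q i - p i\<bar> < d) ==> q : S & \<bar>f q - f p\<bar> < e"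
proof -
 obtain T where T: "open T" "S \<inter> f -` ball (f p) e = T \<inter> S"
  using f unfolding continuous_on_open_invariant by (metis Int_commute open_ball)
 have "openin (Euclidean_space n) (T \<inter> S)" using S T by (auto simp: openin_Rn intro: open_Int)
 moreover have "p : T \<inter> S" using T p e by (metis IntI centre_in_ball vimage_eq)
 ultimately obtain d where "d > 0" "ALL q:Rn n. (ALL i<n. \<bar>q i - p i\<bar> < d) --> q : T \<inter> S"
  unfolding openin_Rn_iff by blast
 then show thesis
  by (intro that) (auto simp: T(2)[symmetric] dist_real_def abs_minus_commute)
qed

lemma mean_value_segment:
 fixes f :: "real => real"
 assumes "a ~= b" "!!x. min a b <= x ==> x <= max a b ==> (f has_real_derivative f' x) (at x)"
 obtains z where "min a b <= z" "z <= max a b" "f b - f a = f' z * (b - a)"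
proof (cases "a < b")
 case True
 then obtain z where "a < z" "z < b" "f b - f a = (b - a) * f' z"
  using MVT2[of a b f f'] assms by (auto simp: min_def max_def)
 then show thesis using that[of z] by (simp add: mult.commute)
next
 case False
 with assms have "b < a" by simp
 then obtain z where "b < z" "z < a" "f a - f b = (a - b) * f' z"
  using MVT2[of b a f f'] assms by (auto simp: min_def max_def)
 then show thesis using that[of z] by (simp add: algebra_simps)
qed

lemma Ck_on_continuous: "Ck_on n k S f ==> continuous_on S f"
 by (cases k) auto

lemma Ck_on_Suc_lower: "Ck_on n (Suc k) S f ==> Ck_on n k S f"
proof (induction k arbitrary: f)
 case (Suc k)
 then have "ALL i<n. Ck_on n k S (partial_deriv i f)" by simp
 with Suc.prems show ?case by simp
qed simp

lemma Ck_on_lower: "Ck_on n k S f ==> j <= k ==> Ck_on n j S f"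
proof (induction k)
 case (Suc k)
 then show ?case using Ck_on_Suc_lower[of n k S f] by (cases "j = Suc k") auto
qed simp

lemma Ck_on_subset: "Ck_on n k S f ==> T \<subseteq> S ==> Ck_on n k T f"
proof (induction k arbitrary: f)
 case 0 then show ?case by (auto intro: continuous_on_subset)
next
 case (Suc k)
 then show ?case by (auto intro: continuous_on_subset)
qed

lemma partial_deriv_cong:
 assumes S: "openin (Euclidean_space n) S" and eq: "!!p. p : S ==> f p = g p" and p: "p : S" "i < n"
 shows "partial_deriv i f p = partial_deriv i g p"
  and "(%h. f (p(i := h))) field_differentiable (at (p i)) \<longleftrightarrow>
     (%h. g (p(i := h))) field_differentiable (at (p i))"
proof -
 have ev: "\<forall>\<^sub>F h in nhds (p i). f (p(i := h)) = g (p(i := h))"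
  using openin_Rn_upd[OF S p] by eventually_elim (rule eq)
 then show "partial_deriv i f p = partial_deriv i g p"
  unfolding partial_deriv_def by (intro deriv_cong_ev) auto
 show "(%h. f (p(i := h))) field_differentiable (at (p i)) \<longleftrightarrow>
     (%h. g (p(i := h))) field_differentiable (at (p i))"
  unfolding field_differentiable_def using DERIV_cong_ev[OF refl ev] by auto
qed

text \<open>\<open>Ck_on\<close> speaks of total functions, and partial derivatives of functions
  that agree on \<open>S\<close> may differ off \<open>S\<close>. Openness keeps them equal on
  \<open>S\<close>, which is what the induction hands on.\<close>

lemma Ck_on_cong:
 assumes S: "openin (Euclidean_space n) S"
 shows "(!!p. p : S ==> f p = g p) ==> Ck_on n k S f \<longleftrightarrow> Ck_on n k S g"
proof (induction k arbitrary: f g)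
 case 0 then show ?case by (auto cong: continuous_on_cong)
next
 case (Suc k)
 have "continuous_on S f \<longleftrightarrow> continuous_on S g" using Suc.prems by (auto cong: continuous_on_cong)
 moreover have "Ck_on n k S (partial_deriv i f) \<longleftrightarrow> Ck_on n k S (partial_deriv i g)" if "i < n" for i
  using that by (intro Suc.IH partial_deriv_cong[OF S Suc.prems])
 moreover have "(ALL p:S. (%h. f (p(i := h))) field_differentiable (at (p i))) \<longleftrightarrow>
   (ALL p:S. (%h. g (p(i := h))) field_differentiable (at (p i)))" if "i < n" for i
  using that by (intro ball_cong refl partial_deriv_cong(2)[OF S Suc.prems])
 ultimately show ?case unfolding Ck_on.simps by blast
qed

lemma Ck_on_const: "Ck_on n k S (%p. c)"
proof (induction k arbitrary: c)
 case (Suc k)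
 have "partial_deriv i (%p. c) = (%p. 0)" for i by (simp add: partial_deriv_def fun_eq_iff)
 then show ?case using Suc by simp
qed simp

lemma continuous_on_apply: "continuous_on S (%p::'a => 'b::topological_space. p i)"
 by (rule continuous_on_subset[OF continuous_on_product_coordinates]) auto

lemma Ck_on_coord: "Ck_on n k S (%p. p i)"
proof (cases k)
 case (Suc k)
 have "partial_deriv j (%p. p i) = (%p. if j = i then 1 else 0)" for j
  by (auto simp: partial_deriv_def fun_eq_iff)
 moreover have "(%h. (p(j := h)) i) field_differentiable (at (p j))" for j and p :: "nat => real"
  by (cases "i = j") auto
 ultimately show ?thesis using Suc by (auto simp: Ck_on_const continuous_on_apply)
qed (simp add: continuous_on_apply)

lemma Ck_on_add:
 assumes S: "openin (Euclidean_space n) S"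
 shows "Ck_on n k S f ==> Ck_on n k S g ==> Ck_on n k S (%p. f p + g p)"
proof (induction k arbitrary: f g)
 case 0 then show ?case by (auto intro: continuous_intros)
next
 case (Suc k)
 have pd: "partial_deriv i (%p. f p + g p) p = partial_deriv i f p + partial_deriv i g p"
  if "p : S" "i < n" for i p
  using Suc.prems that unfolding partial_deriv_def by (auto intro!: deriv_add)
 have "Ck_on n k S (partial_deriv i (%p. f p + g p))" if i: "i < n" for i
  using Suc i by (subst Ck_on_cong[OF S pd]) auto
 moreover have "(%h. f (p(i := h)) + g (p(i := h))) field_differentiable (at (p i))" if "p : S" "i < n" for i p
  using Suc.prems that by (intro Derivative.field_differentiable_add) auto
 ultimately show ?case using Suc.prems by (auto intro: continuous_intros)
qed

lemma Ck_on_mult: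
 assumes S: "openin (Euclidean_space n) S"
 shows "Ck_on n k S f ==> Ck_on n k S g ==> Ck_on n k S (%p. f p * g p)"
proof (induction k arbitrary: f g)
 case 0 then show ?case by (auto intro: continuous_intros)
next
 case (Suc k)
 have pd: "partial_deriv i (%p. f p * g p) p = f p * partial_deriv i g p + partial_deriv i f p * g p"
  if "p : S" "i < n" for i p
  using Suc.prems that unfolding partial_deriv_def by (auto intro!: trans[OF deriv_mult])
 have "Ck_on n k S (partial_deriv i (%p. f p * g p))" if i: "i < n" for i
  using Suc.prems i Ck_on_Suc_lower[OF Suc.prems(1)] Ck_on_Suc_lower[OF Suc.prems(2)]
  by (subst Ck_on_cong[OF S pd]) (auto intro!: Ck_on_add[OF S] Suc.IH)
 moreover have "(%h. f (p(i := h)) * g (p(i := h))) field_differentiable (at (p i))" if "p : S" "i < n" for i p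
  using Suc.prems that by (intro field_differentiable_mult) auto
 ultimately show ?case using Suc.prems by (auto intro: continuous_intros)
qed

lemma Ck_on_sum:
 assumes S: "openin (Euclidean_space n) S"
 shows "(!!i. i : I ==> Ck_on n k S (f i)) ==> Ck_on n k S (%p. SUM i:I. f i p)"
 by (induction I rule: infinite_finite_induct) (auto intro: Ck_on_const Ck_on_add[OF S])

lemma continuous_on_local_Rn:
 assumes S: "S \<subseteq> Rn n"
  and loc: "!!p. p : S ==> EX T. openin (Euclidean_space n) T & p : T & continuous_on T f"
 shows "continuous_on S f"
proof -
 have "continuous (at p within S) f" if p: "p : S" for p
 proof -
  obtain T where T: "openin (Euclidean_space n) T" "p : T" "continuous_on T f" using loc[OF p] by blast
  then obtain T' where T': "open T'" "T = T' \<inter> Rn n" by (auto simp: openin_Rn)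
  have "continuous (at p within T) f"
   using T(2,3) by (simp add: continuous_on_eq_continuous_within)
  then have "continuous (at p within (S \<inter> T')) f"
   using S T' by (auto intro: continuous_within_subset)
  moreover have "at p within (S \<inter> T') = at p within S"
   by (rule at_within_nhd[of _ T']) (use T T' in auto)
  ultimately show ?thesis by simp
 qed
 then show ?thesis by (simp add: continuous_on_eq_continuous_within)
qed

lemma Ck_on_local:
 assumes S: "S \<subseteq> Rn n"
 shows "(!!p. p : S ==> EX T. openin (Euclidean_space n) T & p : T & Ck_on n k T f) ==> Ck_on n k S f"
proof (induction k arbitrary: f)
 case 0
 then show ?case unfolding Ck_on.simps by (rule continuous_on_local_Rn[OF S])
next
 case (Suc k)
 have "EX T. openin (Euclidean_space n) T & p : T & Ck_on n k T (partial_deriv i f)" if "p : S" "i < n" for p i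
  using Suc.prems[OF that(1)] that(2) by auto
 then have "Ck_on n k S (partial_deriv i f)" if "i < n" for i using that by (intro Suc.IH) auto
 moreover have "(%h. f (p(i := h))) field_differentiable (at (p i))" if "p : S" "i < n" for p i
  using Suc.prems[OF that(1)] that(2) by auto
 moreover have "continuous_on S f"
  by (rule continuous_on_local_Rn[OF S]) (use Suc.prems in \<open>force\<close>)
 ultimately show ?case by simp
qed

text \<open>Continuous partial derivatives suffice: the increment of \<open>f\<close> along the
  curve is telescoped into changes of one coordinate at a time, and each of these is, by the mean
  value theorem, a partial derivative at a point near \<open>q t0\<close> times the increment of
  that coordinate. Differentiation within an arbitrary \<open>A\<close> covers the end points of
  intervals.\<close>

lemma has_real_derivative_Ck_curve:
 fixes q :: "real => nat => real"
 assumes T: "openin (Euclidean_space m) T" and f: "Ck_on m 1 T f" and q0: "q t0 : T"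
  and d: "!!j. j < m ==> ((%t. q t j) has_real_derivative d j) (at t0 within A)"
  and ev: "\<forall>\<^sub>F t in at t0 within A. q t : Rn m"
 shows "((%t. f (q t)) has_real_derivative (SUM j<m. partial_deriv j f (q t0) * d j)) (at t0 within A)"
proof -
 define Q where "Q k t = (%j. if j < k then q t j else q t0 j)" for k t
 have QSuc: "Q (Suc k) t = (Q k t)(k := q t k)" for k t by (auto simp: Q_def fun_eq_iff)
 have Q0: "Q k t0 = q t0" for k by (auto simp: Q_def fun_eq_iff)
 have q0E: "q t0 : Rn m" using q0 T openin_subset by blast
 have QE: "Q k t : Rn m" if "k <= m" for k t
  using q0E that by (auto simp: Rn_iff Q_def)
 have step: "((%t. f (Q (Suc k) t) - f (Q k t)) has_real_derivative partial_deriv k f (q t0) * d k) (at t0 within A)"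
  if k: "k < m" for k
 proof -
  define R where "R t = f (Q (Suc k) t) - f (Q k t)" for t
  define P where "P = partial_deriv k f (q t0)"
  \<comment> \<open>The slope in direction \<open>k\<close>, with the expected limit as its value
    where the coordinate has not moved; thus \<open>R t\<close> is a multiple of
    \<open>q t k - q t0 k\<close> for every \<open>t\<close>.\<close>
  define g where "g t = (if q t k = q t0 k then P else R t / (q t k - q t0 k))" for t
  have R: "R t = g t * (q t k - q t0 k)" for t
  proof (cases "q t k = q t0 k")
   case True
   then have "Q (Suc k) t = Q k t" by (auto simp: Q_def fun_eq_iff less_Suc_eq)
   then show ?thesis using True by (simp add: R_def)
  qed (simp add: g_def)
  have cont: "continuous_on T (partial_deriv k f)" using f k by simp
  have "(g \<longlongrightarrow> P) (at t0 within A)"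
  proof (rule tendstoI)
   fix e :: real assume "e > 0"
   from continuous_on_Rn_box[OF T cont q0 this] obtain r where r: "r > 0"
    "!!p. p : Rn m ==> (!!i. i < m ==> \<bar>p i - q t0 i\<bar> < r) ==>
      p : T & \<bar>partial_deriv k f p - partial_deriv k f (q t0)\<bar> < e" by blast
   have "\<forall>\<^sub>F t in at t0 within A. \<bar>q t j - q t0 j\<bar> < r" if "j < m" for j
   proof -
    have "((%t. q t j) \<longlongrightarrow> q t0 j) (at t0 within A)"
     using DERIV_continuous[OF d[OF that]] by (simp add: continuous_within)
    from tendstoD[OF this r(1)] show ?thesis by (simp add: dist_real_def)
   qed
   then have "\<forall>\<^sub>F t in at t0 within A. ALL j:{..<m}. \<bar>q t j - q t0 j\<bar> < r"
    by (intro eventually_ball_finite) auto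
   then show "\<forall>\<^sub>F t in at t0 within A. dist (g t) P < e"
   proof eventually_elim
    case (elim t)
    show ?case
    proof (cases "q t k = q t0 k")
     case False
     have in_box: "(Q k t)(k := h) : T & \<bar>partial_deriv k f ((Q k t)(k := h)) - P\<bar> < e"
      if "min (q t0 k) (q t k) <= h" "h <= max (q t0 k) (q t k)" for h
      unfolding P_def
     proof (rule r(2))
      show "(Q k t)(k := h) : Rn m" using QE[of k t] k by (auto simp: Rn_iff)
      fix i assume "i < m"
      then show "\<bar>((Q k t)(k := h)) i - q t0 i\<bar> < r"
      proof (cases "i = k")
       case True
       have "\<bar>h - q t0 k\<bar> <= \<bar>q t k - q t0 k\<bar>" using that by (auto simp: min_def max_def abs_if split: if_splits)
       also have "\<dots> < r" using elim k by blast
       finally show ?thesis by (simp add: True)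
      qed (use elim \<open>i < m\<close> r(1) in \<open>auto simp: Q_def\<close>)
     qed
     have "((%h. f ((Q k t)(k := h))) has_real_derivative partial_deriv k f ((Q k t)(k := h))) (at h)"
      if "min (q t0 k) (q t k) <= h" "h <= max (q t0 k) (q t k)" for h
     proof -
      have "(%h'. f (((Q k t)(k := h))(k := h'))) field_differentiable (at (((Q k t)(k := h)) k))"
       using f k in_box[OF that] unfolding One_nat_def Ck_on.simps by blast
      then show ?thesis unfolding partial_deriv_def
       by (simp add: DERIV_deriv_iff_field_differentiable)
     qed
     from mean_value_segment[OF False[symmetric] this] obtain z where z:
      "min (q t0 k) (q t k) <= z" "z <= max (q t0 k) (q t k)"
      "f ((Q k t)(k := q t k)) - f ((Q k t)(k := q t0 k)) = partial_deriv k f ((Q k t)(k := z)) * (q t k - q t0 k)" .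
     have "(Q k t)(k := q t0 k) = Q k t" by (auto simp: Q_def fun_eq_iff)
     then have "R t = partial_deriv k f ((Q k t)(k := z)) * (q t k - q t0 k)"
      using z(3) by (simp add: R_def QSuc)
     then have "g t = partial_deriv k f ((Q k t)(k := z))" using False by (simp add: g_def)
     then show ?thesis using in_box[OF z(1,2)] by (simp add: dist_real_def)
    qed (use \<open>e > 0\<close> in \<open>simp add: g_def\<close>)
   qed
  qed
  moreover have "((%t. (q t k - q t0 k) / (t - t0)) \<longlongrightarrow> d k) (at t0 within A)"
   using d[OF k] by (simp add: has_field_derivative_iff)
  ultimately have "((%t. g t * ((q t k - q t0 k) / (t - t0))) \<longlongrightarrow> P * d k) (at t0 within A)"
   by (rule tendsto_mult)
  moreover have "R t0 = 0" by (simp add: R_def Q0)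
  ultimately have "(R has_real_derivative P * d k) (at t0 within A)"
   by (simp add: has_field_derivative_iff R)
  then show ?thesis by (simp add: R_def[abs_def] P_def)
 qed
 have "k <= m ==> ((%t. f (Q k t)) has_real_derivative (SUM j<k. partial_deriv j f (q t0) * d j)) (at t0 within A)" for k
 proof (induction k)
  case 0
  have "Q 0 t = q t0" for t by (simp add: Q_def)
  then show ?case by simp
 next
  case (Suc k)
  then show ?case using DERIV_add[OF Suc.IH step[of k]] by simp
 qed
 from this[of m] have "((%t. f (Q m t)) has_real_derivative (SUM j<m. partial_deriv j f (q t0) * d j)) (at t0 within A)"
  by simp
 moreover have "\<forall>\<^sub>F t in at t0 within A. f (Q m t) = f (q t)"
  using ev
 proof eventually_elim
  case (elim t)
  then have "Q m t = q t" using q0E by (auto simp: Q_def fun_eq_iff Rn_iff)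
  then show ?case by simp
 qed
 ultimately show ?thesis by (subst (asm) has_field_derivative_cong_eventually) (auto simp: Q0)
qed

lemma continuous_on_Rn_valued:
 fixes G :: "'a::topological_space => nat => real"
 assumes "!!p. p : S ==> G p : Rn m" "!!j. j < m ==> continuous_on S (%p. G p j)"
 shows "continuous_on S G"
proof (rule continuous_on_coordinatewise_then_product)
 fix j show "continuous_on S (%p. G p j)"
 proof (cases "j < m")
  case False
  then have "continuous_on S (%p. G p j) \<longleftrightarrow> continuous_on S (%p. 0::real)"
   using assms(1) by (intro continuous_on_cong) (auto simp: Rn_iff)
  then show ?thesis by simp
 qed (use assms in auto)
qed

lemma continuous_on_Rn_compose:
 assumes T: "openin (Euclidean_space m) T" and GT: "G ` S \<subseteq> T"
  and G: "!!j. j < m ==> continuous_on S (%p. G p j)" and f: "continuous_on T f"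
 shows "continuous_on S (%p. f (G p))"
proof -
 have "continuous_on S G"
  using GT openin_subset[OF T] by (intro continuous_on_Rn_valued G) auto
 then show ?thesis by (intro continuous_on_compose2[OF f] GT)
qed

text \<open>The induction keeps \<open>G\<close> fixed and generalizes \<open>f\<close>: by the
  chain rule the derivative is a sum of products of partial derivatives of \<open>f\<close> after
  the same \<open>G\<close> with derivatives of the components of \<open>G\<close>, all of one order
  less.\<close>

lemma Ck_on_compose:
 assumes S: "openin (Euclidean_space n) S" and T: "openin (Euclidean_space m) T" and GT: "G ` S \<subseteq> T"
 shows "(!!j. j < m ==> Ck_on n k S (%p. G p j)) ==> Ck_on m k T f ==> Ck_on n k S (%p. f (G p))"
proof (induction k arbitrary: f)
 case 0
 then show ?case using continuous_on_Rn_compose[OF T GT] by simp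
next
 case (Suc k)
 have GE: "G p : Rn m" if "p : S" for p
  using that GT openin_subset[OF T] by blast
 have cont: "continuous_on S (%p. f (G p))"
  by (rule continuous_on_Rn_compose[OF T GT Ck_on_continuous[OF Suc.prems(1)] Ck_on_continuous[OF Suc.prems(2)]])
 have fd: "((%h. f (G (p(i := h)))) has_real_derivative
   (SUM j<m. partial_deriv j f (G p) * partial_deriv i (%p. G p j) p)) (at (p i))"
  if p: "p : S" and i: "i < n" for p i
 proof -
  have d: "((%h. G (p(i := h)) j) has_real_derivative partial_deriv i (%p. G p j) p) (at (p i))"
   if "j < m" for j
   using Suc.prems(1)[OF that] p i
   by (simp add: partial_deriv_def DERIV_deriv_iff_field_differentiable)
  have "\<forall>\<^sub>F h in at (p i). G (p(i := h)) : Rn m"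
   using openin_Rn_upd[OF S p i] unfolding eventually_nhds_conv_at by (auto elim: eventually_mono intro: GE)
  from has_real_derivative_Ck_curve[OF T Ck_on_lower[OF Suc.prems(2)] _ d this] p GT
  show ?thesis by auto
 qed
 have pd: "partial_deriv i (%p. f (G p)) p = (SUM j<m. partial_deriv j f (G p) * partial_deriv i (%p. G p j) p)"
  if p: "p : S" and i: "i < n" for p i
  using DERIV_imp_deriv[OF fd[OF that]] by (simp add: partial_deriv_def)
 have "Ck_on n k S (partial_deriv i (%p. f (G p)))" if i: "i < n" for i
 proof (subst Ck_on_cong[OF S pd[OF _ i]])
  show "Ck_on n k S (%p. SUM j<m. partial_deriv j f (G p) * partial_deriv i (%p. G p j) p)"
  proof (intro Ck_on_sum[OF S] Ck_on_mult[OF S])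
   fix j assume j: "j : {..<m}"
   show "Ck_on n k S (%p. partial_deriv j f (G p))"
   proof (rule Suc.IH)
    show "Ck_on n k S (%p. G p j)" if "j < m" for j by (rule Ck_on_Suc_lower[OF Suc.prems(1)[OF that]])
    show "Ck_on m k T (partial_deriv j f)" using Suc.prems(2) j by simp
   qed
   show "Ck_on n k S (partial_deriv i (%p. G p j))" using Suc.prems(1) i j by auto
  qed
 qed simp
 moreover have "(%h. f (G (p(i := h)))) field_differentiable (at (p i))" if "p : S" "i < n" for p i
  using fd[OF that] by (auto simp only: field_differentiable_def)
 ultimately show ?case using cont by simp
qed

section \<open>Smooth functions of one variable and bump functions\<close>

primrec diff1 :: "nat => (real => real) => bool" where
 "diff1 0 f = True"
| "diff1 (Suc k) f = ((ALL t. f field_differentiable (at t)) & diff1 k (deriv f))"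

text \<open>Connects the recursive form, which suits inductions over sums, products and
  compositions, with the iterated derivatives that occur in \<open>test_function\<close>.\<close>

lemma diff1_iff: "diff1 k f \<longleftrightarrow> (ALL j<k. ALL t. ((deriv ^^ j) f) field_differentiable (at t))"
proof (induction k arbitrary: f)
 case (Suc k)
 have *: "(ALL j<Suc k. P j) \<longleftrightarrow> P 0 & (ALL j<k. P (Suc j))" for P
  by (metis Suc_less_eq not0_implies_Suc zero_less_Suc)
 have "(deriv ^^ Suc j) f = (deriv ^^ j) (deriv f)" for j by (simp add: funpow_Suc_right del: funpow.simps)
 then show ?case unfolding * by (simp add: Suc del: funpow.simps)
qed simp

lemma diff1_SucD: "diff1 (Suc k) f ==> diff1 k f"
 by (simp add: diff1_iff)

lemma diff1_const: "diff1 k (%t. c)"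
 by (induction k arbitrary: c) auto

lemma diff1_id: "diff1 k (%t. t)"
 by (cases k) (auto simp: diff1_const)

lemma diff1_add: "diff1 k f ==> diff1 k g ==> diff1 k (%t. f t + g t)"
proof (induction k arbitrary: f g)
 case (Suc k)
 then have "deriv (%t. f t + g t) = (%t. deriv f t + deriv g t)" by (auto intro!: ext deriv_add)
 with Suc show ?case by (auto intro: Derivative.field_differentiable_add)
qed simp

lemma diff1_mult: "diff1 k f ==> diff1 k g ==> diff1 k (%t. f t * g t)"
proof (induction k arbitrary: f g)
 case (Suc k)
 then have "deriv (%t. f t * g t) = (%t. f t * deriv g t + deriv f t * g t)" by (auto intro!: ext deriv_mult)
 with Suc diff1_SucD[OF Suc.prems(1)] diff1_SucD[OF Suc.prems(2)] show ?case
  by (auto intro!: field_differentiable_mult diff1_add)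
qed simp

lemma diff1_compose: "diff1 k f ==> diff1 k g ==> diff1 k (%t. f (g t))"
proof (induction k arbitrary: f)
 case (Suc k)
 have D: "((%t. f (g t)) has_real_derivative deriv f (g t) * deriv g t) (at t)" for t
  using Suc.prems by (intro DERIV_chain2[of f]) (simp_all add: DERIV_deriv_iff_field_differentiable)
 have "deriv (%t. f (g t)) = (%t. deriv f (g t) * deriv g t)" using D by (blast intro: DERIV_imp_deriv)
 moreover have "diff1 k (%t. deriv f (g t))"
  using Suc diff1_SucD[OF Suc.prems(2)] by simp
 ultimately show ?case using D Suc.prems by (auto simp: field_differentiable_def intro: diff1_mult)
qed simp

lemma diff1_inverse: "diff1 k f ==> (!!t. f t ~= 0) ==> diff1 k (%t. inverse (f t))"
proof (induction k)
 case (Suc k)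
 have D: "((%t. inverse (f t)) has_real_derivative (-1) * (deriv f t * (inverse (f t) * inverse (f t)))) (at t)" for t
  using Suc.prems
  by (auto intro!: derivative_eq_intros simp: DERIV_deriv_iff_field_differentiable field_simps power2_eq_square)
 then have "deriv (%t. inverse (f t)) = (%t. (-1) * (deriv f t * (inverse (f t) * inverse (f t))))"
  by (blast intro: DERIV_imp_deriv)
 moreover have "diff1 k (%t. (-1) * (deriv f t * (inverse (f t) * inverse (f t))))"
  using Suc diff1_SucD[OF Suc.prems(1)] by (intro diff1_mult diff1_const) auto
 ultimately show ?case using D by (auto simp: field_differentiable_def)
qed simp

text \<open>The functions \<open>P(1/t) exp(-1/t)\<close> with \<open>P\<close> a polynomial, extended by zero; they are closed
  under differentiation.\<close>

definition flat_fun :: "real poly => real => real" where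
 "flat_fun p t = (if t > 0 then poly p (1 / t) * exp (- 1 / t) else 0)"

lemma poly_times_exp_neg_tendsto_0: "((%s::real. poly p s * exp (- s)) \<longlongrightarrow> 0) at_top"
proof -
 have "((%s. SUM i<=degree p. coeff p i * (s ^ i / exp s)) \<longlongrightarrow> (SUM i<=degree p. coeff p i * 0)) at_top"
  by (intro tendsto_intros tendsto_power_div_exp_0)
 then show ?thesis
  by (simp add: poly_altdef exp_minus field_simps sum_distrib_left sum_distrib_right sum_divide_distrib)
qed

text \<open>The inner derivative of \<open>1 / t\<close> contributes, up to sign, the square of
  \<open>1 / t\<close>, which is the polynomial \<open>[:0, 0, 1:]\<close>. The delicate point is
  \<open>t = 0\<close>, where the exponential beats every power.\<close>

lemma has_real_derivative_flat_fun:
 "(flat_fun p has_real_derivative flat_fun ([:0, 0, 1:] * (p - pderiv p)) t) (at t)"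
proof -
 consider "t > 0" | "t < 0" | "t = 0" by linarith
 then show ?thesis
 proof cases
  case 1
  have "((%t. poly p (1 / t) * exp (- 1 / t)) has_real_derivative
    flat_fun ([:0, 0, 1:] * (p - pderiv p)) t) (at t)"
  proof -
   have "((%t. poly p (1 / t)) has_real_derivative poly (pderiv p) (1 / t) * (- 1 / t\<^sup>2)) (at t)"
    by (rule DERIV_chain2[OF poly_DERIV])
     (use 1 in \<open>auto intro!: derivative_eq_intros simp: power2_eq_square\<close>)
   moreover have "((%t. exp (- 1 / t)) has_real_derivative exp (- 1 / t) * (1 / t\<^sup>2)) (at t)"
    by (rule DERIV_chain2[OF DERIV_exp])
     (use 1 in \<open>auto intro!: derivative_eq_intros simp: power2_eq_square\<close>)
   ultimately have "((%t. poly p (1 / t) * exp (- 1 / t)) has_real_derivative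
     poly (pderiv p) (1 / t) * (- 1 / t\<^sup>2) * exp (- 1 / t) + exp (- 1 / t) * (1 / t\<^sup>2) * poly p (1 / t)) (at t)"
    by (rule DERIV_mult)
   moreover have "poly (pderiv p) (1 / t) * (- 1 / t\<^sup>2) * exp (- 1 / t) + exp (- 1 / t) * (1 / t\<^sup>2) * poly p (1 / t) =
     flat_fun ([:0, 0, 1:] * (p - pderiv p)) t"
    using 1 by (simp add: flat_fun_def power2_eq_square algebra_simps)
   ultimately show ?thesis by simp
  qed
  then show ?thesis
   by (rule has_field_derivative_transform_within_open[of _ _ _ "{0<..}"]) (use 1 in \<open>auto simp: flat_fun_def\<close>)
 next
  case 2
  have "((%t. 0) has_real_derivative flat_fun ([:0, 0, 1:] * (p - pderiv p)) t) (at t)"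
   using 2 by (simp add: flat_fun_def)
  then show ?thesis
   by (rule has_field_derivative_transform_within_open[of _ _ _ "{..<0}"]) (use 2 in \<open>auto simp: flat_fun_def\<close>)
 next
  case 3
  \<comment> \<open>Under \<open>s = 1 / t\<close> the difference quotient
    \<open>flat_fun p t / t\<close> is again a polynomial in \<open>s\<close> times
    \<open>exp (- s)\<close>; the factor \<open>[:0, 1:]\<close> stands for the division by
    \<open>t\<close>.\<close>
  have "((%s. poly ([:0, 1:] * p) s * exp (- s)) \<longlongrightarrow> 0) at_top" by (rule poly_times_exp_neg_tendsto_0)
  then have "((%t. poly ([:0, 1:] * p) (inverse t) * exp (- inverse t)) \<longlongrightarrow> 0) (at_right (0::real))"
   by (rule filterlim_compose[OF _ filterlim_inverse_at_top_right])
  then have "((%t. flat_fun p t / t) \<longlongrightarrow> 0) (at_right 0)"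
   by (rule Lim_transform_eventually)
    (auto simp: flat_fun_def field_simps eventually_at_filter intro!: always_eventually)
  moreover have "((%t. flat_fun p t / t) \<longlongrightarrow> 0) (at_left 0)"
   by (rule Lim_transform_eventually[OF tendsto_const])
    (auto simp: flat_fun_def eventually_at_filter intro!: always_eventually)
  ultimately have "((%t. flat_fun p t / t) \<longlongrightarrow> 0) (at 0)" by (simp add: filterlim_split_at)
  then show ?thesis using 3 by (simp add: has_field_derivative_iff flat_fun_def)
 qed
qed

lemma diff1_flat_fun: "diff1 k (flat_fun p)"
proof (induction k arbitrary: p)
 case (Suc k)
 have "deriv (flat_fun p) = flat_fun ([:0, 0, 1:] * (p - pderiv p))"
  using has_real_derivative_flat_fun by (blast intro: DERIV_imp_deriv)
 with Suc show ?case using has_real_derivative_flat_fun by (auto simp: field_differentiable_def)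
qed simp

lemma smooth_step_exists:
 obtains G :: "real => real" where "!!k. diff1 k G" "!!t. 0 <= G t & G t <= 1"
  "!!t. t <= 0 ==> G t = 0" "!!t. 1 <= t ==> G t = 1"
proof -
 define F where "F = flat_fun 1"
 have F0: "F t >= 0" "t > 0 ==> F t > 0" "t <= 0 ==> F t = 0" for t by (auto simp: F_def flat_fun_def)
 \<comment> \<open>Sums with \<open>(-1) *\<close> in place of differences match the closure rules
   of \<open>diff1\<close>. The denominator is positive because \<open>t\<close> and
   \<open>1 - t\<close> cannot both be nonpositive.\<close>
 define N where "N t = F t + F (1 + (-1) * t)" for t
 have N: "N t > 0" for t
  using F0(1)[of t] F0(1)[of "1 + (-1) * t"] F0(2)[of t] F0(2)[of "1 + (-1) * t"]
  by (cases "t > 0") (auto simp: N_def intro!: add_pos_nonneg add_nonneg_pos)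
 define G where "G t = F t * inverse (N t)" for t
 have F: "diff1 k F" for k by (simp add: F_def diff1_flat_fun)
 have "diff1 k N" for k
  unfolding N_def by (intro diff1_add F diff1_compose[OF F] diff1_const diff1_mult diff1_id)
 then have "diff1 k G" for k unfolding G_def using N by (intro diff1_mult F diff1_inverse) (auto simp: less_imp_neq[symmetric])
 moreover have "0 <= G t & G t <= 1" for t
  using F0(1)[of t] F0(1)[of "1 + (-1) * t"] N[of t] by (auto simp: G_def N_def field_simps)
 moreover have "G t = 0" if "t <= 0" for t using that F0 by (simp add: G_def)
 moreover have "G t = 1" if "t >= 1" for t
  using F0(3)[of "1 + (-1) * t"] F0(2)[of t] that by (simp add: G_def N_def)
 ultimately show thesis by (rule that)
qed

lemma smooth_bump_exists:
 fixes a e :: real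
 assumes "e > 0"
 obtains b :: "real => real" where "!!k. diff1 k b" "!!t. 0 <= b t & b t <= 1"
  "!!t. \<bar>t - a\<bar> <= e / 2 ==> b t = 1" "!!t. e <= \<bar>t - a\<bar> ==> b t = 0"
proof -
 obtain G :: "real => real" where G: "!!k. diff1 k G" "!!t. 0 <= G t & G t <= 1"
  "!!t. t <= 0 ==> G t = 0" "!!t. 1 <= t ==> G t = 1" using smooth_step_exists by metis
 \<comment> \<open>The squared distance is smooth where the distance is not. The argument of
   \<open>G\<close> vanishes at distance \<open>e\<close> and is at least \<open>1\<close> up to
   distance \<open>e\<close> over the square root of two, which covers \<open>e / 2\<close>.\<close>
 define b where "b t = G (2 + (- 2 / e\<^sup>2) * ((t + - a) * (t + - a)))" for t
 have "diff1 k b" for k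
  unfolding b_def by (intro diff1_compose[OF G(1)] diff1_add diff1_const diff1_mult diff1_id)
 moreover have "0 <= b t & b t <= 1" for t by (simp add: b_def G(2))
 moreover have "b t = 1" if "\<bar>t - a\<bar> <= e / 2" for t
 proof -
  have "(t - a)\<^sup>2 <= (e / 2)\<^sup>2" using that assms abs_le_square_iff[of "t - a" "e / 2"] by simp
  then have "2 * (t - a)\<^sup>2 <= e\<^sup>2" using zero_le_power2[of e] zero_le_power2[of "t - a"] by (simp add: power_divide) (use zero_le_power2[of "t - a"] in linarith)
  then have "2 * (t - a)\<^sup>2 / e\<^sup>2 <= 1" using assms by simp
  moreover have "2 + (- 2 / e\<^sup>2) * ((t + - a) * (t + - a)) = 2 - 2 * (t - a)\<^sup>2 / e\<^sup>2"
   by (simp add: power2_eq_square)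
  ultimately have "2 + (- 2 / e\<^sup>2) * ((t + - a) * (t + - a)) >= 1" by linarith
  then show ?thesis by (simp add: b_def G(4))
 qed
 moreover have "b t = 0" if "e <= \<bar>t - a\<bar>" for t
 proof -
  have "e\<^sup>2 <= (t - a)\<^sup>2" using that assms abs_le_square_iff[of e "t - a"] by simp
  then have "2 + (- 2 / e\<^sup>2) * ((t + - a) * (t + - a)) <= 0"
   using assms by (simp add: field_simps power2_eq_square)
  then show ?thesis by (simp add: b_def G(3))
 qed
 ultimately show thesis by (rule that)
qed

lemma continuous_on_diff1_coord:
 assumes "diff1 (Suc k) b"
 shows "continuous_on S (%p. b (p i))"
proof -
 have "continuous_on UNIV b"
  using assms by (auto simp: continuous_on_eq_continuous_at field_differentiable_imp_continuous_at)
 then show ?thesis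
  by (rule continuous_on_compose2[OF _ continuous_on_apply]) auto
qed

text \<open>\<open>diff1\<close> only asks that derivatives exist; the extra order makes the last
  one continuous.\<close>

lemma Ck_on_diff1_coord: "diff1 (Suc k) b ==> Ck_on n k S (%p. b (p i))"
proof (induction k arbitrary: b)
 case 0 then show ?case using continuous_on_diff1_coord[of 0] by simp
next
 case (Suc k)
 have "partial_deriv j (%p. b (p i)) = (if j = i then (%p. deriv b (p i)) else (%p. 0))" for j
  by (auto simp: partial_deriv_def fun_eq_iff)
 moreover have "(%h. b ((p(j := h)) i)) field_differentiable (at (p j))" for j and p :: "nat => real"
  using Suc.prems by (cases "i = j") auto
 moreover have "Ck_on n k S (%p. deriv b (p i))" using Suc by simp
 ultimately show ?case using continuous_on_diff1_coord[OF Suc.prems] by (auto simp: Ck_on_const)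
qed

section \<open>Frames, functionals and linear systems with parameters\<close>

lemma sum_lessThan_add:
 fixes f :: "nat => 'a::comm_monoid_add"
 shows "(SUM i<m + n. f i) = (SUM i<m. f i) + (SUM i<n. f (m + i))"
 by (induction n) (auto simp: add.assoc)

text \<open>Two equal members of the family would give a vanishing combination with coefficients
  \<open>1\<close> and \<open>-1\<close>, so injectivity is contained in the independence of the
  family. This indexed form, free of \<open>span\<close> and \<open>independent\<close>, is the one
  used for computations.\<close>

lemma is_frame_iff:
 "is_frame r b V \<longleftrightarrow> (ALL a. (SUM i<r. a i *\<^sub>R b i) = 0 --> (ALL i<r. a i = 0)) &
   V = range (%a. SUM i<r. a i *\<^sub>R b i)"
proof -
 have reindex: "(SUM v:b ` {..<r}. u v *\<^sub>R v) = (SUM i<r. u (b i) *\<^sub>R b i)" if "inj_on b {..<r}" for u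
  using that by (simp add: sum.reindex)
 have fac: "EX u. ALL i<r. u (b i) = a i" if "inj_on b {..<r}" for a :: "nat => real"
  using that by (intro exI[of _ "%v. a (inv_into {..<r} b v)"]) (auto simp: inv_into_f_f)
 have inj: "inj_on b {..<r}" if *: "ALL a. (SUM i<r. a i *\<^sub>R b i) = 0 --> (ALL i<r. a i = 0)"
 proof (rule inj_onI, rule ccontr)
  fix i j assume ij: "i : {..<r}" "j : {..<r}" "b i = b j" "i ~= j"
  define a where "a k = (if k = i then 1 else if k = j then -1 else 0 :: real)" for k
  have "(SUM k<r. a k *\<^sub>R b k) = (SUM k:{i, j}. a k *\<^sub>R b k)"
   using ij by (intro sum.mono_neutral_right) (auto simp: a_def)
  also have "\<dots> = 0" using ij by (simp add: a_def)
  finally have "a i = 0" using * ij by auto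
  then show False by (simp add: a_def)
 qed
 have dep: "independent (b ` {..<r}) \<longleftrightarrow> (ALL a. (SUM i<r. a i *\<^sub>R b i) = 0 --> (ALL i<r. a i = 0))"
  if i: "inj_on b {..<r}"
 proof
  assume ind: "independent (b ` {..<r})"
  show "ALL a. (SUM i<r. a i *\<^sub>R b i) = 0 --> (ALL i<r. a i = 0)"
  proof (intro allI impI)
   fix a :: "nat => real" and k assume a: "(SUM i<r. a i *\<^sub>R b i) = 0" "k < r"
   obtain u where u: "ALL i<r. u (b i) = a i" using fac[OF i] by blast
   then have "(SUM v:b ` {..<r}. u v *\<^sub>R v) = 0" using a by (simp add: reindex[OF i])
   then have "u (b k) = 0" using ind a(2) by (auto simp: dependent_finite)
   then show "a k = 0" using u a(2) by simp
  qed
 next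
  assume *: "ALL a. (SUM i<r. a i *\<^sub>R b i) = 0 --> (ALL i<r. a i = 0)"
  show "independent (b ` {..<r})"
  proof
   assume "dependent (b ` {..<r})"
   then obtain u k where u: "k < r" "u (b k) ~= 0" "(SUM v:b ` {..<r}. u v *\<^sub>R v) = 0"
    by (auto simp: dependent_finite)
   then have "(SUM i<r. u (b i) *\<^sub>R b i) = 0" by (simp add: reindex[OF i])
   with *[rule_format, of "%i. u (b i)" k] u(1,2) show False by simp
  qed
 qed
 have span: "span (b ` {..<r}) = range (%a. SUM i<r. a i *\<^sub>R b i)" if i: "inj_on b {..<r}"
 proof -
  have "range (%u. SUM v:b ` {..<r}. u v *\<^sub>R v) = range (%a. SUM i<r. a i *\<^sub>R b i)"
   unfolding reindex[OF i]
  proof (intro equalityI subsetI; elim rangeE; hypsubst)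
   fix u show "(SUM i<r. u (b i) *\<^sub>R b i) : range (%a. SUM i<r. a i *\<^sub>R b i)"
    by (rule range_eqI[of _ _ "%i. u (b i)"]) simp
  next
   fix a :: "nat => real"
   obtain u where "ALL i<r. u (b i) = a i" using fac[OF i] by blast
   then show "(SUM i<r. a i *\<^sub>R b i) : range (%u. SUM i<r. u (b i) *\<^sub>R b i)"
    by (intro range_eqI[of _ _ u]) simp
  qed
  then show ?thesis by (simp add: span_finite)
 qed
 show ?thesis using inj dep span unfolding is_frame_def by blast
qed

lemma is_frame_sum_mem: "is_frame r b V ==> (SUM i<r. a i *\<^sub>R b i) : V"
 by (simp add: is_frame_iff)

lemma is_frame_subspace: "is_frame r b V ==> subspace V"
 unfolding is_frame_def by auto

lemma is_frame_mem: "is_frame r b V ==> i < r ==> b i : V"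
 unfolding is_frame_def by (auto intro: span_base)

lemma is_frame_zero_iff: "is_frame r b V ==> (SUM i<r. a i *\<^sub>R b i) = 0 \<longleftrightarrow> (ALL i<r. a i = 0)"
 by (auto simp: is_frame_iff)

lemma sum_frame_coord:
 assumes "is_frame r b V" "v : V"
 shows "(SUM i<r. frame_coord r b v i *\<^sub>R b i) = v"
proof -
 have i: "inj_on b {..<r}" and "independent (b ` {..<r})" "v : span (b ` {..<r})"
  using assms by (auto simp: is_frame_def)
 from sum_representation_eq[OF this(2,3), of "b ` {..<r}"]
 have "(SUM w:b ` {..<r}. representation (b ` {..<r}) v w *\<^sub>R w) = v" by simp
 then show ?thesis by (simp add: sum.reindex[OF i] frame_coord_def)
qed

lemma frame_coord_eqI:
 assumes "is_frame r b V" "v = (SUM i<r. a i *\<^sub>R b i)" "k < r"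
 shows "frame_coord r b v k = a k"
proof -
 have "v : V" using assms is_frame_sum_mem by metis
 from sum_frame_coord[OF assms(1) this] assms(2)
 have "(SUM i<r. (frame_coord r b v i - a i) *\<^sub>R b i) = 0"
  by (simp add: algebra_simps sum_subtractf)
 then show ?thesis using assms(1,3) by (auto simp: is_frame_zero_iff)
qed

lemma frame_coord_sum:
 assumes "is_frame r b V" "k < r"
 shows "frame_coord r b (SUM i<r. a i *\<^sub>R b i) k = a k"
 using frame_coord_eqI[OF assms(1) refl assms(2)] .

lemma frame_coord_basis:
 assumes "is_frame r b V" "k < r" "j < r"
 shows "frame_coord r b (b j) k = (if k = j then 1 else 0)"
 using assms by (intro frame_coord_eqI[OF assms(1)]) (auto simp: if_distrib[of "%c. c *\<^sub>R _"] cong: if_cong)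

lemma frame_coord_linear_sum:
 assumes b: "is_frame r b V" and v: "!!j. j : J ==> v j : V" and k: "k < r"
 shows "frame_coord r b (SUM j:J. c j *\<^sub>R v j) k = (SUM j:J. c j * frame_coord r b (v j) k)"
proof (rule frame_coord_eqI[OF b _ k])
 have "(SUM j:J. c j *\<^sub>R v j) = (SUM j:J. c j *\<^sub>R (SUM i<r. frame_coord r b (v j) i *\<^sub>R b i))"
  by (intro sum.cong refl) (simp add: sum_frame_coord[OF b v])
 also have "\<dots> = (SUM i<r. (SUM j:J. c j * frame_coord r b (v j) i) *\<^sub>R b i)"
  by (simp add: scaleR_right.sum scaleR_left.sum) (rule sum.swap)
 finally show "(SUM j:J. c j *\<^sub>R v j) = (SUM i<r. (SUM j:J. c j * frame_coord r b (v j) i) *\<^sub>R b i)" .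
qed

lemma frame_coord_add:
 assumes "is_frame r b V" "u : V" "v : V" "k < r"
 shows "frame_coord r b (u + v) k = frame_coord r b u k + frame_coord r b v k"
 using assms sum_frame_coord[OF assms(1,2)] sum_frame_coord[OF assms(1,3)]
 by (intro frame_coord_eqI[OF assms(1)]) (auto simp: scaleR_left_distrib sum.distrib)

lemma frame_coord_scale:
 assumes "is_frame r b V" "u : V" "k < r"
 shows "frame_coord r b (c *\<^sub>R u) k = c * frame_coord r b u k"
 using frame_coord_linear_sum[OF assms(1), of "{0}" "%_. u" k "%_. c"] assms by simp

lemma frame_coord_zero:
 assumes "is_frame r b V" "k < r"
 shows "frame_coord r b 0 k = 0"
 using frame_coord_linear_sum[OF assms(1), of "{}" undefined k] assms by simp

lemma is_frame_times:
 assumes "is_frame m b V" "is_frame n c W"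
 shows "is_frame (m + n) (%i. if i < m then (b i, 0) else (0, c (i - m))) (V \<times> W)"
proof -
 have sum: "(SUM i<m + n. a i *\<^sub>R (if i < m then (b i, 0) else (0, c (i - m)))) =
   ((SUM i<m. a i *\<^sub>R b i), (SUM i<n. a (m + i) *\<^sub>R c i))" for a
  by (simp add: sum_lessThan_add prod_eq_iff fst_sum snd_sum)
 show ?thesis
  unfolding is_frame_iff sum
 proof (intro conjI allI impI)
  fix a i assume "((SUM i<m. a i *\<^sub>R b i), (SUM i<n. a (m + i) *\<^sub>R c i)) = 0" "i < m + n"
  then have "(ALL i<m. a i = 0) & (ALL i<n. a (m + i) = 0)"
   using is_frame_zero_iff[OF assms(1)] is_frame_zero_iff[OF assms(2), of "%i. a (m + i)"]
   by (simp add: prod_eq_iff)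
  then show "a i = 0" using \<open>i < m + n\<close>
   by (cases "i < m") (auto dest: spec[of _ "i - m"] simp: less_diff_conv2)
 next
  show "V \<times> W = range (%a. ((SUM i<m. a i *\<^sub>R b i), (SUM i<n. a (m + i) *\<^sub>R c i)))"
  proof (intro set_eqI iffI; clarsimp)
   fix v w assume "v : V" "w : W"
   then obtain a a' where "v = (SUM i<m. a i *\<^sub>R b i)" "w = (SUM i<n. a' i *\<^sub>R c i)"
    using assms by (auto simp: is_frame_iff)
   then show "(v, w) : range (%a. ((SUM i<m. a i *\<^sub>R b i), (SUM i<n. a (m + i) *\<^sub>R c i)))"
    by (intro range_eqI[of _ _ "%i. if i < m then a i else a' (i - m)"]) simp
  qed (auto intro: is_frame_sum_mem[OF assms(1)] is_frame_sum_mem[OF assms(2)])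
 qed
qed

lemma frame_coord_times:
 assumes "is_frame m b V" "is_frame n c W" "v : V" "w : W" "k < m + n"
 shows "frame_coord (m + n) (%i. if i < m then (b i, 0) else (0, c (i - m))) (v, w) k =
  (if k < m then frame_coord m b v k else frame_coord n c w (k - m))"
proof -
 have "(v, w) = (SUM i<m + n. (if i < m then frame_coord m b v i else frame_coord n c w (i - m)) *\<^sub>R
   (if i < m then (b i, 0) else (0, c (i - m))))"
  using sum_frame_coord[OF assms(1,3)] sum_frame_coord[OF assms(2,4)]
  by (simp add: sum_lessThan_add prod_eq_iff fst_sum snd_sum)
 then show ?thesis
  using assms(5) by (intro frame_coord_eqI[OF is_frame_times[OF assms(1,2)]])
qed

text \<open>The ambient vector spaces may have infinite dimension, and \<open>dim\<close> alone does
  not certify that a subspace is finite-dimensional. This predicate does, and allows comparing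
  dimensions along inclusions.\<close>

definition has_basis :: "nat => 'a::real_vector set => bool" where
 "has_basis r V \<longleftrightarrow> (EX B. finite B & card B = r & independent B & span B = V)"

lemma is_frame_has_basis: "is_frame r b V ==> has_basis r V"
 unfolding is_frame_def has_basis_def
 by (intro exI[of _ "b ` {..<r}"]) (auto simp: card_image)

lemma has_basis_mono:
 assumes "has_basis r V" "has_basis s W" "V \<subseteq> W"
 shows "r <= s"
proof -
 obtain B C where "finite B" "card B = r" "independent B" "span B = V"
  "finite C" "card C = s" "independent C" "span C = W" using assms unfolding has_basis_def by blast
 then show ?thesis using independent_span_bound[of C B] span_superset[of B] assms(3) by auto
qed

lemma has_basis_unique: "has_basis r V ==> has_basis s V ==> r = s"
 by (meson antisym has_basis_mono subset_refl)

lemma has_basis_eq: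
 assumes "has_basis r V" "has_basis r W" "V \<subseteq> W"
 shows "V = W"
proof (rule ccontr)
 assume "V ~= W"
 then obtain w where w: "w : W" "w ~: V" using assms by blast
 obtain B where B: "finite B" "card B = r" "independent B" "span B = V"
  using assms unfolding has_basis_def by blast
 have "independent (insert w B)" using B w by (simp add: independent_insert)
 moreover have "w ~: B" using w B span_superset by blast
 ultimately have "has_basis (Suc r) (span (insert w B))"
  using B unfolding has_basis_def by (intro exI[of _ "insert w B"]) auto
 moreover have "subspace W" using assms(2) by (auto simp: has_basis_def)
 then have "span (insert w B) \<subseteq> W" using w B assms(3) span_superset[of B] by (intro span_minimal) auto
 ultimately show False using has_basis_mono[OF _ assms(2)] by fastforce
qed

lemma has_basis_linear_image:
 assumes "linear f" "inj_on f V" "has_basis r V"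
 shows "has_basis r (f ` V)"
proof -
 obtain B where B: "finite B" "card B = r" "independent B" "span B = V"
  using assms unfolding has_basis_def by blast
 have "inj_on f B" using assms(2) B(4) span_superset[of B] inj_on_subset by blast
 then have "card (f ` B) = r" using B card_image by blast
 moreover have "independent (f ` B)" using assms B linear_independent_injective_image by blast
 moreover have "span (f ` B) = f ` V" using linear_span_image[OF assms(1)] B by simp
 ultimately show ?thesis using B(1) unfolding has_basis_def by blast
qed

lemma has_basis_dim:
 assumes "subspace V" "V \<subseteq> span F" "finite F"
 shows "has_basis (dim V) V"
proof -
 obtain B where B: "B \<subseteq> V" "independent B" "V \<subseteq> span B" "card B = dim V" using basis_exists by blast
 moreover have "finite B" using independent_span_bound[OF assms(3) B(2)] B(1) assms(2) by auto
 moreover have "span B = V" using B assms(1) by (meson span_minimal subset_antisym)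
 ultimately show ?thesis unfolding has_basis_def by blast
qed

text \<open>Covectors are linear on their fibre and vanish off it, so \<open>linear\<close> does not
  apply to them.\<close>

definition functional_on :: "'a::real_vector set => ('a => real) => bool" where
 "functional_on V g \<longleftrightarrow> (ALL u:V. ALL v:V. g (u + v) = g u + g v) & (ALL a. ALL v:V. g (a *\<^sub>R v) = a * g v)"

lemma functional_on_subset: "functional_on V g ==> W \<subseteq> V ==> functional_on W g"
 unfolding functional_on_def by blast

lemma functional_on_0: "functional_on V g ==> 0 : V ==> g 0 = 0"
 unfolding functional_on_def by (metis mult_zero_left scaleR_zero_left)

lemma functional_on_sum:
 assumes "functional_on V g" "subspace V" "!!i. i : I ==> v i : V"
 shows "g (SUM i:I. c i *\<^sub>R v i) = (SUM i:I. c i * g (v i))"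
 using assms(3)
proof (induction I rule: infinite_finite_induct)
 case (insert i I)
 have "(SUM i:I. c i *\<^sub>R v i) : V" "c i *\<^sub>R v i : V"
  using insert assms(2) by (auto intro!: subspace_sum subspace_scale)
 then show ?case using insert assms(1) by (auto simp: functional_on_def)
qed (use functional_on_0[OF assms(1)] assms(2) in \<open>auto simp: subspace_0\<close>)

lemma functional_on_diff:
 assumes "functional_on V g" "subspace V" "u : V" "v : V"
 shows "g (u - a *\<^sub>R v) = g u - a * g v"
proof -
 have "g (u + (-a) *\<^sub>R v) = g u + g ((-a) *\<^sub>R v)"
  using assms by (auto simp: functional_on_def subspace_scale simp del: scaleR_minus_left)
 also have "g ((-a) *\<^sub>R v) = (-a) * g v" using assms unfolding functional_on_def by blast
 finally show ?thesis by simp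
qed

text \<open>Induction on the number of functionals, generalized over \<open>V\<close>: on the kernel
  of the last one the remaining ones already represent \<open>g\<close>, and a single vector outside
  that kernel fixes the missing coefficient.\<close>

lemma functional_in_span:
 fixes n :: nat
 assumes "subspace V" "functional_on V g" "!!i. i < n ==> functional_on V (\<phi> i)"
  and "!!v. v : V ==> (!!i. i < n ==> \<phi> i v = 0) ==> g v = 0"
 shows "EX a. ALL v:V. g v = (SUM i<n. a i * \<phi> i v)"
 using assms
proof (induction n arbitrary: V)
 case (Suc n)
 define W where "W = {v : V. \<phi> n v = 0}"
 have \<phi>n: "functional_on V (\<phi> n)" using Suc.prems(3) by simp
 have "subspace W"
  using Suc.prems(1) \<phi>n functional_on_0[OF \<phi>n]
  unfolding subspace_def W_def functional_on_def by auto
 moreover have "functional_on W g" "i < n ==> functional_on W (\<phi> i)" for i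
  using functional_on_subset[OF Suc.prems(2), of W] functional_on_subset[OF Suc.prems(3), of i W]
  by (auto simp: W_def)
 moreover have "g v = 0" if "v : W" "!!i. i < n ==> \<phi> i v = 0" for v
  using that Suc.prems(4)[of v] by (auto simp: W_def less_Suc_eq)
 ultimately obtain a where a: "!!v. v : W ==> g v = (SUM i<n. a i * \<phi> i v)" using Suc.IH[of W] by blast
 show ?case
 proof (cases "EX w:V. \<phi> n w ~= 0")
  case False
  then have "W = V" by (auto simp: W_def)
  with False show ?thesis by (intro exI[of _ a]) (auto simp: a)
 next
  case True
  then obtain w where w: "w : V" "\<phi> n w ~= 0" by blast
  define c where "c = (g w - (SUM i<n. a i * \<phi> i w)) / \<phi> n w"
  have "g v = (SUM i<Suc n. (a(n := c)) i * \<phi> i v)" if v: "v : V" for v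
  proof -
   define s where "s = \<phi> n v / \<phi> n w"
   have "v - s *\<^sub>R w : W"
    using functional_on_diff[OF \<phi>n Suc.prems(1) v w(1)] v w Suc.prems(1)
    by (auto simp: W_def s_def subspace_diff subspace_scale)
   then have "g v - s * g w = (SUM i<n. a i * (\<phi> i v - s * \<phi> i w))"
    using a[of "v - s *\<^sub>R w"] functional_on_diff[OF Suc.prems(2,1) v w(1)]
     functional_on_diff[OF Suc.prems(3) Suc.prems(1) v w(1)] by simp
   then have "g v = (SUM i<n. a i * \<phi> i v) + s * (g w - (SUM i<n. a i * \<phi> i w))"
    by (simp add: algebra_simps sum_subtractf sum_distrib_left)
   also have "s * (g w - (SUM i<n. a i * \<phi> i w)) = c * \<phi> n v" using w by (simp add: s_def c_def)
   finally show ?thesis by simp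
  qed
  then show ?thesis by blast
 qed
qed auto

text \<open>An isotropic subspace of half the dimension equals its own orthogonal space: vectors dual to a
  basis of \<open>D\<close> together with that basis already span \<open>V\<close>.\<close>

lemma isotropic_half_dim_maximal:
 fixes \<omega> :: "'a::real_vector => 'a => real"
 assumes V: "subspace V" "has_basis (2 * n) V"
  and lin: "!!u. u : V ==> functional_on V (\<omega> u)" "!!v. v : V ==> functional_on V (%u. \<omega> u v)"
  and nondeg: "!!u. u : V ==> (!!v. v : V ==> \<omega> u v = 0) ==> u = 0"
  and D: "is_frame n b D" "D \<subseteq> V" and iso: "!!d d'. d : D ==> d' : D ==> \<omega> d d' = 0"
  and u: "u : V" "!!d. d : D ==> \<omega> d u = 0"
 shows "u : D"
proof (rule ccontr)
 assume nu: "u ~: D"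
 have bD: "i < n ==> b i : D" for i using is_frame_mem[OF D(1)] .
 have bV: "i < n ==> b i : V" for i using bD D(2) by blast
 \<comment> \<open>If no such vector existed, \<open>\<omega> (b j)\<close> would vanish on the
   common kernel of the others and hence be a combination of them; by nondegeneracy the same
   relation would hold between the \<open>b i\<close>, against their independence.\<close>
 have "EX v:V. \<omega> (b j) v = 1 & (ALL i<n. i ~= j --> \<omega> (b i) v = 0)" if j: "j < n" for j
 proof (rule ccontr)
  assume no: "\<not> ?thesis"
  \<comment> \<open>Slot \<open>j\<close> is filled with the zero functional, so that the sums still
    run over all indices below \<open>n\<close>.\<close>
  define \<phi> where "\<phi> i = (if i = j then (%v. 0) else \<omega> (b i))" for i
  have "EX a. ALL v:V. \<omega> (b j) v = (SUM i<n. a i * \<phi> i v)"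
  proof (rule functional_in_span[OF V(1) lin(1)[OF bV[OF j]]])
   show "functional_on V (\<phi> i)" if "i < n" for i
    using lin(1)[OF bV[OF that]] by (auto simp: \<phi>_def functional_on_def)
   fix v assume v: "v : V" "!!i. i < n ==> \<phi> i v = 0"
   show "\<omega> (b j) v = 0"
   proof (rule ccontr)
    assume nz: "\<omega> (b j) v ~= 0"
    define w where "w = (1 / \<omega> (b j) v) *\<^sub>R v"
    have "w : V" using v V(1) by (simp add: w_def subspace_scale)
    moreover have "\<omega> (b i) w = \<omega> (b i) v / \<omega> (b j) v" if "i < n" for i
     using lin(1)[OF bV[OF that]] v by (simp add: w_def functional_on_def)
    moreover have "\<omega> (b i) v = 0" if "i < n" "i ~= j" for i using v(2)[OF that(1)] that(2) by (simp add: \<phi>_def)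
    ultimately have "\<omega> (b j) w = 1 & (ALL i<n. i ~= j --> \<omega> (b i) w = 0)" using nz j by simp
    then show False using no \<open>w : V\<close> by blast
   qed
  qed
  then obtain a where a: "!!v. v : V ==> \<omega> (b j) v = (SUM i<n. a i * \<phi> i v)" by blast
  define c where "c i = (if i = j then 1 else - a i)" for i
  have "\<omega> (SUM i<n. c i *\<^sub>R b i) v = 0" if v: "v : V" for v
  proof -
   have "\<omega> (SUM i<n. c i *\<^sub>R b i) v = (SUM i<n. c i * \<omega> (b i) v)"
    using functional_on_sum[OF lin(2)[OF v] V(1), of "{..<n}" b c] bV by simp
   also have "\<dots> = \<omega> (b j) v - (SUM i<n. a i * \<phi> i v)"
   proof -
    have "c i * \<omega> (b i) v = (if i = j then \<omega> (b j) v else 0) - a i * \<phi> i v" for i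
     by (simp add: c_def \<phi>_def)
    then show ?thesis using j by (simp add: sum_subtractf)
   qed
   finally show ?thesis using a[OF v] by simp
  qed
  then have "(SUM i<n. c i *\<^sub>R b i) = 0"
   using bV V(1) by (intro nondeg) (auto intro!: subspace_sum subspace_scale)
  then have "c j = 0" using is_frame_zero_iff[OF D(1)] j by blast
  then show False by (simp add: c_def)
 qed
 then obtain v where v: "!!j. j < n ==> v j : V" "!!i j. i < n ==> j < n ==> \<omega> (b i) (v j) = (if i = j then 1 else 0)"
  by metis
 \<comment> \<open>The frame of \<open>D\<close>, the dual vectors and \<open>u\<close> are
   \<open>2 * n + 1\<close> vectors; showing them independent contradicts the dimension of
   \<open>V\<close>.\<close>
 define g where "g i = (if i < n then b i else if i < 2 * n then v (i - n) else u)" for i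
 have gsum: "(SUM i<Suc (2 * n). a i *\<^sub>R g i) =
   (SUM i<n. a i *\<^sub>R b i) + (SUM i<n. a (n + i) *\<^sub>R v i) + a (2 * n) *\<^sub>R u" for a
  using sum_lessThan_add[of "%i. a i *\<^sub>R g i" n n] by (simp add: g_def mult_2)
 have bsumD: "(SUM i<n. a i *\<^sub>R b i) : D" for a using is_frame_sum_mem[OF D(1)] .
 have "is_frame (Suc (2 * n)) g (range (%a. SUM i<Suc (2 * n). a i *\<^sub>R g i))"
  unfolding is_frame_iff
 proof (intro conjI allI impI refl)
  fix a :: "nat => real" and k assume 0: "(SUM i<Suc (2 * n). a i *\<^sub>R g i) = 0" and k: "k < Suc (2 * n)"
  \<comment> \<open>Pairing a vanishing combination with \<open>b i\<close> isolates this
    coefficient: \<open>b i\<close> is orthogonal to \<open>D\<close> and to \<open>u\<close>, and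
    sees of the dual vectors only the one with the same index.\<close>
  have an: "a (n + i) = 0" if i: "i < n" for i
  proof -
   have mem: "(SUM j<n. a j *\<^sub>R b j) : V" "(SUM j<n. a (n + j) *\<^sub>R v j) : V" "a (2 * n) *\<^sub>R u : V"
    using bV v(1) V(1) u(1) by (auto intro!: subspace_sum subspace_scale)
   have "\<omega> (b i) (SUM j<n. a (n + j) *\<^sub>R v j) = (SUM j<n. a (n + j) * \<omega> (b i) (v j))"
    using functional_on_sum[OF lin(1)[OF bV[OF i]] V(1), of "{..<n}" v "%j. a (n + j)"] v(1) by simp
   also have "\<dots> = a (n + i)" using i by (simp add: v(2) if_distrib cong: if_cong)
   finally have 1: "\<omega> (b i) (SUM j<n. a (n + j) *\<^sub>R v j) = a (n + i)" .
   have "\<omega> (b i) 0 = \<omega> (b i) (SUM j<n. a j *\<^sub>R b j) + \<omega> (b i) (SUM j<n. a (n + j) *\<^sub>R v j) + a (2 * n) * \<omega> (b i) u"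
    using lin(1)[OF bV[OF i]] mem u(1) V(1) unfolding 0[symmetric] gsum
    by (auto simp: functional_on_def subspace_add)
   moreover have "\<omega> (b i) 0 = 0" using functional_on_0[OF lin(1)[OF bV[OF i]]] V(1) by (simp add: subspace_0)
   ultimately show ?thesis using 1 iso[OF bD[OF i] bsumD] u(2)[OF bD[OF i]] by simp
  qed
  then have eq: "(SUM i<n. a i *\<^sub>R b i) + a (2 * n) *\<^sub>R u = 0" using 0 unfolding gsum by simp
  have a2: "a (2 * n) = 0"
  proof (rule ccontr)
   assume "a (2 * n) ~= 0"
   then have "u = (- 1 / a (2 * n)) *\<^sub>R (SUM i<n. a i *\<^sub>R b i)"
    using \<open>a (2 * n) ~= 0\<close> eq[unfolded add_eq_0_iff2] by simp
   then show False using nu bsumD is_frame_subspace[OF D(1)] subspace_scale by metis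
  qed
  then have "ALL i<n. a i = 0" using eq is_frame_zero_iff[OF D(1)] by simp
  then show "a k = 0" using an a2 k
   by (cases "k < n"; cases "k = 2 * n") (auto dest: spec[of _ "k - n"], metis add_diff_inverse_nat less_antisym mult_2 nat_add_left_cancel_less)
 qed
 then have "has_basis (Suc (2 * n)) (range (%a. SUM i<Suc (2 * n). a i *\<^sub>R g i))" by (rule is_frame_has_basis)
 moreover have "range (%a. SUM i<Suc (2 * n). a i *\<^sub>R g i) \<subseteq> V"
  using bV v(1) u(1) V(1) by (auto intro!: subspace_sum subspace_scale simp: g_def simp del: sum.lessThan_Suc)
 ultimately show False using has_basis_mono V(2) by fastforce
qed

text \<open>Gaussian elimination with continuous coefficients: for a matrix of locally constant rank, the
  solution of a solvable system can be chosen as a continuous linear function of the right-hand side.\<close>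

definition kernel_on :: "nat => nat set => (nat => nat => real) => (nat => real) set" where
 "kernel_on m J A = {z. (ALL j. j ~: J --> z j = 0) & (ALL i<m. (SUM j:J. A i j * z j) = 0)}"

lemma has_basis_coordinate_space:
 assumes "finite J"
 shows "has_basis (card J) {z::nat => real. ALL j. j ~: J --> z j = 0}"
proof -
 define e where "e j = (%i. if i = j then 1 else 0 :: real)" for j :: nat
 have inj: "inj_on e J" by (auto simp: inj_on_def e_def fun_eq_iff split: if_splits)
 have sum: "(SUM j:J. c j *\<^sub>R e j) i = (if i : J then c i else 0)" for c i
 proof -
  have ap: "(SUM j:K. g j) i = (SUM j:K. g j i)" for K and g :: "nat => nat => real"
   by (induction K rule: infinite_finite_induct) auto
  show ?thesis using assms by (simp add: ap scaleR_fun_def e_def if_distrib cong: if_cong)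
 qed
 have "independent (e ` J)"
 proof
  assume "dependent (e ` J)"
  then obtain u k where u: "k : J" "u (e k) ~= 0" "(SUM v:e ` J. u v *\<^sub>R v) = 0"
   using assms by (auto simp: dependent_finite)
  then have "(SUM j:J. u (e j) *\<^sub>R e j) = 0" by (simp add: sum.reindex[OF inj])
  then have "u (e k) = 0" using u(1) sum[of "%j. u (e j)" k] by simp
  with u show False by simp
 qed
 moreover have "span (e ` J) = {z. ALL j. j ~: J --> z j = 0}"
 proof (intro set_eqI iffI)
  fix z assume "z : span (e ` J)"
  then obtain u where "z = (SUM v:e ` J. u v *\<^sub>R v)" using assms by (auto simp: span_finite)
  then have "z = (SUM j:J. u (e j) *\<^sub>R e j)" by (simp add: sum.reindex[OF inj])
  then show "z : {z. ALL j. j ~: J --> z j = 0}" by (simp add: sum)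
 next
  fix z :: "nat => real" assume "z : {z. ALL j. j ~: J --> z j = 0}"
  then have "z = (SUM j:J. z j *\<^sub>R e j)" by (auto simp: fun_eq_iff sum)
  then show "z : span (e ` J)" by (metis (no_types, lifting) imageI span_base span_scale span_sum)
 qed
 ultimately show ?thesis unfolding has_basis_def using assms inj
  by (intro exI[of _ "e ` J"]) (auto simp: card_image)
qed

lemma continuous_generalized_inverse:
 fixes a :: "real => nat => nat => real"
 assumes "finite J" "p : S" "!!i j. i < m ==> j : J ==> continuous_on S (%t. a t i j)"
  and "!!t. t : S ==> has_basis r (kernel_on m J (a t))"
 shows "EX \<delta>>0. EX C. (ALL j k. continuous_on (S \<inter> cball p \<delta>) (%t. C t j k)) &
  (ALL t:S \<inter> cball p \<delta>. ALL b. (EX z. ALL i<m. (SUM j:J. a t i j * z j) = b i) -->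
    (ALL i<m. (SUM j:J. a t i j * (SUM k<m. C t j k * b k)) = b i))"
 using assms
\<comment> \<open>Induction on the number of unknowns. They are indexed by an arbitrary finite set,
  so that deleting the pivot column needs no renumbering; \<open>S\<close> is generalized because it
  shrinks around \<open>p\<close> in each step.\<close>
proof (induction "card J" arbitrary: J S a)
 case 0
 then show ?case by (intro exI[of _ 1]) (auto intro!: exI[of _ "%t j k. 0"])
next
 case (Suc n)
 show ?case
 proof (cases "ALL i<m. ALL j:J. a p i j = 0")
  \<comment> \<open>Without a pivot at \<open>p\<close> the kernel there is the whole coordinate
    space. Constant rank makes it the whole space at every \<open>t\<close>, so the matrix vanishes
    on all of \<open>S\<close> and zero solves every solvable system.\<close>
  case True
  then have "kernel_on m J (a p) = {z. ALL j. j ~: J --> z j = 0}" by (auto simp: kernel_on_def)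
  then have "r = card J"
   using has_basis_unique Suc.prems(4)[OF Suc.prems(2)] has_basis_coordinate_space[OF Suc.prems(1)] by auto
  then have K: "kernel_on m J (a t) = {z. ALL j. j ~: J --> z j = 0}" if "t : S" for t
   using Suc.prems(4)[OF that] has_basis_coordinate_space[OF Suc.prems(1)]
   by (intro has_basis_eq[of r]) (auto simp: kernel_on_def)
  have "a t i j = 0" if "t : S" "i < m" "j : J" for t i j
  proof -
   have "(%k. if k = j then 1 else 0) : kernel_on m J (a t)" using that by (auto simp: K)
   then show ?thesis using that Suc.prems(1) by (auto simp: kernel_on_def if_distrib cong: if_cong)
  qed
  then show ?thesis by (intro exI[of _ 1]) (auto intro!: exI[of _ "%t j k. 0"])
 next
  case False
  then obtain i0 j0 where ij: "i0 < m" "j0 : J" "a p i0 j0 ~= 0" by blast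
  have "continuous_on S (%t. a t i0 j0)" using Suc.prems(3) ij by blast
  then obtain d where d: "d > 0" "!!t. t : S ==> dist t p < d ==> dist (a t i0 j0) (a p i0 j0) < \<bar>a p i0 j0\<bar>"
   using Suc.prems(2) ij(3) unfolding continuous_on_iff by (metis zero_less_abs_iff)
  define S' where "S' = S \<inter> cball p (d / 2)"
  have nz: "a t i0 j0 ~= 0" if "t : S'" for t
   using d(2)[of t] that d(1) by (auto simp: S'_def dist_commute dist_real_def)
  define J' where "J' = J - {j0}"
  \<comment> \<open>The matrix after clearing column \<open>j0\<close>. Its row \<open>i0\<close>
    becomes zero; it is kept so that the number of equations does not change.\<close>
  define a' where "a' t i j = a t i j - a t i j0 * a t i0 j / a t i0 j0" for t i j
  have Jsum: "(SUM j:J. f j) = f j0 + (SUM j:J'. f j)" for f :: "nat => real"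
   using Suc.prems(1) ij(2) by (simp add: J'_def sum.remove)
  have elim: "(SUM j:J'. a' t i j * z j) =
    (SUM j:J'. a t i j * z j) - a t i j0 / a t i0 j0 * (SUM j:J'. a t i0 j * z j)" for t i z
   by (simp add: a'_def algebra_simps sum_subtractf sum_distrib_left)
  have n: "n = card J'" using Suc.hyps(2) Suc.prems(1) ij(2) by (simp add: J'_def)
  have fin: "finite J'" and pS': "p : S'" using Suc.prems d by (auto simp: J'_def S'_def)
  have cont: "continuous_on S' (%t. a t i j)" if "i < m" "j : J" for i j
   using Suc.prems(3)[OF that] by (rule continuous_on_subset) (auto simp: S'_def)
  have cont': "continuous_on S' (%t. a' t i j)" if "i < m" "j : J'" for i j
   unfolding a'_def using that ij nz by (intro continuous_intros cont) (auto simp: J'_def)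
  \<comment> \<open>Forgetting the unknown \<open>j0\<close> is a linear bijection between the two
    kernels, since equation \<open>i0\<close> recovers it. Thus the dimension \<open>r\<close> is
    inherited and the induction hypothesis applies.\<close>
  have ker: "has_basis r (kernel_on m J' (a' t))" if t: "t : S'" for t
  proof -
   define F where "F z = z(j0 := 0)" for z :: "nat => real"
   have "linear F" by (rule linearI) (auto simp: F_def fun_eq_iff scaleR_fun_def)
   have zj0: "z j0 = - (SUM j:J'. a t i0 j * z j) / a t i0 j0" if "z : kernel_on m J (a t)" for z
   proof -
    have "a t i0 j0 * z j0 + (SUM j:J'. a t i0 j * z j) = 0"
     using that ij by (auto simp: kernel_on_def Jsum)
    then show ?thesis using nz[OF t] by (simp add: field_simps)
   qed
   have FJ: "(SUM j:J'. c j * F z j) = (SUM j:J'. c j * z j)" for c z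
    by (intro sum.cong) (auto simp: F_def J'_def)
   have "inj_on F (kernel_on m J (a t))"
   proof (rule inj_onI)
    fix z z' assume z: "z : kernel_on m J (a t)" "z' : kernel_on m J (a t)" and eq: "F z = F z'"
    have "z j = z' j" if "j ~= j0" for j using fun_cong[OF eq, of j] that by (simp add: F_def)
    moreover from this have "z j0 = z' j0" unfolding zj0[OF z(1)] zj0[OF z(2)] by (simp add: J'_def)
    ultimately show "z = z'" by (metis ext)
   qed
   moreover have "F ` kernel_on m J (a t) = kernel_on m J' (a' t)"
   proof (intro set_eqI iffI)
    fix y assume "y : F ` kernel_on m J (a t)"
    then obtain z where z: "z : kernel_on m J (a t)" "y = F z" by blast
    have "(SUM j:J'. a' t i j * y j) = 0" if i: "i < m" for i
    proof -
     have "a t i j0 * z j0 + (SUM j:J'. a t i j * z j) = 0"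
      using z(1) i by (auto simp: kernel_on_def Jsum)
     then show ?thesis unfolding elim z(2) FJ using zj0[OF z(1)] nz[OF t] by (simp add: field_simps)
    qed
    moreover have "ALL j. j ~: J' --> y j = 0" using z by (auto simp: kernel_on_def F_def J'_def)
    ultimately show "y : kernel_on m J' (a' t)" by (simp add: kernel_on_def)
   next
    fix y assume y: "y : kernel_on m J' (a' t)"
    define z where "z = y(j0 := - (SUM j:J'. a t i0 j * y j) / a t i0 j0)"
    have zJ: "(SUM j:J'. c j * z j) = (SUM j:J'. c j * y j)" for c
     by (intro sum.cong) (auto simp: z_def J'_def)
    have "y j0 = 0" using y by (auto simp: kernel_on_def J'_def)
    then have "F z = y" by (auto simp: F_def z_def fun_eq_iff)
    moreover have "(SUM j:J. a t i j * z j) = 0" if "i < m" for i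
    proof -
     have "(SUM j:J'. a' t i j * y j) = 0" using y that by (simp add: kernel_on_def)
     then show ?thesis unfolding Jsum zJ elim using nz[OF t] by (simp add: z_def field_simps)
    qed
    moreover have "ALL j. j ~: J --> z j = 0" using y ij by (auto simp: kernel_on_def z_def J'_def)
    ultimately show "y : F ` kernel_on m J (a t)" by (intro image_eqI[of _ _ z]) (auto simp: kernel_on_def)
   qed
   ultimately show ?thesis
    using has_basis_linear_image[OF \<open>linear F\<close>] Suc.prems(4)[of t] t by (force simp: S'_def)
  qed
  from Suc.hyps(1)[OF n fin pS' cont' ker] obtain \<delta> C where \<delta>: "\<delta> > 0"
   "!!j k. continuous_on (S' \<inter> cball p \<delta>) (%t. C t j k)"
   and C: "!!t b. t : S' \<inter> cball p \<delta> ==> (EX z. ALL i<m. (SUM j:J'. a' t i j * z j) = b i) ==>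
    (ALL i<m. (SUM j:J'. a' t i j * (SUM k<m. C t j k * b k)) = b i)"
   by blast
  define \<epsilon> where "\<epsilon> = min \<delta> (d / 2)"
  have eps: "S \<inter> cball p \<epsilon> = S' \<inter> cball p \<delta>" by (auto simp: S'_def \<epsilon>_def)
  text \<open>The right-hand side transforms to \<open>b' i = b i - a i j0 / a i0 j0 * b i0\<close>.\<close>
  define B where "B t j k = (if k = i0 then C t j i0 - (SUM l<m. C t j l * (a t l j0 / a t i0 j0)) else C t j k)" for t j k
  \<comment> \<open>Back substitution: the unknown \<open>j0\<close> is read off from equation
    \<open>i0\<close>.\<close>
  define C' where "C' t j k = (if j = j0 then ((if k = i0 then 1 else 0) - (SUM l:J'. a t i0 l * B t l k)) / a t i0 j0
    else B t j k)" for t j k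
  have contB: "continuous_on (S \<inter> cball p \<epsilon>) (%t. B t j k)" for j k
  proof -
   have "continuous_on (S \<inter> cball p \<epsilon>) (%t. a t l j0 / a t i0 j0)" if "l < m" for l
    unfolding eps using that nz ij by (intro continuous_intros continuous_on_subset[OF cont]) auto
   then show ?thesis unfolding B_def using \<delta>(2) unfolding eps
    by (cases "k = i0") (simp_all del: times_divide_eq_right, intro continuous_on_diff continuous_on_sum continuous_on_mult, simp_all)
  qed
  have contC: "continuous_on (S \<inter> cball p \<epsilon>) (%t. C' t j k)" for j k
  proof (cases "j = j0")
   case True
   have "continuous_on (S \<inter> cball p \<epsilon>) (%t. a t i0 l)" if "l : J" for l
    unfolding eps using that ij by (intro continuous_on_subset[OF cont]) auto
   then show ?thesis unfolding C'_def using contB True nz ij(2)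
    by (auto simp: eps J'_def intro!: continuous_intros)
  qed (simp add: C'_def contB)
  have "(SUM j:J. a t i j * (SUM k<m. C' t j k * b k)) = b i"
   if t: "t : S \<inter> cball p \<epsilon>" and ex: "EX z. ALL i<m. (SUM j:J. a t i j * z j) = b i" and i: "i < m" for t b i
  proof -
   have nzt: "a t i0 j0 ~= 0" using nz t eps by auto
   define b' where "b' i = b i - a t i j0 / a t i0 j0 * b i0" for i
   obtain z where z: "ALL i<m. (SUM j:J. a t i j * z j) = b i" using ex by blast
   have "(SUM j:J'. a' t i j * z j) = b' i" if "i < m" for i
   proof -
    have "b i = a t i j0 * z j0 + (SUM j:J'. a t i j * z j)" "b i0 = a t i0 j0 * z j0 + (SUM j:J'. a t i0 j * z j)"
     using z that ij(1) by (auto simp: Jsum)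
    then show ?thesis unfolding elim b'_def using nzt by (simp add: algebra_simps)
   qed
   then have sol: "(SUM j:J'. a' t i j * (SUM k<m. C t j k * b' k)) = b' i" if "i < m" for i
    using C[of t b'] t that eps by blast
   have Bb: "(SUM k<m. B t j k * b k) = (SUM k<m. C t j k * b' k)" for j
   proof -
    have "B t j k * b k = C t j k * b k - (if k = i0 then (SUM l<m. C t j l * (a t l j0 / a t i0 j0)) * b i0 else 0)" for k
     by (simp add: B_def algebra_simps)
    then have "(SUM k<m. B t j k * b k) = (SUM k<m. C t j k * b k) - (SUM l<m. C t j l * (a t l j0 / a t i0 j0)) * b i0"
     using ij(1) by (simp add: sum_subtractf)
    then show ?thesis by (simp add: b'_def algebra_simps sum_subtractf sum_distrib_left sum_distrib_right)
   qed
   define y where "y j = (SUM k<m. C t j k * b' k)" for j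
   have yJ: "(SUM k<m. C' t j k * b k) = y j" if "j : J'" for j
    using that by (simp add: C'_def J'_def Bb y_def)
   have "(SUM k<m. C' t j0 k * b k) = (SUM k<m. ((if k = i0 then b k else 0) - (SUM l:J'. a t i0 l * (B t l k * b k)))) / a t i0 j0"
    unfolding sum_divide_distrib by (intro sum.cong refl) (simp add: C'_def algebra_simps sum_distrib_left)
   also have "\<dots> = (b i0 - (SUM k<m. SUM l:J'. a t i0 l * (B t l k * b k))) / a t i0 j0"
    using ij(1) by (simp add: sum_subtractf)
   also have "(SUM k<m. SUM l:J'. a t i0 l * (B t l k * b k)) = (SUM l:J'. a t i0 l * y l)"
    by (subst sum.swap) (simp add: y_def Bb flip: sum_distrib_left)
   finally have y0: "(SUM k<m. C' t j0 k * b k) = (b i0 - (SUM l:J'. a t i0 l * y l)) / a t i0 j0" .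
   have "(SUM j:J. a t i j * (SUM k<m. C' t j k * b k)) =
     a t i j0 * ((b i0 - (SUM l:J'. a t i0 l * y l)) / a t i0 j0) + (SUM j:J'. a t i j * y j)"
    unfolding Jsum y0 using yJ by simp
   also have "\<dots> = b i"
   proof -
    have "(SUM j:J'. a' t i j * y j) = b' i" using sol[OF i] by (simp add: y_def)
    then have "(SUM j:J'. a t i j * y j) = b' i + a t i j0 / a t i0 j0 * (SUM l:J'. a t i0 l * y l)"
     unfolding elim by linarith
    then show ?thesis by (simp add: b'_def algebra_simps diff_divide_distrib)
   qed
   finally show ?thesis .
  qed
  moreover have "\<epsilon> > 0" using \<delta>(1) d(1) by (simp add: \<epsilon>_def)
  ultimately show ?thesis using contC by blast
 qed
qed

section \<open>Smooth functions and tangent spaces of manifolds\<close>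

lemma chart_openin: "smooth_manifold M ==> c : atlas M ==> openin (mtop M) (fst c)"
 unfolding smooth_manifold_def by (cases c) auto

lemma chart_image_openin:
 "smooth_manifold M ==> c : atlas M ==> openin (Euclidean_space (mdim M)) (snd c ` fst c)"
 unfolding smooth_manifold_def by (cases c) auto

lemma chart_homeomorphic:
 "smooth_manifold M ==> c : atlas M ==>
   homeomorphic_map (subtopology (mtop M) (fst c)) (subtopology (Euclidean_space (mdim M)) (snd c ` fst c)) (snd c)"
 unfolding smooth_manifold_def by (cases c) auto

lemma chart_inj: 
 assumes "smooth_manifold M" "c : atlas M"
 shows "inj_on (snd c) (fst c)"
proof -
 have "inj_on (snd c) (topspace (subtopology (mtop M) (fst c)))"
  using chart_homeomorphic[OF assms] by (simp add: homeomorphic_eq_everything_map)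
 then show ?thesis using openin_subset[OF chart_openin[OF assms]] by (simp add: inf.absorb2)
qed

lemma chart_exists: "smooth_manifold M ==> x : points M ==> EX c:atlas M. x : fst c"
 unfolding smooth_manifold_def by (metis (no_types, lifting) UN_E case_prod_unfold)

lemma chart_subset: "smooth_manifold M ==> c : atlas M ==> x : fst c ==> x : points M"
 using openin_subset[OF chart_openin] by blast

lemma chart_inv_chart:
 "smooth_manifold M ==> c : atlas M ==> x : fst c ==> chart_inv c (snd c x) = x"
 by (simp add: chart_inv_def chart_inj)

lemma chart_inv_mem: "p : snd c ` W ==> W \<subseteq> fst c ==> smooth_manifold M ==> c : atlas M ==> chart_inv c p : W"
 using chart_inv_chart by fastforce

lemma chart_chart_inv: "p : snd c ` fst c ==> snd c (chart_inv c p) = p"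
 by (simp add: chart_inv_def f_inv_into_f)

lemma chart_in_Rn: "smooth_manifold M ==> c : atlas M ==> x : fst c ==> snd c x : Rn (mdim M)"
 using chart_image_openin openin_subset by blast

lemma chart_image_open:
 assumes M: "smooth_manifold M" "c : atlas M" and W: "openin (mtop M) W"
 shows "openin (Euclidean_space (mdim M)) (snd c ` (fst c \<inter> W))"
proof -
 have "openin (subtopology (mtop M) (fst c)) (fst c \<inter> W)"
  using W by (auto simp: openin_subtopology)
 then have "openin (subtopology (Euclidean_space (mdim M)) (snd c ` fst c)) (snd c ` (fst c \<inter> W))"
  using chart_homeomorphic[OF M] by (simp add: homeomorphic_map_openness_eq)
 then show ?thesis using chart_image_openin[OF M] by (simp add: openin_open_subtopology)
qed

lemma chart_preimage_open:
 assumes M: "smooth_manifold M" "c : atlas M" and T: "openin (Euclidean_space (mdim M)) T"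
 shows "openin (mtop M) {x : fst c. snd c x : T}"
proof -
 have "continuous_map (subtopology (mtop M) (fst c)) (subtopology (Euclidean_space (mdim M)) (snd c ` fst c)) (snd c)"
  using chart_homeomorphic[OF M] by (simp add: homeomorphic_imp_continuous_map)
 then have "continuous_map (subtopology (mtop M) (fst c)) (Euclidean_space (mdim M)) (snd c)"
  using continuous_map_into_fulltopology by blast
 then have "openin (subtopology (mtop M) (fst c)) {x : topspace (subtopology (mtop M) (fst c)). snd c x : T}"
  using T by (rule openin_continuous_map_preimage)
 moreover have "{x : topspace (subtopology (mtop M) (fst c)). snd c x : T} = {x : fst c. snd c x : T}"
  using chart_subset[OF M] by auto
 ultimately show ?thesis using chart_openin[OF M] by (simp add: openin_open_subtopology)
qed

lemma smooth_fun_on_iff: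
 "smooth_fun_on M W f \<longleftrightarrow>
   (ALL c:atlas M. ALL k. Ck_on (mdim M) k (snd c ` (fst c \<inter> W)) (%p. f (chart_inv c p)))"
 by (auto simp: smooth_fun_on_def smooth_on_def chart_inv_def comp_def)

lemma smooth_fun_on_subset: "smooth_fun_on M W f ==> V \<subseteq> W ==> smooth_fun_on M V f"
 unfolding smooth_fun_on_iff by (meson Ck_on_subset image_mono inf_mono order_refl)

lemma smooth_fun_on_const: "smooth_fun_on M W (%x. a)"
 by (simp add: smooth_fun_on_iff Ck_on_const)

lemma smooth_fun_on_cong:
 assumes M: "smooth_manifold M" and W: "openin (mtop M) W" and eq: "!!x. x : W ==> f x = g x"
 shows "smooth_fun_on M W f \<longleftrightarrow> smooth_fun_on M W g"
proof -
 have "Ck_on (mdim M) k (snd c ` (fst c \<inter> W)) (%p. f (chart_inv c p)) \<longleftrightarrow>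
    Ck_on (mdim M) k (snd c ` (fst c \<inter> W)) (%p. g (chart_inv c p))" if c: "c : atlas M" for c k
  using chart_inv_mem[OF _ _ M c, of _ "fst c \<inter> W"] by (intro Ck_on_cong[OF chart_image_open[OF M c W]] eq) auto
 then show ?thesis by (simp add: smooth_fun_on_iff)
qed

lemma smooth_fun_on_add:
 assumes "smooth_manifold M" "openin (mtop M) W" "smooth_fun_on M W f" "smooth_fun_on M W g"
 shows "smooth_fun_on M W (%x. f x + g x)"
 using assms by (auto simp: smooth_fun_on_iff intro!: Ck_on_add chart_image_open)

lemma smooth_fun_on_mult:
 assumes "smooth_manifold M" "openin (mtop M) W" "smooth_fun_on M W f" "smooth_fun_on M W g"
 shows "smooth_fun_on M W (%x. f x * g x)"
 using assms by (auto simp: smooth_fun_on_iff intro!: Ck_on_mult chart_image_open)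

lemma smooth_fun_on_sum:
 assumes "smooth_manifold M" "openin (mtop M) W" "!!i. i : I ==> smooth_fun_on M W (f i)"
 shows "smooth_fun_on M W (%x. SUM i:I. f i x)"
 using assms by (auto simp: smooth_fun_on_iff intro!: Ck_on_sum chart_image_open)

lemma smooth_fun_on_prod:
 assumes "smooth_manifold M" "openin (mtop M) W" "!!i. i : I ==> smooth_fun_on M W (f i)"
 shows "smooth_fun_on M W (%x. PROD i:I. f i x)"
 using assms(3)
 by (induction I rule: infinite_finite_induct) (auto intro: smooth_fun_on_const smooth_fun_on_mult[OF assms(1,2)])

lemma smooth_fun_on_diff1:
 assumes M: "smooth_manifold M" "openin (mtop M) W" and f: "smooth_fun_on M W f" and b: "!!k. diff1 k b"
 shows "smooth_fun_on M W (%x. b (f x))"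
 unfolding smooth_fun_on_iff
proof (intro ballI allI)
 fix c k assume c: "c : atlas M"
 \<comment> \<open>The function \<open>f\<close> becomes a map into \<open>Rn 1\<close> and
   \<open>b\<close> a function on it, so that \<open>Ck_on_compose\<close> applies.\<close>
 define G where "G p = (%i. if i = (0::nat) then f (chart_inv c p) else 0)" for p
 have "Ck_on (mdim M) k (snd c ` (fst c \<inter> W)) (%p. (%q. b (q 0)) (G p))"
 proof (rule Ck_on_compose[OF chart_image_open[OF M(1) c M(2)], where f = "%q. b (q 0)" and G = G and m = 1
    and T = "Rn 1"])
  show "openin (Euclidean_space 1) (Rn 1)" by simp
  show "Ck_on 1 k (Rn 1) (%q. b (q 0))" by (rule Ck_on_diff1_coord[OF b])
 qed (use f c in \<open>auto simp: G_def Rn_iff smooth_fun_on_iff\<close>)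
 then show "Ck_on (mdim M) k (snd c ` (fst c \<inter> W)) (%p. b (f (chart_inv c p)))"
  by (simp add: G_def)
qed

lemma smooth_fun_on_local:
 assumes M: "smooth_manifold M" and W: "openin (mtop M) W"
  and loc: "!!x. x : W ==> EX V. openin (mtop M) V & x : V & smooth_fun_on M V f"
 shows "smooth_fun_on M W f"
 unfolding smooth_fun_on_iff
proof (intro ballI allI)
 fix c k assume c: "c : atlas M"
 show "Ck_on (mdim M) k (snd c ` (fst c \<inter> W)) (%p. f (chart_inv c p))"
 proof (rule Ck_on_local)
  show "snd c ` (fst c \<inter> W) \<subseteq> Rn (mdim M)"
   using chart_in_Rn[OF M c] by auto
  fix p assume "p : snd c ` (fst c \<inter> W)"
  then obtain x where x: "x : fst c" "x : W" "p = snd c x" by auto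
  obtain V where "openin (mtop M) V" "x : V" "smooth_fun_on M V f" using loc x by blast
  then show "EX T. openin (Euclidean_space (mdim M)) T & p : T & Ck_on (mdim M) k T (%p. f (chart_inv c p))"
   using x c chart_image_open[OF M c] by (intro exI[of _ "snd c ` (fst c \<inter> V)"]) (auto simp: smooth_fun_on_iff)
 qed
qed

lemma chart_coord_smooth:
 "smooth_manifold M ==> c : atlas M ==> j < mdim M ==> smooth_fun_on M (fst c) (%x. snd c x j)"
 unfolding smooth_manifold_def by (cases c) auto

text \<open>One chart is enough: the coordinates of \<open>c\<close> are smooth functions, so the
  expression in any other chart is the one in \<open>c\<close> composed with a smooth coordinate
  change.\<close>

lemma smooth_fun_on_chartI:
 assumes M: "smooth_manifold M" "c : atlas M" and W: "openin (mtop M) W" "W \<subseteq> fst c"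
  and f: "!!k. Ck_on (mdim M) k (snd c ` W) (%p. f (chart_inv c p))"
 shows "smooth_fun_on M W f"
 unfolding smooth_fun_on_iff
proof (intro ballI allI)
 fix c' k assume c': "c' : atlas M"
 let ?S = "snd c' ` (fst c' \<inter> W)"
 have S: "openin (Euclidean_space (mdim M)) ?S" by (rule chart_image_open[OF M(1) c' W(1)])
 have in_W: "chart_inv c' p : W" if "p : ?S" for p using that chart_inv_chart[OF M(1) c'] by auto
 have "Ck_on (mdim M) k ?S (%p. (%q. f (chart_inv c q)) (snd c (chart_inv c' p)))"
 proof (rule Ck_on_compose[OF S, where f = "%q. f (chart_inv c q)" and T = "snd c ` W"])
  show "openin (Euclidean_space (mdim M)) (snd c ` W)"
   using chart_image_open[OF M W(1)] W(2) by (simp add: inf.absorb2)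
  show "(%p. snd c (chart_inv c' p)) ` ?S \<subseteq> snd c ` W" using in_W by auto
  fix j assume "j < mdim M"
  then have "smooth_fun_on M W (%x. snd c x j)" using chart_coord_smooth[OF M] smooth_fun_on_subset W(2) by blast
  then show "Ck_on (mdim M) k ?S (%p. snd c (chart_inv c' p) j)" using c' by (simp add: smooth_fun_on_iff)
 qed (rule f)
 moreover have "f (chart_inv c (snd c (chart_inv c' p))) = f (chart_inv c' p)" if "p : ?S" for p
  using in_W[OF that] W(2) chart_inv_chart[OF M] by auto
 ultimately show "Ck_on (mdim M) k ?S (%p. f (chart_inv c' p))"
  using Ck_on_cong[OF S, of "%p. f (chart_inv c (snd c (chart_inv c' p)))" "%p. f (chart_inv c' p)" k] by simp
qed

lemma smooth_fun_on_continuous: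
 assumes M: "smooth_manifold M" and W: "openin (mtop M) W" and f: "smooth_fun_on M W f"
 shows "continuous_map (subtopology (mtop M) W) euclideanreal f"
proof -
 have WM: "W \<subseteq> points M" using W openin_subset by blast
 have "openin (mtop M) {x : W. f x : T}" if T: "open T" for T
 proof (subst openin_subopen, intro ballI)
  fix x assume x: "x : {x : W. f x : T}"
  then obtain c where c: "c : atlas M" "x : fst c" using chart_exists[OF M] WM by blast
  let ?S = "snd c ` (fst c \<inter> W)"
  have "continuous_on ?S (%p. f (chart_inv c p))"
   using f c by (auto simp: smooth_fun_on_iff intro: Ck_on_continuous)
  then obtain A where A: "open A" "A \<inter> ?S = (%p. f (chart_inv c p)) -` T \<inter> ?S"
   using T unfolding continuous_on_open_invariant by metis
  have "openin (Euclidean_space (mdim M)) (A \<inter> ?S)"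
   using chart_image_open[OF M c(1) W] A(1) by (auto simp: openin_Rn intro: open_Int)
  then have "openin (mtop M) {y : fst c. snd c y : A \<inter> ?S}" by (rule chart_preimage_open[OF M c(1)])
  moreover have "{y : fst c. snd c y : A \<inter> ?S} = {y : fst c \<inter> W. f y : T}"
   unfolding A(2) using inj_onD[OF chart_inj[OF M c(1)]] by (auto simp: chart_inv_chart[OF M c(1)]; metis)
  ultimately show "EX V. openin (mtop M) V & x : V & V \<subseteq> {x : W. f x : T}" using x c by auto
 qed
 then show ?thesis
  using WM W by (auto simp: continuous_map_def openin_open_subtopology inf.absorb2)
qed

section \<open>Bump functions on manifolds\<close>

lemma compactin_Rn_box:
 "compactin (Euclidean_space n) {q : Rn n. ALL i<n. \<bar>q i - p i\<bar> <= (e::real)}"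
proof -
 let ?B = "{q : Rn n. ALL i<n. \<bar>q i - p i\<bar> <= e}"
 have "?B = Pi\<^sub>E UNIV (%i. if i < n then cball (p i) e else {0})"
  by (auto simp: Rn_iff PiE_iff dist_real_def abs_minus_commute split: if_splits)
 moreover have "compactin (product_topology (%i. euclideanreal) UNIV) (Pi\<^sub>E UNIV (%i. if i < n then cball (p i) e else {0}))"
  unfolding compactin_PiE by simp
 ultimately have "compactin (product_topology (%i. euclideanreal) UNIV) ?B" by metis
 then show ?thesis unfolding Euclidean_space_def by (subst compactin_subtopology) (auto simp: Rn_iff topspace_Euclidean_space)
qed

text \<open>A product of one-dimensional bumps in the coordinates of one chart, extended by zero. If
  \<open>e\<close> is the radius of a box inside the chart image of \<open>W\<close>, the bump is
  \<open>1\<close> on the box of radius \<open>e / 4\<close> and vanishes off the closed box of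
  radius \<open>e / 2\<close>.\<close>

lemma smooth_bump_manifold:
 assumes M: "smooth_manifold M" and W: "openin (mtop M) W" "x : W"
 obtains \<beta> V K where "openin (mtop M) V" "x : V" "V \<subseteq> W" "smooth_fun_on M (points M) \<beta>"
  "!!y. 0 <= \<beta> y & \<beta> y <= 1" "!!y. y : V ==> \<beta> y = 1"
  "closedin (mtop M) K" "K \<subseteq> W" "!!y. y ~: K ==> \<beta> y = 0"
proof -
 let ?n = "mdim M"
 obtain c where c: "c : atlas M" "x : fst c" using chart_exists[OF M] W openin_subset by blast
 define p where "p = snd c x"
 have "p : snd c ` (fst c \<inter> W)" using c W by (auto simp: p_def)
 then obtain e where e: "e > 0"
  "!!q. q : Rn ?n ==> (!!i. i < ?n ==> \<bar>q i - p i\<bar> < e) ==> q : snd c ` (fst c \<inter> W)"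
  using chart_image_open[OF M c(1) W(1), unfolded openin_Rn_iff, THEN conjunct2, rule_format, of p] by metis
 have "EX b. (ALL k. diff1 k b) & (ALL t. 0 <= b t & b t <= 1) & (ALL t. \<bar>t - p i\<bar> <= e / 4 --> b t = 1) &
   (ALL t. e / 2 <= \<bar>t - p i\<bar> --> b t = 0)" for i
 proof -
  obtain b where "!!k. diff1 k b" "!!t. 0 <= b t & b t <= 1"
   "!!t. \<bar>t - p i\<bar> <= (e / 2) / 2 ==> b t = 1" "!!t. e / 2 <= \<bar>t - p i\<bar> ==> b t = 0"
   using smooth_bump_exists[of "e / 2" "p i"] e(1) by auto
  then show ?thesis by auto
 qed
 then obtain b where b: "!!i k. diff1 k (b i)" "!!i t. 0 <= b i t & b i t <= 1"
  "!!i t. \<bar>t - p i\<bar> <= e / 4 ==> b i t = 1" "!!i t. e / 2 <= \<bar>t - p i\<bar> ==> b i t = 0" by metis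
 define \<beta> where "\<beta> y = (if y : fst c then PROD i<?n. b i (snd c y i) else 0)" for y
 define B where "B = {q : Rn ?n. ALL i<?n. \<bar>q i - p i\<bar> <= e / 2}"
 define K where "K = chart_inv c ` B"
 define V where "V = {y : fst c. snd c y : {q : Rn ?n. ALL i<?n. \<bar>q i - p i\<bar> < e / 4}}"
 have BS: "B \<subseteq> snd c ` (fst c \<inter> W)" using e by (auto simp: B_def intro!: e(2))
 have K: "K = {y : fst c. snd c y : B}"
  unfolding K_def using BS chart_inv_chart[OF M c(1)] by force
 have KW: "K \<subseteq> W" unfolding K_def using BS chart_inv_chart[OF M c(1)] by force
 \<comment> \<open>Closedness in the whole manifold, and not only in the chart domain, is what makes
   the extension by zero smooth. It holds because \<open>K\<close> is compact and the manifold
   Hausdorff.\<close>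
 have "closedin (mtop M) K"
 proof -
  obtain g where g: "homeomorphic_maps (subtopology (mtop M) (fst c)) (subtopology (Euclidean_space ?n) (snd c ` fst c)) (snd c) g"
   using chart_homeomorphic[OF M c(1)] by (auto simp: homeomorphic_map_maps)
  have "compactin (subtopology (Euclidean_space ?n) (snd c ` fst c)) B"
   using compactin_Rn_box[of ?n p "e / 2"] BS unfolding B_def by (auto simp: compactin_subtopology)
  then have "compactin (subtopology (mtop M) (fst c)) (g ` B)"
   using g image_compactin unfolding homeomorphic_maps_def by blast
  then have "compactin (mtop M) (g ` B)" by (simp add: compactin_subtopology)
  moreover have "g q = chart_inv c q" if qB: "q : B" for q
  proof -
   obtain y where "y : fst c" "q = snd c y" using subsetD[OF BS qB] by blast
   then show ?thesis using g chart_inv_chart[OF M c(1)] chart_subset[OF M c(1)]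
    by (auto simp: homeomorphic_maps_def)
  qed
  then have "g ` B = K" by (auto simp: K_def)
  ultimately show ?thesis using M compactin_imp_closedin by (auto simp: smooth_manifold_def)
 qed
 moreover have chi0: "\<beta> y = 0" if yK: "y ~: K" for y
 proof (cases "y : fst c")
  case True
  then obtain i where "i < ?n" "\<bar>snd c y i - p i\<bar> > e / 2"
   using yK chart_in_Rn[OF M c(1) True] by (force simp: K B_def)
  then show ?thesis using True b(4)[where i = i and t = "snd c y i"] by (auto simp: \<beta>_def)
 qed (simp add: \<beta>_def)
 moreover have "openin (mtop M) V"
  unfolding V_def
 proof (rule chart_preimage_open[OF M c(1)])
  show "openin (Euclidean_space ?n) {q : Rn ?n. ALL i<?n. \<bar>q i - p i\<bar> < e / 4}"
   unfolding openin_Rn_iff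
  proof (intro conjI ballI)
   fix q assume q: "q : {q : Rn ?n. ALL i<?n. \<bar>q i - p i\<bar> < e / 4}"
   define d where "d = Min (insert (e / 4) ((%i. e / 4 - \<bar>q i - p i\<bar>) ` {..<?n}))"
   have "d > 0" using q e(1) by (auto simp: d_def)
   moreover have dle: "d <= e / 4 - \<bar>q i - p i\<bar>" if "i < ?n" for i using that by (auto simp: d_def)
   have "\<bar>q' i - p i\<bar> < e / 4" if "\<bar>q' i - q i\<bar> < d" "i < ?n" for q' i
    using dle[OF that(2)] that(1) by linarith
   ultimately show "EX d>0. ALL q':Rn ?n. (ALL i<?n. \<bar>q' i - q i\<bar> < d) -->
     q' : {q : Rn ?n. ALL i<?n. \<bar>q i - p i\<bar> < e / 4}" by blast
  qed auto
 qed
 moreover have "x : V" using c e(1) chart_in_Rn[OF M c(1)] by (simp add: V_def p_def)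
 moreover have "V \<subseteq> W"
 proof -
  have "V \<subseteq> K" using e(1) by (fastforce simp: V_def K B_def)
  then show ?thesis using KW by blast
 qed
 moreover have "0 <= \<beta> y & \<beta> y <= 1" for y
  using b(2) by (auto simp: \<beta>_def intro!: prod_nonneg prod_le_1)
 moreover have "\<beta> y = 1" if "y : V" for y
  using that b(3) by (auto simp: \<beta>_def V_def less_imp_le)
 moreover have "smooth_fun_on M (points M) \<beta>"
 proof (rule smooth_fun_on_local[OF M])
  fix y assume y: "y : points M"
  show "EX V. openin (mtop M) V & y : V & smooth_fun_on M V \<beta>"
  proof (cases "y : K")
   case True
   have "smooth_fun_on M (fst c) (%y. PROD i<?n. b i (snd c y i))"
    using chart_coord_smooth[OF M c(1)]
    by (intro smooth_fun_on_prod[OF M chart_openin[OF M c(1)]]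
      smooth_fun_on_diff1[OF M chart_openin[OF M c(1)] _ b(1)]) (simp only: lessThan_iff)
   then have "smooth_fun_on M (fst c) \<beta>"
    using smooth_fun_on_cong[OF M chart_openin[OF M c(1)], of \<beta> "%y. PROD i<?n. b i (snd c y i)"] by (simp add: \<beta>_def)
   then show ?thesis using True chart_openin[OF M c(1)] K by blast
  next
   case False
   have "openin (mtop M) (points M - K)" using \<open>closedin (mtop M) K\<close> by (simp add: openin_diff)
   moreover from this have "smooth_fun_on M (points M - K) \<beta>"
    using smooth_fun_on_cong[OF M, of "points M - K" \<beta> "%y. 0"] chi0 smooth_fun_on_const by auto
   ultimately show ?thesis using False y by blast
  qed
 qed simp
 ultimately show thesis using that KW by blast
qed

text \<open>With bumps \<open>\<beta> k\<close> equal to \<open>1\<close> on the sets of a countable open cover, the functions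
  \<open>\<beta> k * (\<Prod>j<k. 1 - \<beta> j)\<close> form a locally finite family without normalization.\<close>

lemma smooth_partition:
 fixes M :: "'m manifold"
 assumes M: "smooth_manifold M" and U: "ALL x:points M. EX U:\<U>. openin (mtop M) U & x : U"
  and ne: "points M ~= {}"
 shows "EX (\<psi> :: nat => 'm => real) U K.
  (ALL k. U k : \<U>) & (ALL k. openin (mtop M) (U k)) & (ALL k. smooth_fun_on M (points M) (\<psi> k)) &
  (ALL k x. 0 <= \<psi> k x) & (ALL k. closedin (mtop M) (K k)) & (ALL k. K k \<subseteq> U k) &
  (ALL k x. x ~: K k --> \<psi> k x = 0) &
  (ALL x:points M. EX V N. openin (mtop M) V & x : V & (ALL k>=N. ALL y:V. \<psi> k y = 0)) &
  (ALL x:points M. EX k. \<psi> k x > 0)"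
proof -
 have "EX \<beta> V K U. openin (mtop M) V & x : V & U : \<U> & openin (mtop M) U & smooth_fun_on M (points M) \<beta> &
  (ALL y. 0 <= \<beta> y & \<beta> y <= 1) & (ALL y:V. \<beta> y = 1) & closedin (mtop M) K & K \<subseteq> U & (ALL y. y ~: K --> \<beta> y = (0::real))"
  if x: "x : points M" for x
 proof -
  obtain U where U: "U : \<U>" "openin (mtop M) U" "x : U" using U x by blast
  from smooth_bump_manifold[OF M U(2,3)] obtain \<beta> V K where "openin (mtop M) V" "x : V" "smooth_fun_on M (points M) \<beta>"
  "!!y. 0 <= \<beta> y & \<beta> y <= 1" "!!y. y : V ==> \<beta> y = 1"
  "closedin (mtop M) K" "K \<subseteq> U" "!!y. y ~: K ==> \<beta> y = 0" by metis
  with U show ?thesis by blast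
 qed
 then obtain \<beta> V K U where *: "!!x. x : points M ==> openin (mtop M) (V x) & x : V x & U x : \<U> & openin (mtop M) (U x) &
  smooth_fun_on M (points M) (\<beta> x) &
  (ALL y. 0 <= \<beta> x y & \<beta> x y <= 1) & (ALL y:V x. \<beta> x y = 1) & closedin (mtop M) (K x) & K x \<subseteq> U x &
  (ALL y. y ~: K x --> \<beta> x y = (0::real))"
  by metis
 have "Lindelof_space (mtop M)"
  using M by (auto simp: smooth_manifold_def intro: second_countable_imp_Lindelof_space)
 moreover have "!!W. W : V ` points M ==> openin (mtop M) W" "\<Union> (V ` points M) = points M"
  using * openin_subset[of "mtop M"] by blast+
 ultimately obtain \<V> where \<V>: "countable \<V>" "\<V> \<subseteq> V ` points M" "\<Union>\<V> = points M"
  unfolding Lindelof_space_def by meson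
 obtain C where C: "C \<subseteq> points M" "countable C" "\<V> = V ` C"
  using countable_subset_image[of \<V> V "points M"] \<V> by metis
 have "C ~= {}"
 proof
  assume "C = {}"
  then have "\<Union>\<V> = {}" using C(3) by simp
  then show False using \<V>(3) ne by metis
 qed
 define z where "z = from_nat_into C"
 have zC: "range z = C" using C \<open>C ~= {}\<close> by (simp add: z_def range_from_nat_into)
 then have z: "z k : points M" for k using C by blast
 define \<psi> where "\<psi> k y = \<beta> (z k) y * (PROD j<k. 1 + (-1) * \<beta> (z j) y)" for k y
 have ex: "EX k. y : V (z k)" if "y : points M" for y
  using that \<V>(3) C(3) zC by (metis (no_types, lifting) UN_iff image_iff rangeI)
 have z0: "\<psi> k y = 0" if "y : V (z j)" "k > j" for k j y
 proof -
  have "1 + (-1) * \<beta> (z j) y = 0" using *[OF z[of j]] that by auto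
  then have "(PROD j<k. 1 + (-1) * \<beta> (z j) y) = 0" using that(2) by (intro prod_zero) auto
  then show ?thesis by (simp add: \<psi>_def)
 qed
 show ?thesis
 proof (rule exI[of _ \<psi>], rule exI[of _ "%k. U (z k)"], rule exI[of _ "%k. K (z k)"], intro conjI allI impI ballI)
  fix k
  show "U (z k) : \<U>" "openin (mtop M) (U (z k))" "closedin (mtop M) (K (z k))" "K (z k) \<subseteq> U (z k)" using *[OF z[of k]] by auto
  show "smooth_fun_on M (points M) (\<psi> k)"
   unfolding \<psi>_def using *[OF z]
   by (intro smooth_fun_on_mult[OF M] smooth_fun_on_prod[OF M] smooth_fun_on_add[OF M] smooth_fun_on_const) auto
  fix y
  show "0 <= \<psi> k y" unfolding \<psi>_def using *[OF z] by (intro mult_nonneg_nonneg prod_nonneg) auto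
  show "\<psi> k y = 0" if "y ~: K (z k)" using *[OF z[of k]] that by (simp add: \<psi>_def)
 next
  fix y assume y: "y : points M"
  obtain j where "y : V (z j)" using ex[OF y] by blast
  then show "EX V N. openin (mtop M) V & y : V & (ALL k>=N. ALL y:V. \<psi> k y = 0)"
   using *[OF z[of j]] z0 by (intro exI[of _ "V (z j)"] exI[of _ "Suc j"]) auto
  \<comment> \<open>For the first bump that equals \<open>1\<close> at \<open>y\<close> all factors
    coming from earlier bumps are positive.\<close>
  define k where "k = (LEAST k. \<beta> (z k) y = 1)"
  have "\<beta> (z j) y = 1" using *[OF z[of j]] \<open>y : V (z j)\<close> by blast
  then have "\<beta> (z k) y = 1" unfolding k_def by (rule LeastI)
  moreover have "\<beta> (z i) y < 1" if "i < k" for i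
   using not_less_Least[of i "%k. \<beta> (z k) y = 1"] that *[OF z[of i]] unfolding k_def by (auto simp: less_le)
  ultimately have "\<psi> k y > 0" unfolding \<psi>_def by (auto intro!: prod_pos)
  then show "EX k. \<psi> k y > 0" by blast
 qed
qed

section \<open>Coordinate changes and tangent spaces\<close>

lemma smooth_fun_curve_derivative:
 assumes M: "smooth_manifold M" "c : atlas M" and W: "openin (mtop M) W" and F: "smooth_fun_on M W F"
  and x: "x t0 : fst c" "x t0 : W"
  and d: "!!j. j < mdim M ==> ((%t. snd c (x t) j) has_real_derivative d j) (at t0 within A)"
  and ev: "\<forall>\<^sub>F t in at t0 within A. x t : fst c"
 shows "((%t. F (x t)) has_real_derivative
  (SUM j<mdim M. partial_deriv j (%p. F (chart_inv c p)) (snd c (x t0)) * d j)) (at t0 within A)"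
proof -
 have "Ck_on (mdim M) 1 (snd c ` (fst c \<inter> W)) (%p. F (chart_inv c p))"
  using F M by (simp add: smooth_fun_on_iff del: Ck_on.simps One_nat_def)
 then have "((%t. F (chart_inv c (snd c (x t)))) has_real_derivative
  (SUM j<mdim M. partial_deriv j (%p. F (chart_inv c p)) (snd c (x t0)) * d j)) (at t0 within A)"
  using x d ev chart_in_Rn[OF M]
  by (intro has_real_derivative_Ck_curve[OF chart_image_open[OF M W]]) (auto elim: eventually_mono)
 moreover have "\<forall>\<^sub>F t in at t0 within A. F (chart_inv c (snd c (x t))) = F (x t)"
  using ev by eventually_elim (simp add: chart_inv_chart[OF M])
 ultimately show ?thesis
  by (subst (asm) has_field_derivative_cong_eventually) (auto simp: chart_inv_chart[OF M x(1)])
qed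

lemma coordinate_curve:
 assumes M: "smooth_manifold M" "c : atlas M" and x: "x : fst c" and k: "k < mdim M"
  and W: "openin (mtop M) W" "x : W"
 shows "\<forall>\<^sub>F h in nhds (snd c x k). chart_inv c ((snd c x)(k := h)) : fst c \<inter> W &
  snd c (chart_inv c ((snd c x)(k := h))) = (snd c x)(k := h)"
proof -
 have "snd c x : snd c ` (fst c \<inter> W)" using x W by auto
 from openin_Rn_upd[OF chart_image_open[OF M W(1)] this k]
 show ?thesis
 proof eventually_elim
  case (elim h)
  then show ?case using chart_inv_mem[OF elim _ M] chart_chart_inv[of "(snd c x)(k := h)" c] by blast
 qed
qed

lemma coordinate_curve_derivative:
 assumes M: "smooth_manifold M" "c : atlas M" and x: "x : fst c" and k: "k < mdim M"
  and W: "openin (mtop M) W" "x : W" and F: "smooth_fun_on M W F"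
 shows "((%h. F (chart_inv c ((snd c x)(k := h)))) has_real_derivative
   partial_deriv k (%p. F (chart_inv c p)) (snd c x)) (at (snd c x k))"
proof -
 have "Ck_on (mdim M) (Suc 0) (snd c ` (fst c \<inter> W)) (%p. F (chart_inv c p))"
  using F M unfolding smooth_fun_on_iff by blast
 then show ?thesis
  using x W k by (auto simp: partial_deriv_def DERIV_deriv_iff_field_differentiable)
qed

text \<open>The chain rule in the chart \<open>c'\<close>, applied to the coordinate line of
  \<open>c\<close> through \<open>x\<close>; its velocity in \<open>c'\<close> is a column of the
  Jacobian.\<close>

lemma partial_deriv_change_chart:
 assumes M: "smooth_manifold M" and c: "c : charts_at M x" "c' : charts_at M x" and k: "k < mdim M"
  and W: "openin (mtop M) W" "x : W" and F: "smooth_fun_on M W F"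
 shows "partial_deriv k (%p. F (chart_inv c p)) (snd c x) =
  (SUM j<mdim M. partial_deriv j (%p. F (chart_inv c' p)) (snd c' x) * jacobian id c c' x j k)"
proof -
 have cs: "c : atlas M" "x : fst c" "c' : atlas M" "x : fst c'" using c by (auto simp: charts_at_def)
 define y where "y h = chart_inv c ((snd c x)(k := h))" for h
 have y0: "y (snd c x k) = x" by (simp add: y_def chart_inv_chart[OF M cs(1,2)])
 have "((%h. F (y h)) has_real_derivative
   (SUM j<mdim M. partial_deriv j (%p. F (chart_inv c' p)) (snd c' (y (snd c x k))) * jacobian id c c' x j k)) (at (snd c x k))"
 proof (rule smooth_fun_curve_derivative[OF M cs(3) W(1) F])
  show "((%t. snd c' (y t) j) has_real_derivative jacobian id c c' x j k) (at (snd c x k))" if "j < mdim M" for j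
   unfolding jacobian_def y_def id_def
   by (rule coordinate_curve_derivative[OF M cs(1,2) k chart_openin[OF M cs(3)] cs(4) chart_coord_smooth[OF M cs(3) that]])
  show "\<forall>\<^sub>F t in at (snd c x k). y t : fst c'"
   using coordinate_curve[OF M cs(1,2) k chart_openin[OF M cs(3)] cs(4)] unfolding eventually_nhds_conv_at y_def
   by (auto elim: eventually_mono)
 qed (use y0 cs W in auto)
 from DERIV_unique[OF coordinate_curve_derivative[OF M cs(1,2) k W F] this[unfolded y_def]]
 show ?thesis by (simp add: chart_inv_chart[OF M cs(1,2)])
qed

lemma jacobian_chain:
 assumes M: "smooth_manifold M" and c: "c : charts_at M x" "c' : charts_at M x" "c'' : charts_at M x"
  and k: "k < mdim M" "i < mdim M"
 shows "jacobian id c c'' x i k = (SUM j<mdim M. jacobian id c' c'' x i j * jacobian id c c' x j k)"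
proof -
 have c'': "c'' : atlas M" "x : fst c''" using c by (auto simp: charts_at_def)
 show ?thesis
  using partial_deriv_change_chart[OF M c(1,2) k(1) chart_openin[OF M c''(1)] c''(2) chart_coord_smooth[OF M c''(1) k(2)]]
  by (simp add: jacobian_def)
qed

lemma partial_deriv_coord_local:
 assumes M: "smooth_manifold M" and c: "c : charts_at M x" and k: "k < mdim M"
 shows "partial_deriv k (%p. snd c (chart_inv c p) i) (snd c x) = (if i = k then 1 else 0)"
proof -
 have cs: "c : atlas M" "x : fst c" using c by (auto simp: charts_at_def)
 have S: "openin (Euclidean_space (mdim M)) (snd c ` fst c)" by (rule chart_image_openin[OF M cs(1)])
 have "partial_deriv k (%p. snd c (chart_inv c p) i) (snd c x) = partial_deriv k (%p. p i) (snd c x)"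
  using cs k by (intro partial_deriv_cong[OF S]) (auto simp: chart_chart_inv)
 also have "\<dots> = (if i = k then 1 else 0)" by (auto simp: partial_deriv_def)
 finally show ?thesis .
qed

lemma jacobian_self:
 assumes "smooth_manifold M" "c : charts_at M x" "k < mdim M"
 shows "jacobian id c c x i k = (if i = k then 1 else 0)"
 using partial_deriv_coord_local[OF assms] by (simp add: jacobian_def)

lemma sum_fun_apply: "(SUM j:K. g j) i = (SUM j:K. g j i)"
 by (induction K rule: infinite_finite_induct) auto

lemma tangent_space_transform:
 assumes "v : tangent_space M x" "c : charts_at M x" "c' : charts_at M x" "i < mdim M"
 shows "v c' i = (SUM j<mdim M. jacobian id c c' x i j * v c j)"
 using assms by (simp only: tangent_space_def mem_Collect_eq)

lemma tangent_space_zero: "v : tangent_space M x ==> c ~: charts_at M x ==> v c = 0"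
 unfolding tangent_space_def by blast

lemma coordinate_field_tangent:
 assumes M: "smooth_manifold M" and c: "c : charts_at M x" and j: "j < mdim M"
 shows "coordinate_field M c j x : tangent_space M x"
 unfolding tangent_space_def
proof (intro CollectI conjI allI ballI impI)
 fix c1 c2 i assume *: "c1 : charts_at M x" "c2 : charts_at M x" "i < mdim M"
 show "coordinate_field M c j x c2 i = (SUM k<mdim M. jacobian id c1 c2 x i k * coordinate_field M c j x c1 k)"
  using * jacobian_chain[OF M c *(1,2) j *(3)] by (simp add: coordinate_field_def)
qed (auto simp: coordinate_field_def fun_eq_iff Rn_iff)

text \<open>A tangent vector is determined by its component in \<open>c\<close>, and by the cocycle
  rule for Jacobians every coordinate vector in \<open>c\<close> extends to a consistent family.
  Hence frame coordinates are simply the entries of \<open>v c\<close>.\<close>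

lemma tangent_space_frame_coords:
 assumes M: "smooth_manifold M" and c: "c : charts_at M x"
 shows "is_frame (mdim M) (%j. coordinate_field M c j x) (tangent_space M x) &
  (ALL v:tangent_space M x. ALL i<mdim M. frame_coord (mdim M) (%j. coordinate_field M c j x) v i = v c i)"
proof -
 have val: "(SUM j<mdim M. a j *\<^sub>R coordinate_field M c j x) c' i =
   (if c' : charts_at M x & i < mdim M then SUM j<mdim M. a j * jacobian id c c' x i j else 0)" for a c' i
  by (cases "c' : charts_at M x & i < mdim M") (auto simp: sum_fun_apply scaleR_fun_def coordinate_field_def)
 have exp: "v = (SUM j<mdim M. v c j *\<^sub>R coordinate_field M c j x)" if v: "v : tangent_space M x" for v
 proof (intro ext)
  fix c' i
  show "v c' i = (SUM j<mdim M. v c j *\<^sub>R coordinate_field M c j x) c' i"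
  proof (cases "c' : charts_at M x")
   case True
   show ?thesis
   proof (cases "i < mdim M")
    case i: True
    show ?thesis unfolding val tangent_space_transform[OF v c True i] using True i by (simp add: mult.commute)
   next
    case False
    then have "v c' i = 0" using v True by (simp add: tangent_space_def Rn_iff)
    then show ?thesis unfolding val using False by simp
   qed
  next
   case False
   then show ?thesis using tangent_space_zero[OF v] unfolding val by simp
  qed
 qed
 have mem: "(SUM j<mdim M. a j *\<^sub>R coordinate_field M c j x) : tangent_space M x" for a
  unfolding tangent_space_def
 proof (intro CollectI conjI allI ballI impI)
  fix c1 assume "c1 ~: charts_at M x"
  then show "(SUM j<mdim M. a j *\<^sub>R coordinate_field M c j x) c1 = 0" by (simp add: fun_eq_iff val)
 next
  fix c1 assume "c1 : charts_at M x"
  then show "(SUM j<mdim M. a j *\<^sub>R coordinate_field M c j x) c1 : Rn (mdim M)"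
   by (simp add: Rn_iff val)
 next
  fix c1 c2 i assume *: "c1 : charts_at M x" "c2 : charts_at M x" "i < mdim M"
  have "(SUM j<mdim M. a j * jacobian id c c2 x i j) =
   (SUM j<mdim M. a j * (SUM k<mdim M. jacobian id c1 c2 x i k * jacobian id c c1 x k j))"
   using jacobian_chain[OF M c *(1,2) _ *(3)] by simp
  also have "\<dots> = (SUM k<mdim M. jacobian id c1 c2 x i k * (SUM j<mdim M. a j * jacobian id c c1 x k j))"
   by (simp add: sum_distrib_left ac_simps) (rule sum.swap)
  finally show "(SUM j<mdim M. a j *\<^sub>R coordinate_field M c j x) c2 i =
    (SUM k<mdim M. jacobian id c1 c2 x i k * (SUM j<mdim M. a j *\<^sub>R coordinate_field M c j x) c1 k)"
   unfolding val using * by simp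
 qed
 have fr: "is_frame (mdim M) (%j. coordinate_field M c j x) (tangent_space M x)"
  unfolding is_frame_iff
 proof (intro conjI allI impI)
  fix a i assume 0: "(SUM j<mdim M. a j *\<^sub>R coordinate_field M c j x) = 0" "i < mdim M"
  have "(SUM j<mdim M. a j * jacobian id c c x i j) = 0" using val[of a c i] 0 c by simp
  moreover have "(SUM j<mdim M. a j * jacobian id c c x i j) = (SUM j<mdim M. if i = j then a j else 0)"
   by (intro sum.cong refl) (simp add: jacobian_self[OF M c])
  then have "(SUM j<mdim M. a j * jacobian id c c x i j) = a i" using 0(2) by simp
  ultimately show "a i = 0" by simp
 next
  show "tangent_space M x = range (%a. SUM j<mdim M. a j *\<^sub>R coordinate_field M c j x)"
   using exp mem by blast
 qed
 have "frame_coord (mdim M) (%j. coordinate_field M c j x) v i = v c i"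
  if "v : tangent_space M x" "i < mdim M" for v i
  using frame_coord_eqI[OF fr exp[OF that(1)] that(2)] .
 with fr show ?thesis by blast
qed

lemma tangent_space_frame:
 assumes "smooth_manifold M" "c : charts_at M x"
 shows "is_frame (mdim M) (%j. coordinate_field M c j x) (tangent_space M x)"
  and "v : tangent_space M x ==> i < mdim M ==>
   frame_coord (mdim M) (%j. coordinate_field M c j x) v i = v c i"
 using tangent_space_frame_coords[OF assms] by blast+

lemma jacobian_smooth:
 assumes M: "smooth_manifold M" and c: "c : atlas M" "c' : atlas M" and ij: "i < mdim M" "j < mdim M"
 shows "smooth_fun_on M (fst c \<inter> fst c') (%x. jacobian id c c' x i j)"
proof (rule smooth_fun_on_chartI[OF M c(1)])
 have o: "openin (mtop M) (fst c')" using chart_openin[OF M] c by blast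
 then show "openin (mtop M) (fst c \<inter> fst c')" using chart_openin[OF M] c by blast
 fix k
 have S: "openin (Euclidean_space (mdim M)) (snd c ` (fst c \<inter> fst c'))" by (rule chart_image_open[OF M c(1) o])
 have "Ck_on (mdim M) (Suc k) (snd c ` (fst c \<inter> fst c')) (%p. snd c' (chart_inv c p) i)"
  using chart_coord_smooth[OF M c(2) ij(1)] c unfolding smooth_fun_on_iff by blast
 then have "Ck_on (mdim M) k (snd c ` (fst c \<inter> fst c')) (partial_deriv j (%p. snd c' (chart_inv c p) i))"
  using ij by simp
 then show "Ck_on (mdim M) k (snd c ` (fst c \<inter> fst c')) (%p. jacobian id c c' (chart_inv c p) i j)"
  by (subst Ck_on_cong[OF S]) (auto simp: jacobian_def chart_inv_chart[OF M c(1)])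
qed auto

lemma tangent_simps [simp]:
 "fibre (tangent M) = tangent_space M" "vrank (tangent M) = mdim M"
 "vframes (tangent M) = (%c. (fst c, coordinate_field M c)) ` atlas M"
 by (simp_all add: tangent_def Setcompr_eq_image[symmetric] del: split_paired_Ex)

lemma vector_bundle_tangent:
 assumes M: "smooth_manifold M"
 shows "vector_bundle M (tangent M)"
proof -
 have "(UN c:atlas M. fst c) = points M" using M unfolding smooth_manifold_def by (metis (no_types, lifting) SUP_cong case_prod_unfold)
 moreover have "is_frame (mdim M) (%i. coordinate_field M c i x) (tangent_space M x)" if "c : atlas M" "x : fst c" for c x
  using tangent_space_frame(1)[OF M] that by (auto simp: charts_at_def)
 moreover have "smooth_section_on M (tangent M) (fst c) (coordinate_field M c j)" if c: "c : atlas M" and j: "j < mdim M" for c j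
 proof -
  have "smooth_fun_on M (fst c' \<inter> fst c) (%x. frame_coord (mdim M) (%k. coordinate_field M c' k x) (coordinate_field M c j x) i)"
   if "c' : atlas M" "i < mdim M" for c' i
  proof (subst smooth_fun_on_cong[OF M, where g = "%x. jacobian id c c' x i j"])
   show "openin (mtop M) (fst c' \<inter> fst c)" using chart_openin[OF M] that c by blast
   show "smooth_fun_on M (fst c' \<inter> fst c) (%x. jacobian id c c' x i j)"
    using jacobian_smooth[OF M c that j] by (simp add: Int_commute)
   fix x assume "x : fst c' \<inter> fst c"
   then have "c : charts_at M x" "c' : charts_at M x" using that c by (auto simp: charts_at_def)
   then show "frame_coord (mdim M) (%k. coordinate_field M c' k x) (coordinate_field M c j x) i = jacobian id c c' x i j"
    using tangent_space_frame(2)[OF M _ coordinate_field_tangent[OF M]] that j by (simp add: coordinate_field_def)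
  qed
  moreover have "coordinate_field M c j x : tangent_space M x" if "x : fst c" for x
   using coordinate_field_tangent[OF M _ j, of c x] c that by (simp add: charts_at_def)
  ultimately show ?thesis unfolding smooth_section_on_def by simp
 qed
 ultimately show ?thesis unfolding vector_bundle_def by (simp add: chart_openin[OF M])
qed

section \<open>Products, direct sums and duals\<close>

lemma prod_manifold_simps [simp]:
 "mtop (prod_manifold M N) = prod_topology (mtop M) (mtop N)"
 "mdim (prod_manifold M N) = mdim M + mdim N"
 by (simp_all add: prod_manifold_def)

lemma prod_manifold_atlas:
 "atlas (prod_manifold M N) = (%(c, c'). prod_chart (mdim M) c c') ` (atlas M \<times> atlas N)"
 by (auto simp: prod_manifold_def)

lemma fst_prod_chart [simp]: "fst (prod_chart m c c') = fst c \<times> fst c'"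
 and snd_prod_chart: "snd (prod_chart m c c') z i = (if i < m then snd c (fst z) i else snd c' (snd z) (i - m))"
 by (auto simp: prod_chart_def case_prod_unfold)

text \<open>Together with \<open>Rn_right\<close> this splits \<open>Rn (m + n)\<close>. Only the
  left half has to be cut off: on the right the required zeros come from membership in
  \<open>Rn (m + n)\<close>.\<close>

definition Rn_left :: "nat => (nat => real) => nat => real" where
 "Rn_left m p i = (if i < m then p i else 0)"

definition Rn_right :: "nat => (nat => real) => nat => real" where
 "Rn_right m p i = p (m + i)"

lemma Rn_left_in: "Rn_left m p : Rn m"
 by (simp add: Rn_iff Rn_left_def)

lemma Rn_right_in: "p : Rn (m + n) ==> Rn_right m p : Rn n"
 by (simp add: Rn_iff Rn_right_def)

lemma Rn_split_open:
 assumes S: "openin (Euclidean_space m) S" and T: "openin (Euclidean_space n) T"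
 shows "openin (Euclidean_space (m + n)) {p : Rn (m + n). Rn_left m p : S & Rn_right m p : T}"
 unfolding openin_Rn_iff
proof (intro conjI ballI)
 fix p assume p: "p : {p : Rn (m + n). Rn_left m p : S & Rn_right m p : T}"
 obtain d where d: "d > 0" "!!q. q:Rn m ==> (ALL i<m. \<bar>q i - Rn_left m p i\<bar> < d) ==> q : S"
  using S[unfolded openin_Rn_iff, THEN conjunct2, rule_format, of "Rn_left m p"] p by auto
 obtain e where e: "e > 0" "!!q. q:Rn n ==> (ALL i<n. \<bar>q i - Rn_right m p i\<bar> < e) ==> q : T"
  using T[unfolded openin_Rn_iff, THEN conjunct2, rule_format, of "Rn_right m p"] p by auto
 have "q : {p : Rn (m + n). Rn_left m p : S & Rn_right m p : T}"
  if q: "q : Rn (m + n)" "ALL i<m + n. \<bar>q i - p i\<bar> < min d e" for q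
  using q d(2)[OF Rn_left_in, of q] e(2)[OF Rn_right_in[OF q(1)]] by (simp add: Rn_left_def Rn_right_def)
 then show "EX e>0. ALL q:Rn (m + n). (ALL i<m + n. \<bar>q i - p i\<bar> < e) -->
   q : {p : Rn (m + n). Rn_left m p : S & Rn_right m p : T}"
  using d(1) e(1) by (intro exI[of _ "min d e"]) auto
qed auto

lemma prod_chart_left: 
 assumes "smooth_manifold M" "c : atlas M" "x : fst c"
 shows "Rn_left (mdim M) (snd (prod_chart (mdim M) c c') (x, y)) = snd c x"
 using chart_in_Rn[OF assms] by (auto simp: fun_eq_iff Rn_left_def snd_prod_chart Rn_iff)

lemma prod_chart_right: "Rn_right m (snd (prod_chart m c c') (x, y)) = snd c' y"
 by (auto simp: fun_eq_iff Rn_right_def snd_prod_chart)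

lemma prod_chart_in_Rn:
 assumes "smooth_manifold M" "smooth_manifold N" "c : atlas M" "c' : atlas N" "x : fst c" "y : fst c'"
 shows "snd (prod_chart (mdim M) c c') (x, y) : Rn (mdim M + mdim N)"
 using chart_in_Rn[OF assms(1,3,5)] chart_in_Rn[OF assms(2,4,6)] by (auto simp: Rn_iff snd_prod_chart)

lemma Rn_split_eqI:
 assumes "Rn_left m p = Rn_left m q" "Rn_right m p = Rn_right m q"
 shows "p = q"
proof
 fix i show "p i = q i"
  using fun_cong[OF assms(1), of i] fun_cong[OF assms(2), of "i - m"]
  by (cases "i < m") (auto simp: Rn_left_def Rn_right_def)
qed

lemma prod_chart_image:
 assumes M: "smooth_manifold M" "c : atlas M" and N: "smooth_manifold N" "c' : atlas N"
  and U: "U \<subseteq> fst c" "V \<subseteq> fst c'"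
 shows "snd (prod_chart (mdim M) c c') ` (U \<times> V) =
  {p : Rn (mdim M + mdim N). Rn_left (mdim M) p : snd c ` U & Rn_right (mdim M) p : snd c' ` V}"
proof (intro set_eqI iffI)
 fix p assume "p : snd (prod_chart (mdim M) c c') ` (U \<times> V)"
 then obtain x y where "x : U" "y : V" "p = snd (prod_chart (mdim M) c c') (x, y)" by auto
 then show "p : {p : Rn (mdim M + mdim N). Rn_left (mdim M) p : snd c ` U & Rn_right (mdim M) p : snd c' ` V}"
  using U prod_chart_in_Rn[OF M(1) N(1) M(2) N(2)]
  by (auto simp: subset_iff prod_chart_left[OF M] prod_chart_right)
next
 fix p assume "p : {p : Rn (mdim M + mdim N). Rn_left (mdim M) p : snd c ` U & Rn_right (mdim M) p : snd c' ` V}"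
 then obtain x y where xy: "x : U" "y : V" "Rn_left (mdim M) p = snd c x" "Rn_right (mdim M) p = snd c' y" by auto
 have "p = snd (prod_chart (mdim M) c c') (x, y)"
  by (rule Rn_split_eqI[of "mdim M"]) (use xy U in \<open>auto simp: prod_chart_left[OF M] prod_chart_right\<close>)
 then show "p : snd (prod_chart (mdim M) c c') ` (U \<times> V)" using xy by blast
qed

lemma prod_chart_inj:
 assumes M: "smooth_manifold M" "c : atlas M" and N: "smooth_manifold N" "c' : atlas N"
 shows "inj_on (snd (prod_chart (mdim M) c c')) (fst c \<times> fst c')"
proof (rule inj_onI)
 fix z w assume *: "z : fst c \<times> fst c'" "w : fst c \<times> fst c'"
  "snd (prod_chart (mdim M) c c') z = snd (prod_chart (mdim M) c c') w"
 have "snd c (fst z) = snd c (fst w)" "snd c' (snd z) = snd c' (snd w)"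
  using * prod_chart_left[OF M] prod_chart_right by (metis mem_Times_iff prod.collapse)+
 then show "z = w" using * inj_onD[OF chart_inj[OF M]] inj_onD[OF chart_inj[OF N]] by (auto simp: mem_Times_iff prod_eq_iff)
qed

lemma prod_chart_inv:
 assumes M: "smooth_manifold M" "c : atlas M" and N: "smooth_manifold N" "c' : atlas N"
  and p: "p : snd (prod_chart (mdim M) c c') ` (fst c \<times> fst c')"
 shows "chart_inv (prod_chart (mdim M) c c') p = (chart_inv c (Rn_left (mdim M) p), chart_inv c' (Rn_right (mdim M) p))"
proof -
 obtain x y where xy: "x : fst c" "y : fst c'" "p = snd (prod_chart (mdim M) c c') (x, y)" using p by auto
 have "chart_inv (prod_chart (mdim M) c c') p = (x, y)"
  using xy inv_into_f_f[OF prod_chart_inj[OF M N], of "(x, y)"] by (simp add: chart_inv_def)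
 then show ?thesis
  using xy by (simp add: prod_chart_left[OF M] prod_chart_right chart_inv_chart[OF M] chart_inv_chart[OF N])
qed

text \<open>In a product chart the function is the chart expression on the factor, composed with
  \<open>Rn_left\<close> or \<open>Rn_right\<close>, whose components are coordinates or
  zero.\<close>

lemma smooth_fun_on_fst_snd:
 assumes M: "smooth_manifold M" and N: "smooth_manifold N"
 shows "openin (mtop M) W ==> smooth_fun_on M W f ==> smooth_fun_on (prod_manifold M N) (W \<times> points N) (%z. f (fst z))"
  and "openin (mtop N) V ==> smooth_fun_on N V g ==> smooth_fun_on (prod_manifold M N) (points M \<times> V) (%z. g (snd z))"
proof -
 let ?P = "prod_manifold M N"
 have S: "openin (Euclidean_space (mdim ?P)) (snd C ` (fst C \<inter> W \<times> V)) &
   (ALL p:snd C ` (fst C \<inter> W \<times> V). Rn_left (mdim M) p : snd c ` (fst c \<inter> W) & Rn_right (mdim M) p : snd c' ` (fst c' \<inter> V) &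
    chart_inv C p = (chart_inv c (Rn_left (mdim M) p), chart_inv c' (Rn_right (mdim M) p)))"
  if c: "c : atlas M" "c' : atlas N" "C = prod_chart (mdim M) c c'" and W: "openin (mtop M) W" "openin (mtop N) V" for c c' C W V
 proof -
  have "fst C \<inter> W \<times> V = (fst c \<inter> W) \<times> (fst c' \<inter> V)" using c by auto
  then have "snd C ` (fst C \<inter> W \<times> V) = {p : Rn (mdim M + mdim N).
    Rn_left (mdim M) p : snd c ` (fst c \<inter> W) & Rn_right (mdim M) p : snd c' ` (fst c' \<inter> V)}"
   using prod_chart_image[OF M c(1) N c(2), of "fst c \<inter> W" "fst c' \<inter> V"] c(3) by simp
  moreover have "chart_inv C p = (chart_inv c (Rn_left (mdim M) p), chart_inv c' (Rn_right (mdim M) p))"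
   if "p : snd C ` (fst C \<inter> W \<times> V)" for p
   unfolding c(3) using that c(3) by (intro prod_chart_inv[OF M c(1) N c(2)]) auto
  ultimately show ?thesis
   using Rn_split_open[OF chart_image_open[OF M c(1) W(1)] chart_image_open[OF N c(2) W(2)]] by simp
 qed
 { assume W: "openin (mtop M) W" and f: "smooth_fun_on M W f"
  show "smooth_fun_on ?P (W \<times> points N) (%z. f (fst z))"
   unfolding smooth_fun_on_iff
  proof (intro ballI allI)
   fix C k assume "C : atlas ?P"
   then obtain c c' where c: "c : atlas M" "c' : atlas N" "C = prod_chart (mdim M) c c'"
    by (auto simp: prod_manifold_atlas)
   note S = S[OF c W openin_topspace]
   have "Ck_on (mdim ?P) k (snd C ` (fst C \<inter> W \<times> points N)) (%p. f (chart_inv c (Rn_left (mdim M) p)))"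
    by (rule Ck_on_compose[where f = "%q. f (chart_inv c q)" and T = "snd c ` (fst c \<inter> W)"])
     (use S f c chart_image_open[OF M c(1) W] in \<open>auto simp: Rn_left_def Ck_on_coord smooth_fun_on_iff\<close>)
   then show "Ck_on (mdim ?P) k (snd C ` (fst C \<inter> W \<times> points N)) (%p. f (fst (chart_inv C p)))"
    by (subst Ck_on_cong[OF conjunct1[OF S]]) (use S in auto)
  qed }
 { assume V: "openin (mtop N) V" and g: "smooth_fun_on N V g"
  show "smooth_fun_on ?P (points M \<times> V) (%z. g (snd z))"
   unfolding smooth_fun_on_iff
  proof (intro ballI allI)
   fix C k assume "C : atlas ?P"
   then obtain c c' where c: "c : atlas M" "c' : atlas N" "C = prod_chart (mdim M) c c'"
    by (auto simp: prod_manifold_atlas)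
   note S = S[OF c openin_topspace V]
   have "Ck_on (mdim ?P) k (snd C ` (fst C \<inter> points M \<times> V)) (%p. g (chart_inv c' (Rn_right (mdim M) p)))"
    by (rule Ck_on_compose[where f = "%q. g (chart_inv c' q)" and T = "snd c' ` (fst c' \<inter> V)"])
     (use S g c chart_image_open[OF N c(2) V] in \<open>auto simp: Rn_right_def Ck_on_coord smooth_fun_on_iff\<close>)
   then show "Ck_on (mdim ?P) k (snd C ` (fst C \<inter> points M \<times> V)) (%p. g (snd (chart_inv C p)))"
    by (subst Ck_on_cong[OF conjunct1[OF S]]) (use S in auto)
  qed }
qed

lemma continuous_map_into_Rn:
 assumes "!!x. x : topspace X ==> f x : Rn n"
  and "!!i. i < n ==> continuous_map X euclideanreal (%x. f x i)"
 shows "continuous_map X (Euclidean_space n) f"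
proof -
 have "continuous_map X (Euclidean_space n) (%x i. if i < n then f x i else 0)"
  unfolding continuous_map_componentwise_Euclidean_space using assms by blast
 then show ?thesis
  by (rule continuous_map_eq) (use assms(1) in \<open>auto simp: Rn_iff fun_eq_iff\<close>)
qed

lemma continuous_map_Rn_coord: "continuous_map (Euclidean_space n) euclideanreal (%p. p i)"
 unfolding continuous_map_Euclidean_space_iff by (rule continuous_on_apply)

lemma prod_chart_homeomorphic:
 assumes M: "smooth_manifold M" "c : atlas M" and N: "smooth_manifold N" "c' : atlas N"
 shows "homeomorphic_map (subtopology (prod_topology (mtop M) (mtop N)) (fst c \<times> fst c'))
  (subtopology (Euclidean_space (mdim M + mdim N)) (snd (prod_chart (mdim M) c c') ` (fst c \<times> fst c')))
  (snd (prod_chart (mdim M) c c'))"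
proof -
 let ?C = "prod_chart (mdim M) c c'" and ?m = "mdim M" and ?n = "mdim N"
 let ?S = "snd ?C ` (fst c \<times> fst c')"
 obtain g where g: "homeomorphic_maps (subtopology (mtop M) (fst c)) (subtopology (Euclidean_space ?m) (snd c ` fst c)) (snd c) g"
  using chart_homeomorphic[OF M] by (auto simp: homeomorphic_map_maps)
 obtain g' where g': "homeomorphic_maps (subtopology (mtop N) (fst c')) (subtopology (Euclidean_space ?n) (snd c' ` fst c')) (snd c') g'"
  using chart_homeomorphic[OF N] by (auto simp: homeomorphic_map_maps)
 have U: "fst c \<subseteq> points M" "fst c' \<subseteq> points N" using chart_openin[OF M] chart_openin[OF N] openin_subset by auto
 have S: "?S = {p : Rn (?m + ?n). Rn_left ?m p : snd c ` fst c & Rn_right ?m p : snd c' ` fst c'}"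
  by (rule prod_chart_image[OF M N]) auto
 have X: "subtopology (prod_topology (mtop M) (mtop N)) (fst c \<times> fst c') =
   prod_topology (subtopology (mtop M) (fst c)) (subtopology (mtop N) (fst c'))"
  by (simp add: subtopology_Times)
 have cc: "continuous_map (subtopology (mtop M) (fst c)) euclideanreal (%x. snd c x i)" if "i < ?m" for i
  using smooth_fun_on_continuous[OF M(1) chart_openin[OF M] chart_coord_smooth[OF M that]] .
 have cc': "continuous_map (subtopology (mtop N) (fst c')) euclideanreal (%x. snd c' x i)" if "i < ?n" for i
  using smooth_fun_on_continuous[OF N(1) chart_openin[OF N] chart_coord_smooth[OF N that]] .
 have "homeomorphic_maps (subtopology (prod_topology (mtop M) (mtop N)) (fst c \<times> fst c'))
  (subtopology (Euclidean_space (?m + ?n)) ?S) (snd ?C) (%p. (g (Rn_left ?m p), g' (Rn_right ?m p)))"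
  unfolding homeomorphic_maps_def
 proof (intro conjI ballI)
  show "continuous_map (subtopology (prod_topology (mtop M) (mtop N)) (fst c \<times> fst c')) (subtopology (Euclidean_space (?m + ?n)) ?S) (snd ?C)"
   unfolding continuous_map_in_subtopology
  proof (intro conjI continuous_map_into_Rn)
   fix i assume "i < ?m + ?n"
   then show "continuous_map (subtopology (prod_topology (mtop M) (mtop N)) (fst c \<times> fst c')) euclideanreal (%x. snd ?C x i)"
    unfolding snd_prod_chart X
    using continuous_map_compose[OF continuous_map_fst[of "subtopology (mtop M) (fst c)" "subtopology (mtop N) (fst c')"] cc[of i]]
     continuous_map_compose[OF continuous_map_snd[of "subtopology (mtop M) (fst c)" "subtopology (mtop N) (fst c')"] cc'[of "i - ?m"]]
    by (cases "i < ?m") (auto simp: comp_def)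
  qed (use prod_chart_in_Rn[OF M(1) N(1) M(2) N(2)] in auto)
  have "continuous_map (subtopology (Euclidean_space (?m + ?n)) ?S) (subtopology (Euclidean_space ?m) (snd c ` fst c)) (Rn_left ?m)"
   unfolding continuous_map_in_subtopology
  proof (intro conjI continuous_map_into_Rn)
   show "continuous_map (subtopology (Euclidean_space (?m + ?n)) ?S) euclideanreal (%x. Rn_left ?m x i)" if "i < ?m" for i
    using continuous_map_from_subtopology[OF continuous_map_Rn_coord] that by (simp add: Rn_left_def)
  qed (auto simp: Rn_left_in S)
  then have 1: "continuous_map (subtopology (Euclidean_space (?m + ?n)) ?S) (mtop M) (%p. g (Rn_left ?m p))"
   using g continuous_map_compose[of _ _ "Rn_left ?m" "subtopology (mtop M) (fst c)" g]
   unfolding homeomorphic_maps_def comp_def by (meson continuous_map_into_fulltopology)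
  have "continuous_map (subtopology (Euclidean_space (?m + ?n)) ?S) (subtopology (Euclidean_space ?n) (snd c' ` fst c')) (Rn_right ?m)"
   unfolding continuous_map_in_subtopology
  proof (intro conjI continuous_map_into_Rn)
   show "continuous_map (subtopology (Euclidean_space (?m + ?n)) ?S) euclideanreal (%x. Rn_right ?m x i)" for i
    using continuous_map_from_subtopology[OF continuous_map_Rn_coord] by (simp add: Rn_right_def)
  qed (auto simp: Rn_right_in S)
  then have 2: "continuous_map (subtopology (Euclidean_space (?m + ?n)) ?S) (mtop N) (%p. g' (Rn_right ?m p))"
   using g' continuous_map_compose[of _ _ "Rn_right ?m" "subtopology (mtop N) (fst c')" g']
   unfolding homeomorphic_maps_def comp_def by (meson continuous_map_into_fulltopology)
  have gx: "g (snd c x) = x" if "x : fst c" for x using g that U by (auto simp: homeomorphic_maps_def)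
  have gy: "g' (snd c' x) = x" if "x : fst c'" for x using g' that U by (auto simp: homeomorphic_maps_def)
  show "continuous_map (subtopology (Euclidean_space (?m + ?n)) ?S) (subtopology (prod_topology (mtop M) (mtop N)) (fst c \<times> fst c'))
    (%p. (g (Rn_left ?m p), g' (Rn_right ?m p)))"
   unfolding continuous_map_in_subtopology using 1 2 S gx gy by (auto simp: continuous_map_pairwise comp_def)
  have inv: "(g (Rn_left ?m (snd ?C z)), g' (Rn_right ?m (snd ?C z))) = z" if "z : fst c \<times> fst c'" for z
   using that by (cases z) (auto simp: gx gy prod_chart_left[OF M] prod_chart_right)
  show "(g (Rn_left ?m (snd ?C z)), g' (Rn_right ?m (snd ?C z))) = z"
   if "z : topspace (subtopology (prod_topology (mtop M) (mtop N)) (fst c \<times> fst c'))" for z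
   using inv that by auto
  fix p assume "p : topspace (subtopology (Euclidean_space (?m + ?n)) ?S)"
  then obtain z where "z : fst c \<times> fst c'" "p = snd ?C z" by auto
  then show "snd ?C (g (Rn_left ?m p), g' (Rn_right ?m p)) = p" using inv by simp
 qed
 then show ?thesis by (auto simp: homeomorphic_map_maps)
qed

lemma second_countable_prod_topology:
 assumes "second_countable X" "second_countable Y"
 shows "second_countable (prod_topology X Y)"
proof -
 obtain \<A> where A: "countable \<A>" "!!V. V : \<A> ==> openin X V"
  "!!U x. openin X U ==> x : U ==> EX V:\<A>. x : V & V \<subseteq> U"
  using assms(1) unfolding second_countable_def by metis
 obtain \<B> where B: "countable \<B>" "!!V. V : \<B> ==> openin Y V"
  "!!U x. openin Y U ==> x : U ==> EX V:\<B>. x : V & V \<subseteq> U"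
  using assms(2) unfolding second_countable_def by metis
 let ?C = "(%(U, V). U \<times> V) ` (\<A> \<times> \<B>)"
 have "EX V:?C. z : V & V \<subseteq> W" if W: "openin (prod_topology X Y) W" "z : W" for W z
 proof -
  obtain U V where UV: "openin X U" "openin Y V" "fst z : U" "snd z : V" "U \<times> V \<subseteq> W"
   using W unfolding openin_prod_topology_alt by (metis prod.collapse)
  obtain U' where "U' : \<A>" "fst z : U'" "U' \<subseteq> U" using A(3)[OF UV(1,3)] by blast
  moreover obtain V' where "V' : \<B>" "snd z : V'" "V' \<subseteq> V" using B(3)[OF UV(2,4)] by blast
  ultimately show ?thesis using UV(5) by (intro bexI[of _ "U' \<times> V'"]) (auto simp: mem_Times_iff)
 qed
 moreover have "countable ?C" using A(1) B(1) by simp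
 moreover have "openin (prod_topology X Y) V" if "V : ?C" for V
  using that A(2) B(2) by (auto simp: openin_prod_Times_iff)
 ultimately show ?thesis unfolding second_countable_def by (intro exI[of _ ?C]) meson
qed

lemma smooth_manifold_prod:
 assumes M: "smooth_manifold M" and N: "smooth_manifold N"
 shows "smooth_manifold (prod_manifold M N)"
 unfolding smooth_manifold_def
proof (intro conjI)
 let ?P = "prod_manifold M N"
 show "Hausdorff_space (mtop ?P)"
  using M N by (simp add: smooth_manifold_def Hausdorff_space_prod_topology)
 show "second_countable (mtop ?P)"
  using M N by (simp add: smooth_manifold_def second_countable_prod_topology)
 show "ALL (U, \<phi>):atlas ?P. openin (mtop ?P) U & openin (Euclidean_space (mdim ?P)) (\<phi> ` U) &
    homeomorphic_map (subtopology (mtop ?P) U) (subtopology (Euclidean_space (mdim ?P)) (\<phi> ` U)) \<phi>"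
 proof
  fix C assume "C : atlas ?P"
  then obtain c c' where c: "c : atlas M" "c' : atlas N" "C = prod_chart (mdim M) c c'"
   by (auto simp: prod_manifold_atlas)
  have "openin (mtop ?P) (fst C)" using chart_openin[OF M c(1)] chart_openin[OF N c(2)] by (simp add: c(3) openin_prod_Times_iff)
  moreover have "openin (Euclidean_space (mdim ?P)) (snd C ` fst C)"
   using Rn_split_open[OF chart_image_openin[OF M c(1)] chart_image_openin[OF N c(2)]]
   by (simp add: c(3) prod_chart_image[OF M c(1) N c(2)])
  moreover have "homeomorphic_map (subtopology (mtop ?P) (fst C)) (subtopology (Euclidean_space (mdim ?P)) (snd C ` fst C)) (snd C)"
   using prod_chart_homeomorphic[OF M c(1) N c(2)] by (simp add: c(3))
  ultimately show "case C of (U, \<phi>) => openin (mtop ?P) U & openin (Euclidean_space (mdim ?P)) (\<phi> ` U) &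
    homeomorphic_map (subtopology (mtop ?P) U) (subtopology (Euclidean_space (mdim ?P)) (\<phi> ` U)) \<phi>"
   by (simp add: case_prod_unfold)
 qed
 have "(UN C:atlas ?P. fst C) = points ?P"
 proof (intro equalityI subsetI)
  fix z assume "z : (UN C:atlas ?P. fst C)"
  then show "z : points ?P"
   using chart_subset[OF M] chart_subset[OF N] by (auto simp: prod_manifold_atlas)
 next
  fix z assume "z : points ?P"
  then obtain c c' where "c : atlas M" "fst z : fst c" "c' : atlas N" "snd z : fst c'"
   using chart_exists[OF M, of "fst z"] chart_exists[OF N, of "snd z"] by (auto simp: mem_Times_iff)
  then show "z : (UN C:atlas ?P. fst C)"
   by (intro UN_I[of "prod_chart (mdim M) c c'"]) (auto simp: prod_manifold_atlas mem_Times_iff)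
 qed
 then show "(UN (U, \<phi>):atlas ?P. U) = points ?P" by (simp add: case_prod_unfold)
 show "ALL (V, \<psi>):atlas ?P. ALL i<mdim ?P. smooth_fun_on ?P V (%x. \<psi> x i)"
 proof
  fix C assume "C : atlas ?P"
  then obtain c c' where c: "c : atlas M" "c' : atlas N" "C = prod_chart (mdim M) c c'"
   by (auto simp: prod_manifold_atlas)
  have "smooth_fun_on ?P (fst C) (%x. snd C x i)" if i: "i < mdim ?P" for i
  proof (cases "i < mdim M")
   case True
   have "smooth_fun_on ?P (fst C) (%z. snd c (fst z) i)"
    by (rule smooth_fun_on_subset[OF smooth_fun_on_fst_snd(1)[OF M N chart_openin[OF M c(1)] chart_coord_smooth[OF M c(1) True]]])
     (use c chart_subset[OF N c(2)] in auto)
   then show ?thesis using True by (simp add: c(3) snd_prod_chart)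
  next
   case False
   then have "i - mdim M < mdim N" using i by simp
   then have "smooth_fun_on ?P (fst C) (%z. snd c' (snd z) (i - mdim M))"
    by (intro smooth_fun_on_subset[OF smooth_fun_on_fst_snd(2)[OF M N chart_openin[OF N c(2)] chart_coord_smooth[OF N c(2)]]])
     (use c chart_subset[OF M c(1)] in auto)
   then show ?thesis using False by (simp add: c(3) snd_prod_chart)
  qed
  then show "case C of (V, \<psi>) => ALL i<mdim ?P. smooth_fun_on ?P V (%x. \<psi> x i)" by (simp add: case_prod_unfold)
 qed
qed

section \<open>Frames of sums, exterior products and duals\<close>

lemma vb_frame_open: "vector_bundle M E ==> (U, s) : vframes E ==> openin (mtop M) U"
 unfolding vector_bundle_def by fast

lemma vb_frame_subset: "vector_bundle M E ==> (U, s) : vframes E ==> x : U ==> x : points M"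
 using vb_frame_open openin_subset by blast

lemma vb_is_frame: "vector_bundle M E ==> (U, s) : vframes E ==> x : U ==> is_frame (vrank E) (%i. s i x) (fibre E x)"
 unfolding vector_bundle_def by fast

lemma vb_frame_exists: 
 assumes "vector_bundle M E" "x : points M"
 obtains U s where "(U, s) : vframes E" "x : U"
proof -
 have "x : (UN (U, s):vframes E. U)" using assms unfolding vector_bundle_def by blast
 then show thesis using that by blast
qed

lemma vb_transition_smooth:
 "vector_bundle M E ==> (U, s) : vframes E ==> (U', s') : vframes E ==> i < vrank E ==> j < vrank E ==>
  smooth_fun_on M (U' \<inter> U) (%x. vcoord E s' x (s j x) i)"
 unfolding vector_bundle_def smooth_section_on_def by fast

lemma vb_fibre_subspace: "vector_bundle M E ==> x : points M ==> subspace (fibre E x)"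
 by (meson is_frame_subspace vb_frame_exists vb_is_frame)

text \<open>Transition functions are compared on the overlap with an explicit smooth expression
  \<open>h\<close>; the values of \<open>frame_coord\<close> off the overlap, where the family need
  not be a frame, are thereby kept out.\<close>

lemma vector_bundleI:
 assumes M: "smooth_manifold M"
  and "!!x. x : points M ==> EX U s. (U, s) : vframes E & x : U"
  and op: "!!U s. (U, s) : vframes E ==> openin (mtop M) U"
  and fr: "!!U s x. (U, s) : vframes E ==> x : U ==> is_frame (vrank E) (%i. s i x) (fibre E x)"
  and tr: "!!U s U' s' i j. (U, s) : vframes E ==> (U', s') : vframes E ==> i < vrank E ==> j < vrank E ==>
   EX h. smooth_fun_on M (U' \<inter> U) h & (ALL x:U' \<inter> U. vcoord E s' x (s j x) i = h x)"
 shows "vector_bundle M E"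
proof -
 have "smooth_section_on M E U (s j)" if Us: "(U, s) : vframes E" and j: "j < vrank E" for U s j
  unfolding smooth_section_on_def
 proof (intro conjI ballI, goal_cases)
  case (1 x) then show ?case using fr[OF Us] j is_frame_mem by blast
 next
  case (2 Us')
  obtain U' s' where Us': "Us' = (U', s')" by (cases Us')
  have "smooth_fun_on M (U' \<inter> U) (%x. vcoord E s' x (s j x) i)" if i: "i < vrank E" for i
  proof -
   have vf: "(U', s') : vframes E" using 2 Us' by simp
   obtain h where h: "smooth_fun_on M (U' \<inter> U) h" "ALL x:U' \<inter> U. vcoord E s' x (s j x) i = h x"
    using tr[OF Us vf i j] by blast
   have "openin (mtop M) (U' \<inter> U)" using op[OF vf] op[OF Us] by blast
   from smooth_fun_on_cong[OF M this, of "%x. vcoord E s' x (s j x) i" h] h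
   show ?thesis by simp
  qed
  then show ?case by (simp add: Us')
 qed
 moreover have "(UN (U, s):vframes E. U) = points M"
  using assms(2) op openin_subset by fast
 ultimately show ?thesis unfolding vector_bundle_def using op fr by fast
qed

lemma dsum_simps [simp]:
 "fibre (dsum E F) x = fibre E x \<times> fibre F x" "vrank (dsum E F) = vrank E + vrank F"
 by (simp_all add: dsum_def)

lemma ext_prod_simps [simp]:
 "fibre (ext_prod E F) z = fibre E (fst z) \<times> fibre F (snd z)" "vrank (ext_prod E F) = vrank E + vrank F"
 by (simp_all add: ext_prod_def case_prod_unfold)

lemma dual_bundle_simps [simp]:
 "fibre (dual_bundle E) x = dual_space (fibre E x)" "vrank (dual_bundle E) = vrank E"
 by (simp_all add: dual_bundle_def)

definition dsum_frame :: "nat => (nat => 'm => 'v::zero) => (nat => 'm => 'w::zero) => nat => 'm => 'v \<times> 'w" where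
 "dsum_frame r s t i x = (if i < r then (s i x, 0) else (0, t (i - r) x))"

lemma vframes_dsum: "W : vframes (dsum E F) \<longleftrightarrow>
  (EX U s V t. (U, s) : vframes E & (V, t) : vframes F & W = (U \<inter> V, dsum_frame (vrank E) s t))"
 by (auto simp: dsum_def dsum_frame_def[abs_def])

lemma vframes_ext_prod: "W : vframes (ext_prod E F) \<longleftrightarrow>
  (EX U s V t. (U, s) : vframes E & (V, t) : vframes F &
   W = (U \<times> V, dsum_frame (vrank E) (%i z. s i (fst z)) (%i z. t i (snd z))))"
 by (auto simp: ext_prod_def dsum_frame_def[abs_def] case_prod_unfold)

definition dual_frame :: "('m => 'v::real_vector set) => nat => (nat => 'm => 'v) => nat => 'm => 'v => real" where
 "dual_frame V r s i x v = (if v : V x then frame_coord r (%k. s k x) v i else 0)"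

lemma vframes_dual: "W : vframes (dual_bundle E) \<longleftrightarrow>
  (EX U s. (U, s) : vframes E & W = (U, dual_frame (fibre E) (vrank E) s))"
 by (auto simp: dual_bundle_def dual_frame_def[abs_def])

lemma vector_bundle_dsum:
 assumes M: "smooth_manifold M" and E: "vector_bundle M E" and F: "vector_bundle M F"
 shows "vector_bundle M (dsum E F)"
proof (rule vector_bundleI[OF M])
 fix x assume x: "x : points M"
 obtain U s where "(U, s) : vframes E" "x : U" using vb_frame_exists[OF E x] .
 moreover obtain V t where "(V, t) : vframes F" "x : V" using vb_frame_exists[OF F x] .
 ultimately show "EX U s. (U, s) : vframes (dsum E F) & x : U" unfolding vframes_dsum by blast
next
 fix W r assume "(W, r) : vframes (dsum E F)"
 then obtain U s V t where *: "(U, s) : vframes E" "(V, t) : vframes F" "W = U \<inter> V" "r = dsum_frame (vrank E) s t"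
  unfolding vframes_dsum by auto
 then show "openin (mtop M) W" using vb_frame_open[OF E] vb_frame_open[OF F] by auto
 show "is_frame (vrank (dsum E F)) (%i. r i x) (fibre (dsum E F) x)" if "x : W" for x
  using is_frame_times[OF vb_is_frame[OF E *(1)] vb_is_frame[OF F *(2)]] that * by (simp add: dsum_frame_def)
 fix W' r' i j assume "(W', r') : vframes (dsum E F)" and ij: "i < vrank (dsum E F)" "j < vrank (dsum E F)"
 then obtain U' s' V' t' where st': "(U', s') : vframes E" "(V', t') : vframes F" "W' = U' \<inter> V'" "r' = dsum_frame (vrank E) s' t'"
  unfolding vframes_dsum by auto
 \<comment> \<open>The transition matrix is block diagonal, so mixed indices give zero.\<close>
 define h where "h x = (if i < vrank E & j < vrank E then vcoord E s' x (s j x) i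
   else if \<not> i < vrank E & \<not> j < vrank E then vcoord F t' x (t (j - vrank E) x) (i - vrank E) else 0)" for x
 have "smooth_fun_on M (W' \<inter> W) h"
 proof -
  consider "i < vrank E" "j < vrank E" | "\<not> i < vrank E" "\<not> j < vrank E" | "(i < vrank E) ~= (j < vrank E)" by blast
  then show ?thesis
  proof cases
   case 1
   then show ?thesis using smooth_fun_on_subset[OF vb_transition_smooth[OF E *(1) st'(1)], of i j "W' \<inter> W"] * st'
    by (auto simp: h_def[abs_def])
  next
   case 2
   then have ij': "i - vrank E < vrank F" "j - vrank E < vrank F" using ij by auto
   have "W' \<inter> W \<subseteq> V' \<inter> V" using * st' by auto
   from smooth_fun_on_subset[OF vb_transition_smooth[OF F *(2) st'(2) ij'] this] 2
   show ?thesis by (simp add: h_def[abs_def])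
  next
   case 3 then have "h = (%x. 0)" by (auto simp: h_def)
   then show ?thesis by (simp add: smooth_fun_on_const)
  qed
 qed
 moreover have "frame_coord (vrank (dsum E F)) (%k. r' k x) (r j x) i = h x" if x: "x : W' \<inter> W" for x
 proof -
  have fr: "is_frame (vrank E) (%i. s' i x) (fibre E x)" "is_frame (vrank F) (%i. t' i x) (fibre F x)"
   using x * st' vb_is_frame[OF E st'(1)] vb_is_frame[OF F st'(2)] by auto
  have mem: "j < vrank E ==> s j x : fibre E x" "\<not> j < vrank E ==> t (j - vrank E) x : fibre F x"
   using x * ij is_frame_mem[OF vb_is_frame[OF E *(1)], of x j] is_frame_mem[OF vb_is_frame[OF F *(2)], of x "j - vrank E"] by auto
  have z: "0 : fibre E x" "0 : fibre F x" using is_frame_subspace[OF fr(1)] is_frame_subspace[OF fr(2)] by (auto simp: subspace_0)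
  show ?thesis
   using frame_coord_times[OF fr mem(1) z(2), of i] frame_coord_times[OF fr z(1) mem(2), of i] ij
    frame_coord_zero[OF fr(1), of i] frame_coord_zero[OF fr(2), of "i - vrank E"]
   by (simp add: st'(4) *(4) dsum_frame_def h_def)
 qed
 ultimately show "EX h. smooth_fun_on M (W' \<inter> W) h & (ALL x:W' \<inter> W. frame_coord (vrank (dsum E F)) (%k. r' k x) (r j x) i = h x)"
  by blast
qed

lemma vector_bundle_ext_prod:
 assumes M: "smooth_manifold M" and N: "smooth_manifold N" and E: "vector_bundle M E" and F: "vector_bundle N F"
 shows "vector_bundle (prod_manifold M N) (ext_prod E F)"
proof (rule vector_bundleI[OF smooth_manifold_prod[OF M N]])
 fix z assume "z : points (prod_manifold M N)"
 then have x: "fst z : points M" "snd z : points N" by auto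
 obtain U s where "(U, s) : vframes E" "fst z : U" using vb_frame_exists[OF E x(1)] .
 moreover obtain V t where "(V, t) : vframes F" "snd z : V" using vb_frame_exists[OF F x(2)] .
 ultimately show "EX U s. (U, s) : vframes (ext_prod E F) & z : U" 
  unfolding vframes_ext_prod by (metis mem_Times_iff)
next
 fix W r assume "(W, r) : vframes (ext_prod E F)"
 then obtain U s V t where *: "(U, s) : vframes E" "(V, t) : vframes F" "W = U \<times> V"
   "r = dsum_frame (vrank E) (%i z. s i (fst z)) (%i z. t i (snd z))"
  unfolding vframes_ext_prod by auto
 then show "openin (mtop (prod_manifold M N)) W" using vb_frame_open[OF E] vb_frame_open[OF F] by (auto simp: openin_prod_Times_iff)
 show "is_frame (vrank (ext_prod E F)) (%i. r i z) (fibre (ext_prod E F) z)" if "z : W" for z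
  using is_frame_times[OF vb_is_frame[OF E *(1), of "fst z"] vb_is_frame[OF F *(2), of "snd z"]] that *
  by (simp add: dsum_frame_def mem_Times_iff)
 fix W' r' i j assume "(W', r') : vframes (ext_prod E F)" and ij: "i < vrank (ext_prod E F)" "j < vrank (ext_prod E F)"
 then obtain U' s' V' t' where st': "(U', s') : vframes E" "(V', t') : vframes F" "W' = U' \<times> V'"
   "r' = dsum_frame (vrank E) (%i z. s' i (fst z)) (%i z. t' i (snd z))"
  unfolding vframes_ext_prod by auto
 define h where "h z = (if i < vrank E & j < vrank E then vcoord E s' (fst z) (s j (fst z)) i
   else if \<not> i < vrank E & \<not> j < vrank E then vcoord F t' (snd z) (t (j - vrank E) (snd z)) (i - vrank E) else 0)" for z
 have o: "openin (mtop M) (U' \<inter> U)" "openin (mtop N) (V' \<inter> V)"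
  using vb_frame_open[OF E] vb_frame_open[OF F] * st' by auto
 have "smooth_fun_on (prod_manifold M N) (W' \<inter> W) h"
 proof -
  consider "i < vrank E" "j < vrank E" | "\<not> i < vrank E" "\<not> j < vrank E" | "(i < vrank E) ~= (j < vrank E)" by blast
  then show ?thesis
  proof cases
   case 1
   have "smooth_fun_on (prod_manifold M N) (W' \<inter> W) (%z. vcoord E s' (fst z) (s j (fst z)) i)"
    by (rule smooth_fun_on_subset[OF smooth_fun_on_fst_snd(1)[OF M N o(1) vb_transition_smooth[OF E *(1) st'(1) 1]]])
     (use * st' vb_frame_subset[OF F *(2)] in auto)
   then show ?thesis using 1 by (simp add: h_def[abs_def])
  next
   case 2
   then have "i - vrank E < vrank F" "j - vrank E < vrank F" using ij by auto
   then have "smooth_fun_on (prod_manifold M N) (W' \<inter> W)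
     (%z. vcoord F t' (snd z) (t (j - vrank E) (snd z)) (i - vrank E))"
    by (intro smooth_fun_on_subset[OF smooth_fun_on_fst_snd(2)[OF M N o(2) vb_transition_smooth[OF F *(2) st'(2)]]])
     (use * st' vb_frame_subset[OF E *(1)] in auto)
   then show ?thesis using 2 by (simp add: h_def[abs_def])
  next
   case 3 then have "h = (%x. 0)" by (auto simp: h_def)
   then show ?thesis by (simp add: smooth_fun_on_const)
  qed
 qed
 moreover have "frame_coord (vrank (ext_prod E F)) (%k. r' k z) (r j z) i = h z" if z: "z : W' \<inter> W" for z
 proof -
  have fr: "is_frame (vrank E) (%i. s' i (fst z)) (fibre E (fst z))" "is_frame (vrank F) (%i. t' i (snd z)) (fibre F (snd z))"
   using z * st' vb_is_frame[OF E st'(1)] vb_is_frame[OF F st'(2)] by auto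
  have mem: "j < vrank E ==> s j (fst z) : fibre E (fst z)" "\<not> j < vrank E ==> t (j - vrank E) (snd z) : fibre F (snd z)"
   using z * ij is_frame_mem[OF vb_is_frame[OF E *(1)], of "fst z" j] is_frame_mem[OF vb_is_frame[OF F *(2)], of "snd z" "j - vrank E"] by auto
  have 0: "0 : fibre E (fst z)" "0 : fibre F (snd z)" using is_frame_subspace[OF fr(1)] is_frame_subspace[OF fr(2)] by (auto simp: subspace_0)
  show ?thesis
   using frame_coord_times[OF fr mem(1) 0(2), of i] frame_coord_times[OF fr 0(1) mem(2), of i] ij
    frame_coord_zero[OF fr(1), of i] frame_coord_zero[OF fr(2), of "i - vrank E"]
   by (simp add: st'(4) *(4) dsum_frame_def h_def)
 qed
 ultimately show "EX h. smooth_fun_on (prod_manifold M N) (W' \<inter> W) h & (ALL x:W' \<inter> W. frame_coord (vrank (ext_prod E F)) (%k. r' k x) (r j x) i = h x)"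
  by blast
qed

lemma dual_space_functional: "\<alpha> : dual_space V ==> functional_on V \<alpha>"
 by (simp add: dual_space_def functional_on_def)

lemma dual_space_frame:
 assumes b: "is_frame r b V"
 defines "e \<equiv> %i v. if v : V then frame_coord r b v i else 0"
 shows "is_frame r e (dual_space V) & (ALL \<alpha>:dual_space V. ALL i<r. frame_coord r e \<alpha> i = \<alpha> (b i))"
proof -
 have sub: "subspace V" using is_frame_subspace[OF b] .
 have bV: "i < r ==> b i : V" for i using is_frame_mem[OF b] .
 have val: "(SUM i<r. a i *\<^sub>R e i) v = (if v : V then SUM i<r. a i * frame_coord r b v i else 0)" for a v
  by (simp add: sum_fun_apply scaleR_fun_def e_def)
 have exp: "\<alpha> = (SUM i<r. \<alpha> (b i) *\<^sub>R e i)" if \<alpha>: "\<alpha> : dual_space V" for \<alpha>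
 proof
  fix v show "\<alpha> v = (SUM i<r. \<alpha> (b i) *\<^sub>R e i) v"
  proof (cases "v : V")
   case True
   then have "\<alpha> v = \<alpha> (SUM i<r. frame_coord r b v i *\<^sub>R b i)" using sum_frame_coord[OF b] by simp
   also have "\<dots> = (SUM i<r. frame_coord r b v i * \<alpha> (b i))"
    using functional_on_sum[OF dual_space_functional[OF \<alpha>] sub, of "{..<r}" b] bV by simp
   finally show ?thesis using True by (simp add: val mult.commute)
  next
   case False then show ?thesis using \<alpha> by (simp add: val dual_space_def)
  qed
 qed
 have mem: "(SUM i<r. a i *\<^sub>R e i) : dual_space V" for a
  using frame_coord_add[OF b] frame_coord_scale[OF b] sub
  by (auto simp: dual_space_def val subspace_add subspace_scale algebra_simps sum.distrib sum_distrib_left)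
 have fr: "is_frame r e (dual_space V)"
  unfolding is_frame_iff
 proof (intro conjI allI impI)
  fix a i assume 0: "(SUM i<r. a i *\<^sub>R e i) = 0" "i < r"
  have "(SUM k<r. a k * frame_coord r b (b i) k) = (SUM k<r. if k = i then a k else 0)"
   using frame_coord_basis[OF b _ 0(2)] by (intro sum.cong) auto
  then have "(SUM i<r. a i *\<^sub>R e i) (b i) = a i" unfolding val using 0(2) bV by simp
  then show "a i = 0" using 0(1) by simp
 next
  show "dual_space V = range (%a. SUM i<r. a i *\<^sub>R e i)"
  proof (intro equalityI subsetI)
   fix \<alpha> assume "\<alpha> : dual_space V"
   from exp[OF this] show "\<alpha> : range (%a. SUM i<r. a i *\<^sub>R e i)"
    by (rule range_eqI[of _ _ "%i. \<alpha> (b i)"])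
  qed (use mem in auto)
 qed
 have "frame_coord r e \<alpha> i = \<alpha> (b i)" if "\<alpha> : dual_space V" "i < r" for \<alpha> i
  using frame_coord_eqI[OF fr exp[OF that(1)] that(2)] .
 with fr show ?thesis by blast
qed

lemma vector_bundle_dual:
 assumes M: "smooth_manifold M" and E: "vector_bundle M E"
 shows "vector_bundle M (dual_bundle E)"
proof (rule vector_bundleI[OF M])
 fix x assume x: "x : points M"
 obtain U s where "(U, s) : vframes E" "x : U" using vb_frame_exists[OF E x] .
 then show "EX U s. (U, s) : vframes (dual_bundle E) & x : U" unfolding vframes_dual by blast
next
 fix W r assume "(W, r) : vframes (dual_bundle E)"
 then obtain s where *: "(W, s) : vframes E" "r = dual_frame (fibre E) (vrank E) s"
  unfolding vframes_dual by auto
 then show "openin (mtop M) W" using vb_frame_open[OF E] by auto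
 show fr: "is_frame (vrank (dual_bundle E)) (%i. r i x) (fibre (dual_bundle E) x)" if "x : W" for x
  using dual_space_frame[OF vb_is_frame[OF E *(1) that]] * by (simp add: dual_frame_def[abs_def])
 fix W' r' i j assume "(W', r') : vframes (dual_bundle E)" and ij: "i < vrank (dual_bundle E)" "j < vrank (dual_bundle E)"
 then obtain s' where st': "(W', s') : vframes E" "r' = dual_frame (fibre E) (vrank E) s'"
  unfolding vframes_dual by auto
 \<comment> \<open>The dual frames change by the transpose of the inverse transition matrix, so the
   roles of \<open>s\<close> and \<open>s'\<close> and of the indices are interchanged.\<close>
 have "smooth_fun_on M (W' \<inter> W) (%x. vcoord E s x (s' i x) j)"
  using vb_transition_smooth[OF E st'(1) *(1), of j i] ij by (simp add: Int_commute)
 moreover have "frame_coord (vrank (dual_bundle E)) (%k. r' k x) (r j x) i = vcoord E s x (s' i x) j"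
  if x: "x : W' \<inter> W" for x
 proof -
  have "r j x : dual_space (fibre E x)" using is_frame_mem[OF fr, of x j] x ij by simp
  then have "vcoord E r' x (r j x) i = r j x (s' i x)"
   using dual_space_frame[OF vb_is_frame[OF E st'(1)], of x] x ij by (simp add: dual_frame_def[abs_def] st')
  moreover have "s' i x : fibre E x" using is_frame_mem[OF vb_is_frame[OF E st'(1)], of x i] x ij by simp
  ultimately show ?thesis by (simp add: * dual_frame_def)
 qed
 ultimately show "EX h. smooth_fun_on M (W' \<inter> W) h & (ALL x:W' \<inter> W. frame_coord (vrank (dual_bundle E)) (%k. r' k x) (r j x) i = h x)"
  by blast
qed

section \<open>Existence of bundle metrics\<close>

lemma smooth_fun_on_empty: "smooth_fun_on M {} f"
proof -
 have "Ck_on n k {} h" for n k h using Ck_on_local[of "{}" n k h] by simp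
 then show ?thesis by (simp add: smooth_fun_on_iff)
qed

text \<open>Membership in \<open>L1c\<close> asks for a metric, so coordinatewise integrability
  yields it only if one exists. Euclidean products of the coordinates over countably many frames are
  added up with the weights of \<open>smooth_partition\<close>.\<close>

lemma bundle_metric_exists:
 assumes M: "smooth_manifold M" and E: "vector_bundle M E"
 shows "EX g. bundle_metric M E g"
proof (cases "points M = {}")
 case True
 then have "U = {}" if "(U, s) : vframes E" for U s using vb_frame_subset[OF E that] by blast
 then show ?thesis using True smooth_fun_on_empty
  by (intro exI[of _ undefined]) (fastforce simp: bundle_metric_def)
next
 case ne: False
 let ?r = "vrank E"
 have "EX U:fst ` vframes E. openin (mtop M) U & x : U" if x: "x : points M" for x
 proof -
  obtain U s where "(U, s) : vframes E" "x : U" using vb_frame_exists[OF E x] .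
  then show ?thesis using vb_frame_open[OF E] by force
 qed
 then have cov: "ALL x:points M. EX U:fst ` vframes E. openin (mtop M) U & x : U" by blast
 obtain \<psi> :: "nat => _ => real" and U K :: "nat => _ set" where
  *: "ALL k. U k : fst ` vframes E" "ALL k. openin (mtop M) (U k)" "ALL k. smooth_fun_on M (points M) (\<psi> k)"
  "ALL k x. 0 <= \<psi> k x" "ALL k. closedin (mtop M) (K k)" "ALL k. K k \<subseteq> U k" "ALL k x. x ~: K k --> \<psi> k x = 0"
  "ALL x:points M. EX V N. openin (mtop M) V & x : V & (ALL k>=N. ALL y:V. \<psi> k y = 0)"
  "ALL x:points M. EX k. \<psi> k x > 0"
  using smooth_partition[OF M cov ne] by (elim exE conjE) (rule that)
 note U = *(1)[rule_format] and oU = *(2)[rule_format] and sm = *(3)[rule_format] and nn = *(4)[rule_format]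
  and K = *(5-7)[rule_format] and lf = *(8)[rule_format] and pos = *(9)[rule_format]
 have "EX s. (U k, s) : vframes E" for k using U[of k] by auto
 then obtain s where s: "!!k. (U k, s k) : vframes E" by metis
 define fc where "fc k x v i = frame_coord ?r (%j. s k j x) v i" for k x v i
 define q where "q k x v w = \<psi> k x * (SUM i<?r. fc k x v i * fc k x w i)" for k x v w
 \<comment> \<open>Restricting to indices with \<open>\<psi> k x\<close> nonzero ensures that every
   summand is computed in a genuine frame at \<open>x\<close>, and hence is bilinear. For smoothness
   \<open>gN\<close> replaces this varying index set by a fixed range near each point.\<close>
 define g where "g x v w = (SUM k | \<psi> k x ~= 0. q k x v w)" for x v w
 have gN: "g x v w = (SUM k<N. q k x v w)" if "ALL k>=N. \<psi> k x = 0" for x v w and N :: nat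
  unfolding g_def using that by (intro sum.mono_neutral_left) (auto simp: q_def not_le[symmetric])
 have fin: "finite {k. \<psi> k x ~= 0}" if xM: "x : points M" for x
 proof -
  obtain V N where "x : V" "ALL k>=N. ALL y:V. \<psi> k y = 0" using lf[OF xM] by blast
  then have "{k. \<psi> k x ~= 0} \<subseteq> {..<N}" by (auto simp: not_le[symmetric])
  then show ?thesis using finite_subset by blast
 qed
 have fr: "is_frame ?r (%j. s k j x) (fibre E x)" if "\<psi> k x ~= 0" for k x
  using that K(2,3) vb_is_frame[OF E s] by blast
 have "bundle_metric M E g"
  unfolding bundle_metric_def
 proof (intro conjI ballI allI impI)
  fix x assume x: "x : points M"
  fix v assume v: "v : fibre E x"
  show "g x (a *\<^sub>R v) w = a * g x v w" for a w
  proof -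
   have "q k x (a *\<^sub>R v) w = a * q k x v w" if "\<psi> k x ~= 0" for k
    by (simp add: q_def fc_def frame_coord_scale[OF fr[OF that] v] mult.assoc mult.left_commute[of _ a] flip: sum_distrib_left)
   then show ?thesis unfolding g_def sum_distrib_left by (intro sum.cong) auto
  qed
  show "g x v w = g x w v" for w
   unfolding g_def q_def by (simp add: mult.commute)
  show "g x v v > 0" if "v ~= 0"
  proof -
   obtain k where k: "\<psi> k x > 0" using pos[OF x] by blast
   have ex: "EX i<?r. fc k x v i ~= 0"
   proof (rule ccontr)
    assume "\<not> ?thesis"
    then have "(SUM i<?r. fc k x v i *\<^sub>R s k i x) = 0" by simp
    then show False using sum_frame_coord[OF fr v] k \<open>v ~= 0\<close> by (simp add: fc_def)
   qed
   then obtain i where i: "i < ?r" "fc k x v i ~= 0" by blast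
   have "(SUM i<?r. fc k x v i * fc k x v i) > 0"
    using i by (intro sum_pos2[of _ i]) (auto simp: less_le)
   then have "q k x v v > 0" using k by (simp add: q_def)
   moreover have "q j x v v >= 0" for j unfolding q_def using nn by (rule mult_nonneg_nonneg) (simp add: sum_nonneg)
   ultimately show ?thesis unfolding g_def using fin[OF x] k by (intro sum_pos2[of _ k]) auto
  qed
  fix u w assume "u : fibre E x"
 next
  fix x u v w assume x: "x : points M" and uv: "u : fibre E x" "v : fibre E x"
  show "g x (u + v) w = g x u w + g x v w"
  proof -
   have "q k x (u + v) w = q k x u w + q k x v w" if "\<psi> k x ~= 0" for k
    by (simp add: q_def fc_def frame_coord_add[OF fr[OF that] uv] distrib_right distrib_left sum.distrib)
   then show ?thesis unfolding g_def sum.distrib[symmetric] by (intro sum.cong) auto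
  qed
 next
  fix W assume "W : vframes E"
  obtain U' s' where W: "W = (U', s')" by (cases W)
  then have vf: "(U', s') : vframes E" using \<open>W : vframes E\<close> by simp
  have oU': "openin (mtop M) U'" using vb_frame_open[OF E vf] .
  have "smooth_fun_on M U' (%x. g x (s' i x) (s' j x))" if ij: "i < ?r" "j < ?r" for i j
  proof (rule smooth_fun_on_local[OF M oU'])
   fix x assume x: "x : U'"
   obtain V N where V: "openin (mtop M) V" "x : V" "ALL k>=N. ALL y:V. \<psi> k y = 0"
    using lf vb_frame_subset[OF E vf x] by meson
   have o: "openin (mtop M) (V \<inter> U')" using V(1) oU' by blast
   \<comment> \<open>Two open sets cover: on \<open>U k\<close> the frame coordinates are smooth,
     and on the complement of the closed set \<open>K k\<close> the summand vanishes.\<close>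
   have "smooth_fun_on M (V \<inter> U') (%x. q k x (s' i x) (s' j x))" for k
   proof (rule smooth_fun_on_local[OF M o])
    fix y assume y: "y : V \<inter> U'"
    show "EX A. openin (mtop M) A & y : A & smooth_fun_on M A (%x. q k x (s' i x) (s' j x))"
    proof (cases "y : U k")
     case True
     have o2: "openin (mtop M) (U k \<inter> U')" using oU oU' by blast
     have "smooth_fun_on M (U k \<inter> U') (%x. q k x (s' i x) (s' j x))"
      unfolding q_def fc_def
      by (intro smooth_fun_on_mult[OF M o2] smooth_fun_on_sum[OF M o2] vb_transition_smooth[OF E vf s] ij
        smooth_fun_on_subset[OF sm]) (use o2 openin_subset in auto)
     then show ?thesis using o2 True y by blast
    next
     case False
     have o3: "openin (mtop M) (points M - K k)" using K(1) by (simp add: openin_diff)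
     have "smooth_fun_on M (points M - K k) (%x. q k x (s' i x) (s' j x))"
      using smooth_fun_on_cong[OF M o3, of "%x. q k x (s' i x) (s' j x)" "%x. 0"] K(3)
      by (auto simp: q_def smooth_fun_on_const)
     then show ?thesis using o3 False y K(2) vb_frame_subset[OF E vf] by blast
    qed
   qed
   then have "smooth_fun_on M (V \<inter> U') (%x. SUM k<N. q k x (s' i x) (s' j x))"
    by (intro smooth_fun_on_sum[OF M o])
   then have "smooth_fun_on M (V \<inter> U') (%x. g x (s' i x) (s' j x))"
    using smooth_fun_on_cong[OF M o, of "%x. g x (s' i x) (s' j x)" "%x. SUM k<N. q k x (s' i x) (s' j x)"] gN V(3) by auto
   then show "EX A. openin (mtop M) A & x : A & smooth_fun_on M A (%x. g x (s' i x) (s' j x))"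
    using o x V(2) by blast
  qed
  then show "case W of (U, s) => ALL i<?r. ALL j<?r. smooth_fun_on M U (%x. g x (s i x) (s j x))" by (simp add: W)
 qed
 then show ?thesis by blast
qed

section \<open>Continuous and integrable curves in vector bundles\<close>

text \<open>Bisection: a property of intervals that passes to concatenations and holds on all small
  intervals around each point holds on the whole compact interval. It carries local statements over
  one frame to global ones.\<close>

lemma interval_induct:
 fixes a b :: real
 assumes "a <= b"
  and trans: "!!c d e. a <= c ==> c <= d ==> d <= e ==> e <= b ==> P c d ==> P d e ==> P c e"
  and loc: "!!t. a <= t ==> t <= b ==> EX \<delta>>0. ALL c d. a <= c & c <= t & t <= d & d <= b & d - c < \<delta> --> P c d"
 shows "P a b"
proof -
 have "a <= a & b <= b --> P a b"
  using \<open>a <= b\<close>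
 proof (induction rule: Bolzano[of a b "%c d. a <= c & d <= b --> P c d"])
  case (trans c d e)
  then show ?case using assms(2)[of c d e] by auto
 next
  case (local t)
  from loc[OF this] show ?case by blast
 qed
 then show ?thesis by simp
qed

text \<open>Continuity and integrability share all the closure rules that matter here: sums,
  products with continuous functions, restriction and gluing. Arguments that use nothing else are
  given once for both behaviours.\<close>

primrec reg :: "behaviour_type => real set => (real => real) => bool" where
 "reg Classical J h = continuous_on J h"
| "reg Weak J h = set_integrable lebesgue J h"

lemma reg_cong: "(!!t. t : J ==> h t = h' t) ==> reg \<tt> J h \<longleftrightarrow> reg \<tt> J h'"
 by (cases \<tt>) (auto cong: continuous_on_cong set_integrable_cong)

lemma reg_0: "reg \<tt> J (%t. 0)"
 by (cases \<tt>) (auto simp: set_integrable_def)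

lemma reg_add: "reg \<tt> J h ==> reg \<tt> J h' ==> reg \<tt> J (%t. h t + h' t)"
 by (cases \<tt>) (auto intro: continuous_intros set_integral_add)

lemma reg_sum: "(!!i. i : I ==> reg \<tt> J (h i)) ==> reg \<tt> J (%t. SUM i:I. h i t)"
 by (induction I rule: infinite_finite_induct) (auto intro: reg_0 reg_add)

lemma reg_mult_continuous:
 assumes "continuous_on {c..d} f" "reg \<tt> {c..d} h"
 shows "reg \<tt> {c..d} (%t. f t * h t)"
proof (cases \<tt>)
 case Weak
 have "bounded (f ` {c..d})"
  using assms(1) by (intro compact_imp_bounded compact_continuous_image) auto
 then have "(%t. f t * h t) absolutely_integrable_on {c..d}"
  using assms Weak
  by (intro absolutely_integrable_bounded_measurable_product_real continuous_imp_measurable_on_sets_lebesgue) auto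
 then show ?thesis using Weak by simp
qed (use assms in \<open>auto intro: continuous_intros\<close>)

lemma reg_continuous: "continuous_on {c..d} f ==> reg \<tt> {c..d} f"
 by (cases \<tt>) (auto intro: absolutely_integrable_continuous_real)

lemma reg_subset: "reg \<tt> {a..b} h ==> a <= c ==> d <= b ==> reg \<tt> {c..d} h"
 by (cases \<tt>) (auto intro: continuous_on_subset set_integrable_subset)

lemma reg_glue:
 assumes "a <= b" "b <= c" "reg \<tt> {a..b} h" "reg \<tt> {b..c} h"
 shows "reg \<tt> {a..c} h"
proof -
 have "{a..c} = {a..b} \<union> {b..c}" using assms by auto
 then show ?thesis using assms
  by (cases \<tt>) (auto intro: continuous_on_closed_Un set_integrable_Un)
qed

lemma shadow_interval:
 assumes x: "continuous_map (top_of_set {a..b}) X x" and U: "openin X U" and t: "t : {a..b::real}" "x t : U"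
 obtains \<delta> where "\<delta> > 0" "!!s. s : {a..b} ==> \<bar>s - t\<bar> < \<delta> ==> x s : U"
proof -
 have "openin (top_of_set {a..b}) {s : {a..b}. x s : U}"
  using openin_continuous_map_preimage[OF x U] by simp
 then obtain \<delta> where "\<delta> > 0" "!!s. s : {a..b} ==> dist s t < \<delta> ==> s : {s : {a..b}. x s : U}"
  unfolding openin_euclidean_subtopology_iff using t by blast
 then show thesis by (intro that) (auto simp: dist_real_def)
qed

lemma continuous_on_smooth_compose:
 assumes M: "smooth_manifold M" and W: "openin (mtop M) W" and f: "smooth_fun_on M W f"
  and x: "path_on M a b x" and cd: "{c..d} \<subseteq> {a..b}" "!!t. t : {c..d} ==> x t : W"
 shows "continuous_on {c..d} (%t. f (x t))"
proof -
 have "path_on M c d x"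
  using continuous_map_from_subtopology_mono[OF x cd(1)] .
 then have "continuous_map (top_of_set {c..d}) (subtopology (mtop M) W) x"
  using cd(2) by (simp add: continuous_map_in_subtopology image_subset_iff)
 from continuous_map_compose[OF this smooth_fun_on_continuous[OF M W f]]
 show ?thesis by (simp add: comp_def)
qed

text \<open>A coordinate description of curves in a bundle that avoids the topology and the Borel
  sets of the total space. It agrees with \<open>continuous_curve\<close> in the classical and with
  \<open>L1c\<close> in the weak case.\<close>

definition creg ::
  "behaviour_type => 'm manifold => ('m, 'v::real_vector) vbundle => real => real => (real => 'm \<times> 'v) => bool" where
 "creg \<tt> M E a b \<xi> \<longleftrightarrow>
   path_on M a b (fst \<circ> \<xi>) & (ALL t:{a..b}. \<xi> t : total_space M E) &
   (ALL U s c d i. (U, s) : vframes E --> a <= c --> d <= b --> (ALL t:{c..d}. fst (\<xi> t) : U) --> i < vrank E -->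
    reg \<tt> {c..d} (%t. vcoord E s (fst (\<xi> t)) (snd (\<xi> t)) i))"

lemma creg_shadow: "creg \<tt> M E a b \<xi> ==> path_on M a b (fst \<circ> \<xi>)"
 by (simp add: creg_def)

lemma creg_mem: 
 assumes "creg \<tt> M E a b \<xi>" "t : {a..b}" 
 shows "fst (\<xi> t) : points M" "snd (\<xi> t) : fibre E (fst (\<xi> t))"
proof -
 have "\<xi> t : total_space M E" using assms by (simp add: creg_def)
 then show "fst (\<xi> t) : points M" "snd (\<xi> t) : fibre E (fst (\<xi> t))" by (auto simp: total_space_def)
qed

lemma creg_coord:
 "creg \<tt> M E a b \<xi> ==> (U, s) : vframes E ==> a <= c ==> d <= b ==> (!!t. t : {c..d} ==> fst (\<xi> t) : U) ==> i < vrank E ==>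
  reg \<tt> {c..d} (%t. vcoord E s (fst (\<xi> t)) (snd (\<xi> t)) i)"
 by (simp add: creg_def)

lemma creg_local_frame:
 assumes E: "vector_bundle M E" and \<xi>: "creg \<tt> M E a b \<xi>" and t: "t : {a..b}"
 obtains U s \<delta> where "(U, s) : vframes E" "\<delta> > 0" "!!r. r : {a..b} ==> \<bar>r - t\<bar> < \<delta> ==> fst (\<xi> r) : U"
proof -
 obtain U s where U: "(U, s) : vframes E" "fst (\<xi> t) : U" using vb_frame_exists[OF E creg_mem(1)[OF \<xi> t]] .
 obtain \<delta> where "\<delta> > 0" "!!r. r : {a..b} ==> \<bar>r - t\<bar> < \<delta> ==> (fst \<circ> \<xi>) r : U"
  by (rule shadow_interval[OF creg_shadow[OF \<xi>] vb_frame_open[OF E U(1)] t]) (use U in auto)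
 then show thesis using that U by auto
qed

text \<open>It suffices to check the coordinates locally in one frame each.\<close>

lemma cregI:
 assumes M: "smooth_manifold M" and E: "vector_bundle M E"
  and x: "path_on M a b (fst \<circ> \<xi>)"
  and tot: "!!t. t : {a..b} ==> snd (\<xi> t) : fibre E (fst (\<xi> t))"
  and loc: "!!t. t : {a..b} ==> EX \<delta>>0. EX U s. (U, s) : vframes E &
   (ALL r:{a..b}. \<bar>r - t\<bar> < \<delta> --> fst (\<xi> r) : U) &
   (ALL c d i. a <= c & c <= t & t <= d & d <= b & d - c < \<delta> & i < vrank E -->
    reg \<tt> {c..d} (%t. vcoord E s (fst (\<xi> t)) (snd (\<xi> t)) i))"
 shows "creg \<tt> M E a b \<xi>"
proof -
 have xM: "fst (\<xi> t) : points M" if "t : {a..b}" for t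
  using continuous_map_image_subset_topspace[OF x] that by auto
 have "reg \<tt> {c..d} (%t. vcoord E s (fst (\<xi> t)) (snd (\<xi> t)) i)"
  if Us: "(U, s) : vframes E" and cd: "a <= c" "d <= b" and U: "ALL t:{c..d}. fst (\<xi> t) : U" and i: "i < vrank E"
  for U s c d i
 proof (cases "c <= d")
  case True
  then show ?thesis
  proof (rule interval_induct)
   fix p q r assume "c <= p" "p <= q" "q <= r" "r <= d"
   then show "reg \<tt> {p..q} (%t. vcoord E s (fst (\<xi> t)) (snd (\<xi> t)) i) ==>
     reg \<tt> {q..r} (%t. vcoord E s (fst (\<xi> t)) (snd (\<xi> t)) i) ==>
     reg \<tt> {p..r} (%t. vcoord E s (fst (\<xi> t)) (snd (\<xi> t)) i)"
    using reg_glue[of p q r] by blast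
  next
   fix t assume t: "c <= t" "t <= d"
   then have tI: "t : {a..b}" using cd by auto
   obtain \<delta> U' s' where \<delta>: "\<delta> > 0" and Us': "(U', s') : vframes E"
    and U': "!!r. r : {a..b} ==> \<bar>r - t\<bar> < \<delta> ==> fst (\<xi> r) : U'"
    and reg': "!!c d i. a <= c ==> c <= t ==> t <= d ==> d <= b ==> d - c < \<delta> ==> i < vrank E ==>
     reg \<tt> {c..d} (%t. vcoord E s' (fst (\<xi> t)) (snd (\<xi> t)) i)"
    using loc[OF tI] by blast
   have "reg \<tt> {p..q} (%t. vcoord E s (fst (\<xi> t)) (snd (\<xi> t)) i)"
    if pq: "c <= p" "p <= t" "t <= q" "q <= d" "q - p < \<delta>" for p q
   proof -
    have sub: "{p..q} \<subseteq> {a..b}" using pq cd by auto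
    have both: "fst (\<xi> r) : U \<inter> U'" if r: "r : {p..q}" for r using r U U'[of r] pq cd by auto
    \<comment> \<open>Change of frame: the transition functions are continuous along the shadow, and
      both kinds of regularity survive multiplication by continuous functions.\<close>
    have "reg \<tt> {p..q} (%t. SUM j<vrank E. vcoord E s (fst (\<xi> t)) (s' j (fst (\<xi> t))) i *
      vcoord E s' (fst (\<xi> t)) (snd (\<xi> t)) j)"
    proof (intro reg_sum reg_mult_continuous)
     fix j assume j: "j : {..<vrank E}"
     have o: "openin (mtop M) (U \<inter> U')" using vb_frame_open[OF E Us] vb_frame_open[OF E Us'] by blast
     have "continuous_on {p..q} (%t. vcoord E s ((fst \<circ> \<xi>) t) (s' j ((fst \<circ> \<xi>) t)) i)"
      by (rule continuous_on_smooth_compose[OF M o vb_transition_smooth[OF E Us' Us i] x sub]) (use j both in auto)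
     then show "continuous_on {p..q} (%t. vcoord E s (fst (\<xi> t)) (s' j (fst (\<xi> t))) i)" by simp
     show "reg \<tt> {p..q} (%t. vcoord E s' (fst (\<xi> t)) (snd (\<xi> t)) j)"
      using reg'[of p q j] j pq cd by auto
    qed
    moreover have "vcoord E s (fst (\<xi> r)) (snd (\<xi> r)) i =
      (SUM j<vrank E. vcoord E s (fst (\<xi> r)) (s' j (fst (\<xi> r))) i *
       vcoord E s' (fst (\<xi> r)) (snd (\<xi> r)) j)" if r: "r : {p..q}" for r
    proof -
     have fr: "is_frame (vrank E) (%k. s k (fst (\<xi> r))) (fibre E (fst (\<xi> r)))"
      "is_frame (vrank E) (%k. s' k (fst (\<xi> r))) (fibre E (fst (\<xi> r)))"
      using both[OF r] vb_is_frame[OF E Us] vb_is_frame[OF E Us'] by auto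
     have "snd (\<xi> r) = (SUM j<vrank E. vcoord E s' (fst (\<xi> r)) (snd (\<xi> r)) j *\<^sub>R s' j (fst (\<xi> r)))"
      using sum_frame_coord[OF fr(2) tot] r sub by auto
     then have "vcoord E s (fst (\<xi> r)) (snd (\<xi> r)) i =
      vcoord E s (fst (\<xi> r))
       (SUM j<vrank E. vcoord E s' (fst (\<xi> r)) (snd (\<xi> r)) j *\<^sub>R s' j (fst (\<xi> r))) i" by simp
     also have "\<dots> = (SUM j<vrank E. vcoord E s' (fst (\<xi> r)) (snd (\<xi> r)) j *
       vcoord E s (fst (\<xi> r)) (s' j (fst (\<xi> r))) i)"
      using is_frame_mem[OF fr(2)] by (intro frame_coord_linear_sum[OF fr(1) _ i]) auto
     finally show ?thesis by (simp add: mult.commute)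
    qed
    ultimately show ?thesis by (rule iffD2[OF reg_cong, rotated])
   qed
   then show "EX \<delta>>0. ALL p q. c <= p & p <= t & t <= q & q <= d & q - p < \<delta> -->
     reg \<tt> {p..q} (%t. vcoord E s (fst (\<xi> t)) (snd (\<xi> t)) i)"
    using \<delta> by blast
  qed
 next
  case False
  then have "{c..d} = {}" by simp
  then show ?thesis by (cases \<tt>) (auto simp: set_integrable_def)
 qed
 moreover have "\<xi> t : total_space M E" if "t : {a..b}" for t
  unfolding total_space_def using tot[OF that] xM[OF that] by (metis SigmaI prod.collapse)
 ultimately show ?thesis unfolding creg_def using x by blast
qed

lemma openin_total_topology: "openin (total_topology M E) W \<longleftrightarrow> open_total M E W"
 by (simp add: total_topology_def topology_inverse'[OF istopology_open_total])

lemma topspace_total_topology: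
 assumes M: "smooth_manifold M" and E: "vector_bundle M E"
 shows "topspace (total_topology M E) = total_space M E"
proof -
 have "open_total M E (total_space M E)"
  unfolding open_total_def
 proof (intro conjI ballI subset_refl)
  fix Us assume "Us : vframes E"
  obtain U s where Us: "Us = (U, s)" by (cases Us)
  with \<open>Us : vframes E\<close> have vf: "(U, s) : vframes E" by simp
  have "{(x, a). x : U \<inter> points M & a : Rn (vrank E) &
          (x, SUM i<vrank E. a i *\<^sub>R s i x) : total_space M E} =
   topspace (prod_topology (subtopology (mtop M) U) (Euclidean_space (vrank E)))"
   using is_frame_sum_mem[OF vb_is_frame[OF E vf]] by (auto simp: total_space_def)
  then show "case Us of (U, s) => openin (prod_topology (subtopology (mtop M) U) (Euclidean_space (vrank E)))
     {(x, a). x : U \<inter> points M & a : Rn (vrank E) &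
          (x, SUM i<vrank E. a i *\<^sub>R s i x) : total_space M E}"
   by (simp only: Us prod.case openin_topspace)
 qed
 then have "total_space M E \<subseteq> topspace (total_topology M E)"
  by (intro openin_subset) (simp add: openin_total_topology)
 moreover have "open_total M E (topspace (total_topology M E))"
  using openin_topspace[of "total_topology M E"] by (simp only: openin_total_topology)
 ultimately show ?thesis by (simp add: open_total_def subset_antisym)
qed

lemma open_total_base:
 assumes M: "smooth_manifold M" and E: "vector_bundle M E" and V: "openin (mtop M) V"
 shows "open_total M E {z : total_space M E. fst z : V}"
 unfolding open_total_def
proof (intro conjI ballI)
 fix Us assume "Us : vframes E"
 obtain U s where Us: "Us = (U, s)" by (cases Us)
 with \<open>Us : vframes E\<close> have vf: "(U, s) : vframes E" by simp
 have "{(x, a). x : U \<inter> points M & a : Rn (vrank E) &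
         (x, SUM i<vrank E. a i *\<^sub>R s i x) : {z : total_space M E. fst z : V}} =
   (U \<inter> V) \<times> Rn (vrank E)"
  using is_frame_sum_mem[OF vb_is_frame[OF E vf]] openin_subset[OF V] by (auto simp: total_space_def)
 moreover have "openin (subtopology (mtop M) U) (U \<inter> V)" using V by (auto simp: openin_subtopology)
 ultimately show "case Us of (U, s) => openin (prod_topology (subtopology (mtop M) U) (Euclidean_space (vrank E)))
   {(x, a). x : U \<inter> points M & a : Rn (vrank E) &
         (x, SUM i<vrank E. a i *\<^sub>R s i x) : {z : total_space M E. fst z : V}}"
  by (simp only: Us prod.case openin_prod_Times_iff openin_topspace) simp
qed auto

text \<open>Preimages of these sets are what gives continuity or measurability of single
  coordinates. In another frame the condition becomes one on a continuous combination of coordinates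
  with the transition functions.\<close>

lemma open_total_coord:
 assumes M: "smooth_manifold M" and E: "vector_bundle M E" and Us: "(U, s) : vframes E" and i: "i < vrank E" and Q: "open Q"
 shows "open_total M E {z : total_space M E. fst z : U & vcoord E s (fst z) (snd z) i : Q}"
 unfolding open_total_def
proof (intro conjI ballI)
 fix Us' assume "Us' : vframes E"
 obtain U' s' where Us': "Us' = (U', s')" by (cases Us')
 with \<open>Us' : vframes E\<close> have vf: "(U', s') : vframes E" by simp
 let ?r = "vrank E"
 let ?T = "%x j. frame_coord ?r (%k. s k x) (s' j x) i"
 let ?X = "prod_topology (subtopology (mtop M) (U' \<inter> U)) (Euclidean_space ?r)"
 have oU: "openin (mtop M) U'" "openin (mtop M) (U' \<inter> U)" using vb_frame_open[OF E Us] vb_frame_open[OF E vf] by auto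
 have c: "continuous_map ?X euclideanreal (%z. SUM j<?r. snd z j * ?T (fst z) j)"
 proof (intro continuous_map_sum continuous_map_real_mult)
  fix j assume j: "j : {..<?r}"
  have "smooth_fun_on M (U' \<inter> U) (%x. ?T x j)" using vb_transition_smooth[OF E vf Us i, of j] j by (simp add: Int_commute)
  from continuous_map_compose[OF continuous_map_fst smooth_fun_on_continuous[OF M oU(2) this]]
  show "continuous_map ?X euclideanreal (%z. ?T (fst z) j)" by (simp add: comp_def)
  from continuous_map_compose[OF continuous_map_snd continuous_map_Rn_coord]
  show "continuous_map ?X euclideanreal (%z. snd z j)" by (simp add: comp_def)
 qed simp
 have A1: "openin ?X {z : topspace ?X. (SUM j<?r. snd z j * ?T (fst z) j) : Q}"
  by (rule openin_continuous_map_preimage[OF c]) (use Q in simp)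
 have A2: "{z : topspace ?X. (SUM j<?r. snd z j * ?T (fst z) j) : Q} = {(x, a). x : U' \<inter> points M & a : Rn ?r &
   (x, SUM i<?r. a i *\<^sub>R s' i x) : {z : total_space M E. fst z : U & frame_coord ?r (%k. s k (fst z)) (snd z) i : Q}}"
 proof -
  have "frame_coord ?r (%k. s k x) (SUM i<?r. a i *\<^sub>R s' i x) i = (SUM j<?r. a j * ?T x j)" if x: "x : U' \<inter> U" for x a
   using is_frame_mem[OF vb_is_frame[OF E vf, of x]] x
   by (intro frame_coord_linear_sum[OF vb_is_frame[OF E Us, of x] _ i]) auto
  moreover have "(SUM i<?r. a i *\<^sub>R s' i x) : fibre E x" if "x : U'" for x a
   using is_frame_sum_mem[OF vb_is_frame[OF E vf that]] .
  ultimately show ?thesis by (auto simp: total_space_def)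
 qed
 have A3: "?X = subtopology (prod_topology (subtopology (mtop M) U') (Euclidean_space ?r)) ((U' \<inter> U) \<times> Rn ?r)"
  by (simp add: subtopology_Times subtopology_subtopology)
 have A4: "openin (prod_topology (subtopology (mtop M) U') (Euclidean_space ?r)) ((U' \<inter> U) \<times> Rn ?r)"
  using oU(2) oU(1) by (simp add: openin_prod_Times_iff openin_open_subtopology)
 show "case Us' of (U', s') => openin (prod_topology (subtopology (mtop M) U') (Euclidean_space ?r))
   {(x, a). x : U' \<inter> points M & a : Rn ?r &
   (x, SUM i<?r. a i *\<^sub>R s' i x) : {z : total_space M E. fst z : U & frame_coord ?r (%k. s k (fst z)) (snd z) i : Q}}"
  unfolding Us' prod.case
 proof (rule openin_trans_full[OF _ A4])
  show "openin (subtopology (prod_topology (subtopology (mtop M) U') (Euclidean_space ?r)) ((U' \<inter> U) \<times> Rn ?r))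
   {(x, a). x : U' \<inter> points M & a : Rn ?r &
   (x, SUM i<?r. a i *\<^sub>R s' i x) : {z : total_space M E. fst z : U & frame_coord ?r (%k. s k (fst z)) (snd z) i : Q}}"
   by (subst A3[symmetric]) (use A1 in \<open>simp only: A2\<close>)
 qed
qed auto

text \<open>The converse tool: over one frame an open set of the total space becomes, along a
  continuous base curve, an ordinary open condition on time and coordinate vector.\<close>

lemma open_total_frame:
 assumes M: "smooth_manifold M" and E: "vector_bundle M E" and Us: "(U, s) : vframes E" and W: "open_total M E W"
  and x: "path_on M c d x" and U: "!!t. t : {c..d} ==> x t : U"
 obtains T :: "(real \<times> (nat => real)) set" where "open T"
  "!!t a. t : {c..d} ==> a : Rn (vrank E) ==>
    (x t, SUM i<vrank E. a i *\<^sub>R s i (x t)) : W \<longleftrightarrow> (t, a) : T"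
proof -
 let ?r = "vrank E"
 let ?A = "{(x, a). x : U \<inter> points M & a : Rn ?r & (x, SUM i<?r. a i *\<^sub>R s i x) : W}"
 have A: "openin (prod_topology (subtopology (mtop M) U) (Euclidean_space ?r)) ?A"
  using W Us by (auto simp: open_total_def)
 have "continuous_map (top_of_set {c..d}) (subtopology (mtop M) U) x"
  using x U by (simp add: continuous_map_in_subtopology image_subset_iff)
 from continuous_map_compose[OF continuous_map_fst this]
 have c: "continuous_map (prod_topology (top_of_set {c..d}) (Euclidean_space ?r)) (prod_topology (subtopology (mtop M) U) (Euclidean_space ?r))
   (%z. (x (fst z), snd z))"
  by (simp add: continuous_map_pairwise comp_def continuous_map_snd)
 have E_eq: "Euclidean_space ?r = top_of_set (Rn ?r)"
  by (simp add: Euclidean_space_def euclidean_product_topology topspace_Euclidean_space)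
 have "prod_topology (top_of_set {c..d}) (Euclidean_space ?r) = top_of_set ({c..d} \<times> Rn ?r)"
  by (subst E_eq) (simp only: prod_topology_subtopology_eu)
 with openin_continuous_map_preimage[OF c A] obtain T where T: "open T"
  "{z : {c..d} \<times> Rn ?r. (x (fst z), snd z) : ?A} = ({c..d} \<times> Rn ?r) \<inter> T"
  by (auto simp: openin_open)
 show thesis
 proof (rule that[OF T(1)])
  fix t a assume ta: "t : {c..d}" "a : Rn ?r"
  then have "(x t, SUM i<?r. a i *\<^sub>R s i (x t)) : W \<longleftrightarrow> (t, a) : {z : {c..d} \<times> Rn ?r. (x (fst z), snd z) : ?A}"
   using U[of t] vb_frame_subset[OF E Us] by auto
  then show "(x t, SUM i<?r. a i *\<^sub>R s i (x t)) : W \<longleftrightarrow> (t, a) : T" unfolding T(2) using ta by auto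
 qed
qed

definition coord_curve :: "('m, 'v::real_vector) vbundle => (nat => 'm => 'v) => (real => 'm \<times> 'v) => real => nat => real" where
 "coord_curve E s \<xi> t i = vcoord E s (fst (\<xi> t)) (snd (\<xi> t)) i"

lemma coord_curve_Rn: "coord_curve E s \<xi> t : Rn (vrank E)"
 by (simp add: Rn_iff coord_curve_def frame_coord_def)

lemma coord_curve_expand:
 assumes "vector_bundle M E" "(U, s) : vframes E" "\<xi> t : total_space M E" "fst (\<xi> t) : U"
 shows "(fst (\<xi> t), SUM i<vrank E. coord_curve E s \<xi> t i *\<^sub>R s i (fst (\<xi> t))) = \<xi> t"
 using sum_frame_coord[OF vb_is_frame[OF assms(1,2,4)]] assms(3)
 by (auto simp: coord_curve_def total_space_def prod_eq_iff)

lemma continuous_curve_iff_creg: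
 assumes M: "smooth_manifold M" and E: "vector_bundle M E"
 shows "continuous_curve M E a b \<xi> \<longleftrightarrow> creg Classical M E a b \<xi>"
proof
 assume c: "continuous_curve M E a b \<xi>"
 then have c: "continuous_map (top_of_set {a..b}) (total_topology M E) \<xi>" by (simp add: continuous_curve_def)
 then have tot: "\<xi> t : total_space M E" if "t : {a..b}" for t
  using that continuous_map_image_subset_topspace[OF c] by (auto simp: topspace_total_topology[OF M E])
 have pre: "openin (top_of_set {a..b}) {t : {a..b}. \<xi> t : W}" if W: "open_total M E W" for W
  using openin_continuous_map_preimage[OF c, of W] W by (simp add: openin_total_topology)
 have sh: "path_on M a b (fst \<circ> \<xi>)"
  unfolding continuous_map_def
 proof (intro conjI allI impI)
  show "fst \<circ> \<xi> : topspace (top_of_set {a..b}) \<rightarrow> points M" using tot by (force simp: total_space_def)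
  fix V assume V: "openin (mtop M) V"
  have "{t : {a..b}. \<xi> t : {z : total_space M E. fst z : V}} = {t : topspace (top_of_set {a..b}). (fst \<circ> \<xi>) t : V}"
   using tot by auto
  with pre[OF open_total_base[OF M E V]] show "openin (top_of_set {a..b}) {t : topspace (top_of_set {a..b}). (fst \<circ> \<xi>) t : V}" by metis
 qed
 have "continuous_on {c..d} (%t. vcoord E s (fst (\<xi> t)) (snd (\<xi> t)) i)"
  if Us: "(U, s) : vframes E" and cd: "a <= c" "d <= b" and U: "ALL t:{c..d}. fst (\<xi> t) : U" and i: "i < vrank E"
  for U s c d i
  unfolding continuous_on_open_invariant
 proof (intro allI impI)
  fix Q :: "real set" assume Q: "open Q"
  obtain T where T: "open T" "{t : {a..b}. \<xi> t : {z : total_space M E. fst z : U & vcoord E s (fst z) (snd z) i : Q}} = {a..b} \<inter> T"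
   using pre[OF open_total_coord[OF M E Us i Q]] by (auto simp: openin_open)
  have "T \<inter> {c..d} = (%t. vcoord E s (fst (\<xi> t)) (snd (\<xi> t)) i) -` Q \<inter> {c..d}"
  proof (intro set_eqI)
   fix t
   have "t : {c..d} ==> t : {a..b}" using cd by auto
   moreover have "t : {a..b} ==> t : T \<longleftrightarrow> t : {t : {a..b}. \<xi> t : {z : total_space M E. fst z : U & vcoord E s (fst z) (snd z) i : Q}}"
    unfolding T(2) by simp
   ultimately show "t : T \<inter> {c..d} \<longleftrightarrow> t : (%t. vcoord E s (fst (\<xi> t)) (snd (\<xi> t)) i) -` Q \<inter> {c..d}"
    using tot[of t] U by auto
  qed
  then show "EX A. open A & A \<inter> {c..d} = (%t. vcoord E s (fst (\<xi> t)) (snd (\<xi> t)) i) -` Q \<inter> {c..d}"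
   using T(1) by blast
 qed
 then show "creg Classical M E a b \<xi>" using sh tot by (simp add: creg_def)
next
 assume c: "creg Classical M E a b \<xi>"
 have tot: "\<xi> t : total_space M E" if "t : {a..b}" for t using c that by (simp add: creg_def)
 show "continuous_curve M E a b \<xi>"
  unfolding continuous_curve_def continuous_map_def
 proof (intro conjI allI impI)
  show "\<xi> : topspace (top_of_set {a..b}) \<rightarrow> topspace (total_topology M E)" using tot by (simp add: topspace_total_topology[OF M E])
  fix W assume "openin (total_topology M E) W"
  then have W: "open_total M E W" by (simp add: openin_total_topology)
  have "EX e>0. ALL r:{a..b}. dist r t < e --> \<xi> r : W" if t: "t : {a..b}" "\<xi> t : W" for t
  proof -
   obtain U s \<delta> where Us: "(U, s) : vframes E" and \<delta>: "\<delta> > 0" "!!r. r : {a..b} ==> \<bar>r - t\<bar> < \<delta> ==> fst (\<xi> r) : U"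
    using creg_local_frame[OF E c t(1)] by metis
   define p q where "p = max a (t - \<delta> / 2)" and "q = min b (t + \<delta> / 2)"
   have pq: "{p..q} \<subseteq> {a..b}" "t : {p..q}" using t \<delta> by (auto simp: p_def q_def)
   have U: "fst (\<xi> r) : U" if "r : {p..q}" for r
    using \<delta>(2)[of r] that pq \<delta>(1) by (auto simp: p_def q_def)
   have x: "path_on M p q (%t. fst (\<xi> t))"
    using continuous_map_from_subtopology_mono[OF creg_shadow[OF c] pq(1)] by (simp add: comp_def)
   obtain T where T: "open T" "!!t a. t : {p..q} ==> a : Rn (vrank E) ==>
     (fst (\<xi> t), SUM i<vrank E. a i *\<^sub>R s i (fst (\<xi> t))) : W \<longleftrightarrow> (t, a) : T"
    using open_total_frame[OF M E Us W x U] by blast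
   have "continuous_on {p..q} (%t. coord_curve E s \<xi> t)"
    using creg_coord[OF c Us, of p q] pq U
    by (intro continuous_on_Rn_valued[OF coord_curve_Rn]) (auto simp: coord_curve_def p_def q_def)
   then have "continuous_on {p..q} (%t. (t, coord_curve E s \<xi> t))" by (intro continuous_on_Pair continuous_on_id)
   then have op: "openin (top_of_set {p..q}) ({p..q} \<inter> (%t. (t, coord_curve E s \<xi> t)) -` T)"
    using T(1) by (simp add: continuous_openin_preimage_gen)
   have W_iff: "(t, coord_curve E s \<xi> t) : T \<longleftrightarrow> \<xi> t : W" if tt: "t : {p..q}" for t
    using T(2)[OF tt coord_curve_Rn, of s \<xi> t] coord_curve_expand[of M E U s \<xi> t, OF E Us tot U] tt pq by auto
   have "{p..q} \<inter> (%t. (t, coord_curve E s \<xi> t)) -` T = {t : {p..q}. \<xi> t : W}"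
    using W_iff by blast
   with op have "openin (top_of_set {p..q}) {t : {p..q}. \<xi> t : W}" by simp
   then obtain e where e: "e > 0" "!!r. r : {p..q} ==> dist r t < e ==> \<xi> r : W"
    using pq(2) t(2) unfolding openin_euclidean_subtopology_iff by blast
   have "\<xi> r : W" if "r : {a..b}" "dist r t < min e (\<delta> / 2)" for r
    using e(2)[of r] that by (auto simp: p_def q_def dist_real_def abs_real_def split: if_splits)
   then show ?thesis using e(1) \<delta>(1) by (intro exI[of _ "min e (\<delta> / 2)"]) auto
  qed
  then show "openin (top_of_set {a..b}) {t : topspace (top_of_set {a..b}). \<xi> t : W}"
   unfolding openin_euclidean_subtopology_iff by auto
 qed
qed


lemma absolutely_integrable_measurable:
 fixes f :: "real => real"
 assumes "set_integrable lebesgue {c..d} f"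
 shows "f : borel_measurable (lebesgue_on {c..d})"
proof -
 have "integrable (lebesgue_on {c..d}) f"
  using assms by (simp add: integrable_restrict_space set_integrable_def)
 then show ?thesis by (rule borel_measurable_integrable)
qed

lemma bundle_metricD:
 assumes "bundle_metric M E g" "x : points M" "v : fibre E x" "w : fibre E x"
 shows "u : fibre E x ==> g x (u + v) w = g x u w + g x v w"
  and "g x (a *\<^sub>R v) w = a * g x v w" and "g x v w = g x w v" and "v ~= 0 ==> g x v v > 0"
 using conjunct1[OF assms(1)[unfolded bundle_metric_def], rule_format, OF assms(2)] assms(3,4) by auto

lemma bundle_metric_frame:
 assumes g: "bundle_metric M E g" and E: "vector_bundle M E" and Us: "(U, s) : vframes E" and x: "x : U"
 shows "g x (SUM i<vrank E. a i *\<^sub>R s i x) (SUM i<vrank E. a i *\<^sub>R s i x) =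
  (SUM i<vrank E. SUM j<vrank E. a i * a j * g x (s i x) (s j x))"
proof -
 have xM: "x : points M" using vb_frame_subset[OF E Us x] .
 have fr: "is_frame (vrank E) (%i. s i x) (fibre E x)" using vb_is_frame[OF E Us x] .
 have sub: "subspace (fibre E x)" using is_frame_subspace[OF fr] .
 have mem: "i < vrank E ==> s i x : fibre E x" for i using is_frame_mem[OF fr] .
 have f1: "functional_on (fibre E x) (%u. g x u w)" if "w : fibre E x" for w
  using bundle_metricD(1,2)[OF g xM] that unfolding functional_on_def by auto
 have sym: "g x u w = g x w u" if "u : fibre E x" "w : fibre E x" for u w
  using bundle_metricD(3)[OF g xM] that by auto
 let ?v = "SUM i<vrank E. a i *\<^sub>R s i x"
 have v: "?v : fibre E x" using is_frame_sum_mem[OF fr] .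
 have "g x ?v ?v = (SUM i<vrank E. a i * g x (s i x) ?v)"
  using functional_on_sum[OF f1[OF v] sub, of "{..<vrank E}" "%i. s i x" a] mem by simp
 also have "\<dots> = (SUM i<vrank E. a i * (SUM j<vrank E. a j * g x (s j x) (s i x)))"
 proof (intro sum.cong refl arg_cong2[where f = "(*)"])
  fix i assume i: "i : {..<vrank E}"
  then show "g x (s i x) ?v = (SUM j<vrank E. a j * g x (s j x) (s i x))"
   using functional_on_sum[OF f1[OF mem] sub, of i "{..<vrank E}" "%i. s i x" a] mem sym[OF mem v, of i] by simp
 qed
 also have "\<dots> = (SUM i<vrank E. SUM j<vrank E. a i * a j * g x (s i x) (s j x))"
  using sym mem by (auto simp: sum_distrib_left mult.assoc intro!: sum.cong)
 finally show ?thesis .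
qed

text \<open>On a compact interval over one frame, a bundle metric and the Euclidean norm of the coordinates
  are equivalent.\<close>

lemma metric_bounds:
 fixes a b c d :: real
 assumes M: "smooth_manifold M" and g: "bundle_metric M E g" and E: "vector_bundle M E" and Us: "(U, s) : vframes E"
  and x: "path_on M a b x" and cd: "{c..d} \<subseteq> {a..b}" and U: "!!t. t : {c..d} ==> x t : U"
 defines "q \<equiv> %t (v :: nat => real). SUM i<vrank E. SUM j<vrank E. v i * v j * g (x t) (s i (x t)) (s j (x t))"
 obtains k K where "k > 0" "K >= 0"
  "!!t v i. t : {c..d} ==> i < vrank E ==> k * \<bar>v i\<bar> <= sqrt (q t v)"
  "!!t v. t : {c..d} ==> sqrt (q t v) <= K * (SUM i<vrank E. \<bar>v i\<bar>)"
  "!!t v. t : {c..d} ==> 0 <= q t v"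
  "!!i j. i < vrank E ==> j < vrank E ==> continuous_on {c..d} (%t. g (x t) (s i (x t)) (s j (x t)))"
proof -
 let ?r = "vrank E"
 let ?G = "%i j t. g (x t) (s i (x t)) (s j (x t))"
 have oU: "openin (mtop M) U" using vb_frame_open[OF E Us] .
 have cont: "continuous_on {c..d} (?G i j)" if "i < ?r" "j < ?r" for i j
 proof -
  have "smooth_fun_on M U (%x. g x (s i x) (s j x))"
   using conjunct2[OF g[unfolded bundle_metric_def]] Us that by auto
  from continuous_on_smooth_compose[OF M oU this x cd U] show ?thesis .
 qed
 have q_g: "q t v = g (x t) (SUM i<?r. v i *\<^sub>R s i (x t)) (SUM i<?r. v i *\<^sub>R s i (x t))" if "t : {c..d}" for t v
  using bundle_metric_frame[OF g E Us U[OF that]] by (simp add: q_def)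
 have q_pos: "q t v > 0" if t: "t : {c..d}" and i: "i < ?r" "v i ~= 0" for t v i
 proof -
  have fr: "is_frame ?r (%i. s i (x t)) (fibre E (x t))" using vb_is_frame[OF E Us U[OF t]] .
  have "(SUM i<?r. v i *\<^sub>R s i (x t)) ~= 0" using is_frame_zero_iff[OF fr] i by blast
  then show ?thesis unfolding q_g[OF t]
   using bundle_metricD(4)[OF g vb_frame_subset[OF E Us U[OF t]] is_frame_sum_mem[OF fr] is_frame_sum_mem[OF fr]] by simp
 qed
 have q_nonneg: "0 <= q t v" if t: "t : {c..d}" for t v
 proof (cases "EX i<?r. v i ~= 0")
  case True then show ?thesis using q_pos[OF t] less_imp_le by blast
 next
  case False then show ?thesis by (simp add: q_def)
 qed
 have q_scale: "q t (%i. l * v i) = l\<^sup>2 * q t v" for t v l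
  by (simp add: q_def sum_distrib_left power2_eq_square algebra_simps)
 \<comment> \<open>Lower bound: \<open>q\<close> is positive on the compact product of the interval
   with the unit sphere of coordinates, so it has a positive minimum there, which extends to all
   vectors by homogeneity.\<close>
 define S where "S = {v : Rn ?r. (SUM i<?r. (v i)\<^sup>2) = 1}"
 have "compact S"
 proof -
  have "compactin (Euclidean_space ?r) {v : Rn ?r. ALL i<?r. \<bar>v i - 0\<bar> <= 1}"
   using compactin_Rn_box[of ?r "%i. 0" 1] by simp
  then have c1: "compact {v : Rn ?r. ALL i<?r. \<bar>v i - 0\<bar> <= 1}"
   by (simp add: Euclidean_space_def euclidean_product_topology compactin_subtopology)
  have c2: "closed {v::nat=>real. (SUM i<?r. (v i)\<^sup>2) = 1}"
   by (intro closed_Collect_eq continuous_intros continuous_on_apply)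
  have eq: "S = {v : Rn ?r. ALL i<?r. \<bar>v i - 0\<bar> <= 1} \<inter> {v. (SUM i<?r. (v i)\<^sup>2) = 1}"
  proof -
   have "\<bar>v i\<bar> <= 1" if "(SUM i<?r. (v i)\<^sup>2) = 1" "i < ?r" for v :: "nat => real" and i
   proof -
    have "(v i)\<^sup>2 <= (SUM i<?r. (v i)\<^sup>2)" using that(2) by (intro member_le_sum) auto
    then show ?thesis using that(1) by (simp add: abs_square_le_1)
   qed
   then show ?thesis by (auto simp: S_def)
  qed
  show ?thesis unfolding eq by (rule compact_Int_closed[OF c1 c2])
 qed
 have "EX m>0. ALL t:{c..d}. ALL v:S. m <= q t v"
 proof (cases "{c..d} \<times> S = {}")
  case True then show ?thesis by (intro exI[of _ 1]) auto
 next
  case False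
  have "continuous_on ({c..d} \<times> S) (%z. q (fst z) (snd z))"
   unfolding q_def
  proof (intro continuous_on_sum continuous_on_mult)
   fix i j assume "i : {..<?r}" "j : {..<?r}"
   then show "continuous_on ({c..d} \<times> S) (%z. ?G i j (fst z))"
    using continuous_on_compose2[OF cont[of i j] continuous_on_fst[OF continuous_on_id], of "{c..d} \<times> S"] by auto
  qed (rule continuous_on_compose2[OF continuous_on_apply[of UNIV] continuous_on_snd[OF continuous_on_id]]; simp)+
  moreover have "compact ({c..d} \<times> S)" using \<open>compact S\<close> by (intro compact_Times) auto
  ultimately obtain z where z: "z : {c..d} \<times> S" "!!w. w : {c..d} \<times> S ==> q (fst z) (snd z) <= q (fst w) (snd w)"
   using continuous_attains_inf[OF _ False, of "%z. q (fst z) (snd z)"] by blast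
  have "EX i<?r. snd z i ~= 0"
  proof (rule ccontr)
   assume "\<not> ?thesis"
   then have "(SUM i<?r. (snd z i)\<^sup>2) = 0" by simp
   then show False using z(1) by (auto simp: S_def)
  qed
  then have "q (fst z) (snd z) > 0" using q_pos z(1) by (auto simp: mem_Times_iff)
  then show ?thesis using z(2) by (intro exI[of _ "q (fst z) (snd z)"]) auto
 qed
 then obtain m where m: "m > 0" "!!t v. t : {c..d} ==> v : S ==> m <= q t v" by blast
 have lower: "sqrt m * \<bar>v i\<bar> <= sqrt (q t v)" if t: "t : {c..d}" and i: "i < ?r" for t v i
 proof (cases "v i = 0")
  case True then show ?thesis using q_nonneg[OF t] by simp
 next
  case False
  define n where "n = sqrt (SUM i<?r. (v i)\<^sup>2)"
  have le: "(v i)\<^sup>2 <= (SUM i<?r. (v i)\<^sup>2)" using i by (intro member_le_sum) auto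
  have n2: "n\<^sup>2 = (SUM i<?r. (v i)\<^sup>2)" by (simp add: n_def sum_nonneg)
  have npos: "n > 0" using le False unfolding n_def by (simp add: less_le_trans[of 0 "(v i)\<^sup>2"])
  define w where "w i = (if i < ?r then v i / n else 0)" for i
  have "(SUM i<?r. (w i)\<^sup>2) = 1"
   using npos by (simp add: w_def power_divide n2[symmetric] flip: sum_divide_distrib)
  then have "w : S" by (simp add: S_def Rn_iff w_def)
  from m(2)[OF t this] have "m <= q t w" .
  also have "q t w = q t (%i. (1 / n) * v i)" by (simp add: q_def w_def)
  also have "\<dots> = (1 / n)\<^sup>2 * q t v" by (rule q_scale)
  finally have "m * n\<^sup>2 <= q t v" using npos by (simp add: power_divide field_simps)
  moreover have "m * (v i)\<^sup>2 <= m * n\<^sup>2" using le m(1) by (simp add: n2)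
  ultimately have "m * (v i)\<^sup>2 <= q t v" by linarith
  then have "sqrt (m * (v i)\<^sup>2) <= sqrt (q t v)" by simp
  then show ?thesis by (simp add: real_sqrt_mult)
 qed
 have "EX B>=0. ALL t:{c..d}. \<bar>?G i j t\<bar> <= B" if "i < ?r" "j < ?r" for i j
 proof -
  have "bounded (?G i j ` {c..d})" using cont[OF that] by (intro compact_imp_bounded compact_continuous_image) auto
  then obtain B where B: "ALL y:?G i j ` {c..d}. norm y <= B" using bounded_iff by blast
  then show ?thesis by (intro exI[of _ "max 0 B"]) auto
 qed
 then obtain B where B: "!!i j. i < ?r ==> j < ?r ==> B i j >= 0 & (ALL t:{c..d}. \<bar>?G i j t\<bar> <= B i j)" by metis
 \<comment> \<open>A crude common bound: the sum of the nonnegative bounds dominates each of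
   them.\<close>
 define BB where "BB = (SUM i<?r. SUM j<?r. B i j)"
 have BB0: "BB >= 0" unfolding BB_def using B by (intro sum_nonneg) auto
 have Ble: "B i j <= BB" if "i < ?r" "j < ?r" for i j
 proof -
  have "B i j <= (SUM j<?r. B i j)" using that B by (intro member_le_sum) auto
  also have "\<dots> <= BB" unfolding BB_def using that B by (intro member_le_sum) (auto intro!: sum_nonneg)
  finally show ?thesis .
 qed
 have upper: "sqrt (q t v) <= sqrt BB * (SUM i<?r. \<bar>v i\<bar>)" if t: "t : {c..d}" for t v
 proof -
  have "q t v <= (SUM i<?r. SUM j<?r. \<bar>v i\<bar> * \<bar>v j\<bar> * BB)"
   unfolding q_def
  proof (intro sum_mono)
   fix i j assume ij: "i : {..<?r}" "j : {..<?r}"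
   have "v i * v j * ?G i j t <= \<bar>v i * v j * ?G i j t\<bar>" by simp
   also have "\<dots> = \<bar>v i\<bar> * \<bar>v j\<bar> * \<bar>?G i j t\<bar>" by (simp add: abs_mult)
   also have "\<dots> <= \<bar>v i\<bar> * \<bar>v j\<bar> * BB"
    using B[of i j] Ble[of i j] ij t by (intro mult_left_mono) (auto intro: order_trans)
   finally show "v i * v j * ?G i j t <= \<bar>v i\<bar> * \<bar>v j\<bar> * BB" .
  qed
  also have "\<dots> = BB * (SUM i<?r. \<bar>v i\<bar>)\<^sup>2"
   by (simp add: power2_eq_square sum_product sum_distrib_left algebra_simps)
  finally have "sqrt (q t v) <= sqrt (BB * (SUM i<?r. \<bar>v i\<bar>)\<^sup>2)" by simp
  then show ?thesis by (simp add: real_sqrt_mult sum_nonneg)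
 qed
 show thesis
  by (rule that[of "sqrt m" "sqrt BB"]) (use m(1) BB0 lower upper q_nonneg cont in auto)
qed

text \<open>By \<open>metric_bounds\<close> the norm of any metric is comparable with the
  coordinates on compact pieces over one frame; measurability is transferred by
  \<open>open_total_coord\<close> in one direction and \<open>open_total_frame\<close> in the
  other.\<close>

lemma L1c_iff_creg:
 assumes M: "smooth_manifold M" and E: "vector_bundle M E" and ab: "a <= b"
 shows "\<xi> : L1c M E a b \<longleftrightarrow> creg Weak M E a b \<xi>"
proof
 assume \<xi>: "\<xi> : L1c M E a b"
 then have ms: "\<xi> : measurable (lebesgue_on {a..b}) (sigma (total_space M E) {W. openin (total_topology M E) W})"
  and x: "path_on M a b (fst \<circ> \<xi>)" by (auto simp: L1c_def)
 obtain g where g: "bundle_metric M E g" and gi: "set_integrable lebesgue {a..b} (%t. sqrt (g (fst (\<xi> t)) (snd (\<xi> t)) (snd (\<xi> t))))"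
  using \<xi> by (auto simp: L1c_def)
 have pow: "{W. openin (total_topology M E) W} \<subseteq> Pow (total_space M E)"
  by (auto simp: openin_total_topology open_total_def)
 have tot: "\<xi> t : total_space M E" if "t : {a..b}" for t
  using measurable_space[OF ms, of t] that pow by (simp add: space_measure_of)
 have pre: "{t : {a..b}. \<xi> t : W} : sets (lebesgue_on {a..b})" if W: "open_total M E W" for W
 proof -
  have "W : sets (sigma (total_space M E) {W. openin (total_topology M E) W})"
   unfolding sets_measure_of[OF pow] using W by (intro sigma_sets.Basic) (simp add: openin_total_topology)
  from measurable_sets[OF ms this] have "\<xi> -` W \<inter> {a..b} : sets (lebesgue_on {a..b})" by simp
  moreover have "\<xi> -` W \<inter> {a..b} = {t : {a..b}. \<xi> t : W}" by auto
  ultimately show ?thesis by simp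
 qed
 have "set_integrable lebesgue {c..d} (%t. vcoord E s (fst (\<xi> t)) (snd (\<xi> t)) i)"
  if Us: "(U, s) : vframes E" and cd: "a <= c" "d <= b" and U: "ALL t:{c..d}. fst (\<xi> t) : U" and i: "i < vrank E"
  for U s c d i
 proof -
  let ?h = "%t. coord_curve E s \<xi> t i"
  have sub: "{c..d} \<subseteq> {a..b}" using cd by auto
  obtain k K where k: "k > 0" and lower: "!!t v i. t : {c..d} ==> i < vrank E ==> k * \<bar>v i\<bar> <=
    sqrt (SUM i<vrank E. SUM j<vrank E. v i * v j * g ((fst \<circ> \<xi>) t) (s i ((fst \<circ> \<xi>) t)) (s j ((fst \<circ> \<xi>) t)))"
   by (rule metric_bounds[OF M g E Us x sub]) (use U in auto)
  have "?h : borel_measurable (lebesgue_on {c..d})"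
  proof (rule borel_measurableI)
   fix Q :: "real set" assume Q: "open Q"
   have "{t : {a..b}. \<xi> t : {z : total_space M E. fst z : U & vcoord E s (fst z) (snd z) i : Q}} \<inter> {c..d} : sets (lebesgue_on {c..d})"
    using pre[OF open_total_coord[OF M E Us i Q]] sub by (auto simp: sets_restrict_space_iff)
   moreover have "?h -` Q \<inter> space (lebesgue_on {c..d}) =
    {t : {a..b}. \<xi> t : {z : total_space M E. fst z : U & vcoord E s (fst z) (snd z) i : Q}} \<inter> {c..d}"
    using tot U cd by (auto simp: coord_curve_def)
   ultimately show "?h -` Q \<inter> space (lebesgue_on {c..d}) : sets (lebesgue_on {c..d})" by simp
  qed
  moreover have "norm (?h t) <= 1 / k * sqrt (g (fst (\<xi> t)) (snd (\<xi> t)) (snd (\<xi> t)))" if t: "t : {c..d}" for t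
  proof -
   have "(fst (\<xi> t), SUM i<vrank E. coord_curve E s \<xi> t i *\<^sub>R s i (fst (\<xi> t))) = \<xi> t"
    using t U tot sub by (intro coord_curve_expand[OF E Us]) auto
   then have "snd (\<xi> t) = (SUM i<vrank E. coord_curve E s \<xi> t i *\<^sub>R s i (fst (\<xi> t)))" by (metis snd_conv)
   then have "g (fst (\<xi> t)) (snd (\<xi> t)) (snd (\<xi> t)) = (SUM i<vrank E. SUM j<vrank E. coord_curve E s \<xi> t i *
     coord_curve E s \<xi> t j * g (fst (\<xi> t)) (s i (fst (\<xi> t))) (s j (fst (\<xi> t))))"
    using bundle_metric_frame[OF g E Us, of "fst (\<xi> t)" "coord_curve E s \<xi> t"] t U by simp
   then have "k * \<bar>?h t\<bar> <= sqrt (g (fst (\<xi> t)) (snd (\<xi> t)) (snd (\<xi> t)))"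
    using lower[OF t i, of "coord_curve E s \<xi> t"] by simp
   then show ?thesis using k by (simp add: field_simps)
  qed
  moreover have "(%t. 1 / k * sqrt (g (fst (\<xi> t)) (snd (\<xi> t)) (snd (\<xi> t)))) integrable_on {c..d}"
   using set_integrable_subset[OF gi _ sub] by (intro integrable_on_mult_right set_lebesgue_integral_eq_integral(1)) auto
  ultimately have "?h absolutely_integrable_on {c..d}"
   by (intro measurable_bounded_by_integrable_imp_absolutely_integrable) auto
  then show ?thesis by (simp add: coord_curve_def)
 qed
 then show "creg Weak M E a b \<xi>" using x tot by (simp add: creg_def)
next
 assume c: "creg Weak M E a b \<xi>"
 have x: "path_on M a b (fst \<circ> \<xi>)" using creg_shadow[OF c] .
 have tot: "\<xi> t : total_space M E" if "t : {a..b}" for t using c that by (simp add: creg_def)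
 obtain g where g: "bundle_metric M E g" using bundle_metric_exists[OF M E] by blast
 have loc: "EX \<delta>>0. ALL p q. a <= p & p <= t & t <= q & q <= b & q - p < \<delta> -->
   (EX U s. (U, s) : vframes E & (ALL r:{p..q}. fst (\<xi> r) : U))" if t: "a <= t" "t <= b" for t
 proof -
  have "t : {a..b}" using t by simp
  then obtain U s \<delta> where "(U, s) : vframes E" "\<delta> > 0" "!!r. r : {a..b} ==> \<bar>r - t\<bar> < \<delta> ==> fst (\<xi> r) : U"
   using creg_local_frame[OF E c] by metis
  then show ?thesis by (intro exI[of _ \<delta>] conjI allI impI exI[of _ U] exI[of _ s]) auto
 qed
 have meas: "coord_curve E s \<xi> : borel_measurable (lebesgue_on {p..q})"
  if Us: "(U, s) : vframes E" and pq: "a <= p" "q <= b" and U: "ALL r:{p..q}. fst (\<xi> r) : U" for U s p q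
 proof (rule measurable_coordinatewise_then_product)
  fix i show "(%t. coord_curve E s \<xi> t i) : borel_measurable (lebesgue_on {p..q})"
  proof (cases "i < vrank E")
   case True
   have "set_integrable lebesgue {p..q} (%t. coord_curve E s \<xi> t i)"
    using creg_coord[OF c Us pq _ True] U by (simp add: coord_curve_def)
   then show ?thesis by (rule absolutely_integrable_measurable)
  qed (simp add: coord_curve_def frame_coord_def)
 qed
 \<comment> \<open>Over a small interval the set is the preimage of an open set under the measurable
   map \<open>t\<close> to \<open>(t, coord_curve E s \<xi> t)\<close>; the pieces are then united
   by \<open>interval_induct\<close>.\<close>
 have pre: "{t : {a..b}. \<xi> t : W} : sets lebesgue" if W: "open_total M E W" for W
  using ab
 proof (rule interval_induct)
  fix c d e assume "c <= d" "d <= e" "{t : {c..d}. \<xi> t : W} : sets lebesgue" "{t : {d..e}. \<xi> t : W} : sets lebesgue"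
  moreover from this have "{t : {c..e}. \<xi> t : W} = {t : {c..d}. \<xi> t : W} \<union> {t : {d..e}. \<xi> t : W}" by auto
  ultimately show "{t : {c..e}. \<xi> t : W} : sets lebesgue" by simp
 next
  fix t assume "a <= t" "t <= b"
  from loc[OF this] obtain \<delta> where \<delta>: "\<delta> > 0" "!!p q. a <= p ==> p <= t ==> t <= q ==> q <= b ==> q - p < \<delta> ==>
   (EX U s. (U, s) : vframes E & (ALL r:{p..q}. fst (\<xi> r) : U))" by blast
  have "{t : {p..q}. \<xi> t : W} : sets lebesgue" if pq: "a <= p" "p <= t" "t <= q" "q <= b" "q - p < \<delta>" for p q
  proof -
   obtain U s where Us: "(U, s) : vframes E" and U: "ALL r:{p..q}. fst (\<xi> r) : U" using \<delta>(2)[OF pq] by blast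
   have sub: "{p..q} \<subseteq> {a..b}" using pq by auto
   have xp: "path_on M p q (%t. fst (\<xi> t))"
    using continuous_map_from_subtopology_mono[OF x sub] by (simp add: comp_def)
   obtain T where T: "open T" "!!t a. t : {p..q} ==> a : Rn (vrank E) ==>
     (fst (\<xi> t), SUM i<vrank E. a i *\<^sub>R s i (fst (\<xi> t))) : W \<longleftrightarrow> (t, a) : T"
    by (rule open_total_frame[OF M E Us W xp]) (use U in auto)
   have "(%t. (t, coord_curve E s \<xi> t)) : borel_measurable (lebesgue_on {p..q})"
    by (intro borel_measurable_Pair meas[OF Us pq(1,4) U] continuous_imp_measurable_on_sets_lebesgue continuous_on_id) auto
   from measurable_sets[OF this, of T] T(1)
   have "(%t. (t, coord_curve E s \<xi> t)) -` T \<inter> {p..q} : sets (lebesgue_on {p..q})" by simp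
   moreover have "(%t. (t, coord_curve E s \<xi> t)) -` T \<inter> {p..q} = {t : {p..q}. \<xi> t : W}"
   proof -
    have "(t, coord_curve E s \<xi> t) : T \<longleftrightarrow> \<xi> t : W" if t: "t : {p..q}" for t
     using T(2)[OF t coord_curve_Rn, of s \<xi> t] coord_curve_expand[of M E U s \<xi> t, OF E Us tot] t U sub by auto
    then show ?thesis by auto
   qed
   ultimately have "{t : {p..q}. \<xi> t : W} : sets (lebesgue_on {p..q})" by simp
   then show ?thesis by (subst (asm) sets_restrict_space_iff) auto
  qed
  then show "EX \<delta>>0. ALL c d. a <= c & c <= t & t <= d & d <= b & d - c < \<delta> --> {t : {c..d}. \<xi> t : W} : sets lebesgue"
   using \<delta>(1) by blast
 qed
 have "\<xi> : measurable (lebesgue_on {a..b}) (sigma (total_space M E) {W. openin (total_topology M E) W})"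
 proof (rule measurable_measure_of)
  show "{W. openin (total_topology M E) W} \<subseteq> Pow (total_space M E)"
   by (auto simp: openin_total_topology open_total_def)
  show "\<xi> : space (lebesgue_on {a..b}) \<rightarrow> total_space M E" using tot by auto
  fix W assume "W : {W. openin (total_topology M E) W}"
  then have "{t : {a..b}. \<xi> t : W} : sets lebesgue" using pre by (simp add: openin_total_topology)
  moreover have "\<xi> -` W \<inter> space (lebesgue_on {a..b}) = {t : {a..b}. \<xi> t : W}" by auto
  ultimately show "\<xi> -` W \<inter> space (lebesgue_on {a..b}) : sets (lebesgue_on {a..b})"
   by (auto simp: sets_restrict_space_iff)
 qed
 moreover have "set_integrable lebesgue {a..b} (%t. sqrt (g (fst (\<xi> t)) (snd (\<xi> t)) (snd (\<xi> t))))"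
  using ab
 proof (rule interval_induct)
  let ?f = "%t. sqrt (g (fst (\<xi> t)) (snd (\<xi> t)) (snd (\<xi> t)))"
  fix c d e assume "c <= d" "d <= e" "set_integrable lebesgue {c..d} ?f" "set_integrable lebesgue {d..e} ?f"
  moreover from this have "{c..e} = {c..d} \<union> {d..e}" by auto
  ultimately show "set_integrable lebesgue {c..e} ?f" by (simp add: set_integrable_Un)
 next
  let ?f = "%t. sqrt (g (fst (\<xi> t)) (snd (\<xi> t)) (snd (\<xi> t)))"
  fix t assume "a <= t" "t <= b"
  from loc[OF this] obtain \<delta> where \<delta>: "\<delta> > 0" "!!p q. a <= p ==> p <= t ==> t <= q ==> q <= b ==> q - p < \<delta> ==>
   (EX U s. (U, s) : vframes E & (ALL r:{p..q}. fst (\<xi> r) : U))" by blast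
  have "set_integrable lebesgue {p..q} ?f" if pq: "a <= p" "p <= t" "t <= q" "q <= b" "q - p < \<delta>" for p q
  proof -
   obtain U s where Us: "(U, s) : vframes E" and U: "ALL r:{p..q}. fst (\<xi> r) : U" using \<delta>(2)[OF pq] by blast
   have sub: "{p..q} \<subseteq> {a..b}" using pq by auto
   let ?q = "%t (v :: nat => real). SUM i<vrank E. SUM j<vrank E. v i * v j * g (fst (\<xi> t)) (s i (fst (\<xi> t))) (s j (fst (\<xi> t)))"
   obtain k K where upper: "!!t v. t : {p..q} ==> sqrt (?q t v) <= K * (SUM i<vrank E. \<bar>v i\<bar>)"
    and nn: "!!t v. t : {p..q} ==> 0 <= ?q t v"
    and cont: "!!i j. i < vrank E ==> j < vrank E ==> continuous_on {p..q} (%t. g (fst (\<xi> t)) (s i (fst (\<xi> t))) (s j (fst (\<xi> t))))"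
    by (rule metric_bounds[OF M g E Us x sub]) (use U in auto)
   have eq: "?f t = sqrt (?q t (coord_curve E s \<xi> t))" if t: "t : {p..q}" for t
   proof -
    have "(fst (\<xi> t), SUM i<vrank E. coord_curve E s \<xi> t i *\<^sub>R s i (fst (\<xi> t))) = \<xi> t"
     using t U tot sub by (intro coord_curve_expand[OF E Us]) auto
    then have "snd (\<xi> t) = (SUM i<vrank E. coord_curve E s \<xi> t i *\<^sub>R s i (fst (\<xi> t)))" by (metis snd_conv)
    then show ?thesis
     using bundle_metric_frame[OF g E Us, of "fst (\<xi> t)" "coord_curve E s \<xi> t"] t U by simp
   qed
   have ci: "set_integrable lebesgue {p..q} (%t. coord_curve E s \<xi> t i)" if "i < vrank E" for i
    using creg_coord[OF c Us pq(1,4) _ that] U by (simp add: coord_curve_def)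
   have cm: "(%t. coord_curve E s \<xi> t i) : borel_measurable (lebesgue_on {p..q})" if "i < vrank E" for i
    using ci[OF that] by (rule absolutely_integrable_measurable)
   have "(%t. sqrt (?q t (coord_curve E s \<xi> t))) : borel_measurable (lebesgue_on {p..q})"
   proof (rule measurable_compose[OF _ borel_measurable_sqrt], intro borel_measurable_sum)
    fix i j assume ij: "i : {..<vrank E}" "j : {..<vrank E}"
    then have "(%t. g (fst (\<xi> t)) (s i (fst (\<xi> t))) (s j (fst (\<xi> t)))) : borel_measurable (lebesgue_on {p..q})"
     by (intro continuous_imp_measurable_on_sets_lebesgue[OF cont]) simp_all
    with cm[of i] cm[of j] ij
    show "(%t. coord_curve E s \<xi> t i * coord_curve E s \<xi> t j * g (fst (\<xi> t)) (s i (fst (\<xi> t))) (s j (fst (\<xi> t))))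
      : borel_measurable (lebesgue_on {p..q})" by (intro borel_measurable_times) simp_all
   qed
   moreover have "(%t. K * (SUM i<vrank E. \<bar>coord_curve E s \<xi> t i\<bar>)) integrable_on {p..q}"
    using set_integrable_abs[OF ci] by (intro integrable_on_mult_right integrable_sum set_lebesgue_integral_eq_integral(1)) auto
   ultimately have "(%t. sqrt (?q t (coord_curve E s \<xi> t))) absolutely_integrable_on {p..q}"
    using upper nn by (intro measurable_bounded_by_integrable_imp_absolutely_integrable) auto
   then show ?thesis by (rule iffD2[OF set_integrable_cong[OF refl refl eq], rotated]) (simp add: simp_implies_def)
  qed
  then show "EX \<delta>>0. ALL c d. a <= c & c <= t & t <= d & d <= b & d - c < \<delta> --> set_integrable lebesgue {c..d} ?f"
   using \<delta>(1) by blast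
 qed
 ultimately show "\<xi> : L1c M E a b" using x g by (auto simp: L1c_def)
qed

section \<open>Linear inclusions along a curve\<close>

lemma creg_subinterval:
 assumes "creg \<tt> M E a b \<xi>" "a <= c" "d <= b"
 shows "creg \<tt> M E c d \<xi>"
proof -
 have "{c..d} \<subseteq> {a..b}" using assms by auto
 then have "path_on M c d (fst \<circ> \<xi>)"
  using continuous_map_from_subtopology_mono[OF creg_shadow[OF assms(1)]] by blast
 then show ?thesis using assms unfolding creg_def by (auto intro: order_trans)
qed

lemma creg_cong:
 assumes "!!t. t : {a..b} ==> \<xi> t = \<xi>' t" "creg \<tt> M E a b \<xi>"
 shows "creg \<tt> M E a b \<xi>'"
 unfolding creg_def
proof (intro conjI ballI allI impI)
 show "path_on M a b (fst \<circ> \<xi>')"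
  by (rule continuous_map_eq[OF creg_shadow[OF assms(2)]]) (use assms(1) in auto)
 show "\<xi>' t : total_space M E" if "t : {a..b}" for t
  using assms that by (auto simp: creg_def)
 fix U s c d i assume *: "(U, s) : vframes E" "a <= c" "d <= b" "ALL t:{c..d}. fst (\<xi>' t) : U" "i < vrank E"
 have eq: "\<xi> t = \<xi>' t" if "t : {c..d}" for t using assms(1)[of t] that * by auto
 have "reg \<tt> {c..d} (%t. vcoord E s (fst (\<xi> t)) (snd (\<xi> t)) i)"
  using * eq by (intro creg_coord[OF assms(2)]) auto
 then show "reg \<tt> {c..d} (%t. vcoord E s (fst (\<xi>' t)) (snd (\<xi>' t)) i)"
  by (rule iffD1[OF reg_cong, rotated]) (simp add: eq)
qed

lemma creg_glue:
 assumes x: "path_on M a c (fst \<circ> \<xi>)" and "a <= b" "b <= c"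
  and 1: "creg \<tt> M E a b \<xi>" and 2: "creg \<tt> M E b c \<xi>"
 shows "creg \<tt> M E a c \<xi>"
 unfolding creg_def
proof (intro conjI ballI allI impI x)
 show "\<xi> t : total_space M E" if "t : {a..c}" for t
  using 1 2 that by (cases "t <= b") (auto simp: creg_def)
 fix U s p q i assume *: "(U, s) : vframes E" "a <= p" "q <= c" "ALL t:{p..q}. fst (\<xi> t) : U" "i < vrank E"
 let ?h = "%t. vcoord E s (fst (\<xi> t)) (snd (\<xi> t)) i"
 consider "q <= b" | "b <= p" | "p <= b" "b <= q" by linarith
 then show "reg \<tt> {p..q} ?h"
 proof cases
  case 1 then show ?thesis using * by (intro creg_coord[OF assms(4)]) auto
 next
  case 2 then show ?thesis using * by (intro creg_coord[OF assms(5)]) auto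
 next
  case 3
  then have "reg \<tt> {p..b} ?h" using * by (intro creg_coord[OF assms(4)]) auto
  moreover have "reg \<tt> {b..q} ?h" using * 3 by (intro creg_coord[OF assms(5)]) auto
  ultimately    show ?thesis using 3 reg_glue[of p b q] by blast
 qed
qed

lemma continuous_shadow_mem:
 "continuous_map (top_of_set {a..b}) X x ==> t : {a..b} ==> x t : topspace X"
 for x :: "real => 'a"
 using continuous_map_image_subset_topspace by fastforce

lemma creg_zero:
 assumes E: "vector_bundle M E" and x: "path_on M a b x"
 shows "creg \<tt> M E a b (%t. (x t, 0))"
proof -
 have "reg \<tt> {c..d} (%t. vcoord E s (x t) 0 i)"
  if "(U, s) : vframes E" "!!t. t : {c..d} ==> x t : U" "i < vrank E" for U s c d i
  by (rule iffD2[OF reg_cong reg_0]) (use that frame_coord_zero[OF vb_is_frame[OF E that(1)]] in auto)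
 moreover have "0 : fibre E (x t)" if "t : {a..b}" for t
  using vb_fibre_subspace[OF E continuous_shadow_mem[OF x that]] by (simp add: subspace_0)
 ultimately show ?thesis
  unfolding creg_def total_space_def using x continuous_shadow_mem[OF x] by (auto simp: comp_def)
qed

lemma creg_add:
 assumes E: "vector_bundle M E" and v: "creg \<tt> M E a b (%t. (x t, v t))" and w: "creg \<tt> M E a b (%t. (x t, w t))"
 shows "creg \<tt> M E a b (%t. (x t, v t + w t))"
proof -
 have x: "path_on M a b x" using creg_shadow[OF v] by (simp add: comp_def)
 have mem: "v t : fibre E (x t)" "w t : fibre E (x t)" "x t : points M" if "t : {a..b}" for t
  using creg_mem[OF v that] creg_mem[OF w that] by auto
 have "reg \<tt> {c..d} (%t. vcoord E s (x t) (v t + w t) i)"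
  if *: "(U, s) : vframes E" "a <= c" "d <= b" "ALL t:{c..d}. x t : U" "i < vrank E" for U s c d i
 proof -
  have "reg \<tt> {c..d} (%t. vcoord E s (x t) (v t) i + vcoord E s (x t) (w t) i)"
   using creg_coord[OF v, of U s c d i] creg_coord[OF w, of U s c d i] * by (auto intro!: reg_add)
  then show ?thesis
   by (rule iffD1[OF reg_cong, rotated]) (use * mem in \<open>auto simp: frame_coord_add[OF vb_is_frame[OF E *(1)]]\<close>)
 qed
 moreover have "v t + w t : fibre E (x t)" if "t : {a..b}" for t
  using mem[OF that] vb_fibre_subspace[OF E] by (auto intro: subspace_add)
 ultimately show ?thesis unfolding creg_def total_space_def using x mem by (auto simp: comp_def)
qed

text \<open>The product rule is a premise because it is needed in two forms: a continuous factor
  times a regular curve, and a regular factor times a continuous curve.\<close>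

lemma creg_scale_gen:
 assumes E: "vector_bundle M E" and v: "creg \<tt>1 M E a b (%t. (x t, v t))"
  and prod: "!!c d f. a <= c ==> d <= b ==> reg \<tt>1 {c..d} f ==> reg \<tt> {c..d} (%t. h t * f t)"
 shows "creg \<tt> M E a b (%t. (x t, h t *\<^sub>R v t))"
proof -
 have x: "path_on M a b x" using creg_shadow[OF v] by (simp add: comp_def)
 have mem: "v t : fibre E (x t)" "x t : points M" if "t : {a..b}" for t
  using creg_mem[OF v that] by auto
 have "reg \<tt> {c..d} (%t. vcoord E s (x t) (h t *\<^sub>R v t) i)"
  if *: "(U, s) : vframes E" "a <= c" "d <= b" "ALL t:{c..d}. x t : U" "i < vrank E" for U s c d i
 proof -
  have "reg \<tt> {c..d} (%t. h t * vcoord E s (x t) (v t) i)"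
   using creg_coord[OF v, of U s c d i] * by (intro prod) auto
  then show ?thesis
   by (rule iffD1[OF reg_cong, rotated]) (use * mem in \<open>auto simp: frame_coord_scale[OF vb_is_frame[OF E *(1)]]\<close>)
 qed
 moreover have "h t *\<^sub>R v t : fibre E (x t)" if "t : {a..b}" for t
  using mem[OF that] vb_fibre_subspace[OF E] by (auto intro: subspace_scale)
 ultimately show ?thesis unfolding creg_def total_space_def using x mem by (auto simp: comp_def)
qed

lemma creg_scale_continuous:
 assumes "vector_bundle M E" "creg \<tt> M E a b (%t. (x t, v t))" "continuous_on {a..b} h"
 shows "creg \<tt> M E a b (%t. (x t, h t *\<^sub>R v t))"
proof (rule creg_scale_gen[OF assms(1,2)])
 fix c d f assume "a <= c" "d <= b" "reg \<tt> {c..d} f"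
 moreover have "continuous_on {c..d} h" using assms(3) by (rule continuous_on_subset) (use \<open>a <= c\<close> \<open>d <= b\<close> in auto)
 ultimately show "reg \<tt> {c..d} (%t. h t * f t)" by (intro reg_mult_continuous)
qed

lemma creg_scale_reg:
 assumes "vector_bundle M E" "creg Classical M E a b (%t. (x t, v t))" "reg \<tt> {a..b} h"
 shows "creg \<tt> M E a b (%t. (x t, h t *\<^sub>R v t))"
proof (rule creg_scale_gen[OF assms(1,2)])
 fix c d f assume "a <= c" "d <= b" "reg Classical {c..d} f"
 then have "reg \<tt> {c..d} (%t. f t * h t)"
  using reg_subset[OF assms(3)] by (intro reg_mult_continuous) auto
 then show "reg \<tt> {c..d} (%t. h t * f t)" by (simp add: mult.commute)
qed

lemma creg_uminus:
 assumes "vector_bundle M E" "creg \<tt> M E a b (%t. (x t, v t))"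
 shows "creg \<tt> M E a b (%t. (x t, - v t))"
 using creg_scale_continuous[OF assms, of "%t. - 1"] by simp

lemma creg_sum:
 assumes E: "vector_bundle M E" and x: "path_on M a b x"
  and "!!i. i : I ==> creg \<tt> M E a b (%t. (x t, v i t))"
 shows "creg \<tt> M E a b (%t. (x t, SUM i:I. v i t))"
 using assms(3)
proof (induction I rule: infinite_finite_induct)
 case (insert i I)
 then show ?case using creg_add[OF E, of \<tt> a b x "v i" "%t. SUM i:I. v i t"] by simp
qed (use creg_zero[OF E x] in auto)

text \<open>Common source of the statements on direct sums and on exterior products.\<close>

lemma creg_times_iff:
 assumes Z: "smooth_manifold Z" and M: "smooth_manifold M" and N: "smooth_manifold N"
  and G: "vector_bundle Z G" and E: "vector_bundle M E" and F: "vector_bundle N F"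
  and fib: "!!t. t : {a..b} ==> fibre G (z t) = fibre E (x t) \<times> fibre F (y t)" and rank: "vrank G = vrank E + vrank F"
  and sh: "path_on Z a b z \<longleftrightarrow>
   path_on M a b x & path_on N a b y"
  and fr: "!!U s V r. (U, s) : vframes E ==> (V, r) : vframes F ==> EX W q. (W, q) : vframes G &
   (ALL t. z t : W \<longleftrightarrow> x t : U & y t : V) &
   (ALL t i. q i (z t) = (if i < vrank E then (s i (x t), 0) else (0, r (i - vrank E) (y t))))"
 shows "creg \<tt> Z G a b (%t. (z t, v t, w t)) \<longleftrightarrow>
  creg \<tt> M E a b (%t. (x t, v t)) & creg \<tt> N F a b (%t. (y t, w t))"
proof -
 \<comment> \<open>Frames of both factors and of \<open>G\<close> with one radius, in which
   coordinates split; each direction below merely reads them off.\<close>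
 have loc: "EX \<delta>>0. EX U s V r W q. (U, s) : vframes E & (V, r) : vframes F & (W, q) : vframes G &
   (ALL \<tau>:{a..b}. \<bar>\<tau> - t\<bar> < \<delta> --> x \<tau> : U & y \<tau> : V & z \<tau> : W) &
   (ALL \<tau>:{a..b}. \<bar>\<tau> - t\<bar> < \<delta> --> v \<tau> : fibre E (x \<tau>) --> w \<tau> : fibre F (y \<tau>) -->
    (ALL i<vrank G. vcoord G q (z \<tau>) (v \<tau>, w \<tau>) i =
     (if i < vrank E then vcoord E s (x \<tau>) (v \<tau>) i
      else vcoord F r (y \<tau>) (w \<tau>) (i - vrank E))))"
  if x: "path_on M a b x" and y: "path_on N a b y"
   and t: "t : {a..b}" for t
 proof -
  obtain U s where Us: "(U, s) : vframes E" "x t : U" using vb_frame_exists[OF E continuous_shadow_mem[OF x t]] .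
  obtain V r where Vr: "(V, r) : vframes F" "y t : V" using vb_frame_exists[OF F continuous_shadow_mem[OF y t]] .
  obtain W q where Wq: "(W, q) : vframes G" "!!t. z t : W \<longleftrightarrow> x t : U & y t : V"
   "!!t i. q i (z t) = (if i < vrank E then (s i (x t), 0) else (0, r (i - vrank E) (y t)))" using fr[OF Us(1) Vr(1)] by blast
  obtain \<delta>1 where \<delta>1: "\<delta>1 > 0" "!!\<tau>. \<tau> : {a..b} ==> \<bar>\<tau> - t\<bar> < \<delta>1 ==> x \<tau> : U"
   using shadow_interval[OF x vb_frame_open[OF E Us(1)] t Us(2)] by blast
  obtain \<delta>2 where \<delta>2: "\<delta>2 > 0" "!!\<tau>. \<tau> : {a..b} ==> \<bar>\<tau> - t\<bar> < \<delta>2 ==> y \<tau> : V"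
   using shadow_interval[OF y vb_frame_open[OF F Vr(1)] t Vr(2)] by blast
  have "vcoord G q (z \<tau>) (v \<tau>, w \<tau>) i =
     (if i < vrank E then vcoord E s (x \<tau>) (v \<tau>) i
      else vcoord F r (y \<tau>) (w \<tau>) (i - vrank E))"
   if "\<tau> : {a..b}" "\<bar>\<tau> - t\<bar> < min \<delta>1 \<delta>2" "v \<tau> : fibre E (x \<tau>)" "w \<tau> : fibre F (y \<tau>)" "i < vrank G" for \<tau> i
  proof -
   have "x \<tau> : U" "y \<tau> : V" using that \<delta>1(2)[of \<tau>] \<delta>2(2)[of \<tau>] by auto
   from frame_coord_times[OF vb_is_frame[OF E Us(1) this(1)] vb_is_frame[OF F Vr(1) this(2)] that(3,4), of i] that(5)
   show ?thesis by (simp add: Wq(3) rank)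
  qed
  then show ?thesis
   using \<delta>1 \<delta>2 Us(1) Vr(1) Wq(1,2)
   by (intro exI[of _ "min \<delta>1 \<delta>2"] conjI exI[of _ U] exI[of _ s] exI[of _ V] exI[of _ r] exI[of _ W] exI[of _ q]) auto
 qed
 show ?thesis
 proof
  assume c: "creg \<tt> Z G a b (%t. (z t, v t, w t))"
  have z: "path_on Z a b z" using creg_shadow[OF c] by (simp add: comp_def)
  then have x: "path_on M a b x" and y: "path_on N a b y"
   using sh by auto
  have mem: "v t : fibre E (x t)" "w t : fibre F (y t)" if "t : {a..b}" for t
   using creg_mem(2)[OF c that] fib[OF that] by auto
  show "creg \<tt> M E a b (%t. (x t, v t)) & creg \<tt> N F a b (%t. (y t, w t))"
  proof
   show "creg \<tt> M E a b (%t. (x t, v t))"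
   proof (rule cregI[OF M E])
    fix t assume t: "t : {a..b}"
    obtain \<delta> U s V r W q where o: "\<delta> > 0" "(U, s) : vframes E" "(V, r) : vframes F" "(W, q) : vframes G"
     "ALL \<tau>:{a..b}. \<bar>\<tau> - t\<bar> < \<delta> --> x \<tau> : U & y \<tau> : V & z \<tau> : W"
     "ALL \<tau>:{a..b}. \<bar>\<tau> - t\<bar> < \<delta> --> v \<tau> : fibre E (x \<tau>) --> w \<tau> : fibre F (y \<tau>) -->
    (ALL i<vrank G. vcoord G q (z \<tau>) (v \<tau>, w \<tau>) i =
     (if i < vrank E then vcoord E s (x \<tau>) (v \<tau>) i
      else vcoord F r (y \<tau>) (w \<tau>) (i - vrank E)))"
     using loc[OF x y t] by (elim exE conjE) (rule that)
    note * = o(1,2,4) o(5)[rule_format] o(6)[rule_format]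
    have "reg \<tt> {c..d} (%t. vcoord E s (x t) (v t) i)"
     if cd: "a <= c" "c <= t" "t <= d" "d <= b" "d - c < \<delta>" "i < vrank E" for c d i
    proof -
     have near: "\<tau> : {a..b}" "\<bar>\<tau> - t\<bar> < \<delta>" if "\<tau> : {c..d}" for \<tau> using that cd by auto
     have "reg \<tt> {c..d} (%t. vcoord G q (z t) (v t, w t) i)"
      using creg_coord[OF c *(3) cd(1,4), of i] *(4)[OF near] cd rank by auto
     then show ?thesis
      by (rule iffD1[OF reg_cong, rotated]) (use *(5)[OF near mem[OF near(1)]] cd rank in auto)
    qed
    then show "EX \<delta>>0. EX U s. (U, s) : vframes E &
     (ALL r:{a..b}. \<bar>r - t\<bar> < \<delta> --> fst ((x r, v r)) : U) &
     (ALL c d i. a <= c & c <= t & t <= d & d <= b & d - c < \<delta> & i < vrank E -->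
      reg \<tt> {c..d} (%t. frame_coord (vrank E) (%k. s k (fst ((x t, v t)))) (snd ((x t, v t))) i))"
     using * by (intro exI[of _ \<delta>] conjI exI[of _ U] exI[of _ s]) auto
   qed (use x mem in \<open>auto simp: comp_def\<close>)
   show "creg \<tt> N F a b (%t. (y t, w t))"
   proof (rule cregI[OF N F])
    fix t assume t: "t : {a..b}"
    obtain \<delta> U s V r W q where o: "\<delta> > 0" "(U, s) : vframes E" "(V, r) : vframes F" "(W, q) : vframes G"
     "ALL \<tau>:{a..b}. \<bar>\<tau> - t\<bar> < \<delta> --> x \<tau> : U & y \<tau> : V & z \<tau> : W"
     "ALL \<tau>:{a..b}. \<bar>\<tau> - t\<bar> < \<delta> --> v \<tau> : fibre E (x \<tau>) --> w \<tau> : fibre F (y \<tau>) -->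
    (ALL i<vrank G. vcoord G q (z \<tau>) (v \<tau>, w \<tau>) i =
     (if i < vrank E then vcoord E s (x \<tau>) (v \<tau>) i
      else vcoord F r (y \<tau>) (w \<tau>) (i - vrank E)))"
     using loc[OF x y t] by (elim exE conjE) (rule that)
    note * = o(1,3,4) o(5)[rule_format] o(6)[rule_format]
    have "reg \<tt> {c..d} (%t. vcoord F r (y t) (w t) i)"
     if cd: "a <= c" "c <= t" "t <= d" "d <= b" "d - c < \<delta>" "i < vrank F" for c d i
    proof -
     have near: "\<tau> : {a..b}" "\<bar>\<tau> - t\<bar> < \<delta>" if "\<tau> : {c..d}" for \<tau> using that cd by auto
     have "reg \<tt> {c..d} (%t. vcoord G q (z t) (v t, w t) (vrank E + i))"
      using creg_coord[OF c *(3) cd(1,4), of "vrank E + i"] *(4)[OF near] cd rank by auto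
     then show ?thesis
      by (rule iffD1[OF reg_cong, rotated]) (use *(5)[OF near mem[OF near(1)]] cd rank in auto)
    qed
    then show "EX \<delta>>0. EX U s. (U, s) : vframes F &
     (ALL r:{a..b}. \<bar>r - t\<bar> < \<delta> --> fst ((y r, w r)) : U) &
     (ALL c d i. a <= c & c <= t & t <= d & d <= b & d - c < \<delta> & i < vrank F -->
      reg \<tt> {c..d} (%t. frame_coord (vrank F) (%k. s k (fst ((y t, w t)))) (snd ((y t, w t))) i))"
     using * by (intro exI[of _ \<delta>] conjI exI[of _ V] exI[of _ r]) auto
   qed (use y mem in \<open>auto simp: comp_def\<close>)
  qed
 next
  assume "creg \<tt> M E a b (%t. (x t, v t)) & creg \<tt> N F a b (%t. (y t, w t))"
  then have cx: "creg \<tt> M E a b (%t. (x t, v t))" and cy: "creg \<tt> N F a b (%t. (y t, w t))" by auto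
  have x: "path_on M a b x" and y: "path_on N a b y"
   using creg_shadow[OF cx] creg_shadow[OF cy] by (auto simp: comp_def)
  then have z: "path_on Z a b z" using sh by auto
  have mem: "v t : fibre E (x t)" "w t : fibre F (y t)" if "t : {a..b}" for t
   using creg_mem(2)[OF cx that] creg_mem(2)[OF cy that] by auto
  show "creg \<tt> Z G a b (%t. (z t, v t, w t))"
  proof (rule cregI[OF Z G])
   fix t assume t: "t : {a..b}"
   obtain \<delta> U s V r W q where o: "\<delta> > 0" "(U, s) : vframes E" "(V, r) : vframes F" "(W, q) : vframes G"
     "ALL \<tau>:{a..b}. \<bar>\<tau> - t\<bar> < \<delta> --> x \<tau> : U & y \<tau> : V & z \<tau> : W"
     "ALL \<tau>:{a..b}. \<bar>\<tau> - t\<bar> < \<delta> --> v \<tau> : fibre E (x \<tau>) --> w \<tau> : fibre F (y \<tau>) -->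
    (ALL i<vrank G. vcoord G q (z \<tau>) (v \<tau>, w \<tau>) i =
     (if i < vrank E then vcoord E s (x \<tau>) (v \<tau>) i
      else vcoord F r (y \<tau>) (w \<tau>) (i - vrank E)))"
     using loc[OF x y t] by (elim exE conjE) (rule that)
    note * = o(1-4) o(5)[rule_format] o(6)[rule_format]
   have "reg \<tt> {c..d} (%t. vcoord G q (z t) (v t, w t) i)"
    if cd: "a <= c" "c <= t" "t <= d" "d <= b" "d - c < \<delta>" "i < vrank G" for c d i
   proof -
    have near: "\<tau> : {a..b}" "\<bar>\<tau> - t\<bar> < \<delta>" if "\<tau> : {c..d}" for \<tau> using that cd by auto
    have "reg \<tt> {c..d} (%t. if i < vrank E then vcoord E s (x t) (v t) i
      else vcoord F r (y t) (w t) (i - vrank E))"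
     using creg_coord[OF cx *(2) cd(1,4), of i] creg_coord[OF cy *(3) cd(1,4), of "i - vrank E"] *(5)[OF near] cd rank
     by (cases "i < vrank E") auto
    then show ?thesis
     by (rule iffD2[OF reg_cong, rotated]) (use *(6)[OF near mem[OF near(1)]] cd in auto)
   qed
   then show "EX \<delta>>0. EX U s. (U, s) : vframes G &
     (ALL r:{a..b}. \<bar>r - t\<bar> < \<delta> --> fst ((z r, v r, w r)) : U) &
     (ALL c d i. a <= c & c <= t & t <= d & d <= b & d - c < \<delta> & i < vrank G -->
      reg \<tt> {c..d} (%t. frame_coord (vrank G) (%k. s k (fst ((z t, v t, w t)))) (snd ((z t, v t, w t))) i))"
    using * by (intro exI[of _ \<delta>] conjI exI[of _ W] exI[of _ q]) auto
  qed (use z mem fib in \<open>auto simp: comp_def\<close>)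
 qed
qed

lemma creg_dsum:
 assumes M: "smooth_manifold M" and E: "vector_bundle M E" and F: "vector_bundle M F"
 shows "creg \<tt> M (dsum E F) a b (%t. (x t, v t, w t)) \<longleftrightarrow>
  creg \<tt> M E a b (%t. (x t, v t)) & creg \<tt> M F a b (%t. (x t, w t))"
proof (rule creg_times_iff[OF M M M vector_bundle_dsum[OF M E F] E F])
 fix U s V r assume "(U, s) : vframes E" "(V, r) : vframes F"
 then show "EX W q. (W, q) : vframes (dsum E F) & (ALL t. x t : W \<longleftrightarrow> x t : U & x t : V) &
   (ALL t i. q i (x t) = (if i < vrank E then (s i (x t), 0) else (0, r (i - vrank E) (x t))))"
  by (intro exI[of _ "U \<inter> V"] exI[of _ "dsum_frame (vrank E) s r"]) (auto simp: vframes_dsum dsum_frame_def)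
qed auto

lemma creg_ext_prod:
 assumes M: "smooth_manifold M" and N: "smooth_manifold N" and E: "vector_bundle M E" and F: "vector_bundle N F"
 shows "creg \<tt> (prod_manifold M N) (ext_prod E F) a b (%t. ((x t, y t), v t, w t)) \<longleftrightarrow>
  creg \<tt> M E a b (%t. (x t, v t)) & creg \<tt> N F a b (%t. (y t, w t))"
proof (rule creg_times_iff[OF smooth_manifold_prod[OF M N] M N vector_bundle_ext_prod[OF M N E F] E F])
 show "path_on (prod_manifold M N) a b (%t. (x t, y t)) \<longleftrightarrow>
   path_on M a b x & path_on N a b y"
  by (simp add: continuous_map_pairwise comp_def)
 fix U s V r assume "(U, s) : vframes E" "(V, r) : vframes F"
 then show "EX W q. (W, q) : vframes (ext_prod E F) & (ALL t. (x t, y t) : W \<longleftrightarrow> x t : U & y t : V) &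
   (ALL t i. q i (x t, y t) = (if i < vrank E then (s i (x t), 0) else (0, r (i - vrank E) (y t))))"
  by (intro exI[of _ "U \<times> V"] exI[of _ "dsum_frame (vrank E) (%i z. s i (fst z)) (%i z. r i (snd z))"])
   (auto simp: vframes_ext_prod dsum_frame_def)
qed auto

text \<open>Frames are asked for along the curve only. In this form the property passes to
  \<open>D1 \<times> D2\<close> over a pair of curves, without treating that product as a smooth
  subbundle over the product manifold.\<close>

definition framed_along ::
  "'m manifold => ('m, 'v::real_vector) vbundle => nat => ('m => 'v set) => real => real => (real => 'm) => bool" where
 "framed_along M E k D a b x \<longleftrightarrow> (ALL t:{a..b}. EX \<delta>>0. EX \<sigma>. ALL c d. a <= c & c <= t & t <= d & d <= b & d - c < \<delta> -->
   (ALL i<k. creg Classical M E c d (%r. (x r, \<sigma> i r))) & (ALL r:{c..d}. is_frame k (%i. \<sigma> i r) (D (x r))))"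

lemma framed_along_subbundle:
 assumes M: "smooth_manifold M" and E: "vector_bundle M E" and D: "smooth_subbundle M E k D"
  and x: "path_on M a b x"
 shows "framed_along M E k D a b x"
 unfolding framed_along_def
proof
 fix t assume t: "t : {a..b}"
 obtain U s where U: "openin (mtop M) U" "x t : U" and sec': "ALL i<k. smooth_section_on M E U (s i)"
  and fr': "ALL y:U. is_frame k (%i. s i y) (D y)"
  using bspec[OF conjunct2[OF D[unfolded smooth_subbundle_def]] continuous_shadow_mem[OF x t]]
  by (elim exE conjE) (rule that)
 note sec = sec'[rule_format] and fr = fr'[rule_format]
 obtain \<delta> where \<delta>: "\<delta> > 0" "!!\<tau>. \<tau> : {a..b} ==> \<bar>\<tau> - t\<bar> < \<delta> ==> x \<tau> : U"
  using shadow_interval[OF x U(1) t U(2)] by blast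
 have "creg Classical M E c d (%r. (x r, s i (x r)))"
  if cd: "a <= c" "c <= t" "t <= d" "d <= b" "d - c < \<delta>" and i: "i < k" for c d i
 proof -
  have sub: "{c..d} \<subseteq> {a..b}" using cd by auto
  have inU: "x r : U" if "r : {c..d}" for r using \<delta>(2)[of r] that cd by auto
  have xc: "path_on M c d x" using continuous_map_from_subtopology_mono[OF x sub] .
  have "continuous_on {p..q} (%t. vcoord E s' (x t) (s i (x t)) j)"
   if *: "(U', s') : vframes E" "c <= p" "q <= d" "ALL t:{p..q}. x t : U'" "j < vrank E" for U' s' p q j
  proof -
   have o: "openin (mtop M) (U' \<inter> U)" using vb_frame_open[OF E *(1)] U(1) by blast
   have sm: "smooth_fun_on M (U' \<inter> U) (%x. vcoord E s' x (s i x) j)"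
    using sec[OF i] * unfolding smooth_section_on_def by fast
   show ?thesis
    by (rule continuous_on_smooth_compose[OF M o sm xc]) (use * inU in auto)
  qed
  moreover have "s i (x r) : fibre E (x r)" if "r : {c..d}" for r
   using sec[OF i] inU[OF that] unfolding smooth_section_on_def by blast
  ultimately show ?thesis
   unfolding creg_def total_space_def using xc continuous_shadow_mem[OF xc] by (auto simp: comp_def)
 qed
 moreover have "is_frame k (%i. s i (x r)) (D (x r))" if "r : {c..d}" "a <= c & c <= t & t <= d & d <= b & d - c < \<delta>" for c d r
  using fr[OF \<delta>(2)[of r]] that by auto
 ultimately show "EX \<delta>>0. EX \<sigma>. ALL c d. a <= c & c <= t & t <= d & d <= b & d - c < \<delta> -->
   (ALL i<k. creg Classical M E c d (%r. (x r, \<sigma> i r))) & (ALL r:{c..d}. is_frame k (%i. \<sigma> i r) (D (x r)))"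
  using \<delta>(1) by (intro exI[of _ \<delta>] conjI exI[of _ "%i r. s i (x r)"]) auto
qed

lemma framed_along_times:
 assumes M: "smooth_manifold M" and N: "smooth_manifold N" and E: "vector_bundle M E" and F: "vector_bundle N F"
  and x: "path_on M a b x" and y: "path_on N a b y"
  and C: "framed_along M E k C a b x" and D: "framed_along N F l D a b y"
 shows "framed_along (prod_manifold M N) (ext_prod E F) (k + l) (%z. C (fst z) \<times> D (snd z)) a b (%t. (x t, y t))"
 unfolding framed_along_def
proof
 fix t assume t: "t : {a..b}"
 obtain \<delta>1 \<sigma> where 1: "\<delta>1 > 0" "!!c d. a <= c & c <= t & t <= d & d <= b & d - c < \<delta>1 ==>
   (ALL i<k. creg Classical M E c d (%r. (x r, \<sigma> i r))) & (ALL r:{c..d}. is_frame k (%i. \<sigma> i r) (C (x r)))"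
  using C t unfolding framed_along_def by blast
 obtain \<delta>2 \<rho> where 2: "\<delta>2 > 0" "!!c d. a <= c & c <= t & t <= d & d <= b & d - c < \<delta>2 ==>
   (ALL i<l. creg Classical N F c d (%r. (y r, \<rho> i r))) & (ALL r:{c..d}. is_frame l (%i. \<rho> i r) (D (y r)))"
  using D t unfolding framed_along_def by blast
 define \<tau> where "\<tau> i r = (if i < k then (\<sigma> i r, 0) else (0, \<rho> (i - k) r))" for i r
 have "(ALL i<k + l. creg Classical (prod_manifold M N) (ext_prod E F) c d (%r. ((x r, y r), \<tau> i r))) &
   (ALL r:{c..d}. is_frame (k + l) (%i. \<tau> i r) (C (fst (x r, y r)) \<times> D (snd (x r, y r))))"
  if cd: "a <= c & c <= t & t <= d & d <= b & d - c < min \<delta>1 \<delta>2" for c d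
 proof (intro conjI allI impI ballI)
  have sub: "{c..d} \<subseteq> {a..b}" using cd by auto
  have xc: "path_on M c d x" "path_on N c d y"
   using continuous_map_from_subtopology_mono[OF x sub] continuous_map_from_subtopology_mono[OF y sub] .
  fix i assume i: "i < k + l"
  show "creg Classical (prod_manifold M N) (ext_prod E F) c d (%r. ((x r, y r), \<tau> i r))"
  proof (cases "i < k")
   case True
   then show ?thesis
    using 1(2)[of c d] cd creg_zero[OF F xc(2)] by (simp add: \<tau>_def creg_ext_prod[OF M N E F])
  next
   case False
   then show ?thesis
    using 2(2)[of c d] cd i creg_zero[OF E xc(1)] by (simp add: \<tau>_def creg_ext_prod[OF M N E F])
  qed
 next
  fix r assume "r : {c..d}"
  then show "is_frame (k + l) (%i. \<tau> i r) (C (fst (x r, y r)) \<times> D (snd (x r, y r)))"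
   using is_frame_times[of k "%i. \<sigma> i r" "C (x r)" l "%i. \<rho> i r" "D (y r)"] 1(2)[of c d] 2(2)[of c d] cd
   by (simp add: \<tau>_def)
 qed
 then show "EX \<delta>>0. EX \<sigma>. ALL c d. a <= c & c <= t & t <= d & d <= b & d - c < \<delta> -->
   (ALL i<k + l. creg Classical (prod_manifold M N) (ext_prod E F) c d (%r. ((x r, y r), \<sigma> i r))) &
   (ALL r:{c..d}. is_frame (k + l) (%i. \<sigma> i r) (C (fst (x r, y r)) \<times> D (snd (x r, y r))))"
  using 1(1) 2(1) by (intro exI[of _ "min \<delta>1 \<delta>2"] conjI exI[of _ \<tau>]) auto
qed

lemma subspace_kernel_on: "subspace (kernel_on m J A)"
 unfolding subspace_def kernel_on_def
 by (auto simp: scaleR_fun_def distrib_left sum.distrib mult.left_commute simp flip: sum_distrib_left)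

text \<open>Solving \<open>\<beta> + j c \<in> S\<close>, \<open>c \<in> T\<close> along a curve when the homogeneous problem has constant rank.
  The curve \<open>c\<close> stays in \<open>T\<close> also where the problem has no solution.\<close>

lemma solve_along_local:
 assumes B: "vector_bundle Z B" and C: "vector_bundle Z C"
  and S: "framed_along Z B k S a b z" and T: "framed_along Z C l T a b z"
  and z: "path_on Z a b z"
  and lin: "linear j"
  and j: "!!c d \<gamma>. a <= c ==> d <= b ==> creg Classical Z C c d (%t. (z t, \<gamma> t)) ==> creg Classical Z B c d (%t. (z t, j (\<gamma> t)))"
  and rank: "!!t. t : {a..b} ==> has_basis r {c : T (z t). j c : S (z t)}"
  and \<beta>: "creg \<tt> Z B a b (%t. (z t, \<beta> t))" and t: "t : {a..b}"
 shows "EX \<delta>>0. ALL c d. a <= c & c <= t & t <= d & d <= b & d - c < \<delta> -->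
  (EX \<gamma>. creg \<tt> Z C c d (%t. (z t, \<gamma> t)) & (ALL \<tau>:{c..d}. \<gamma> \<tau> : T (z \<tau>) &
   ((EX c':T (z \<tau>). \<beta> \<tau> + j c' : S (z \<tau>)) --> \<beta> \<tau> + j (\<gamma> \<tau>) : S (z \<tau>))))"
proof -
 obtain \<delta>1 \<sigma> where 1: "\<delta>1 > 0" "!!c d. a <= c & c <= t & t <= d & d <= b & d - c < \<delta>1 ==>
   (ALL i<k. creg Classical Z B c d (%r. (z r, \<sigma> i r))) & (ALL r:{c..d}. is_frame k (%i. \<sigma> i r) (S (z r)))"
  using S t unfolding framed_along_def by blast
 obtain \<delta>2 \<rho> where 2: "\<delta>2 > 0" "!!c d. a <= c & c <= t & t <= d & d <= b & d - c < \<delta>2 ==>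
   (ALL i<l. creg Classical Z C c d (%r. (z r, \<rho> i r))) & (ALL r:{c..d}. is_frame l (%i. \<rho> i r) (T (z r)))"
  using T t unfolding framed_along_def by blast
 obtain U s \<delta>3 where Us: "(U, s) : vframes B" and 3: "\<delta>3 > 0" "!!r. r : {a..b} ==> \<bar>r - t\<bar> < \<delta>3 ==> z r : U"
  using creg_local_frame[OF B \<beta> t] by (metis fst_conv)
 \<comment> \<open>A third, because the interval extends by \<open>\<delta>0\<close> to both sides
   of \<open>t\<close> and its length must stay below each of the three radii.\<close>
 define \<delta>0 where "\<delta>0 = min \<delta>1 (min \<delta>2 \<delta>3) / 3"
 define p q where "p = max a (t - \<delta>0)" and "q = min b (t + \<delta>0)"
 have d0: "\<delta>0 > 0" using 1(1) 2(1) 3(1) by (simp add: \<delta>0_def)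
 have pq: "a <= p" "p <= t" "t <= q" "q <= b" "q - p < \<delta>1" "q - p < \<delta>2" "q - p < \<delta>3"
  using t d0 by (auto simp: p_def q_def \<delta>0_def)
 have sub: "{p..q} \<subseteq> {a..b}" using pq by auto
 have zU: "z r : U" if "r : {p..q}" for r using 3(2)[of r] that pq by auto
 have \<sigma>: "i < k ==> creg Classical Z B p q (%r. (z r, \<sigma> i r))" "r : {p..q} ==> is_frame k (%i. \<sigma> i r) (S (z r))" for i r
  using 1(2)[of p q] pq by auto
 have \<rho>: "i < l ==> creg Classical Z C p q (%r. (z r, \<rho> i r))" "r : {p..q} ==> is_frame l (%i. \<rho> i r) (T (z r))" for i r
  using 2(2)[of p q] pq by auto
 have j\<rho>: "creg Classical Z B p q (%r. (z r, j (\<rho> i r)))" if "i < l" for i using j[OF pq(1,4) \<rho>(1)[OF that]] .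
 let ?m = "vrank B"
 define cB where "cB r v i = frame_coord ?m (%k. s k (z r)) v i" for r v i
 have frB: "is_frame ?m (%k. s k (z r)) (fibre B (z r))" if "r : {p..q}" for r using vb_is_frame[OF B Us zU[OF that]] .
 have mem: "i < k ==> \<sigma> i r : fibre B (z r)" "i < l ==> j (\<rho> i r) : fibre B (z r)" "\<beta> r : fibre B (z r)" if "r : {p..q}" for i r
  using creg_mem(2)[OF \<sigma>(1) that] creg_mem(2)[OF j\<rho> that] creg_mem(2)[OF \<beta>, of r] that sub by auto
 \<comment> \<open>The columns for \<open>T\<close> carry a minus sign since
   \<open>\<beta> + j c = s\<close> is read as \<open>s - j c = \<beta>\<close>.\<close>
 define A where "A r i n = (if n < k then cB r (\<sigma> n r) i else - cB r (j (\<rho> (n - k) r)) i)" for r i n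
 have jsum: "j (SUM n<l. y n *\<^sub>R \<rho> n r) = (SUM n<l. y n *\<^sub>R j (\<rho> n r))" for y r
  by (simp add: linear_sum[OF lin] linear_scale[OF lin])
 text \<open>The unknown vector lists the frame coefficients in \<open>S\<close>, then those in \<open>T\<close>.\<close>
 have key: "(ALL i<?m. (SUM n<k + l. A r i n * y n) = cB r w i) \<longleftrightarrow> w + j (SUM n<l. y (k + n) *\<^sub>R \<rho> n r) = (SUM n<k. y n *\<^sub>R \<sigma> n r)"
  if r: "r : {p..q}" and w: "w : fibre B (z r)" for r y w
 proof -
  let ?u = "SUM n<k. y n *\<^sub>R \<sigma> n r" and ?v = "SUM n<l. y (k + n) *\<^sub>R j (\<rho> n r)"
  have sb: "subspace (fibre B (z r))" using is_frame_subspace[OF frB[OF r]] .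
  have uv: "?u : fibre B (z r)" "?v : fibre B (z r)"
   using mem[OF r] sb by (auto intro!: subspace_sum subspace_scale)
  have "(SUM n<k + l. A r i n * y n) = cB r ?u i - cB r ?v i" if i: "i < ?m" for i
   using frame_coord_linear_sum[OF frB[OF r] _ i, of "{..<k}" "%n. \<sigma> n r" y]
    frame_coord_linear_sum[OF frB[OF r] _ i, of "{..<l}" "%n. j (\<rho> n r)" "%n. y (k + n)"] mem[OF r]
   by (simp add: sum_lessThan_add A_def cB_def sum_negf mult.commute)
  moreover have "(ALL i<?m. cB r ?u i - cB r ?v i = cB r w i) \<longleftrightarrow> w + ?v = ?u"
  proof -
   have "(ALL i<?m. cB r ?u i - cB r ?v i = cB r w i) \<longleftrightarrow> (ALL i<?m. cB r (w + ?v) i = cB r ?u i)"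
    using frame_coord_add[OF frB[OF r] w uv(2)] by (auto simp: cB_def)
   also have "\<dots> \<longleftrightarrow> w + ?v = ?u"
   proof
    assume *: "ALL i<?m. cB r (w + ?v) i = cB r ?u i"
    have "w + ?v = (SUM i<?m. cB r (w + ?v) i *\<^sub>R s i (z r))"
     using sum_frame_coord[OF frB[OF r] subspace_add[OF sb w uv(2)]] by (simp add: cB_def)
    also have "\<dots> = (SUM i<?m. cB r ?u i *\<^sub>R s i (z r))" using * by simp
    also have "\<dots> = ?u" using sum_frame_coord[OF frB[OF r] uv(1)] by (simp add: cB_def)
    finally show "w + ?v = ?u" .
   qed simp
   finally show ?thesis .
  qed
  ultimately show ?thesis by (simp add: jsum)
 qed
 have contA: "continuous_on {p..q} (%r. A r i n)" if "i < ?m" "n : {..<k + l}" for i n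
 proof (cases "n < k")
  case True
  then show ?thesis using creg_coord[OF \<sigma>(1) Us, of n p q i] zU that by (simp add: A_def cB_def)
 next
  case False
  then have "n - k < l" using that by auto
  from creg_coord[OF j\<rho>[OF this] Us, of p q i] False zU that show ?thesis
   by (simp add: A_def cB_def continuous_on_minus)
 qed
 \<comment> \<open>Sending a coefficient vector to its part in \<open>T\<close> is a linear
   bijection from the kernel of \<open>A\<close> onto the homogeneous solutions: the coefficients in
   \<open>S\<close> are determined by those in \<open>T\<close>.\<close>
 have ker: "has_basis r (kernel_on ?m {..<k + l} (A \<tau>))" if \<tau>: "\<tau> : {p..q}" for \<tau>
 proof -
  define e where "e c n = (if n < k then frame_coord k (%i. \<sigma> i \<tau>) (j c) n
    else if n < k + l then frame_coord l (%i. \<rho> i \<tau>) c (n - k) else 0)" for c n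
  define F where "F y = (SUM n<l. y (k + n) *\<^sub>R \<rho> n \<tau>)" for y :: "nat => real"
  have linF: "linear F"
   by (rule linearI) (auto simp: F_def scaleR_fun_def scaleR_left_distrib sum.distrib scaleR_sum_right)
  let ?K = "kernel_on ?m {..<k + l} (A \<tau>)"
  have zero: "(0::'b) : fibre B (z \<tau>)" using is_frame_subspace[OF frB[OF \<tau>]] by (simp add: subspace_0)
  have K: "y : ?K \<longleftrightarrow> (ALL n>=k + l. y n = 0) & j (F y) = (SUM n<k. y n *\<^sub>R \<sigma> n \<tau>)" for y
   using key[OF \<tau> zero, of y] frame_coord_zero[OF frB[OF \<tau>]]
   by (auto simp: kernel_on_def cB_def F_def not_less)
  have KF: "F ` ?K = {c : T (z \<tau>). j c : S (z \<tau>)}"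
  proof (intro equalityI subsetI)
   fix c assume "c : F ` ?K"
   then obtain y where y: "y : ?K" "c = F y" by blast
   then show "c : {c : T (z \<tau>). j c : S (z \<tau>)}"
    using K is_frame_sum_mem[OF \<sigma>(2)[OF \<tau>], of y] is_frame_sum_mem[OF \<rho>(2)[OF \<tau>], of "%n. y (k + n)"]
    by (auto simp: F_def)
  next
   fix c assume c: "c : {c : T (z \<tau>). j c : S (z \<tau>)}"
   have "F (e c) = c" using sum_frame_coord[OF \<rho>(2)[OF \<tau>], of c] c by (simp add: F_def e_def)
   moreover have "(SUM n<k. e c n *\<^sub>R \<sigma> n \<tau>) = j c" using sum_frame_coord[OF \<sigma>(2)[OF \<tau>], of "j c"] c by (simp add: e_def)
   ultimately have "e c : ?K" "F (e c) = c" unfolding K by (auto simp: e_def)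
   then show "c : F ` ?K" by force
  qed
  have injF: "inj_on F ?K"
  proof (rule inj_onI)
   fix y y' assume y: "y : ?K" "y' : ?K" "F y = F y'"
   have tail: "y (k + n) = y' (k + n)" if "n < l" for n
    using frame_coord_sum[OF \<rho>(2)[OF \<tau>] that, of "%n. y (k + n)"] frame_coord_sum[OF \<rho>(2)[OF \<tau>] that, of "%n. y' (k + n)"] y(3)
    by (simp add: F_def)
   have "(SUM n<k. y n *\<^sub>R \<sigma> n \<tau>) = (SUM n<k. y' n *\<^sub>R \<sigma> n \<tau>)" using y K by metis
   then have head: "y n = y' n" if "n < k" for n
    using frame_coord_sum[OF \<sigma>(2)[OF \<tau>] that, of y] frame_coord_sum[OF \<sigma>(2)[OF \<tau>] that, of y'] by simp
   show "y = y'"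
   proof
    fix n
    consider "n < k" | "n >= k" "n - k < l" | "n >= k + l" by linarith
    then show "y n = y' n"
    proof cases
     case 1 then show ?thesis by (rule head)
    next
     case 2 then show ?thesis using tail[of "n - k"] by simp
    next
     case 3
     have "y n = 0" "y' n = 0" using K y(1,2) 3 by blast+
     then show ?thesis by simp
    qed
   qed
  qed
  have sub_K: "subspace ?K" by (rule subspace_kernel_on)
  obtain W where W: "finite W" "span W = {y::nat => real. ALL n. n ~: {..<k + l} --> y n = 0}"
   using has_basis_coordinate_space[of "{..<k + l}"] unfolding has_basis_def by auto
  have "?K \<subseteq> span W" unfolding W(2) by (auto simp: kernel_on_def)
  from has_basis_dim[OF sub_K this W(1)] have bK: "has_basis (dim ?K) ?K" .
  have "has_basis r (F ` ?K)" using rank[of \<tau>] \<tau> sub unfolding KF by auto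
  with has_basis_linear_image[OF linF injF bK] have "dim ?K = r" by (rule has_basis_unique)
  then show ?thesis using bK by simp
 qed
 have "t : {p..q}" using pq by simp
 have "EX \<delta>>0. EX G. (ALL n i. continuous_on ({p..q} \<inter> cball t \<delta>) (%r. G r n i)) &
   (ALL r:{p..q} \<inter> cball t \<delta>. ALL v. (EX y. ALL i<?m. (SUM n<k + l. A r i n * y n) = v i) -->
    (ALL i<?m. (SUM n<k + l. A r i n * (SUM h<?m. G r n h * v h)) = v i))"
  by (rule continuous_generalized_inverse[OF finite_lessThan \<open>t : {p..q}\<close> contA ker])
 then obtain \<delta>4 G where \<delta>4: "\<delta>4 > 0" and G': "ALL n i. continuous_on ({p..q} \<inter> cball t \<delta>4) (%r. G r n i)"
   "ALL r:{p..q} \<inter> cball t \<delta>4. ALL v. (EX y. ALL i<?m. (SUM n<k + l. A r i n * y n) = v i) -->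
    (ALL i<?m. (SUM n<k + l. A r i n * (SUM h<?m. G r n h * v h)) = v i)" by (elim exE conjE) (rule that)
 note contG = G'(1)[rule_format]
 have G: "ALL i<?m. (SUM n<k + l. A r i n * (SUM h<?m. G r n h * v h)) = v i"
  if "r : {p..q} \<inter> cball t \<delta>4" "EX y. ALL i<?m. (SUM n<k + l. A r i n * y n) = v i" for r v
  using bspec[OF G'(2) that(1)] that(2) by blast
 have "EX \<gamma>. creg \<tt> Z C c d (%t. (z t, \<gamma> t)) & (ALL \<tau>:{c..d}. \<gamma> \<tau> : T (z \<tau>) &
   ((EX c':T (z \<tau>). \<beta> \<tau> + j c' : S (z \<tau>)) --> \<beta> \<tau> + j (\<gamma> \<tau>) : S (z \<tau>)))"
  if cd: "a <= c" "c <= t" "t <= d" "d <= b" "d - c < min \<delta>0 \<delta>4" for c d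
 proof -
  have sub': "p <= c" "d <= q" "{c..d} \<subseteq> {p..q} \<inter> cball t \<delta>4"
   using cd by (auto simp: p_def q_def dist_real_def)
  \<comment> \<open>Linear in the coordinates of \<open>\<beta>\<close> with continuous
    coefficients, hence as regular as \<open>\<beta>\<close>. The formula makes sense whether or not
    the system is solvable, and its second part always describes an element of
    \<open>T\<close>.\<close>
  define y where "y r n = (SUM h<?m. G r n h * cB r (\<beta> r) h)" for r n
  define \<gamma> where "\<gamma> r = (SUM n<l. y r (k + n) *\<^sub>R \<rho> n r)" for r
  have y_reg: "reg \<tt> {c..d} (%r. y r n)" for n
   unfolding y_def
  proof (intro reg_sum reg_mult_continuous continuous_on_subset[OF contG sub'(3)])
   fix h assume "h : {..<?m}"
   then show "reg \<tt> {c..d} (%r. cB r (\<beta> r) h)"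
    using creg_coord[OF \<beta> Us cd(1,4), of h] zU sub'(3) by (auto simp: cB_def)
  qed
  have zc: "path_on Z c d z"
   by (rule continuous_map_from_subtopology_mono[OF z]) (use cd in auto)
  have "creg \<tt> Z C c d (%r. (z r, \<gamma> r))"
   unfolding \<gamma>_def
   by (intro creg_sum[OF C zc] creg_scale_reg[OF C _ y_reg] creg_subinterval[OF \<rho>(1)]) (use sub' in auto)
  moreover have "\<gamma> \<tau> : T (z \<tau>)" if "\<tau> : {c..d}" for \<tau>
   using is_frame_sum_mem[OF \<rho>(2)] that sub' by (auto simp: \<gamma>_def)
  moreover have "\<beta> \<tau> + j (\<gamma> \<tau>) : S (z \<tau>)" if \<tau>: "\<tau> : {c..d}" and c': "c' : T (z \<tau>)" "\<beta> \<tau> + j c' : S (z \<tau>)" for \<tau> c'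
  proof -
   have \<tau>': "\<tau> : {p..q}" "\<tau> : {p..q} \<inter> cball t \<delta>4" using \<tau> sub'(3) by auto
   define y0 where "y0 n = (if n < k then frame_coord k (%i. \<sigma> i \<tau>) (\<beta> \<tau> + j c') n
    else frame_coord l (%i. \<rho> i \<tau>) c' (n - k))" for n
   have "(SUM n<l. y0 (k + n) *\<^sub>R \<rho> n \<tau>) = c'" "(SUM n<k. y0 n *\<^sub>R \<sigma> n \<tau>) = \<beta> \<tau> + j c'"
    using sum_frame_coord[OF \<rho>(2)[OF \<tau>'(1)] c'(1)] sum_frame_coord[OF \<sigma>(2)[OF \<tau>'(1)] c'(2)] by (auto simp: y0_def)
   then have "ALL i<?m. (SUM n<k + l. A \<tau> i n * y0 n) = cB \<tau> (\<beta> \<tau>) i"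
    using key[OF \<tau>'(1) mem(3)[OF \<tau>'(1)], of y0] by simp
   then have "ALL i<?m. (SUM n<k + l. A \<tau> i n * y \<tau> n) = cB \<tau> (\<beta> \<tau>) i"
    using G[OF \<tau>'(2)] unfolding y_def by blast
   then have "\<beta> \<tau> + j (\<gamma> \<tau>) = (SUM n<k. y \<tau> n *\<^sub>R \<sigma> n \<tau>)"
    using key[OF \<tau>'(1) mem(3)[OF \<tau>'(1)], of "y \<tau>"] by (simp add: \<gamma>_def)
   then show ?thesis using is_frame_sum_mem[OF \<sigma>(2)[OF \<tau>'(1)], of "y \<tau>"] by simp
  qed
  ultimately show ?thesis by (intro exI[of _ \<gamma>]) blast
 qed
 then show ?thesis using d0 \<delta>4 by (intro exI[of _ "min \<delta>0 \<delta>4"]) auto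
qed

section \<open>Tangent vectors and covectors of a product\<close>

text \<open>Local solutions are patched by affine interpolation in time. This works because the
  admissible values at a given time form a convex set, even an affine subspace where the problem is
  solvable.\<close>

lemma solve_along:
 assumes Z: "smooth_manifold Z" and B: "vector_bundle Z B" and C: "vector_bundle Z C"
  and S: "framed_along Z B k S a b z" and T: "framed_along Z C l T a b z"
  and subS: "!!t. t : {a..b} ==> subspace (S (z t))" and subT: "!!t. t : {a..b} ==> subspace (T (z t))"
  and z: "path_on Z a b z"
  and lin: "linear j"
  and j: "!!c d \<gamma>. a <= c ==> d <= b ==> creg Classical Z C c d (%t. (z t, \<gamma> t)) ==> creg Classical Z B c d (%t. (z t, j (\<gamma> t)))"
  and rank: "!!t. t : {a..b} ==> has_basis r {c : T (z t). j c : S (z t)}"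
  and \<beta>: "creg \<tt> Z B a b (%t. (z t, \<beta> t))" and ab: "a <= b"
 shows "EX \<gamma>. creg \<tt> Z C a b (%t. (z t, \<gamma> t)) & (ALL \<tau>:{a..b}. \<gamma> \<tau> : T (z \<tau>) &
   ((EX c':T (z \<tau>). \<beta> \<tau> + j c' : S (z \<tau>)) --> \<beta> \<tau> + j (\<gamma> \<tau>) : S (z \<tau>)))"
proof -
 \<comment> \<open>The premise on solvability does not involve \<open>g\<close>, so the condition as
   a whole remains convex in \<open>g\<close>.\<close>
 define Good where "Good \<tau> g \<longleftrightarrow> g : T (z \<tau>) &
   ((EX c':T (z \<tau>). \<beta> \<tau> + j c' : S (z \<tau>)) --> \<beta> \<tau> + j g : S (z \<tau>))" for \<tau> g
 define Sol where "Sol c d \<gamma> \<longleftrightarrow> creg \<tt> Z C c d (%t. (z t, \<gamma> t)) & (ALL \<tau>:{c..d}. Good \<tau> (\<gamma> \<tau>))" for c d \<gamma>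
 have convex: "Good \<tau> ((1 - s) *\<^sub>R u + s *\<^sub>R v)" if \<tau>: "\<tau> : {a..b}" and "Good \<tau> u" "Good \<tau> v" for \<tau> s u v
 proof -
  have "(1 - s) *\<^sub>R u + s *\<^sub>R v : T (z \<tau>)"
   using that subT[OF \<tau>] by (auto simp: Good_def intro!: subspace_add subspace_scale)
  moreover have "\<beta> \<tau> + j ((1 - s) *\<^sub>R u + s *\<^sub>R v) : S (z \<tau>)"
   if "EX c':T (z \<tau>). \<beta> \<tau> + j c' : S (z \<tau>)"
  proof -
   have "\<beta> \<tau> + j u : S (z \<tau>)" "\<beta> \<tau> + j v : S (z \<tau>)"
    using \<open>Good \<tau> u\<close> \<open>Good \<tau> v\<close> that by (auto simp: Good_def)
   then have "(1 - s) *\<^sub>R (\<beta> \<tau> + j u) + s *\<^sub>R (\<beta> \<tau> + j v) : S (z \<tau>)"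
    using subS[OF \<tau>] by (auto intro!: subspace_add subspace_scale)
   also have "(1 - s) *\<^sub>R (\<beta> \<tau> + j u) + s *\<^sub>R (\<beta> \<tau> + j v) = \<beta> \<tau> + j ((1 - s) *\<^sub>R u + s *\<^sub>R v)"
    unfolding linear_add[OF lin] linear_scale[OF lin] by (simp add: algebra_simps)
   finally show ?thesis .
  qed
  ultimately show ?thesis by (auto simp: Good_def)
 qed
 have blend: "EX \<gamma>. Sol c e \<gamma>"
  if ord: "a <= c" "c <= p" "p < q" "q <= e" "e <= b" and u: "Sol c q u" and v: "Sol p e v" for c p q e u v
 proof -
  define s where "s \<tau> = (\<tau> - p) / (q - p)" for \<tau>
  define \<gamma> where "\<gamma> \<tau> = (if \<tau> <= p then u \<tau> else if q <= \<tau> then v \<tau> else (1 - s \<tau>) *\<^sub>R u \<tau> + s \<tau> *\<^sub>R v \<tau>)" for \<tau>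
  have zc: "path_on Z c' d' (fst \<circ> (%t. (z t, \<gamma> t)))" if "a <= c'" "d' <= b" for c' d'
   using continuous_map_from_subtopology_mono[OF z, of "{c'..d'}"] that by (simp add: comp_def)
  have cu: "creg \<tt> Z C c q (%t. (z t, u t))" and cv: "creg \<tt> Z C p e (%t. (z t, v t))"
   using u v by (auto simp: Sol_def)
  have 1: "creg \<tt> Z C c p (%t. (z t, \<gamma> t))"
   by (rule creg_cong[OF _ creg_subinterval[OF cu]]) (use ord in \<open>auto simp: \<gamma>_def\<close>)
  have 3: "creg \<tt> Z C q e (%t. (z t, \<gamma> t))"
   by (rule creg_cong[OF _ creg_subinterval[OF cv]]) (use ord in \<open>auto simp: \<gamma>_def\<close>)
  have "creg \<tt> Z C p q (%t. (z t, (1 - s t) *\<^sub>R u t + s t *\<^sub>R v t))"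
   using ord unfolding s_def
   by (intro creg_add[OF C] creg_scale_continuous[OF C] creg_subinterval[OF cu] creg_subinterval[OF cv] continuous_intros) auto
  then have 2: "creg \<tt> Z C p q (%t. (z t, \<gamma> t))"
   by (rule creg_cong[rotated]) (use ord in \<open>auto simp: \<gamma>_def s_def\<close>)
  have "creg \<tt> Z C c q (%t. (z t, \<gamma> t))"
   by (rule creg_glue[OF zc _ _ 1 2]) (use ord in auto)
  then have "creg \<tt> Z C c e (%t. (z t, \<gamma> t))"
   by (rule creg_glue[OF zc, rotated 4]) (use ord 3 in auto)
  moreover have "Good \<tau> (\<gamma> \<tau>)" if \<tau>: "\<tau> : {c..e}" for \<tau>
  proof -
   have "\<tau> <= q ==> Good \<tau> (u \<tau>)" "p <= \<tau> ==> Good \<tau> (v \<tau>)" "\<tau> : {a..b}"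
    using u v \<tau> ord by (auto simp: Sol_def)
   then show ?thesis using ord convex by (auto simp: \<gamma>_def)
  qed
  ultimately show ?thesis unfolding Sol_def by blast
 qed
 have loc: "EX \<delta>>0. ALL c d. a <= c & c <= t & t <= d & d <= b & d - c < \<delta> --> (EX \<gamma>. Sol c d \<gamma>)" if "a <= t" "t <= b" for t
 proof -
  have t: "t : {a..b}" using that by simp
  show ?thesis unfolding Sol_def Good_def by (rule solve_along_local[OF B C S T z lin j rank \<beta> t])
 qed
 have "EX \<gamma>. Sol a b \<gamma>"
  using ab
 proof (rule interval_induct)
  fix c d e assume ord: "a <= c" "c <= d" "d <= e" "e <= b" and s1: "EX \<gamma>. Sol c d \<gamma>" and s2: "EX \<gamma>. Sol d e \<gamma>"
  show "EX \<gamma>. Sol c e \<gamma>"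
  proof (cases "c = d \<or> d = e")
   case True then show ?thesis using s1 s2 by auto
  next
   case False
   obtain \<delta> where \<delta>: "\<delta> > 0" "!!p q. a <= p ==> p <= d ==> d <= q ==> q <= b ==> q - p < \<delta> ==> EX \<gamma>. Sol p q \<gamma>"
    using loc[of d] ord by auto
   \<comment> \<open>The two given solutions share only the time \<open>d\<close>. A third one on a
     small interval around \<open>d\<close> overlaps both, so that blending twice joins
     them.\<close>
   define p q where "p = max c (d - \<delta> / 4)" and "q = min e (d + \<delta> / 4)"
   have pq: "c <= p" "p < d" "d < q" "q <= e" "q - p < \<delta>" using False ord \<delta>(1) by (auto simp: p_def q_def)
   obtain u where u: "Sol c d u" using s1 by blast
   obtain v where v: "Sol p q v" using \<delta>(2)[of p q] pq ord by auto
   obtain w where w: "Sol d e w" using s2 by blast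
   obtain g where "Sol c q g" using blend[OF ord(1) pq(1,2) _ _ u v] pq ord by auto
   then show ?thesis using blend[OF ord(1) _ pq(3,4) ord(4) _ w] ord by auto
  qed
 qed (rule loc)
 then show ?thesis unfolding Sol_def Good_def .
qed

section \<open>Tangent and cotangent spaces in product charts\<close>

lemma charts_at_prod:
 "C : charts_at (prod_manifold M N) z \<longleftrightarrow>
  (EX c:charts_at M (fst z). EX c':charts_at N (snd z). C = prod_chart (mdim M) c c')"
proof
 assume "C : charts_at (prod_manifold M N) z"
 then obtain c c' where "c : atlas M" "c' : atlas N" "C = prod_chart (mdim M) c c'" "z : fst C"
  unfolding charts_at_def prod_manifold_atlas by auto
 then show "EX c:charts_at M (fst z). EX c':charts_at N (snd z). C = prod_chart (mdim M) c c'"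
  by (intro bexI[of _ c] bexI[of _ c']) (simp_all add: charts_at_def mem_Times_iff)
next
 assume "EX c:charts_at M (fst z). EX c':charts_at N (snd z). C = prod_chart (mdim M) c c'"
 then obtain c c' where "c : charts_at M (fst z)" "c' : charts_at N (snd z)" "C = prod_chart (mdim M) c c'" by blast
 then show "C : charts_at (prod_manifold M N) z"
  by (simp add: charts_at_def prod_manifold_atlas mem_Times_iff image_iff) blast
qed

lemma charts_at_exists: "smooth_manifold M ==> x : points M ==> EX c. c : charts_at M x"
 using chart_exists by (force simp: charts_at_def)

lemma charts_at_points: "smooth_manifold M ==> c : charts_at M x ==> x : points M"
 by (auto simp: charts_at_def intro: chart_subset)

text \<open>Moving one coordinate of a product chart moves one factor and leaves the point of the
  other fixed.\<close>

lemma partial_deriv_prod_chart: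
 assumes M: "smooth_manifold M" and N: "smooth_manifold N" and c: "c : charts_at M x" and c': "c' : charts_at N y"
 shows "j < mdim M ==> partial_deriv j (%p. F (chart_inv (prod_chart (mdim M) c c') p)) (snd (prod_chart (mdim M) c c') (x, y)) =
   partial_deriv j (%p. F (chart_inv c p, y)) (snd c x)"
  and "j < mdim N ==> partial_deriv (mdim M + j) (%p. F (chart_inv (prod_chart (mdim M) c c') p)) (snd (prod_chart (mdim M) c c') (x, y)) =
   partial_deriv j (%p. F (x, chart_inv c' p)) (snd c' y)"
proof -
 let ?C = "prod_chart (mdim M) c c'" and ?P = "prod_manifold M N" and ?m = "mdim M"
 have cs: "c : atlas M" "x : fst c" "c' : atlas N" "y : fst c'" using c c' by (auto simp: charts_at_def)
 have CA: "?C : atlas ?P" using cs by (auto simp: prod_manifold_atlas)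
 have op: "openin (Euclidean_space (mdim ?P)) (snd ?C ` fst ?C)" by (rule chart_image_openin[OF smooth_manifold_prod[OF M N] CA])
 have P: "snd ?C (x, y) : snd ?C ` fst ?C" using cs by auto
 have left: "Rn_left ?m (snd ?C (x, y)) = snd c x" and right: "Rn_right ?m (snd ?C (x, y)) = snd c' y"
  by (simp_all add: prod_chart_left[OF M cs(1,2)] prod_chart_right)
 have inv: "chart_inv ?C p = (chart_inv c (Rn_left ?m p), chart_inv c' (Rn_right ?m p))" if "p : snd ?C ` fst ?C" for p
  using prod_chart_inv[OF M cs(1) N cs(3), of p] that by simp
 show "partial_deriv j (%p. F (chart_inv ?C p)) (snd ?C (x, y)) = partial_deriv j (%p. F (chart_inv c p, y)) (snd c x)"
  if j: "j < mdim M"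
 proof -
  have pj: "snd ?C (x, y) j = snd c x j" using j by (simp add: snd_prod_chart)
  have "\<forall>\<^sub>F h in nhds (snd c x j). F (chart_inv ?C ((snd ?C (x, y))(j := h))) = F (chart_inv c ((snd c x)(j := h)), y)"
  proof (rule eventually_mono)
   show "\<forall>\<^sub>F h in nhds (snd c x j). (snd ?C (x, y))(j := h) : snd ?C ` fst ?C"
    using openin_Rn_upd[OF op P, of j] j unfolding pj prod_manifold_simps by simp
   fix h assume h: "(snd ?C (x, y))(j := h) : snd ?C ` fst ?C"
   have "Rn_left ?m ((snd ?C (x, y))(j := h)) = (snd c x)(j := h)"
    using j by (auto simp: fun_eq_iff Rn_left_def simp flip: left)
   moreover have "Rn_right ?m ((snd ?C (x, y))(j := h)) = snd c' y"
    using j by (auto simp: fun_eq_iff Rn_right_def simp flip: right)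
   ultimately show "F (chart_inv ?C ((snd ?C (x, y))(j := h))) = F (chart_inv c ((snd c x)(j := h)), y)"
    using inv[OF h] chart_inv_chart[OF N cs(3,4)] by simp
  qed
  then show ?thesis unfolding partial_deriv_def pj by (intro deriv_cong_ev) auto
 qed
 show "partial_deriv (?m + j) (%p. F (chart_inv ?C p)) (snd ?C (x, y)) = partial_deriv j (%p. F (x, chart_inv c' p)) (snd c' y)"
  if j: "j < mdim N"
 proof -
  have pj: "snd ?C (x, y) (?m + j) = snd c' y j" by (simp add: snd_prod_chart)
  have "\<forall>\<^sub>F h in nhds (snd c' y j). F (chart_inv ?C ((snd ?C (x, y))(?m + j := h))) = F (x, chart_inv c' ((snd c' y)(j := h)))"
  proof (rule eventually_mono)
   show "\<forall>\<^sub>F h in nhds (snd c' y j). (snd ?C (x, y))(?m + j := h) : snd ?C ` fst ?C"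
    using openin_Rn_upd[OF op P, of "?m + j"] j unfolding pj prod_manifold_simps by simp
   fix h assume h: "(snd ?C (x, y))(?m + j := h) : snd ?C ` fst ?C"
   have "Rn_left ?m ((snd ?C (x, y))(?m + j := h)) = snd c x"
    by (auto simp: fun_eq_iff Rn_left_def simp flip: left)
   moreover have "Rn_right ?m ((snd ?C (x, y))(?m + j := h)) = (snd c' y)(j := h)"
    by (auto simp: fun_eq_iff Rn_right_def simp flip: right)
   ultimately show "F (chart_inv ?C ((snd ?C (x, y))(?m + j := h))) = F (x, chart_inv c' ((snd c' y)(j := h)))"
    using inv[OF h] chart_inv_chart[OF M cs(1,2)] by simp
  qed
  then show ?thesis unfolding partial_deriv_def pj by (intro deriv_cong_ev) auto
 qed
qed

lemma partial_deriv_const [simp]: "partial_deriv j (%p. a) q = 0"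
 by (simp add: partial_deriv_def)

lemma tangent_eqI:
 assumes M: "smooth_manifold M" and c: "c : charts_at M x" and v: "v : tangent_space M x" "w : tangent_space M x"
  and eq: "!!i. i < mdim M ==> v c i = w c i"
 shows "v = w"
proof -
 have "v = (SUM i<mdim M. v c i *\<^sub>R coordinate_field M c i x)" "w = (SUM i<mdim M. w c i *\<^sub>R coordinate_field M c i x)"
  using sum_frame_coord[OF tangent_space_frame(1)[OF M c] v(1)] sum_frame_coord[OF tangent_space_frame(1)[OF M c] v(2)]
   tangent_space_frame(2)[OF M c v(1)] tangent_space_frame(2)[OF M c v(2)] by simp_all
 then show ?thesis using eq by simp
qed

context
 fixes M :: "'m manifold" and N :: "'n manifold" and x :: 'm and y :: 'n
 assumes M: "smooth_manifold M" and N: "smooth_manifold N" and x: "x : points M" and y: "y : points N"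
begin

lemma smooth_P: "smooth_manifold (prod_manifold M N)" by (rule smooth_manifold_prod[OF M N])

lemma some_chart_P: "(SOME C. C : charts_at (prod_manifold M N) (x, y)) : charts_at (prod_manifold M N) (x, y)"
 using charts_at_exists[OF smooth_P, of "(x, y)"] x y by (auto intro: someI_ex)

text \<open>The projections are defined through a chosen chart of the product. By the transformation
  law every product chart gives the same result, and there the projections merely select
  coordinates.\<close>

lemma proj_chart:
 assumes v: "v : tangent_space (prod_manifold M N) (x, y)" and c: "c : charts_at M x" and c': "c' : charts_at N y"
 shows "i < mdim M ==> proj1 M N (x, y) v c i = v (prod_chart (mdim M) c c') i"
  and "i < mdim N ==> proj2 M N (x, y) v c' i = v (prod_chart (mdim M) c c') (mdim M + i)"
proof -
 let ?C = "prod_chart (mdim M) c c'" and ?S = "SOME C. C : charts_at (prod_manifold M N) (x, y)"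
 have C: "?C : charts_at (prod_manifold M N) (x, y)" using c c' by (auto simp: charts_at_prod)
 show "proj1 M N (x, y) v c i = v ?C i" if i: "i < mdim M"
  using tangent_space_transform[OF v some_chart_P C, of i] i c
  by (simp add: proj1_def tangent_map_def Let_def jacobian_def snd_prod_chart)
 show "proj2 M N (x, y) v c' i = v ?C (mdim M + i)" if i: "i < mdim N"
  using tangent_space_transform[OF v some_chart_P C, of "mdim M + i"] i c'
  by (simp add: proj2_def tangent_map_def Let_def jacobian_def snd_prod_chart)
qed

lemma jacobian_prod:
 assumes c: "c : charts_at M x" "c1 : charts_at M x" and c': "c' : charts_at N y" "c1' : charts_at N y"
 defines "J \<equiv> jacobian id (prod_chart (mdim M) c c') (prod_chart (mdim M) c1 c1') (x, y)"
 shows "i < mdim M ==> j < mdim M ==> J i j = jacobian id c c1 x i j"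
  and "i < mdim M ==> j < mdim N ==> J i (mdim M + j) = 0"
  and "i < mdim N ==> j < mdim M ==> J (mdim M + i) j = 0"
  and "i < mdim N ==> j < mdim N ==> J (mdim M + i) (mdim M + j) = jacobian id c' c1' y i j"
 using partial_deriv_prod_chart(1)[OF M N c(1) c'(1), of j "%z. snd (prod_chart (mdim M) c1 c1') z i"]
  partial_deriv_prod_chart(2)[OF M N c(1) c'(1), of j "%z. snd (prod_chart (mdim M) c1 c1') z i"]
  partial_deriv_prod_chart(1)[OF M N c(1) c'(1), of j "%z. snd (prod_chart (mdim M) c1 c1') z (mdim M + i)"]
  partial_deriv_prod_chart(2)[OF M N c(1) c'(1), of j "%z. snd (prod_chart (mdim M) c1 c1') z (mdim M + i)"]
 by (simp_all add: J_def jacobian_def snd_prod_chart)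

lemma proj_tangent:
 assumes v: "v : tangent_space (prod_manifold M N) (x, y)"
 shows "proj1 M N (x, y) v : tangent_space M x" and "proj2 M N (x, y) v : tangent_space N y"
proof -
 obtain d where d: "d : charts_at M x" using charts_at_exists[OF M x] by blast
 obtain d' where d': "d' : charts_at N y" using charts_at_exists[OF N y] by blast
 show "proj1 M N (x, y) v : tangent_space M x"
  unfolding tangent_space_def
 proof (intro CollectI conjI allI ballI impI)
  fix c1 c2 i assume c: "c1 : charts_at M x" "c2 : charts_at M x" and i: "i < mdim M"
  have C: "prod_chart (mdim M) c1 d' : charts_at (prod_manifold M N) (x, y)" "prod_chart (mdim M) c2 d' : charts_at (prod_manifold M N) (x, y)"
   using c d' by (auto simp: charts_at_prod)
  have "i < mdim (prod_manifold M N)" using i by simp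
  from tangent_space_transform[OF v C this]
  show "proj1 M N (x, y) v c2 i = (SUM j<mdim M. jacobian id c1 c2 x i j * proj1 M N (x, y) v c1 j)"
   using jacobian_prod(1,2)[OF c d' d'] i proj_chart(1)[OF v _ d'] c by (simp add: sum_lessThan_add)
 qed (auto simp: proj1_def tangent_map_def Let_def fun_eq_iff Rn_iff)
 show "proj2 M N (x, y) v : tangent_space N y"
  unfolding tangent_space_def
 proof (intro CollectI conjI allI ballI impI)
  fix c1 c2 i assume c: "c1 : charts_at N y" "c2 : charts_at N y" and i: "i < mdim N"
  have C: "prod_chart (mdim M) d c1 : charts_at (prod_manifold M N) (x, y)" "prod_chart (mdim M) d c2 : charts_at (prod_manifold M N) (x, y)"
   using c d by (auto simp: charts_at_prod)
  have "mdim M + i < mdim (prod_manifold M N)" using i by simp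
  from tangent_space_transform[OF v C this]
  show "proj2 M N (x, y) v c2 i = (SUM j<mdim N. jacobian id c1 c2 y i j * proj2 M N (x, y) v c1 j)"
   using jacobian_prod(3,4)[OF d d c] i proj_chart(2)[OF v d] c by (simp add: sum_lessThan_add)
 qed (auto simp: proj2_def tangent_map_def Let_def fun_eq_iff Rn_iff)
qed

lemma proj_linear:
 assumes "v : tangent_space (prod_manifold M N) (x, y)" "w : tangent_space (prod_manifold M N) (x, y)"
 shows "proj1 M N (x, y) (a *\<^sub>R v + b *\<^sub>R w) = a *\<^sub>R proj1 M N (x, y) v + b *\<^sub>R proj1 M N (x, y) w"
  and "proj2 M N (x, y) (a *\<^sub>R v + b *\<^sub>R w) = a *\<^sub>R proj2 M N (x, y) v + b *\<^sub>R proj2 M N (x, y) w"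
 by (auto simp: proj1_def proj2_def tangent_map_def Let_def fun_eq_iff scaleR_fun_def distrib_left sum.distrib
   mult.left_commute simp flip: sum_distrib_left)

lemma proj_inj:
 assumes v: "v : tangent_space (prod_manifold M N) (x, y)" "w : tangent_space (prod_manifold M N) (x, y)"
  and eq: "proj1 M N (x, y) v = proj1 M N (x, y) w" "proj2 M N (x, y) v = proj2 M N (x, y) w"
 shows "v = w"
proof -
 obtain d where d: "d : charts_at M x" using charts_at_exists[OF M x] by blast
 obtain d' where d': "d' : charts_at N y" using charts_at_exists[OF N y] by blast
 show ?thesis
 proof (rule tangent_eqI[OF smooth_P _ v, of "prod_chart (mdim M) d d'"])
  show "prod_chart (mdim M) d d' : charts_at (prod_manifold M N) (x, y)" using d d' by (auto simp: charts_at_prod)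
  fix i assume i: "i < mdim (prod_manifold M N)"
  show "v (prod_chart (mdim M) d d') i = w (prod_chart (mdim M) d d') i"
  proof (cases "i < mdim M")
   case True
   then show ?thesis using proj_chart(1)[OF v(1) d d' True] proj_chart(1)[OF v(2) d d' True] eq by simp
  next
   case False
   then have "i - mdim M < mdim N" "mdim M + (i - mdim M) = i" using i by auto
   then show ?thesis using proj_chart(2)[OF v(1) d d', of "i - mdim M"] proj_chart(2)[OF v(2) d d', of "i - mdim M"] eq by simp
  qed
 qed
qed

lemma proj_surj:
 assumes v1: "v1 : tangent_space M x" and v2: "v2 : tangent_space N y"
 shows "EX v:tangent_space (prod_manifold M N) (x, y). proj1 M N (x, y) v = v1 & proj2 M N (x, y) v = v2"
proof -
 obtain d where d: "d : charts_at M x" using charts_at_exists[OF M x] by blast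
 obtain d' where d': "d' : charts_at N y" using charts_at_exists[OF N y] by blast
 let ?C = "prod_chart (mdim M) d d'"
 have C: "?C : charts_at (prod_manifold M N) (x, y)" using d d' by (auto simp: charts_at_prod)
 define a where "a i = (if i < mdim M then v1 d i else v2 d' (i - mdim M))" for i
 define v where "v = (SUM i<mdim (prod_manifold M N). a i *\<^sub>R coordinate_field (prod_manifold M N) ?C i (x, y))"
 have v: "v : tangent_space (prod_manifold M N) (x, y)"
  unfolding v_def by (rule is_frame_sum_mem[OF tangent_space_frame(1)[OF smooth_P C]])
 have va: "v ?C i = a i" if "i < mdim (prod_manifold M N)" for i
  using tangent_space_frame(2)[OF smooth_P C v that] frame_coord_sum[OF tangent_space_frame(1)[OF smooth_P C] that, of a]
  by (simp add: v_def)
 have "proj1 M N (x, y) v = v1"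
  using proj_chart(1)[OF v d d'] va by (intro tangent_eqI[OF M d proj_tangent(1)[OF v] v1]) (simp add: a_def)
 moreover have "proj2 M N (x, y) v = v2"
  using proj_chart(2)[OF v d d'] va by (intro tangent_eqI[OF N d' proj_tangent(2)[OF v] v2]) (simp add: a_def)
 ultimately show ?thesis using v by blast
qed

lemma tangent_space_subspace: "subspace (tangent_space M x)" "subspace (tangent_space N y)" "subspace (tangent_space (prod_manifold M N) (x, y))"
 using vb_fibre_subspace[OF vector_bundle_tangent[OF M] x] vb_fibre_subspace[OF vector_bundle_tangent[OF N] y]
  vb_fibre_subspace[OF vector_bundle_tangent[OF smooth_P], of "(x, y)"] x y by auto

text \<open>The components are \<open>\<alpha>\<close> after the lifts of a vector of one factor
  that project to zero on the other. A lift is unique by \<open>proj_inj\<close>, which is why the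
  chosen lifts are linear.\<close>

lemma covector_pair_surj:
 assumes \<alpha>: "\<alpha> : dual_space (tangent_space (prod_manifold M N) (x, y))"
 shows "EX \<alpha>1:dual_space (tangent_space M x). EX \<alpha>2:dual_space (tangent_space N y). \<alpha> = covector_pair M N (x, y) \<alpha>1 \<alpha>2"
proof -
 note f = dual_space_functional[OF \<alpha>, unfolded functional_on_def]
 define l1 where "l1 v1 = (SOME v. v : tangent_space (prod_manifold M N) (x, y) & proj1 M N (x, y) v = v1 & proj2 M N (x, y) v = 0)" for v1
 define l2 where "l2 v2 = (SOME v. v : tangent_space (prod_manifold M N) (x, y) & proj1 M N (x, y) v = 0 & proj2 M N (x, y) v = v2)" for v2
 have l1: "l1 v : tangent_space (prod_manifold M N) (x, y)" "proj1 M N (x, y) (l1 v) = v" "proj2 M N (x, y) (l1 v) = 0" if "v : tangent_space M x" for v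
  using someI_ex[of "%w. w : tangent_space (prod_manifold M N) (x, y) & proj1 M N (x, y) w = v & proj2 M N (x, y) w = 0"]
   proj_surj[OF that subspace_0[OF tangent_space_subspace(2)]] unfolding l1_def by blast+
 have l2: "l2 v : tangent_space (prod_manifold M N) (x, y)" "proj1 M N (x, y) (l2 v) = 0" "proj2 M N (x, y) (l2 v) = v" if "v : tangent_space N y" for v
  using someI_ex[of "%w. w : tangent_space (prod_manifold M N) (x, y) & proj1 M N (x, y) w = 0 & proj2 M N (x, y) w = v"]
   proj_surj[OF subspace_0[OF tangent_space_subspace(1)] that] unfolding l2_def by blast+
 have lin1: "l1 (a *\<^sub>R v + b *\<^sub>R w) = a *\<^sub>R l1 v + b *\<^sub>R l1 w" if "v : tangent_space M x" "w : tangent_space M x" for a b v w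
  using l1[of v] l1[of w] l1[of "a *\<^sub>R v + b *\<^sub>R w"] that tangent_space_subspace
  by (intro proj_inj) (auto simp: proj_linear subspace_add subspace_scale)
 have lin2: "l2 (a *\<^sub>R v + b *\<^sub>R w) = a *\<^sub>R l2 v + b *\<^sub>R l2 w" if "v : tangent_space N y" "w : tangent_space N y" for a b v w
  using l2[of v] l2[of w] l2[of "a *\<^sub>R v + b *\<^sub>R w"] that tangent_space_subspace
  by (intro proj_inj) (auto simp: proj_linear subspace_add subspace_scale)
 define \<alpha>1 where "\<alpha>1 v = (if v : tangent_space M x then \<alpha> (l1 v) else 0)" for v
 define \<alpha>2 where "\<alpha>2 v = (if v : tangent_space N y then \<alpha> (l2 v) else 0)" for v
 have "\<alpha>1 : dual_space (tangent_space M x)"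
  using lin1[of _ _ 1 1] lin1[of _ _ _ 0] l1 f tangent_space_subspace
  by (auto simp: dual_space_def \<alpha>1_def subspace_add subspace_scale)
 moreover have "\<alpha>2 : dual_space (tangent_space N y)"
  using lin2[of _ _ 1 1] lin2[of _ _ _ 0] l2 f tangent_space_subspace
  by (auto simp: dual_space_def \<alpha>2_def subspace_add subspace_scale)
 moreover have "\<alpha> v = covector_pair M N (x, y) \<alpha>1 \<alpha>2 v" for v
 proof (cases "v : tangent_space (prod_manifold M N) (x, y)")
  case True
  note p = proj_tangent[OF True]
  have "v = 1 *\<^sub>R l1 (proj1 M N (x, y) v) + 1 *\<^sub>R l2 (proj2 M N (x, y) v)"
   using l1[OF p(1)] l2[OF p(2)] True tangent_space_subspace(3)
   by (intro proj_inj) (auto simp: proj_linear[of _ _ 1 1, simplified] subspace_add)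
  then have "\<alpha> v = \<alpha> (l1 (proj1 M N (x, y) v)) + \<alpha> (l2 (proj2 M N (x, y) v))"
   using f l1(1)[OF p(1)] l2(1)[OF p(2)] by (metis scaleR_one)
  then show ?thesis using True p by (simp add: covector_pair_def \<alpha>1_def \<alpha>2_def)
 next
  case False then show ?thesis using \<alpha> by (simp add: covector_pair_def dual_space_def)
 qed
 ultimately show ?thesis by (metis ext)
qed

text \<open>In \<open>interconnection\<close> the components of the covector are existentially
  quantified; this recovers them when the covector is the differential of a sum.\<close>

lemma covector_pair_inj:
 assumes "\<alpha>1 : dual_space (tangent_space M x)" "\<alpha>2 : dual_space (tangent_space N y)"
  "\<beta>1 : dual_space (tangent_space M x)" "\<beta>2 : dual_space (tangent_space N y)"
  and eq: "covector_pair M N (x, y) \<alpha>1 \<alpha>2 = covector_pair M N (x, y) \<beta>1 \<beta>2"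
 shows "\<alpha>1 = \<beta>1" "\<alpha>2 = \<beta>2"
proof -
 have z: "\<alpha>1 0 = 0" "\<alpha>2 0 = 0" "\<beta>1 0 = 0" "\<beta>2 0 = 0"
  by (rule functional_on_0[OF dual_space_functional[OF assms(1)] subspace_0[OF tangent_space_subspace(1)]]
    functional_on_0[OF dual_space_functional[OF assms(2)] subspace_0[OF tangent_space_subspace(2)]]
    functional_on_0[OF dual_space_functional[OF assms(3)] subspace_0[OF tangent_space_subspace(1)]]
    functional_on_0[OF dual_space_functional[OF assms(4)] subspace_0[OF tangent_space_subspace(2)]])+
 show "\<alpha>1 = \<beta>1"
 proof
  fix v show "\<alpha>1 v = \<beta>1 v"
  proof (cases "v : tangent_space M x")
   case True
   then obtain w where "w : tangent_space (prod_manifold M N) (x, y)" "proj1 M N (x, y) w = v" "proj2 M N (x, y) w = 0"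
    using proj_surj[OF True subspace_0[OF tangent_space_subspace(2)]] by blast
   then show ?thesis using fun_cong[OF eq, of w] z by (simp add: covector_pair_def)
  qed (use assms in \<open>auto simp: dual_space_def\<close>)
 qed
 show "\<alpha>2 = \<beta>2"
 proof
  fix v show "\<alpha>2 v = \<beta>2 v"
  proof (cases "v : tangent_space N y")
   case True
   then obtain w where "w : tangent_space (prod_manifold M N) (x, y)" "proj1 M N (x, y) w = 0" "proj2 M N (x, y) w = v"
    using proj_surj[OF subspace_0[OF tangent_space_subspace(1)] True] by blast
   then show ?thesis using fun_cong[OF eq, of w] z by (simp add: covector_pair_def)
  qed (use assms in \<open>auto simp: dual_space_def\<close>)
 qed
qed

end

text \<open>Removes the choice of a chart in \<open>differential\<close>: the Jacobian that changes
  the partial derivatives is absorbed by the transformation law of \<open>v\<close>.\<close>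

lemma differential_chart:
 assumes M: "smooth_manifold M" and H: "smooth_fun_on M (points M) H" and c: "c : charts_at M x" and v: "v : tangent_space M x"
 shows "differential M H x v = (SUM j<mdim M. partial_deriv j (%p. H (chart_inv c p)) (snd c x) * v c j)"
proof -
 have x: "x : points M" using charts_at_points[OF M c] .
 define c0 where "c0 = (SOME c. c : charts_at M x)"
 have c0: "c0 : charts_at M x" unfolding c0_def using c by (rule someI)
 have "differential M H x v = (SUM j<mdim M. partial_deriv j (%p. H (chart_inv c0 p)) (snd c0 x) * v c0 j)"
  using v by (simp add: differential_def Let_def c0_def)
 also have "\<dots> = (SUM j<mdim M. (SUM k<mdim M. partial_deriv k (%p. H (chart_inv c p)) (snd c x) * jacobian id c0 c x k j) * v c0 j)"
  by (intro sum.cong refl) (simp add: partial_deriv_change_chart[OF M c0 c _ openin_topspace x H])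
 also have "\<dots> = (SUM k<mdim M. partial_deriv k (%p. H (chart_inv c p)) (snd c x) * (SUM j<mdim M. jacobian id c0 c x k j * v c0 j))"
  by (simp add: sum_distrib_left sum_distrib_right ac_simps) (rule sum.swap)
 also have "\<dots> = (SUM k<mdim M. partial_deriv k (%p. H (chart_inv c p)) (snd c x) * v c k)"
  by (intro sum.cong refl) (simp add: tangent_space_transform[OF v c0 c])
 finally show ?thesis .
qed

lemma differential_dual:
 assumes M: "smooth_manifold M" and x: "x : points M"
 shows "differential M H x : dual_space (tangent_space M x)"
 unfolding dual_space_def
proof (intro CollectI conjI ballI allI impI)
 have S: "subspace (tangent_space M x)" using vb_fibre_subspace[OF vector_bundle_tangent[OF M] x] by simp
 fix v assume v: "v : tangent_space M x"
 show "differential M H x (v + w) = differential M H x v + differential M H x w" if w: "w : tangent_space M x" for w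
  using v w subspace_add[OF S v w] by (simp add: differential_def Let_def distrib_left sum.distrib)
 show "differential M H x (a *\<^sub>R v) = a * differential M H x v" for a
  using v subspace_scale[OF S v, of a] unfolding differential_def Let_def
  by (simp add: sum_distrib_left) (simp add: scaleR_fun_def ac_simps)
qed (simp add: differential_def)

lemma smooth_fun_on_prod_sum:
 assumes M: "smooth_manifold M" and N: "smooth_manifold N"
  and H: "smooth_fun_on M (points M) H1" "smooth_fun_on N (points N) H2"
 shows "smooth_fun_on (prod_manifold M N) (points (prod_manifold M N)) (%(x1, x2). H1 x1 + H2 x2)"
proof -
 have "smooth_fun_on (prod_manifold M N) (points (prod_manifold M N)) (%z. H1 (fst z) + H2 (snd z))"
  using smooth_fun_on_fst_snd(1)[OF M N openin_topspace H(1)] smooth_fun_on_fst_snd(2)[OF M N openin_topspace H(2)]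
  by (intro smooth_fun_on_add[OF smooth_manifold_prod[OF M N] openin_topspace]) simp_all
 then show ?thesis by (simp add: case_prod_unfold)
qed

text \<open>While coordinates of one factor vary, the summand belonging to the other factor is
  constant and drops out.\<close>

lemma differential_prod:
 assumes M: "smooth_manifold M" and N: "smooth_manifold N" and x: "x : points M" and y: "y : points N"
  and H: "smooth_fun_on M (points M) H1" "smooth_fun_on N (points N) H2"
 shows "differential (prod_manifold M N) (%(x1, x2). H1 x1 + H2 x2) (x, y) =
   covector_pair M N (x, y) (differential M H1 x) (differential N H2 y)"
proof -
 let ?P = "prod_manifold M N" and ?H = "%(x1, x2). H1 x1 + H2 x2"
 note P = smooth_manifold_prod[OF M N] and smH = smooth_fun_on_prod_sum[OF M N H]
 obtain c where c: "c : charts_at M x" using charts_at_exists[OF M x] by blast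
 obtain c' where c': "c' : charts_at N y" using charts_at_exists[OF N y] by blast
 have C: "prod_chart (mdim M) c c' : charts_at ?P (x, y)" using c c' by (auto simp: charts_at_prod)
 have pd1: "partial_deriv j (%p. H1 (chart_inv c p) + H2 y) (snd c x) = partial_deriv j (%p. H1 (chart_inv c p)) (snd c x)"
  if "j < mdim M" for j
 proof -
  have "x : fst c" "c : atlas M" using c by (auto simp: charts_at_def)
  from DERIV_add[OF coordinate_curve_derivative[OF M this(2,1) that openin_topspace x H(1)] DERIV_const[of "H2 y"]]
  show ?thesis by (simp add: partial_deriv_def DERIV_imp_deriv)
 qed
 have pd2: "partial_deriv j (%p. H1 x + H2 (chart_inv c' p)) (snd c' y) = partial_deriv j (%p. H2 (chart_inv c' p)) (snd c' y)"
  if "j < mdim N" for j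
 proof -
  have "y : fst c'" "c' : atlas N" using c' by (auto simp: charts_at_def)
  from DERIV_add[OF DERIV_const[of "H1 x"] coordinate_curve_derivative[OF N this(2,1) that openin_topspace y H(2)]]
  show ?thesis by (simp add: partial_deriv_def DERIV_imp_deriv)
 qed
 show "differential ?P ?H (x, y) = covector_pair M N (x, y) (differential M H1 x) (differential N H2 y)"
 proof
  fix v show "differential ?P ?H (x, y) v = covector_pair M N (x, y) (differential M H1 x) (differential N H2 y) v"
  proof (cases "v : tangent_space ?P (x, y)")
   case True
   have "differential ?P ?H (x, y) v =
     (SUM j<mdim M. partial_deriv j (%p. H1 (chart_inv c p)) (snd c x) * proj1 M N (x, y) v c j) +
     (SUM j<mdim N. partial_deriv j (%p. H2 (chart_inv c' p)) (snd c' y) * proj2 M N (x, y) v c' j)"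
    unfolding differential_chart[OF P smH C True] prod_manifold_simps sum_lessThan_add
    using partial_deriv_prod_chart[OF M N c c', of _ ?H] pd1 pd2 proj_chart[OF M N x y True c c'] by simp
   then show ?thesis
    using True differential_chart[OF M H(1) c proj_tangent(1)[OF M N x y True]]
     differential_chart[OF N H(2) c' proj_tangent(2)[OF M N x y True]] by (simp add: covector_pair_def)
  next
   case False then show ?thesis by (simp add: covector_pair_def differential_def)
  qed
 qed
qed

text \<open>In a dual coordinate frame the coordinates are the partial derivatives of
  \<open>H\<close>, smooth functions of the base point and so continuous along the curve; on compact
  intervals this is regularity of either kind.\<close>

lemma creg_differential:
 assumes M: "smooth_manifold M" and H: "smooth_fun_on M (points M) H" and x: "path_on M a b x"
 shows "creg \<tt> M (dual_bundle (tangent M)) a b (%t. (x t, differential M H (x t)))"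
proof -
 have "reg \<tt> {p..q} (%t. frame_coord (mdim M) (%k. s k (x t)) (differential M H (x t)) i)"
  if Us: "(U, s) : vframes (dual_bundle (tangent M))" and pq: "a <= p" "q <= b" and U: "ALL t:{p..q}. x t : U" and i: "i < mdim M"
  for U s p q i
 proof -
  obtain c where c: "c : atlas M" "U = fst c" "s = dual_frame (tangent_space M) (mdim M) (coordinate_field M c)"
   using Us by (auto simp: vframes_dual)
  let ?G = "%x. partial_deriv i (%p. H (chart_inv c p)) (snd c x)"
  have oc: "openin (mtop M) (fst c)" using chart_openin[OF M c(1)] .
  have "smooth_fun_on M (fst c) ?G"
  proof (rule smooth_fun_on_chartI[OF M c(1) oc subset_refl])
   fix k
   have "Ck_on (mdim M) (Suc k) (snd c ` (fst c \<inter> points M)) (%p. H (chart_inv c p))"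
    using H c unfolding smooth_fun_on_iff by blast
   then have "Ck_on (mdim M) (Suc k) (snd c ` fst c) (%p. H (chart_inv c p))"
    using openin_subset[OF oc] by (simp add: inf.absorb1 del: Ck_on.simps)
   then have "Ck_on (mdim M) k (snd c ` fst c) (partial_deriv i (%p. H (chart_inv c p)))" using i by simp
   then show "Ck_on (mdim M) k (snd c ` fst c) (%p. ?G (chart_inv c p))"
    by (subst Ck_on_cong[OF chart_image_openin[OF M c(1)]]) (auto simp: chart_inv_chart[OF M c(1)])
  qed
  from continuous_on_smooth_compose[OF M oc this x, of p q] have "continuous_on {p..q} (%t. ?G (x t))"
   using pq U c by auto
  then have "reg \<tt> {p..q} (%t. ?G (x t))" by (rule reg_continuous)
  then show ?thesis
  proof (rule iffD1[OF reg_cong, rotated])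
   fix t assume t: "t : {p..q}"
   then have cx: "c : charts_at M (x t)" "x t : points M" using U c chart_subset[OF M c(1)] by (auto simp: charts_at_def)
   have "frame_coord (mdim M) (%k. s k (x t)) (differential M H (x t)) i = differential M H (x t) (coordinate_field M c i (x t))"
    using dual_space_frame[OF tangent_space_frame(1)[OF M cx(1)]] differential_dual[OF M cx(2), of H] i
    unfolding c(3) dual_frame_def[abs_def] by blast
   also have "\<dots> = (SUM j<mdim M. partial_deriv j (%p. H (chart_inv c p)) (snd c (x t)) * (if j = i then 1 else 0))"
    unfolding differential_chart[OF M H cx(1) coordinate_field_tangent[OF M cx(1) i]]
    using cx(1) i by (intro sum.cong refl) (simp add: coordinate_field_def jacobian_self[OF M cx(1)])
   also have "\<dots> = (SUM j<mdim M. if j = i then ?G (x t) else 0)" by (intro sum.cong refl) simp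
   also have "\<dots> = ?G (x t)" using i by simp
   finally show "?G (x t) = frame_coord (mdim M) (%k. s k (x t)) (differential M H (x t)) i" by simp
  qed
 qed
 then show ?thesis
  unfolding creg_def total_space_def using x continuous_shadow_mem[OF x] differential_dual[OF M] by (auto simp: comp_def)
qed

section \<open>Derivatives of curves\<close>

lemma creg_tangent_iff:
 assumes M: "smooth_manifold M"
 shows "creg \<tt> M (tangent M) a b (%t. (x t, v t)) \<longleftrightarrow>
  path_on M a b x & (ALL t:{a..b}. v t : tangent_space M (x t)) &
  (ALL c:atlas M. ALL p q i. a <= p --> q <= b --> (ALL t:{p..q}. x t : fst c) --> i < mdim M --> reg \<tt> {p..q} (%t. v t c i))"
  (is "_ \<longleftrightarrow> ?x & ?v & ?r")
proof -
 have eq: "reg \<tt> {p..q} (%t. frame_coord (mdim M) (%k. coordinate_field M c k (x t)) (v t) i) \<longleftrightarrow> reg \<tt> {p..q} (%t. v t c i)"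
  if "c : atlas M" "ALL t:{p..q}. x t : fst c" "i < mdim M" "ALL t:{p..q}. v t : tangent_space M (x t)" for c p q i
  using that by (intro reg_cong tangent_space_frame(2)[OF M]) (auto simp: charts_at_def)
 show ?thesis
 proof
  assume L: "creg \<tt> M (tangent M) a b (%t. (x t, v t))"
  have x: ?x using creg_shadow[OF L] by (simp add: comp_def)
  have v: ?v using creg_mem(2)[OF L] by simp
  moreover have ?r
  proof (intro ballI allI impI)
   fix c p q i assume *: "c : atlas M" "a <= p" "q <= b" "ALL t:{p..q}. x t : fst c" "i < mdim M"
   have "(fst c, coordinate_field M c) : vframes (tangent M)" using *(1) by auto
   from creg_coord[OF L this *(2,3)] * show "reg \<tt> {p..q} (%t. v t c i)"
    using eq[OF *(1,4,5)] v by auto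
  qed
  ultimately show "?x & ?v & ?r" using x by blast
 next
  assume R: "?x & ?v & ?r"
  show "creg \<tt> M (tangent M) a b (%t. (x t, v t))"
   unfolding creg_def
  proof (intro conjI ballI allI impI)
   show "path_on M a b (fst \<circ> (%t. (x t, v t)))" using R by (simp add: comp_def)
   show "(x t, v t) : total_space M (tangent M)" if "t : {a..b}" for t
    using that R continuous_shadow_mem[of a b "mtop M" x] by (simp add: total_space_def)
   fix U s p q i assume *: "(U, s) : vframes (tangent M)" "a <= p" "q <= b" "ALL t:{p..q}. fst (x t, v t) : U" "i < vrank (tangent M)"
   then obtain c where c: "c : atlas M" "U = fst c" "s = coordinate_field M c" by auto
   have "ALL t:{p..q}. v t : tangent_space M (x t)" using R *(2,3) by auto
   with c * eq[OF c(1), of p q i] R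
   show "reg \<tt> {p..q} (%t. frame_coord (vrank (tangent M)) (%k. s k (fst (x t, v t))) (snd (x t, v t)) i)" by auto
  qed
 qed
qed

text \<open>Needed for projections from a product, whose coordinates are at first under control in
  one product chart near each time.\<close>

lemma tangent_section_local:
 assumes M: "smooth_manifold M" and x: "path_on M a b x"
  and v: "!!t. t : {a..b} ==> v t : tangent_space M (x t)"
  and loc: "!!t. t : {a..b} ==> EX \<delta>>0. EX c:atlas M. (ALL r:{a..b}. \<bar>r - t\<bar> < \<delta> --> x r : fst c) &
   (ALL p q i. a <= p & p <= t & t <= q & q <= b & q - p < \<delta> & i < mdim M --> reg \<tt> {p..q} (%t. v t c i))"
 shows "creg \<tt> M (tangent M) a b (%t. (x t, v t))"
proof (rule cregI[OF M vector_bundle_tangent[OF M]])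
 fix t assume t: "t : {a..b}"
 obtain \<delta> c where \<delta>: "\<delta> > 0" "c : atlas M" "!!r. r : {a..b} ==> \<bar>r - t\<bar> < \<delta> ==> x r : fst c"
  "!!p q i. a <= p ==> p <= t ==> t <= q ==> q <= b ==> q - p < \<delta> ==> i < mdim M ==> reg \<tt> {p..q} (%t. v t c i)"
  using loc[OF t] by blast
 show "EX \<delta>>0. EX U s. (U, s) : vframes (tangent M) & (ALL r:{a..b}. \<bar>r - t\<bar> < \<delta> --> fst (x r, v r) : U) &
   (ALL p q i. a <= p & p <= t & t <= q & q <= b & q - p < \<delta> & i < vrank (tangent M) -->
    reg \<tt> {p..q} (%t. frame_coord (vrank (tangent M)) (%k. s k (fst (x t, v t))) (snd (x t, v t)) i))"
 proof (intro exI[of _ \<delta>] exI[of _ "fst c"] exI[of _ "coordinate_field M c"] conjI allI impI ballI)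
  fix p q i assume *: "a <= p & p <= t & t <= q & q <= b & q - p < \<delta> & i < vrank (tangent M)"
  have "frame_coord (mdim M) (%k. coordinate_field M c k (x r)) (v r) i = v r c i" if "r : {p..q}" for r
  proof -
   have "r : {a..b}" "\<bar>r - t\<bar> < \<delta>" using that * by auto
   then show ?thesis using \<delta>(2,3) v * by (intro tangent_space_frame(2)[OF M]) (auto simp: charts_at_def)
  qed
  then show "reg \<tt> {p..q} (%t. frame_coord (vrank (tangent M)) (%k. coordinate_field M c k (fst (x t, v t))) (snd (x t, v t)) i)"
   using \<delta>(4)[of p q i] * by (subst reg_cong[where h' = "%t. v t c i"]) auto
 qed (use \<delta> in auto)
qed (use x v in \<open>auto simp: comp_def\<close>)

text \<open>In a product chart the coordinates of \<open>v\<close> are those of its projections in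
  succession. From left to right a chart of the other factor has to be supplied near each time; from
  right to left the product chart is given.\<close>

lemma creg_tangent_prod:
 assumes M: "smooth_manifold M" and N: "smooth_manifold N"
  and v: "!!t. t : {a..b} ==> v t : tangent_space (prod_manifold M N) (x t, y t)"
 shows "creg \<tt> (prod_manifold M N) (tangent (prod_manifold M N)) a b (%t. ((x t, y t), v t)) \<longleftrightarrow>
  creg \<tt> M (tangent M) a b (%t. (x t, proj1 M N (x t, y t) (v t))) &
  creg \<tt> N (tangent N) a b (%t. (y t, proj2 M N (x t, y t) (v t)))" (is "?L \<longleftrightarrow> ?R1 & ?R2")
proof
 let ?P = "prod_manifold M N"
 note P = smooth_manifold_prod[OF M N]
 assume L: ?L
 have xy: "path_on ?P a b (%t. (x t, y t))" using creg_shadow[OF L] by (simp add: comp_def)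
 then have x: "path_on M a b x" and y: "path_on N a b y"
  by (simp_all add: continuous_map_pairwise comp_def)
 have pts: "x t : points M" "y t : points N" if "t : {a..b}" for t
  using continuous_shadow_mem[OF x that] continuous_shadow_mem[OF y that] by auto
 have loc: "EX \<delta>>0. EX c:atlas M. EX c':atlas N. (ALL r:{a..b}. \<bar>r - t\<bar> < \<delta> --> x r : fst c & y r : fst c')"
  if t: "t : {a..b}" for t
 proof -
  obtain c where c: "c : atlas M" "x t : fst c" using charts_at_exists[OF M pts(1)[OF t]] by (auto simp: charts_at_def)
  obtain c' where c': "c' : atlas N" "y t : fst c'" using charts_at_exists[OF N pts(2)[OF t]] by (auto simp: charts_at_def)
  have "openin (mtop ?P) (fst c \<times> fst c')" using chart_openin[OF M c(1)] chart_openin[OF N c'(1)] by (simp add: openin_prod_Times_iff)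
  from shadow_interval[OF xy this t] c c' obtain \<delta> where "\<delta> > 0" "!!r. r : {a..b} ==> \<bar>r - t\<bar> < \<delta> ==> (x r, y r) : fst c \<times> fst c'"
   by auto
  then show ?thesis using c c' by (intro exI[of _ \<delta>] bexI[of _ c] bexI[of _ c'] conjI) auto
 qed
 have reg: "reg \<tt> {p..q} (%r. v r (prod_chart (mdim M) c c') i)"
  if "c : atlas M" "c' : atlas N" "a <= p" "q <= b" "ALL r:{p..q}. x r : fst c & y r : fst c'" "i < mdim M + mdim N" for c c' p q i
 proof -
  have "prod_chart (mdim M) c c' : atlas ?P" using that by (auto simp: prod_manifold_atlas)
  then show ?thesis using L[unfolded creg_tangent_iff[OF P]] that by auto
 qed
 have 1: ?R1
 proof (rule tangent_section_local[OF M x])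
  fix t assume t: "t : {a..b}"
  show "proj1 M N (x t, y t) (v t) : tangent_space M (x t)" using proj_tangent(1)[OF M N pts[OF t] v[OF t]] .
  obtain \<delta> c c' where \<delta>: "\<delta> > 0" "c : atlas M" "c' : atlas N" "!!r. r : {a..b} ==> \<bar>r - t\<bar> < \<delta> ==> x r : fst c & y r : fst c'"
   using loc[OF t] by blast
  have "reg \<tt> {p..q} (%t. proj1 M N (x t, y t) (v t) c i)"
   if *: "a <= p & p <= t & t <= q & q <= b & q - p < \<delta> & i < mdim M" for p q i
  proof -
   have r: "x r : fst c & y r : fst c' & r : {a..b}" if "r : {p..q}" for r using \<delta>(4)[of r] that * by auto
   then have "reg \<tt> {p..q} (%r. v r (prod_chart (mdim M) c c') i)" using * \<delta> by (intro reg) auto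
   then show ?thesis
    by (rule iffD1[OF reg_cong, rotated])
     (use * r \<delta> pts v proj_chart(1)[OF M N, of _ _ _ c c' i] in \<open>auto simp: charts_at_def\<close>)
  qed
  then show "EX \<delta>>0. EX c:atlas M. (ALL r:{a..b}. \<bar>r - t\<bar> < \<delta> --> x r : fst c) &
   (ALL p q i. a <= p & p <= t & t <= q & q <= b & q - p < \<delta> & i < mdim M --> reg \<tt> {p..q} (%t. proj1 M N (x t, y t) (v t) c i))"
   using \<delta> by (intro exI[of _ \<delta>] bexI[of _ c] conjI) auto
 qed
 have 2: ?R2
 proof (rule tangent_section_local[OF N y])
  fix t assume t: "t : {a..b}"
  show "proj2 M N (x t, y t) (v t) : tangent_space N (y t)" using proj_tangent(2)[OF M N pts[OF t] v[OF t]] .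
  obtain \<delta> c c' where \<delta>: "\<delta> > 0" "c : atlas M" "c' : atlas N" "!!r. r : {a..b} ==> \<bar>r - t\<bar> < \<delta> ==> x r : fst c & y r : fst c'"
   using loc[OF t] by blast
  have "reg \<tt> {p..q} (%t. proj2 M N (x t, y t) (v t) c' i)"
   if *: "a <= p & p <= t & t <= q & q <= b & q - p < \<delta> & i < mdim N" for p q i
  proof -
   have r: "x r : fst c & y r : fst c' & r : {a..b}" if "r : {p..q}" for r using \<delta>(4)[of r] that * by auto
   then have "reg \<tt> {p..q} (%r. v r (prod_chart (mdim M) c c') (mdim M + i))" using * \<delta> by (intro reg) auto
   then show ?thesis
    by (rule iffD1[OF reg_cong, rotated])
     (use * r \<delta> pts v proj_chart(2)[OF M N, of _ _ _ c c' i] in \<open>auto simp: charts_at_def\<close>)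
  qed
  then show "EX \<delta>>0. EX c:atlas N. (ALL r:{a..b}. \<bar>r - t\<bar> < \<delta> --> y r : fst c) &
   (ALL p q i. a <= p & p <= t & t <= q & q <= b & q - p < \<delta> & i < mdim N --> reg \<tt> {p..q} (%t. proj2 M N (x t, y t) (v t) c i))"
   using \<delta> by (intro exI[of _ \<delta>] bexI[of _ c'] conjI) auto
 qed
 show "?R1 & ?R2" using 1 2 by blast
next
 let ?P = "prod_manifold M N"
 note P = smooth_manifold_prod[OF M N]
 assume R: "?R1 & ?R2"
 then have x: "path_on M a b x" and y: "path_on N a b y"
  using creg_shadow by (force simp: comp_def)+
 have pts: "x t : points M" "y t : points N" if "t : {a..b}" for t
  using continuous_shadow_mem[OF x that] continuous_shadow_mem[OF y that] by auto
 show ?L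
  unfolding creg_tangent_iff[OF P]
 proof (intro conjI ballI allI impI)
  show "path_on ?P a b (%t. (x t, y t))" using x y by (simp add: continuous_map_pairwise comp_def)
  fix C p q i assume "C : atlas ?P" and *: "a <= p" "q <= b" "ALL t:{p..q}. (x t, y t) : fst C" and i: "i < mdim ?P"
  then obtain c c' where c: "c : atlas M" "c' : atlas N" "C = prod_chart (mdim M) c c'" unfolding prod_manifold_atlas by auto
  have r: "x r : fst c & y r : fst c' & r : {a..b}" if "r : {p..q}" for r using * that c by auto
  show "reg \<tt> {p..q} (%t. v t C i)"
  proof (cases "i < mdim M")
   case True
   then have "reg \<tt> {p..q} (%t. proj1 M N (x t, y t) (v t) c i)"
    using R[unfolded creg_tangent_iff[OF M]] c * r by auto
   then show ?thesis
    by (rule iffD1[OF reg_cong, rotated])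
     (use True r c pts v proj_chart(1)[OF M N, of _ _ _ c c' i] in \<open>auto simp: charts_at_def\<close>)
  next
   case False
   define k where "k = i - mdim M"
   have k: "k < mdim N" "i = mdim M + k" using False i by (auto simp: k_def)
   then have "reg \<tt> {p..q} (%t. proj2 M N (x t, y t) (v t) c' k)"
    using R[unfolded creg_tangent_iff[OF N]] c * r by auto
   then show ?thesis
    by (rule iffD1[OF reg_cong, rotated])
     (use k r c pts v proj_chart(2)[OF M N, of _ _ _ c c' k] in \<open>auto simp: charts_at_def\<close>)
  qed
 qed (rule v)
qed

text \<open>On the closed interval \<open>velocity\<close> equals the derivative of any extension:
  on a nondegenerate interval the derivative within it is unique, at the end points too. Tangency is
  the chain rule for a coordinate change.\<close>

lemma C1_curve_velocity:
 assumes M: "smooth_manifold M" and x: "C1_curve M a b x" and ab: "a < b"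
 shows "creg Classical M (tangent M) a b (%t. (x t, velocity M a b x t))"
proof -
 obtain a' b' z where ab': "a' < a" "b < b'" and z: "C1_on_open_interval M a' b' z" and zx: "!!t. t : {a..b} ==> z t = x t"
  using x unfolding C1_curve_def by blast
 have zc: "continuous_map (top_of_set {a'<..<b'}) (mtop M) z" using z by (simp add: C1_on_open_interval_def)
 have "path_on M a b z"
  by (rule continuous_map_from_subtopology_mono[OF zc]) (use ab' in auto)
 then have xc: "path_on M a b x" by (rule continuous_map_eq) (use zx in auto)
 have zD: "(%s. snd c (z s) i) field_differentiable (at t)" and zD': "continuous_on {t:{a'<..<b'}. z t : fst c} (deriv (%s. snd c (z s) i))"
  if "c : atlas M" "t : {a'<..<b'}" "z t : fst c" "i < mdim M" for c t i
  using z that unfolding C1_on_open_interval_def by force+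
 have der: "((%s. snd c (x s) i) has_real_derivative deriv (%s. snd c (z s) i) t) (at t within {a..b})"
  if c: "c : atlas M" "x t : fst c" and t: "t : {a..b}" and i: "i < mdim M" for c t i
 proof -
  have "DERIV (%s. snd c (z s) i) t :> deriv (%s. snd c (z s) i) t"
   using zD[of c t i] that ab' zx[OF t] by (simp add: DERIV_deriv_iff_field_differentiable)
  then have "((%s. snd c (z s) i) has_real_derivative deriv (%s. snd c (z s) i) t) (at t within {a..b})"
   by (rule has_field_derivative_at_within)
  then show ?thesis
   by (rule has_field_derivative_transform_within[of _ _ _ _ 1]) (use t zx in auto)
 qed
 have vel: "velocity M a b x t c i = deriv (%s. snd c (z s) i) t"
  if c: "c : atlas M" "x t : fst c" and t: "t : {a..b}" and i: "i < mdim M" for c t i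
  using vector_derivative_within_closed_interval[OF ab, of t] t der[OF that] c i
  by (simp add: velocity_def charts_at_def has_real_derivative_iff_has_vector_derivative)
 have tan: "velocity M a b x t : tangent_space M (x t)" if t: "t : {a..b}" for t
  unfolding tangent_space_def
 proof (intro CollectI conjI allI ballI impI)
  fix c c' i assume c: "c : charts_at M (x t)" "c' : charts_at M (x t)" and i: "i < mdim M"
  then have cc: "c : atlas M" "x t : fst c" "c' : atlas M" "x t : fst c'" by (auto simp: charts_at_def)
  have "((%s. snd c' (x s) i) has_real_derivative
    (SUM j<mdim M. partial_deriv j (%p. snd c' (chart_inv c p) i) (snd c (x t)) * deriv (%s. snd c (z s) j) t)) (at t within {a..b})"
  proof (rule smooth_fun_curve_derivative[where x = x and ?t0.0 = t, OF M cc(1) chart_openin[OF M cc(3)] chart_coord_smooth[OF M cc(3) i] cc(2,4)])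
   show "((%s. snd c (x s) j) has_real_derivative deriv (%s. snd c (z s) j) t) (at t within {a..b})" if "j < mdim M" for j
    using der[OF cc(1,2) t that] .
   obtain \<delta> where "\<delta> > 0" "!!s. s : {a..b} ==> \<bar>s - t\<bar> < \<delta> ==> x s : fst c"
    using shadow_interval[OF xc chart_openin[OF M cc(1)] t cc(2)] by blast
   then show "\<forall>\<^sub>F s in at t within {a..b}. x s : fst c"
    unfolding eventually_at by (intro exI[of _ \<delta>]) (auto simp: dist_real_def)
  qed
  then have "((%s. snd c' (x s) i) has_vector_derivative
    (SUM j<mdim M. partial_deriv j (%p. snd c' (chart_inv c p) i) (snd c (x t)) * deriv (%s. snd c (z s) j) t)) (at t within {a..b})"
   by (simp add: has_real_derivative_iff_has_vector_derivative)
  from vector_derivative_within_closed_interval[OF ab t this]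
  show "velocity M a b x t c' i = (SUM j<mdim M. jacobian id c c' (x t) i j * velocity M a b x t c j)"
   using vel[OF cc(1,2) t] c i by (simp add: velocity_def jacobian_def)
 qed (auto simp: velocity_def fun_eq_iff Rn_iff)
 show ?thesis
  unfolding creg_tangent_iff[OF M]
 proof (intro conjI ballI allI impI xc)
  fix c p q i assume *: "c : atlas M" "a <= p" "q <= b" "ALL t:{p..q}. x t : fst c" "i < mdim M"
  have sub: "{p..q} \<subseteq> {t:{a'<..<b'}. z t : fst c}" using * ab' zx by auto
  have "continuous_on {p..q} (%t. velocity M a b x t c i)"
  proof (cases "p <= q")
   case True
   then have "continuous_on {p..q} (deriv (%s. snd c (z s) i))"
    using sub zD'[OF *(1) _ _ *(5), of p] by (intro continuous_on_subset[OF _ sub]) auto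
   then show ?thesis by (rule continuous_on_eq) (use * vel in auto)
  qed simp
  then show "reg Classical {p..q} (%t. velocity M a b x t c i)" by simp
 qed (rule tan)
qed

lemma C1_on_open_interval_subset:
 assumes "C1_on_open_interval M a b x" "a <= a'" "b' <= b"
 shows "C1_on_open_interval M a' b' x"
proof -
 have sub: "{a'<..<b'} \<subseteq> {a<..<b}" using assms by auto
 then have sub': "{t : {a'<..<b'}. x t : U} \<subseteq> {t : {a<..<b}. x t : U}" for U by auto
 have "continuous_map (top_of_set {a'<..<b'}) (mtop M) x"
  using assms(1) unfolding C1_on_open_interval_def by (blast intro: continuous_map_from_subtopology_mono[OF _ sub])
 moreover have "(ALL t:{t:{a'<..<b'}. x t : fst c}. (%s. snd c (x s) i) field_differentiable (at t)) &
   continuous_on {t:{a'<..<b'}. x t : fst c} (deriv (%s. snd c (x s) i))" if "c : atlas M" "i < mdim M" for c i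
 proof -
  have "(ALL t:{t:{a<..<b}. x t : fst c}. (%s. snd c (x s) i) field_differentiable (at t)) &
   continuous_on {t:{a<..<b}. x t : fst c} (deriv (%s. snd c (x s) i))"
   using assms(1) that unfolding C1_on_open_interval_def by (auto simp: case_prod_unfold)
  with sub'[of "fst c"] show ?thesis by (blast intro: continuous_on_subset)
 qed
 ultimately show ?thesis unfolding C1_on_open_interval_def by (simp add: case_prod_unfold)
qed

text \<open>A chart of one factor is tested by completing it with a chart around the current point
  of the other. That completion works only near the given time, so continuity of the derivative is
  stated pointwise, as \<open>isCont\<close>.\<close>

lemma C1_on_open_interval_prod:
 assumes M: "smooth_manifold M" and N: "smooth_manifold N"
 shows "C1_on_open_interval (prod_manifold M N) a b (%t. (x t, y t)) \<longleftrightarrow>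
  C1_on_open_interval M a b x & C1_on_open_interval N a b y"
proof
 let ?P = "prod_manifold M N" and ?I = "{a<..<b}"
 assume L: "C1_on_open_interval ?P a b (%t. (x t, y t))"
 then have x: "continuous_map (top_of_set ?I) (mtop M) x" and y: "continuous_map (top_of_set ?I) (mtop N) y"
  by (simp_all add: C1_on_open_interval_def continuous_map_pairwise comp_def)
 have LD: "(%s. snd (prod_chart (mdim M) c c') (x s, y s) i) field_differentiable at t &
   isCont (deriv (%s. snd (prod_chart (mdim M) c c') (x s, y s) i)) t"
  if c: "c : atlas M" "c' : atlas N" and t: "t : ?I" "x t : fst c" "y t : fst c'" and i: "i < mdim M + mdim N" for c c' t i
 proof -
  have C: "prod_chart (mdim M) c c' : atlas ?P" using c by (auto simp: prod_manifold_atlas)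
  have "open {t : ?I. x t : fst c}" "open {t : ?I. y t : fst c'}"
   using openin_continuous_map_preimage[OF x chart_openin[OF M c(1)]] openin_continuous_map_preimage[OF y chart_openin[OF N c(2)]]
   by (simp_all add: openin_open_eq)
  from open_Int[OF this] have op: "open {t : ?I. (x t, y t) : fst c \<times> fst c'}" by (rule back_subst[of "open"]) auto
  have "(ALL t:{t:?I. (x t, y t) : fst (prod_chart (mdim M) c c')}. (%s. snd (prod_chart (mdim M) c c') (x s, y s) i) field_differentiable (at t)) &
    continuous_on {t:?I. (x t, y t) : fst (prod_chart (mdim M) c c')} (deriv (%s. snd (prod_chart (mdim M) c c') (x s, y s) i))"
   using L C i unfolding C1_on_open_interval_def by (force simp: case_prod_unfold)
  with op t show ?thesis by (auto simp: continuous_on_eq_continuous_at)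
 qed
 have pts: "x t : points M" "y t : points N" if "t : ?I" for t
  using x y that by (auto simp: continuous_map_def)
 have 1: "(%s. snd c (x s) i) field_differentiable at t & isCont (deriv (%s. snd c (x s) i)) t"
  if c: "c : atlas M" "t : ?I" "x t : fst c" "i < mdim M" for c t i
 proof -
  obtain c' where "c' : atlas N" "y t : fst c'" using charts_at_exists[OF N pts(2)[OF c(2)]] by (auto simp: charts_at_def)
  with LD[of c c' t i] c show ?thesis by (simp add: snd_prod_chart)
 qed
 have 2: "(%s. snd c (y s) i) field_differentiable at t & isCont (deriv (%s. snd c (y s) i)) t"
  if c: "c : atlas N" "t : ?I" "y t : fst c" "i < mdim N" for c t i
 proof -
  obtain c' where "c' : atlas M" "x t : fst c'" using charts_at_exists[OF M pts(1)[OF c(2)]] by (auto simp: charts_at_def)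
  with LD[of c' c t "mdim M + i"] c show ?thesis by (simp add: snd_prod_chart)
 qed
 show "C1_on_open_interval M a b x & C1_on_open_interval N a b y"
  unfolding C1_on_open_interval_def using x y 1 2 by (auto intro!: continuous_at_imp_continuous_on)
next
 let ?P = "prod_manifold M N" and ?I = "{a<..<b}"
 assume R: "C1_on_open_interval M a b x & C1_on_open_interval N a b y"
 show "C1_on_open_interval ?P a b (%t. (x t, y t))"
  unfolding C1_on_open_interval_def
 proof (intro conjI)
  show "continuous_map (top_of_set ?I) (mtop ?P) (%t. (x t, y t))"
   using R by (simp add: C1_on_open_interval_def continuous_map_pairwise comp_def)
  have "(ALL t:{t:?I. (x t, y t) : fst C}. (%s. snd C (x s, y s) i) field_differentiable (at t)) &
    continuous_on {t:?I. (x t, y t) : fst C} (deriv (%s. snd C (x s, y s) i))" if C: "C : atlas ?P" and i: "i < mdim ?P" for C i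
  proof -
   obtain c c' where c: "c : atlas M" "c' : atlas N" "C = prod_chart (mdim M) c c'" using C unfolding prod_manifold_atlas by auto
   have sub: "{t:?I. (x t, y t) : fst C} \<subseteq> {t : ?I. x t : fst c}" "{t:?I. (x t, y t) : fst C} \<subseteq> {t : ?I. y t : fst c'}"
    using c by auto
   show ?thesis
   proof (cases "i < mdim M")
    case True
    then have "(ALL t:{t:?I. x t : fst c}. (%s. snd c (x s) i) field_differentiable (at t)) &
     continuous_on {t:?I. x t : fst c} (deriv (%s. snd c (x s) i))"
     using R c(1) unfolding C1_on_open_interval_def by (force simp: case_prod_unfold)
    with True sub(1) c(3) show ?thesis by (auto simp: snd_prod_chart intro: continuous_on_subset)
   next
    case False
    with i have "i - mdim M < mdim N" by auto
    then have "(ALL t:{t:?I. y t : fst c'}. (%s. snd c' (y s) (i - mdim M)) field_differentiable (at t)) &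
     continuous_on {t:?I. y t : fst c'} (deriv (%s. snd c' (y s) (i - mdim M)))"
     using R c(2) unfolding C1_on_open_interval_def by (force simp: case_prod_unfold)
    with False sub(2) c(3) show ?thesis by (auto simp: snd_prod_chart intro: continuous_on_subset)
   qed
  qed
  then show "ALL (U, \<phi>):atlas ?P. ALL i<mdim ?P. (ALL t:{t:?I. (x t, y t) : U}. (%s. \<phi> (x s, y s) i) field_differentiable (at t)) &
    continuous_on {t:?I. (x t, y t) : U} (deriv (%s. \<phi> (x s, y s) i))" by force
 qed
qed

lemma C1_curve_prod:
 assumes M: "smooth_manifold M" and N: "smooth_manifold N"
 shows "C1_curve (prod_manifold M N) a b (%t. (x t, y t)) \<longleftrightarrow> C1_curve M a b x & C1_curve N a b y"
proof
 assume "C1_curve (prod_manifold M N) a b (%t. (x t, y t))"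
 then obtain a' b' z where z: "a' < a" "b < b'" "C1_on_open_interval (prod_manifold M N) a' b' (%t. (fst (z t), snd (z t)))" "ALL t:{a..b}. z t = (x t, y t)"
  unfolding C1_curve_def by auto
 then show "C1_curve M a b x & C1_curve N a b y"
  unfolding C1_on_open_interval_prod[OF M N] C1_curve_def
  by (intro conjI exI[of _ a'] exI[of _ b'] exI[of _ "%t. fst (z t)"] exI[of _ "%t. snd (z t)"]) auto
next
 assume "C1_curve M a b x & C1_curve N a b y"
 then obtain a1 b1 z1 a2 b2 z2 where z: "a1 < a" "b < b1" "C1_on_open_interval M a1 b1 z1" "ALL t:{a..b}. z1 t = x t"
  "a2 < a" "b < b2" "C1_on_open_interval N a2 b2 z2" "ALL t:{a..b}. z2 t = y t" unfolding C1_curve_def by blast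
 then have "C1_on_open_interval (prod_manifold M N) (max a1 a2) (min b1 b2) (%t. (z1 t, z2 t))"
  unfolding C1_on_open_interval_prod[OF M N] by (auto elim!: C1_on_open_interval_subset)
 then show "C1_curve (prod_manifold M N) a b (%t. (x t, y t))"
  unfolding C1_curve_def using z
  by (intro exI[of _ "max a1 a2"] exI[of _ "min b1 b2"] exI[of _ "%t. (z1 t, z2 t)"]) auto
qed

lemma velocity_prod:
 assumes M: "smooth_manifold M" and N: "smooth_manifold N" and C1: "C1_curve (prod_manifold M N) a b (%t. (x t, y t))"
  and ab: "a < b" and t: "t : {a..b}"
 defines "v \<equiv> velocity (prod_manifold M N) a b (%t. (x t, y t)) t"
 shows "proj1 M N (x t, y t) v = velocity M a b x t" and "proj2 M N (x t, y t) v = velocity N a b y t"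
proof -
 let ?P = "prod_manifold M N"
 note P = smooth_manifold_prod[OF M N]
 note cr = C1_curve_velocity[OF P C1 ab]
 have v: "v : tangent_space ?P (x t, y t)" and xy: "x t : points M" "y t : points N"
  using creg_mem[OF cr t] by (simp_all add: v_def)
 obtain d where d: "d : charts_at M (x t)" using charts_at_exists[OF M xy(1)] by blast
 obtain d' where d': "d' : charts_at N (y t)" using charts_at_exists[OF N xy(2)] by blast
 have C: "prod_chart (mdim M) c c' : charts_at ?P (x t, y t)" if "c : charts_at M (x t)" "c' : charts_at N (y t)" for c c'
  using that by (auto simp: charts_at_prod)
 have "proj1 M N (x t, y t) v c i = velocity M a b x t c i" for c i
 proof (cases "c : charts_at M (x t) & i < mdim M")
  case True
  then show ?thesis using proj_chart(1)[OF M N xy v _ d', of c i] C[OF _ d', of c]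
   by (simp add: v_def velocity_def snd_prod_chart)
 qed (auto simp: proj1_def tangent_map_def Let_def velocity_def)
 then show "proj1 M N (x t, y t) v = velocity M a b x t" by (intro ext)
 have "proj2 M N (x t, y t) v c i = velocity N a b y t c i" for c i
 proof (cases "c : charts_at N (y t) & i < mdim N")
  case True
  then show ?thesis using proj_chart(2)[OF M N xy v d, of c i] C[OF d, of c]
   by (simp add: v_def velocity_def snd_prod_chart)
 qed (auto simp: proj2_def tangent_map_def Let_def velocity_def)
 then show "proj2 M N (x t, y t) v = velocity N a b y t" by (intro ext)
qed

section \<open>Weak derivatives are local\<close>

definition smooth_supp :: "real set => (real => real) => bool" where
 "smooth_supp K \<psi> \<longleftrightarrow> (ALL k. diff1 k \<psi>) & compact K & (ALL t. t ~: K --> \<psi> t = 0)"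

text \<open>The compact set carrying the function becomes an argument, so that it can be cut up
  together with the function.\<close>

lemma test_function_iff: "test_function S \<psi> \<longleftrightarrow> (EX K. K \<subseteq> S & smooth_supp K \<psi>)"
 unfolding test_function_def smooth_supp_def diff1_iff by blast

lemma smooth_supp_deriv:
 assumes "smooth_supp K \<psi>"
 shows "continuous_on UNIV \<psi>" "continuous_on UNIV (deriv \<psi>)" "t ~: K ==> \<psi> t = 0" "t ~: K ==> deriv \<psi> t = 0" "compact K"
  "\<psi> field_differentiable at s"
proof -
 have d: "!!t. \<psi> field_differentiable at t" "!!t. deriv \<psi> field_differentiable at t"
  using assms[unfolded smooth_supp_def] by (metis diff1.simps(2))+
 then show "continuous_on UNIV \<psi>" "continuous_on UNIV (deriv \<psi>)" "\<psi> field_differentiable at s"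
  by (auto intro!: continuous_at_imp_continuous_on field_differentiable_imp_continuous_at)
 show "t ~: K ==> \<psi> t = 0" "compact K" using assms by (auto simp: smooth_supp_def)
 assume t: "t ~: K"
 have "open (- K)" using assms by (auto simp: smooth_supp_def intro: compact_imp_closed)
 then have "\<forall>\<^sub>F s in nhds t. \<psi> s = 0"
  using t assms by (intro eventually_nhds[THEN iffD2] exI[of _ "- K"]) (auto simp: smooth_supp_def)
 then have "deriv \<psi> t = deriv (%s. 0) t" by (intro deriv_cong_ev) auto
 then show "deriv \<psi> t = 0" by simp
qed

lemma integrable_mult_supp:
 fixes u f :: "real => real"
 assumes u: "set_integrable lebesgue K u" and K: "compact K" and f: "continuous_on UNIV f" "!!t. t ~: K ==> f t = 0"
 shows "integrable lebesgue (%t. u t * f t)"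
proof -
 have "continuous_on K f" using f(1) continuous_on_subset by blast
 moreover have "K : sets lebesgue" using K by (simp add: lmeasurable_compact fmeasurableD)
 ultimately have "(%t. f t * u t) absolutely_integrable_on K"
  using u K by (intro absolutely_integrable_bounded_measurable_product_real continuous_imp_measurable_on_sets_lebesgue
    compact_imp_bounded compact_continuous_image) auto
 then have "integrable lebesgue (%t. indicator K t *\<^sub>R (f t * u t))" by (simp add: set_integrable_def)
 also have "(%t. indicator K t *\<^sub>R (f t * u t)) = (%t. u t * f t)"
  using f(2) by (force simp: fun_eq_iff indicator_def)
 finally show ?thesis .
qed

lemma set_integral_supp:
 fixes f :: "real => real"
 assumes "K \<subseteq> S" "!!t. t ~: K ==> f t = 0"
 shows "(LINT t:S|lebesgue. f t) = (LINT t|lebesgue. f t)"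
 unfolding set_lebesgue_integral_def using assms by (intro Bochner_Integration.integral_cong) (auto simp: indicator_def)

text \<open>Off the support of a test function both integrands vanish, so that the open set over which one
  integrates does not matter.\<close>

lemma weak_deriv_on_iff:
 "weak_deriv_on S u w \<longleftrightarrow> locally_integrable_on S u & locally_integrable_on S w &
  (ALL K \<psi>. K \<subseteq> S --> smooth_supp K \<psi> --> (LINT t|lebesgue. u t * deriv \<psi> t) = - (LINT t|lebesgue. w t * \<psi> t))"
proof -
 have "(LINT t:S|lebesgue. u t * deriv \<psi> t) = (LINT t|lebesgue. u t * deriv \<psi> t)"
  "(LINT t:S|lebesgue. w t * \<psi> t) = (LINT t|lebesgue. w t * \<psi> t)" if "K \<subseteq> S" "smooth_supp K \<psi>" for K \<psi>
  using smooth_supp_deriv(3,4)[OF that(2)] by (auto intro!: set_integral_supp[OF that(1)])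
 then show ?thesis unfolding weak_deriv_on_def test_function_iff by (smt (verit))
qed

lemma weak_deriv_on_subset: "weak_deriv_on S u w ==> T \<subseteq> S ==> weak_deriv_on T u w"
 unfolding weak_deriv_on_iff locally_integrable_on_def by (meson subset_trans)

lemma weak_deriv_on_cong:
 assumes "!!t. t : S ==> u t = u' t" "!!t. t : S ==> w t = w' t"
 shows "weak_deriv_on S u w \<longleftrightarrow> weak_deriv_on S u' w'"
proof -
 have "locally_integrable_on S u = locally_integrable_on S u'" "locally_integrable_on S w = locally_integrable_on S w'"
  unfolding locally_integrable_on_def using assms by (metis (no_types, lifting) set_integrable_cong subsetD)+
 moreover have "(LINT t:S|lebesgue. u t * deriv \<psi> t) = (LINT t:S|lebesgue. u' t * deriv \<psi> t)"
  "(LINT t:S|lebesgue. w t * \<psi> t) = (LINT t:S|lebesgue. w' t * \<psi> t)" for \<psi>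
  unfolding set_lebesgue_integral_def using assms by (auto intro!: Bochner_Integration.integral_cong simp: indicator_def)
 ultimately show ?thesis by (simp add: weak_deriv_on_def)
qed

lemma compact_closed_interval_cover:
 fixes e :: "real => real"
 assumes "compact K" "!!t. t : K ==> e t > 0"
 obtains F where "finite F" "F \<subseteq> K" "K \<subseteq> (UN t:F. ball t (e t))"
 by (rule compactE_image[OF assms(1), of K "%t. ball t (e t)"]) (use assms(2) in auto)

text \<open>A test function is split by smooth bumps into pieces carried by small balls, where the
  identity is known. Local integrability makes all integrals finite, so that they add up.\<close>

lemma weak_deriv_on_local:
 fixes u w :: "real => real"
 assumes loc: "!!t. t : S ==> EX T. open T & t : T & T \<subseteq> S & weak_deriv_on T u w"
 shows "weak_deriv_on S u w"
proof -
 have "EX e>0. cball t e \<subseteq> S & weak_deriv_on (cball t e) u w" if t: "t : S" for t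
 proof -
  obtain T where T: "open T" "t : T" "T \<subseteq> S" "weak_deriv_on T u w" using loc[OF t] by blast
  then obtain e where "e > 0" "cball t e \<subseteq> T" using open_contains_cball by blast
  then show ?thesis using T weak_deriv_on_subset by (intro exI[of _ e]) auto
 qed
 then obtain e where e: "!!t. t : S ==> e t > 0" "!!t. t : S ==> cball t (e t) \<subseteq> S" "!!t. t : S ==> weak_deriv_on (cball t (e t)) u w"
  by metis
 have li: "locally_integrable_on S g" if "!!t. t : S ==> locally_integrable_on (cball t (e t)) g" for g :: "real => real"
  unfolding locally_integrable_on_def
 proof (intro allI impI)
  fix K assume K: "compact K & K \<subseteq> S"
  obtain F where F: "finite F" "F \<subseteq> K" "K \<subseteq> (UN t:F. ball t (e t))"
   by (rule compact_closed_interval_cover[of K e]) (use K e(1) in auto)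
  have "set_integrable lebesgue (UN t:F. cball t (e t)) g"
   using F K that by (intro set_integrable_UN) (auto simp: locally_integrable_on_def)
  then show "set_integrable lebesgue K g"
  proof (rule set_integrable_subset)
   show "K : sets lebesgue" using K by (simp add: lmeasurable_compact fmeasurableD)
   have "(UN t:F. ball t (e t)) \<subseteq> (UN t:F. cball t (e t))" by (intro UN_mono) auto
   with F(3) show "K \<subseteq> (UN t:F. cball t (e t))" by (rule subset_trans)
  qed
 qed
 have liu: "locally_integrable_on S u" and liw: "locally_integrable_on S w"
  using e(3) by (auto intro!: li simp: weak_deriv_on_iff)
 \<comment> \<open>The covering uses half radii: a bump carried by the ball of radius
   \<open>e t\<close> is \<open>1\<close> on the half ball, so the remainder lives on what the other
   half balls cover, which is the hypothesis for the smaller \<open>F\<close>.\<close>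
 have main: "(LINT t|lebesgue. u t * deriv \<psi> t) = - (LINT t|lebesgue. w t * \<psi> t)"
  if "finite F" "F \<subseteq> S" "K \<subseteq> S" "K \<subseteq> (UN t:F. ball t (e t / 2))" "smooth_supp K \<psi>" for F K \<psi>
  using that
 proof (induction F arbitrary: K \<psi>)
  case empty
  then show ?case using smooth_supp_deriv(3,4)[OF empty(4)] by simp
 next
  case (insert t F)
  note \<psi> = smooth_supp_deriv[OF insert.prems(4)]
  have t: "t : S" "0 < e t" using insert.prems e(1) by auto
  obtain b where b: "!!k. diff1 k b" "!!s. \<bar>s - t\<bar> <= e t / 2 ==> b s = 1" "!!s. e t <= \<bar>s - t\<bar> ==> b s = 0"
   using smooth_bump_exists[OF t(2), of t] by metis
  \<comment> \<open>The part near \<open>t\<close>, handled on the ball around \<open>t\<close>, and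
    the remainder, handled by the induction hypothesis.\<close>
  define f g where "f s = \<psi> s * b s" and "g s = \<psi> s * (1 + (-1) * b s)" for s
  have dpsi: "!!k. diff1 k \<psi>" using insert.prems(4) by (simp add: smooth_supp_def)
  have fg: "diff1 k f" "diff1 k g" for k
   unfolding f_def[abs_def] g_def[abs_def] by (intro diff1_mult diff1_add diff1_const dpsi b(1))+
  have f: "smooth_supp (K \<inter> cball t (e t)) f"
   unfolding smooth_supp_def using \<psi>(3,5) b fg by (auto simp: f_def dist_real_def abs_minus_commute intro!: compact_Int)
  have g: "smooth_supp (K - ball t (e t / 2)) g"
   unfolding smooth_supp_def using \<psi>(3,5) b fg
   by (auto simp: g_def dist_real_def abs_minus_commute intro!: compact_diff)
  have \<psi>_eq: "\<psi> = (%s. f s + g s)" by (auto simp: f_def g_def algebra_simps)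
  have d\<psi>: "deriv \<psi> s = deriv f s + deriv g s" for s
   unfolding \<psi>_eq by (rule deriv_add[OF smooth_supp_deriv(6)[OF f] smooth_supp_deriv(6)[OF g]])
  have ef: "(LINT s|lebesgue. u s * deriv f s) = - (LINT s|lebesgue. w s * f s)"
   using e(3)[OF t(1)] f unfolding weak_deriv_on_iff by (meson Int_lower2)
  have eg: "(LINT s|lebesgue. u s * deriv g s) = - (LINT s|lebesgue. w s * g s)"
   by (rule insert.IH[OF _ _ _ g]) (use insert.prems in auto)
  have int: "integrable lebesgue (%s. u s * deriv h s)" "integrable lebesgue (%s. w s * h s)"
   if "smooth_supp K' h" "K' \<subseteq> S" for h K'
   using that liu liw smooth_supp_deriv[OF that(1)] by (auto intro!: integrable_mult_supp[of K'] simp: locally_integrable_on_def)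
  have sub: "K \<inter> cball t (e t) \<subseteq> S" "K - ball t (e t / 2) \<subseteq> S" using insert.prems by auto
  have "(LINT s|lebesgue. u s * deriv \<psi> s) = (LINT s|lebesgue. u s * deriv f s + u s * deriv g s)"
   by (simp add: d\<psi> distrib_left)
  also have "\<dots> = - ((LINT s|lebesgue. w s * f s) + (LINT s|lebesgue. w s * g s))"
   using ef eg by (simp add: Bochner_Integration.integral_add[OF int(1)[OF f sub(1)] int(1)[OF g sub(2)]])
  also have "\<dots> = - (LINT s|lebesgue. w s * f s + w s * g s)"
   by (simp add: Bochner_Integration.integral_add[OF int(2)[OF f sub(1)] int(2)[OF g sub(2)]])
  also have "(%s. w s * f s + w s * g s) = (%s. w s * \<psi> s)" by (simp add: \<psi>_eq distrib_left)
  finally show ?case .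
 qed
 show ?thesis
  unfolding weak_deriv_on_iff
 proof (intro conjI allI impI liu liw)
  fix K \<psi> assume K: "K \<subseteq> S" "smooth_supp K \<psi>"
  obtain F where "finite F" "F \<subseteq> K" "K \<subseteq> (UN t:F. ball t (e t / 2))"
   by (rule compact_closed_interval_cover[OF smooth_supp_deriv(5)[OF K(2)], of "%t. e t / 2"]) (use K(1) e(1) in auto)
  then show "(LINT t|lebesgue. u t * deriv \<psi> t) = - (LINT t|lebesgue. w t * \<psi> t)"
   using K by (intro main[of F K]) auto
 qed
qed

text \<open>A product chart only controls the times at which both shadows lie in chart domains. To
  obtain the identity on the full domain of a chart of one factor, these open sets of times are
  joined by \<open>weak_deriv_on_local\<close>; the other direction is restriction.\<close>

lemma weak_derivative_prod:
 assumes M: "smooth_manifold M" and N: "smooth_manifold N"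
  and v: "!!t. t : {a..b} ==> v t : tangent_space (prod_manifold M N) (x t, y t)"
 shows "weak_derivative (prod_manifold M N) a b (%t. (x t, y t)) (%t. ((x t, y t), v t)) \<longleftrightarrow>
  weak_derivative M a b x (%t. (x t, proj1 M N (x t, y t) (v t))) &
  weak_derivative N a b y (%t. (y t, proj2 M N (x t, y t) (v t)))" (is "?L \<longleftrightarrow> ?R1 & ?R2")
proof -
 let ?P = "prod_manifold M N" and ?I = "{a<..<b}"
 let ?x = "path_on M a b x" and ?y = "path_on N a b y"
 let ?v1 = "%t. proj1 M N (x t, y t) (v t)" and ?v2 = "%t. proj2 M N (x t, y t) (v t)"
 have pts: "x t : points M" "y t : points N" if "t : {a..b}" ?x ?y for t
  using continuous_shadow_mem[of a b "mtop M" x] continuous_shadow_mem[of a b "mtop N" y] that by auto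
 have L: "?L \<longleftrightarrow> ?x & ?y & (ALL c:atlas M. ALL c':atlas N. ALL i<mdim M + mdim N.
   weak_deriv_on {t:?I. x t : fst c & y t : fst c'} (%t. snd (prod_chart (mdim M) c c') (x t, y t) i) (%t. v t (prod_chart (mdim M) c c') i))"
  unfolding weak_derivative_def prod_manifold_atlas using v pts
  by (auto simp: continuous_map_pairwise comp_def total_space_def)
 have R1: "?R1 \<longleftrightarrow> ?x & (ALL c:atlas M. ALL i<mdim M. weak_deriv_on {t:?I. x t : fst c} (%t. snd c (x t) i) (%t. ?v1 t c i))" if ?x ?y
  using that proj_tangent(1)[OF M N pts(1,2) v] pts by (simp add: weak_derivative_def total_space_def)
 have R2: "?R2 \<longleftrightarrow> ?y & (ALL c:atlas N. ALL i<mdim N. weak_deriv_on {t:?I. y t : fst c} (%t. snd c (y t) i) (%t. ?v2 t c i))" if ?x ?y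
  using that proj_tangent(2)[OF M N pts(1,2) v] pts by (simp add: weak_derivative_def total_space_def)
 have opn: "open {t:?I. z t : U}" if "continuous_map (top_of_set {a..b}) X z" "openin X U" for X and z :: "real => 'c" and U
 proof -
  have "continuous_map (top_of_set ?I) X z"
   by (rule continuous_map_from_subtopology_mono[OF that(1)]) auto
  from openin_continuous_map_preimage[OF this that(2)] show ?thesis by (simp add: openin_open_eq)
 qed
 have c1: "weak_deriv_on {t:?I. x t : fst c & y t : fst c'} (%t. snd (prod_chart (mdim M) c c') (x t, y t) i) (%t. v t (prod_chart (mdim M) c c') i)
   \<longleftrightarrow> weak_deriv_on {t:?I. x t : fst c & y t : fst c'} (%t. snd c (x t) i) (%t. ?v1 t c i)"
  if "c : atlas M" "c' : atlas N" "i < mdim M" ?x ?y for c c' i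
  using that pts v proj_chart(1)[OF M N, of _ _ _ c c' i]
  by (intro weak_deriv_on_cong) (auto simp: charts_at_def snd_prod_chart)
 have c2: "weak_deriv_on {t:?I. x t : fst c & y t : fst c'} (%t. snd (prod_chart (mdim M) c c') (x t, y t) (mdim M + i)) (%t. v t (prod_chart (mdim M) c c') (mdim M + i))
   \<longleftrightarrow> weak_deriv_on {t:?I. x t : fst c & y t : fst c'} (%t. snd c' (y t) i) (%t. ?v2 t c' i)"
  if "c : atlas M" "c' : atlas N" "i < mdim N" ?x ?y for c c' i
  using that pts v proj_chart(2)[OF M N, of _ _ _ c c' i]
  by (intro weak_deriv_on_cong) (auto simp: charts_at_def snd_prod_chart)
 show ?thesis
 proof
  assume l: ?L
  then have x: ?x and y: ?y using L by auto
  have opn2: "open {t:?I. x t : fst c & y t : fst c'}" if "c : atlas M" "c' : atlas N" for c c'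
   using open_Int[OF opn[OF x chart_openin[OF M that(1)]] opn[OF y chart_openin[OF N that(2)]]]
   by (rule back_subst[of "open"]) auto
  have "weak_deriv_on {t:?I. x t : fst c} (%t. snd c (x t) i) (%t. ?v1 t c i)" if c: "c : atlas M" and i: "i < mdim M" for c i
  proof (rule weak_deriv_on_local)
   fix t assume t: "t : {t:?I. x t : fst c}"
   then have "y t : points N" using pts x y by auto
   then obtain c' where c': "c' : atlas N" "y t : fst c'" using charts_at_exists[OF N] unfolding charts_at_def by blast
   show "EX T. open T & t : T & T \<subseteq> {t:?I. x t : fst c} & weak_deriv_on T (%t. snd c (x t) i) (%t. ?v1 t c i)"
    using l[unfolded L] c1[OF c c'(1) i x y] opn2[OF c c'(1)] t c c' i
    by (intro exI[of _ "{t:?I. x t : fst c & y t : fst c'}"]) auto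
  qed
  moreover have "weak_deriv_on {t:?I. y t : fst c'} (%t. snd c' (y t) i) (%t. ?v2 t c' i)" if c': "c' : atlas N" and i: "i < mdim N" for c' i
  proof (rule weak_deriv_on_local)
   fix t assume t: "t : {t:?I. y t : fst c'}"
   then have "x t : points M" using pts x y by auto
   then obtain c where c: "c : atlas M" "x t : fst c" using charts_at_exists[OF M] unfolding charts_at_def by blast
   show "EX T. open T & t : T & T \<subseteq> {t:?I. y t : fst c'} & weak_deriv_on T (%t. snd c' (y t) i) (%t. ?v2 t c' i)"
    using l[unfolded L] c2[OF c(1) c' i x y] opn2[OF c(1) c'] t c c' i
    by (intro exI[of _ "{t:?I. x t : fst c & y t : fst c'}"]) auto
  qed
  ultimately show "?R1 & ?R2" unfolding R1[OF x y] R2[OF x y] using x y by blast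
 next
  assume r: "?R1 & ?R2"
  then have x: ?x and y: ?y by (auto simp: weak_derivative_def)
  have "weak_deriv_on {t:?I. x t : fst c & y t : fst c'} (%t. snd (prod_chart (mdim M) c c') (x t, y t) i) (%t. v t (prod_chart (mdim M) c c') i)"
   if c: "c : atlas M" "c' : atlas N" and i: "i < mdim M + mdim N" for c c' i
  proof (cases "i < mdim M")
   case True
   then have "weak_deriv_on {t:?I. x t : fst c} (%t. snd c (x t) i) (%t. ?v1 t c i)"
    using r[unfolded R1[OF x y]] c by blast
   then show ?thesis unfolding c1[OF c True x y] by (rule weak_deriv_on_subset) auto
  next
   case False
   then obtain k where k: "i = mdim M + k" "k < mdim N" using i by (metis add_diff_inverse_nat nat_add_left_cancel_less)
   then have "weak_deriv_on {t:?I. y t : fst c'} (%t. snd c' (y t) k) (%t. ?v2 t c' k)"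
    using r[unfolded R2[OF x y]] c by blast
   then show ?thesis unfolding k(1) c2[OF c k(2) x y] by (rule weak_deriv_on_subset) auto
  qed
  then show ?L unfolding L using x y by blast
 qed
qed

section \<open>Weak membership\<close>

text \<open>The counterpart of \<open>reg\<close> for relations: everywhere in the classical and
  almost everywhere in the weak case.\<close>

primrec holds :: "behaviour_type => real set => (real => bool) => bool" where
 "holds Classical J Q \<longleftrightarrow> (ALL t:J. Q t)"
| "holds Weak J Q \<longleftrightarrow> negligible {t : J. \<not> Q t}"

lemma holds_mono: "holds \<tt> J Q ==> (!!t. t : J ==> Q t ==> Q' t) ==> holds \<tt> J Q'"
 by (cases \<tt>) (auto elim!: negligible_subset)

lemma holds_conj: "holds \<tt> J (%t. Q t & Q' t) \<longleftrightarrow> holds \<tt> J Q & holds \<tt> J Q'"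
proof (cases \<tt>)
 case Weak
 have "{t : J. \<not> (Q t & Q' t)} = {t : J. \<not> Q t} \<union> {t : J. \<not> Q' t}" by auto
 then show ?thesis using Weak by (simp add: negligible_Un_eq)
qed auto

lemma AE_lebesgue_on_iff:
 fixes S :: "real set"
 assumes "S : sets lebesgue"
 shows "(AE t in lebesgue_on S. Q t) \<longleftrightarrow> negligible {t : S. \<not> Q t}"
proof -
 have "(AE t in lebesgue_on S. Q t) \<longleftrightarrow> (AE t in lebesgue. t : S --> Q t)"
  using assms by (simp add: AE_restrict_space_iff)
 also have "\<dots> \<longleftrightarrow> {t. \<not> (t : S --> Q t)} : null_sets lebesgue"
  by (simp add: completion.AE_iff_null_sets) 
 also have "{t. \<not> (t : S --> Q t)} = {t : S. \<not> Q t}" by auto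
 finally show ?thesis by (simp add: negligible_iff_null_sets)
qed

lemma has_bochner_integral_zero:
 fixes h :: "real => real"
 assumes "negligible {t : {a..b}. h t ~= 0}"
 shows "has_bochner_integral (lebesgue_on {a..b}) h 0"
proof -
 have ae: "AE t in lebesgue_on {a..b}. h t = 0" using assms by (simp add: AE_lebesgue_on_iff)
 have "set_integrable lebesgue {a..b} (%t. 0 :: real)" by (simp add: set_integrable_def)
 then have "set_integrable lebesgue {a..b} h"
  by (rule absolutely_integrable_spike[OF _ assms]) auto
 then have "integrable (lebesgue_on {a..b}) h" by (simp add: integrable_restrict_space set_integrable_def)
 moreover have "integral\<^sup>L (lebesgue_on {a..b}) h = 0" by (rule integral_eq_zero_AE[OF ae])
 ultimately show ?thesis by (simp add: has_bochner_integral_iff)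
qed

text \<open>Apply the hypothesis to bounded continuous functions converging almost everywhere to the sign
  of \<open>k\<close>.\<close>

lemma ae_zero_of_orthogonal:
 fixes k :: "real => real"
 assumes ortho: "!!g. continuous_on UNIV g ==> has_bochner_integral (lebesgue_on {a..b}) (%s. g s * k s) 0"
 shows "negligible {s : {a..b}. k s ~= 0}"
proof -
 let ?M = "lebesgue_on {a..b}"
 have ik: "integrable ?M k" using ortho[of "%s. 1"] by (simp add: has_bochner_integral_iff)
 then have km [measurable]: "k : borel_measurable ?M" by (rule borel_measurable_integrable)
 have "(%s. sgn (k s)) : borel_measurable ?M" by measurable
 then have "(%s. sgn (k s)) measurable_on {a..b}" by (subst measurable_on_iff_borel_measurable) auto
 then obtain N :: "real set" and g where N: "negligible N" and g: "!!n. continuous_on UNIV (g n)"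
  and lim: "!!s. s ~: N ==> (%n. g n s) \<longlonglongrightarrow> (if s : {a..b} then sgn (k s) else 0)" unfolding measurable_on_def by blast
 \<comment> \<open>Truncation to \<open>[-1, 1]\<close> provides the dominating function; it does
   not affect the limit, as a sign already lies in that range.\<close>
 define \<phi> where "\<phi> n s = max (- 1) (min 1 (g n s))" for n s
 have c\<phi>: "continuous_on UNIV (\<phi> n)" for n
  unfolding \<phi>_def[abs_def] by (intro continuous_intros g)
 have "(%n. integral\<^sup>L ?M (%s. \<phi> n s * k s)) \<longlonglongrightarrow> integral\<^sup>L ?M (%s. \<bar>k s\<bar>)"
 proof (rule integral_dominated_convergence)
  show "(%s. \<bar>k s\<bar>) : borel_measurable ?M" by measurable
  show "(%s. \<phi> n s * k s) : borel_measurable ?M" for n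
   using ortho[OF c\<phi>[of n]] by (auto simp: has_bochner_integral_iff)
  show "integrable ?M (%s. \<bar>k s\<bar>)" using ik by (rule integrable_abs)
  have "(%n. \<phi> n s * k s) \<longlonglongrightarrow> \<bar>k s\<bar>" if "s : {a..b}" "s ~: N" for s
  proof -
   have "(%n. \<phi> n s * k s) \<longlonglongrightarrow> max (- 1) (min 1 (sgn (k s))) * k s"
    unfolding \<phi>_def using lim[OF that(2)] that(1) by (intro tendsto_intros) auto
   moreover have "max (- 1) (min 1 (sgn (k s))) * k s = \<bar>k s\<bar>" by (simp add: sgn_if)
   ultimately show ?thesis by simp
  qed
  then have "negligible {s : {a..b}. \<not> ((%n. \<phi> n s * k s) \<longlonglongrightarrow> \<bar>k s\<bar>)}"
   by (intro negligible_subset[OF N]) auto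
  then show "AE s in ?M. (%n. \<phi> n s * k s) \<longlonglongrightarrow> \<bar>k s\<bar>" by (simp add: AE_lebesgue_on_iff)
  have "\<bar>\<phi> n s\<bar> <= 1" for n s by (auto simp: \<phi>_def)
  then show "AE s in ?M. norm (\<phi> n s * k s) <= \<bar>k s\<bar>" for n
   by (intro always_eventually) (simp add: abs_mult mult_left_le_one_le)
 qed
 moreover have "integral\<^sup>L ?M (%s. \<phi> n s * k s) = 0" for n
  using ortho[OF c\<phi>[of n]] by (auto simp: has_bochner_integral_iff)
 ultimately have "integral\<^sup>L ?M (%s. \<bar>k s\<bar>) = 0" by (simp add: LIMSEQ_const_iff)
 then have "AE s in ?M. \<bar>k s\<bar> = 0"
  using integral_nonneg_eq_0_iff_AE[OF integrable_abs[OF ik]] by simp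
 then show ?thesis by (simp add: AE_lebesgue_on_iff)
qed

definition perfect_pairing :: "'v::real_vector set => 'w::real_vector set => ('w => 'v => real) => bool" where
 "perfect_pairing V W B \<longleftrightarrow>
  (ALL e:W. functional_on V (B e) & ((ALL f:V. B e f = 0) --> e = 0)) &
  (ALL f:V. functional_on W (%e. B e f) & ((ALL e:W. B e f = 0) --> f = 0))"

text \<open>What is used of a realized dual: equal ranks and a pairing that is nondegenerate on both
  sides. Unlike \<open>with_dual\<close> itself, this is preserved by \<open>psum\<close> and
  \<open>pprod\<close>.\<close>

definition dual_pair :: "'m manifold => ('m, 'v::real_vector, 'w::real_vector) paired => bool" where
 "dual_pair M E \<longleftrightarrow> vector_bundle M (vb E) & vector_bundle M (dvb E) & vrank (dvb E) = vrank (vb E) &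
  (ALL x:points M. perfect_pairing (fibre (vb E) x) (fibre (dvb E) x) (pairing E))"

lemma dual_pairD:
 assumes "dual_pair M E"
 shows "vector_bundle M (vb E)" "vector_bundle M (dvb E)" "vrank (dvb E) = vrank (vb E)"
  and "x : points M ==> e : fibre (dvb E) x ==> functional_on (fibre (vb E) x) (pairing E e)"
  and "x : points M ==> f : fibre (vb E) x ==> functional_on (fibre (dvb E) x) (%e. pairing E e f)"
  and "x : points M ==> e : fibre (dvb E) x ==> (!!f. f : fibre (vb E) x ==> pairing E e f = 0) ==> e = 0"
  and "x : points M ==> f : fibre (vb E) x ==> (!!e. e : fibre (dvb E) x ==> pairing E e f = 0) ==> f = 0"
 using assms unfolding dual_pair_def perfect_pairing_def by blast+

lemma dual_pair_zero:
 assumes "dual_pair M E" "x : points M"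
 shows "e : fibre (dvb E) x ==> pairing E e 0 = 0" "f : fibre (vb E) x ==> pairing E 0 f = 0"
  "subspace (fibre (vb E) x)" "subspace (fibre (dvb E) x)"
proof -
 show S: "subspace (fibre (vb E) x)" "subspace (fibre (dvb E) x)"
  using vb_fibre_subspace[OF dual_pairD(1)[OF assms(1)] assms(2)] vb_fibre_subspace[OF dual_pairD(2)[OF assms(1)] assms(2)] .
 show "e : fibre (dvb E) x ==> pairing E e 0 = 0" by (rule functional_on_0[OF dual_pairD(4)[OF assms] subspace_0[OF S(1)]])
 show "f : fibre (vb E) x ==> pairing E 0 f = 0" by (rule functional_on_0[OF dual_pairD(5)[OF assms] subspace_0[OF S(2)]])
qed

text \<open>A vector on which all covectors vanish is zero because the covectors of a dual frame
  return its coordinates.\<close>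

lemma dual_pair_with_dual:
 assumes M: "smooth_manifold M" and E: "vector_bundle M E"
 shows "dual_pair M (with_dual E)"
proof -
 have "f = 0" if x: "x : points M" and f: "f : fibre E x" and z: "ALL e:dual_space (fibre E x). e f = 0" for x f
 proof -
  obtain U s where U: "(U, s) : vframes E" "x : U" using vb_frame_exists[OF E x] .
  note fr = vb_is_frame[OF E U]
  have "vcoord E s x f i = 0" if "i < vrank E" for i
   using bspec[OF z is_frame_mem[OF dual_space_frame[OF fr, THEN conjunct1] that]] f by simp
  then show ?thesis using sum_frame_coord[OF fr f] by simp
 qed
 moreover have "e = 0" if "e : dual_space (fibre E x)" "ALL f:fibre E x. e f = 0" for e x
  using that by (auto simp: dual_space_def fun_eq_iff)
 ultimately show ?thesis
  unfolding dual_pair_def perfect_pairing_def with_dual_def using E vector_bundle_dual[OF M E]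
  by (auto simp: functional_on_def plus_fun_def scaleR_fun_def dest: dual_space_functional)
qed

lemma functional_on_times:
 assumes "functional_on V g" "functional_on W h"
 shows "functional_on (V \<times> W) (%(v, w). g v + h w)"
 using assms unfolding functional_on_def by (auto simp: distrib_left)

text \<open>Nondegeneracy is tested with pairs whose second or first component is zero.\<close>

lemma perfect_pairing_times:
 assumes 1: "perfect_pairing V W B" "subspace V" "subspace W" and 2: "perfect_pairing V' W' B'" "subspace V'" "subspace W'"
 shows "perfect_pairing (V \<times> V') (W \<times> W') (%(a, b) (v, w). B a v + B' b w)"
proof -
 note f = 1(1)[unfolded perfect_pairing_def] 2(1)[unfolded perfect_pairing_def]
 have o: "0 : V" "0 : W" "0 : V'" "0 : W'" using assms by (auto intro: subspace_0)
 have z: "a : W ==> B a 0 = 0" "v : V ==> B 0 v = 0" "b : W' ==> B' b 0 = 0" "w : V' ==> B' 0 w = 0" for a b v w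
  using f o by (auto intro: functional_on_0 functional_on_0[where g = "%e. B e v"] functional_on_0[where g = "%e. B' e w"])
 have n1: "e = 0" if e: "e : W \<times> W'" and h: "ALL u:V \<times> V'. B (fst e) (fst u) + B' (snd e) (snd u) = 0" for e
 proof -
  have m: "fst e : W" "snd e : W'" using e by auto
  have "B (fst e) v = 0" if "v : V" for v using h[rule_format, of "(v, 0)"] that o z(3)[OF m(2)] by simp
  moreover have "B' (snd e) w = 0" if "w : V'" for w using h[rule_format, of "(0, w)"] that o z(1)[OF m(1)] by simp
  ultimately show ?thesis using f m by (simp add: prod_eq_iff)
 qed
 have n2: "u = 0" if u: "u : V \<times> V'" and h: "ALL e:W \<times> W'. B (fst e) (fst u) + B' (snd e) (snd u) = 0" for u
 proof -
  have m: "fst u : V" "snd u : V'" using u by auto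
  have "B a (fst u) = 0" if "a : W" for a using h[rule_format, of "(a, 0)"] that o z(4)[OF m(2)] by simp
  moreover have "B' b (snd u) = 0" if "b : W'" for b using h[rule_format, of "(0, b)"] that o z(2)[OF m(1)] by simp
  ultimately show ?thesis using f m by (simp add: prod_eq_iff)
 qed
 have "functional_on (V \<times> V') (%(v, w). B a v + B' b w)" if "a : W" "b : W'" for a b
  using f that by (auto intro!: functional_on_times)
 moreover have "functional_on (W \<times> W') (%(a, b). B a v + B' b w)" if "v : V" "w : V'" for v w
  using f that by (auto intro!: functional_on_times)
 ultimately show ?thesis
  unfolding perfect_pairing_def using n1 n2 by (simp add: case_prod_unfold mem_Times_iff)
qed

lemma dual_pair_perfect:
 assumes "dual_pair M E" "x : points M"
 shows "perfect_pairing (fibre (vb E) x) (fibre (dvb E) x) (pairing E)"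
 using assms by (simp add: dual_pair_def)

lemma dual_pair_psum:
 assumes M: "smooth_manifold M" and E: "dual_pair M E" and F: "dual_pair M F"
 shows "dual_pair M (psum E F)"
 using dual_pairD(1-3)[OF E] dual_pairD(1-3)[OF F]
  perfect_pairing_times[OF dual_pair_perfect[OF E] dual_pair_zero(3,4)[OF E] dual_pair_perfect[OF F] dual_pair_zero(3,4)[OF F]]
 unfolding dual_pair_def[of M "psum E F"] by (simp add: psum_def vector_bundle_dsum[OF M])

lemma dual_pair_pprod:
 assumes M: "smooth_manifold M" and N: "smooth_manifold N" and E: "dual_pair M E" and F: "dual_pair N F"
 shows "dual_pair (prod_manifold M N) (pprod E F)"
 using dual_pairD(1-3)[OF E] dual_pairD(1-3)[OF F]
  perfect_pairing_times[OF dual_pair_perfect[OF E] dual_pair_zero(3,4)[OF E] dual_pair_perfect[OF F] dual_pair_zero(3,4)[OF F]]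
 unfolding dual_pair_def[of "prod_manifold M N" "pprod E F"] by (auto simp: pprod_def vector_bundle_ext_prod[OF M N])

text \<open>For \<open>sg = 1\<close> the symmetric form of Dirac structures and for
  \<open>sg = - 1\<close> the symplectic form of Lagrangian subbundles; the argument order is that
  of the integrand in \<open>weakly_in\<close>, with the test section second.\<close>

definition pair_form :: "real => ('m, 'v, 'w) paired => 'v \<times> 'w => 'v \<times> 'w => real" where
 "pair_form sg E u v = pairing E (snd v) (fst u) + sg * pairing E (snd u) (fst v)"

definition maximal_isotropic ::
  "real => 'm manifold => ('m, 'v::real_vector, 'w::real_vector) paired => ('m => ('v \<times> 'w) set) => bool" where
 "maximal_isotropic sg M E D \<longleftrightarrow>
  (ALL x:points M. ALL u:fibre (dbl E) x. u : D x \<longleftrightarrow> (ALL d:D x. pair_form sg E u d = 0))"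

lemma vector_bundle_dbl: "smooth_manifold M ==> dual_pair M E ==> vector_bundle M (dbl E)"
 unfolding dbl_def by (intro vector_bundle_dsum dual_pairD)

lemma pair_form_functional:
 assumes E: "dual_pair M E" and x: "x : points M" and u: "u : fibre (dbl E) x"
 shows "functional_on (fibre (dbl E) x) (pair_form sg E u)" "functional_on (fibre (dbl E) x) (%v. pair_form sg E v u)"
 using dual_pairD(4,5)[OF E x] u unfolding functional_on_def pair_form_def dbl_def by (auto simp: algebra_simps)

text \<open>The rank condition enters here: a fibre of \<open>dbl E\<close> has twice the dimension
  of an isotropic fibre of \<open>D\<close>, so the latter cannot be enlarged.\<close>

lemma dirac_structure_maximal:
 assumes M: "smooth_manifold M" and E: "dual_pair M E" and D: "dirac_structure M E D"
 shows "maximal_isotropic 1 M E D"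
 unfolding maximal_isotropic_def
proof (intro ballI)
 let ?n = "vrank (vb E)" and ?V = "%x. fibre (dbl E) x"
 note B = vector_bundle_dbl[OF M E]
 fix x u assume x: "x : points M" and u: "u : ?V x"
 obtain U s where "(U, s) : vframes (dbl E)" "x : U" using vb_frame_exists[OF B x] .
 from is_frame_has_basis[OF vb_is_frame[OF B this]] have V: "subspace (?V x)" "has_basis (2 * ?n) (?V x)"
  using vb_fibre_subspace[OF B x] dual_pairD(3)[OF E] by (simp_all add: dbl_def mult_2)
 obtain b where b: "is_frame ?n b (D x)" and DV: "D x \<subseteq> ?V x"
  using D x unfolding dirac_structure_def smooth_subbundle_def by blast
 have iso: "pair_form 1 E d d' = 0" if "d : D x" "d' : D x" for d d'
  using D x that unfolding dirac_structure_def pair_form_def by (force simp: case_prod_unfold)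
 have z: "(0, e) : ?V x \<longleftrightarrow> e : fibre (dvb E) x" "(f, 0) : ?V x \<longleftrightarrow> f : fibre (vb E) x" for e f
  using dual_pair_zero(3,4)[OF E x] by (auto simp: dbl_def subspace_0)
 have nondeg: "w = 0" if w: "w : ?V x" and h: "!!v. v : ?V x ==> pair_form 1 E w v = 0" for w
 proof -
  have m: "fst w : fibre (vb E) x" "snd w : fibre (dvb E) x" using w by (auto simp: dbl_def)
  have "fst w = 0"
  proof (rule dual_pairD(7)[OF E x m(1)])
   fix e assume "e : fibre (dvb E) x" then show "pairing E e (fst w) = 0"
    using h[of "(0, e)"] z dual_pair_zero(1)[OF E x m(2)] by (simp add: pair_form_def)
  qed
  moreover have "snd w = 0"
  proof (rule dual_pairD(6)[OF E x m(2)])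
   fix f assume "f : fibre (vb E) x" then show "pairing E (snd w) f = 0"
    using h[of "(f, 0)"] z dual_pair_zero(2)[OF E x m(1)] by (simp add: pair_form_def)
  qed
  ultimately show ?thesis by (simp add: prod_eq_iff)
 qed
 have sym: "pair_form 1 E v w = pair_form 1 E w v" for v w by (simp add: pair_form_def)
 show "u : D x \<longleftrightarrow> (ALL d:D x. pair_form 1 E u d = 0)"
 proof
  assume "ALL d:D x. pair_form 1 E u d = 0"
  then show "u : D x"
   by (intro isotropic_half_dim_maximal[OF V pair_form_functional[OF E x] nondeg b DV iso u]) (simp_all add: sym)
 qed (use iso in blast)
qed

lemma weakly_in_alt:
 "weakly_in sg M E D a b (%t. (x t, u t)) \<longleftrightarrow> (%t. (x t, u t)) : L1c M (dbl E) a b &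
  (ALL \<eta>. test_section M (dbl E) D a b x \<eta> -->
   has_bochner_integral (lebesgue_on {a..b}) (%t. pair_form sg E (u t) (snd (\<eta> t))) 0)"
 unfolding weakly_in_def pair_form_def by (simp add: case_prod_unfold comp_def)

text \<open>Test sections are built from a local continuous frame of \<open>D\<close>, cut off in
  time and multiplied by arbitrary continuous functions; so the pairing with each frame vector
  vanishes almost everywhere, and maximality turns this into membership. The rank \<open>k\<close>
  is left open because admissibility does not name one.\<close>

lemma weakly_in_iff:
 fixes x :: "real => 'm"
 assumes M: "smooth_manifold M" and E: "dual_pair M E" and D: "maximal_isotropic sg M E D"
  and sub: "smooth_subbundle M (dbl E) k D" and ab: "a < b"
 shows "weakly_in sg M E D a b (%t. (x t, u t)) \<longleftrightarrow>
  creg Weak M (dbl E) a b (%t. (x t, u t)) & holds Weak {a..b} (%t. u t : D (x t))"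
proof -
 note B = vector_bundle_dbl[OF M E]
 have L1: "(%t. (x t, u t)) : L1c M (dbl E) a b \<longleftrightarrow> creg Weak M (dbl E) a b (%t. (x t, u t))"
  using L1c_iff_creg[OF M B] ab by simp
 show ?thesis
 proof
  assume R: "creg Weak M (dbl E) a b (%t. (x t, u t)) & holds Weak {a..b} (%t. u t : D (x t))"
  have "has_bochner_integral (lebesgue_on {a..b}) (%t. pair_form sg E (u t) (snd (\<eta> t))) 0"
   if \<eta>: "test_section M (dbl E) D a b x \<eta>" for \<eta>
  proof (rule has_bochner_integral_zero, rule negligible_subset)
   show "negligible {t : {a..b}. u t ~: D (x t)}" using R by simp
   show "{t : {a..b}. pair_form sg E (u t) (snd (\<eta> t)) ~= 0} \<subseteq> {t : {a..b}. u t ~: D (x t)}"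
   proof safe
    fix t assume t: "t : {a..b}" and u: "u t : D (x t)" and n: "pair_form sg E (u t) (snd (\<eta> t)) ~= 0"
    have "snd (\<eta> t) : D (x t)" using \<eta> t unfolding test_section_def by blast
    then show False using D creg_mem[OF conjunct1[OF R] t] u n unfolding maximal_isotropic_def by auto
   qed
  qed
  then show "weakly_in sg M E D a b (%t. (x t, u t))" unfolding weakly_in_alt L1 using R by blast
 next
  assume W: "weakly_in sg M E D a b (%t. (x t, u t))"
  then have cr: "creg Weak M (dbl E) a b (%t. (x t, u t))" unfolding weakly_in_alt L1 by blast
  have xc: "path_on M a b x" using creg_shadow[OF cr] by (simp add: comp_def)
  define S where "S = {t : {a<..<b}. u t ~: D (x t)}"
  have "EX U. openin (top_of_set S) U & p : U & negligible U" if p: "p : S" for p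
  proof -
   have p': "a < p" "p < b" using p by (auto simp: S_def)
   then have "p : {a..b}" by simp
   with framed_along_subbundle[OF M B sub xc] obtain \<delta> \<sigma> where \<delta>: "\<delta> > 0"
    "ALL c d. a <= c & c <= p & p <= d & d <= b & d - c < \<delta> -->
     (ALL i<k. creg Classical M (dbl E) c d (%r. (x r, \<sigma> i r))) & (ALL r:{c..d}. is_frame k (%i. \<sigma> i r) (D (x r)))"
    unfolding framed_along_def by blast
   \<comment> \<open>The interval of radius \<open>e\<close> around \<open>p\<close> stays in
     \<open>{a..b}\<close> and is shorter than \<open>\<delta>\<close>; the cut-off below lives on
     half that radius and so keeps away from \<open>a\<close> and \<open>b\<close>.\<close>
   define e where "e = min (\<delta> / 3) (min (p - a) (b - p))"
   have "e <= \<delta> / 3" unfolding e_def by (rule min.cobounded1)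
   moreover have "e <= p - a" "e <= b - p" by (simp_all add: e_def)
   ultimately have e: "e > 0" "e <= \<delta> / 3" "a <= p - e" "p + e <= b" using \<delta>(1) p' by (auto simp: e_def)
   define c d where "c = p - e" and "d = p + e"
   have cd: "a <= c" "c < p" "p < d" "d <= b" using e by (auto simp: c_def d_def)
   have "d - c < \<delta>" using e \<delta>(1) by (simp add: c_def d_def)
   then have \<sigma>: "i < k ==> creg Classical M (dbl E) c d (%r. (x r, \<sigma> i r))" and fr: "r : {c..d} ==> is_frame k (%i. \<sigma> i r) (D (x r))" for i r
    using \<delta>(2)[rule_format, of c d] cd by auto
   \<comment> \<open>A tent function: test sections need only be continuous.\<close>
   define \<kappa> where "\<kappa> s = max 0 (e / 2 - \<bar>s - p\<bar>)" for s
   define \<tau> where "\<tau> i s = (if s : {c..d} then \<kappa> s *\<^sub>R \<sigma> i s else 0)" for i s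
   have \<kappa>0: "\<kappa> s = 0" if "s ~: cball p (e / 2)" for s
    using that abs_minus_commute[of p s] by (simp add: \<kappa>_def dist_real_def max_def)
   have supp: "cball p (e / 2) \<subseteq> {a<..<b}"
   proof
    fix s assume "s : cball p (e / 2)"
    then have "\<bar>p - s\<bar> <= e / 2" by (simp add: dist_real_def)
    then have "p - s <= e / 2" "s - p <= e / 2" by linarith+
    then show "s : {a<..<b}" using e by simp
   qed
   have \<kappa>c: "continuous_on X \<kappa>" for X unfolding \<kappa>_def[abs_def] by (intro continuous_intros)
   have \<tau>c: "creg Classical M (dbl E) a b (%t. (x t, \<tau> i t))" if i: "i < k" for i
   proof -
    have xs: "path_on M q r (fst \<circ> (%t. (x t, \<tau> i t)))" if "a <= q" "r <= b" for q r
     using continuous_map_from_subtopology_mono[OF xc, of "{q..r}"] that by (simp add: comp_def)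
    have mid: "creg Classical M (dbl E) c d (%t. (x t, \<tau> i t))"
     by (rule creg_cong[OF _ creg_scale_continuous[OF B \<sigma>[OF i] \<kappa>c]]) (simp add: \<tau>_def)
    have "creg Classical M (dbl E) a c (%t. (x t, \<tau> i t))"
     by (rule creg_cong[OF _ creg_subinterval[OF creg_zero[OF B xc]]])
      (use cd e \<kappa>0 in \<open>auto simp: \<tau>_def c_def dist_real_def\<close>)
    from creg_glue[OF xs _ _ this mid] cd have "creg Classical M (dbl E) a d (%t. (x t, \<tau> i t))" by simp
    moreover have "creg Classical M (dbl E) d b (%t. (x t, \<tau> i t))"
     by (rule creg_cong[OF _ creg_subinterval[OF creg_zero[OF B xc]]])
      (use cd e \<kappa>0 in \<open>auto simp: \<tau>_def d_def dist_real_def\<close>)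
    ultimately show ?thesis using creg_glue[OF xs, of a b d] cd by simp
   qed
   have Dsub: "subspace (D (x t))" "D (x t) \<subseteq> fibre (dbl E) (x t)" if "t : {a..b}" for t
    using sub continuous_shadow_mem[OF xc that] unfolding smooth_subbundle_def by blast+
   have \<tau>D: "\<tau> i t : D (x t)" if "i < k" "t : {a..b}" for i t
    using Dsub(1)[OF that(2)] is_frame_mem[OF fr that(1), of t] by (auto simp: \<tau>_def intro: subspace_0 subspace_scale)
   define h where "h i t = pair_form sg E (u t) (\<tau> i t)" for i t
   have neg: "negligible {s : {a..b}. h i s ~= 0}" if i: "i < k" for i
   proof (rule ae_zero_of_orthogonal)
    fix g :: "real => real" assume g: "continuous_on UNIV g"
    have "continuous_on {a..b} g" using g continuous_on_subset by blast
    from creg_scale_continuous[OF B \<tau>c[OF i] this]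
    have "continuous_curve M (dbl E) a b (%t. (x t, g t *\<^sub>R \<tau> i t))" by (simp add: continuous_curve_iff_creg[OF M B])
    moreover have "EX K. compact K & K \<subseteq> {a<..<b} & (ALL t:{a..b} - K. snd (x t, g t *\<^sub>R \<tau> i t) = 0)"
     using \<kappa>0 supp by (intro exI[of _ "cball p (e / 2)"]) (auto simp: \<tau>_def)
    ultimately have "test_section M (dbl E) D a b x (%t. (x t, g t *\<^sub>R \<tau> i t))"
     unfolding test_section_def using \<tau>D[OF i] Dsub(1) by (auto intro: subspace_scale)
    with W have "has_bochner_integral (lebesgue_on {a..b}) (%t. pair_form sg E (u t) (snd (x t, g t *\<^sub>R \<tau> i t))) 0"
     unfolding weakly_in_alt by blast
    moreover have "pair_form sg E (u t) (g t *\<^sub>R \<tau> i t) = g t * h i t" if t: "t : {a..b}" for t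
     using pair_form_functional(1)[OF E _ _, of "x t" "u t" sg] creg_mem[OF cr t] \<tau>D[OF i t] Dsub(2)[OF t]
     unfolding functional_on_def h_def by auto
    ultimately show "has_bochner_integral (lebesgue_on {a..b}) (%s. g s * h i s) 0"
     by (subst has_bochner_integral_cong[OF refl _ refl, where g = "%t. pair_form sg E (u t) (g t *\<^sub>R \<tau> i t)"]) auto
   qed
   \<comment> \<open>On this neighbourhood the cut-off is positive. Where membership fails, the
     pairing with at least one of the finitely many frame vectors is nonzero, so a finite union of
     null sets covers \<open>U\<close>.\<close>
   define U where "U = S \<inter> ball p (e / 2)"
   have "U \<subseteq> (UN i:{..<k}. {s : {a..b}. h i s ~= 0})"
   proof
    fix s assume s: "s : U"
    then have sab: "s : {a..b}" and nD: "u s ~: D (x s)" and d: "\<bar>p - s\<bar> < e / 2"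
     by (auto simp: U_def S_def dist_real_def)
    from d have "p - s < e / 2" "s - p < e / 2" by linarith+
    then have scd: "s : {c..d}" using e by (simp add: c_def d_def)
    have \<kappa>s: "\<kappa> s > 0" using d abs_minus_commute[of p s] unfolding \<kappa>_def less_max_iff_disj by linarith
    have m: "x s : points M" "u s : fibre (dbl E) (x s)" using creg_mem[OF cr sab] by auto
    note fn = pair_form_functional(1)[OF E m, of sg]
    show "s : (UN i:{..<k}. {s : {a..b}. h i s ~= 0})"
    proof (rule ccontr)
     assume "\<not> ?thesis"
     then have "h i s = 0" if "i < k" for i using that sab by auto
     moreover have "h i s = \<kappa> s * pair_form sg E (u s) (\<sigma> i s)" if "i < k" for i
      using fn is_frame_mem[OF fr[OF scd] that] Dsub(2)[OF sab] scd unfolding h_def \<tau>_def functional_on_def by auto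
     ultimately have z: "pair_form sg E (u s) (\<sigma> i s) = 0" if "i < k" for i using that \<kappa>s by auto
     have "pair_form sg E (u s) w = 0" if w: "w : D (x s)" for w
     proof -
      have "pair_form sg E (u s) (SUM i<k. frame_coord k (%i. \<sigma> i s) w i *\<^sub>R \<sigma> i s) =
        (SUM i<k. frame_coord k (%i. \<sigma> i s) w i * pair_form sg E (u s) (\<sigma> i s))"
       using is_frame_mem[OF fr[OF scd]] Dsub(2)[OF sab] vb_fibre_subspace[OF B m(1)]
       by (intro functional_on_sum[OF fn]) auto
      then show ?thesis using z by (simp add: sum_frame_coord[OF fr[OF scd] w])
     qed
     then show False using D m nD unfolding maximal_isotropic_def by blast
    qed
   qed
   moreover have "negligible (UN i:{..<k}. {s : {a..b}. h i s ~= 0})" using neg by (intro negligible_Union) auto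
   ultimately have "negligible U" by (rule negligible_subset[rotated])
   then show ?thesis using p e by (intro exI[of _ U]) (auto simp: U_def)
  qed
  then have "negligible S" by (subst locally_negligible_alt) blast
  then have "negligible (S \<union> {a, b})" by simp
  then have "negligible {t : {a..b}. u t ~: D (x t)}" by (rule negligible_subset) (auto simp: S_def)
  then show "creg Weak M (dbl E) a b (%t. (x t, u t)) & holds Weak {a..b} (%t. u t : D (x t))" using cr by simp
 qed
qed

lemma creg_dbl_pprod:
 assumes M: "smooth_manifold M" and N: "smooth_manifold N" and E: "dual_pair M E" and F: "dual_pair N F"
 shows "creg \<tt> (prod_manifold M N) (dbl (pprod E F)) a b (%t. ((x t, y t), ((f1 t, f2 t), (e1 t, e2 t)))) \<longleftrightarrow>
  creg \<tt> M (dbl E) a b (%t. (x t, (f1 t, e1 t))) & creg \<tt> N (dbl F) a b (%t. (y t, (f2 t, e2 t)))"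
 unfolding dbl_def pprod_def paired.simps
 by (simp add: creg_dsum[OF smooth_manifold_prod[OF M N] vector_bundle_ext_prod[OF M N] vector_bundle_ext_prod[OF M N]]
   creg_ext_prod[OF M N] creg_dsum[OF M] creg_dsum[OF N] dual_pairD(1,2)[OF E] dual_pairD(1,2)[OF F]) blast

lemma vector_bundle_dbl_pprod:
 assumes M: "smooth_manifold M" and N: "smooth_manifold N" and E: "dual_pair M E" and F: "dual_pair N F"
 shows "vector_bundle (prod_manifold M N) (dbl (pprod E F))"
 unfolding dbl_def pprod_def paired.simps
 by (intro vector_bundle_dsum smooth_manifold_prod vector_bundle_ext_prod M N dual_pairD(1,2)[OF E] dual_pairD(1,2)[OF F])

text \<open>A test section of one factor is completed by the zero section of the other, which is why
  the zero vectors must belong to \<open>R1\<close> and \<open>R2\<close>; conversely the two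
  integrals are added.\<close>

lemma weakly_in_box_sum:
 assumes M: "smooth_manifold M" and N: "smooth_manifold N" and E: "dual_pair M E" and F: "dual_pair N F" and ab: "a <= b"
  and R: "!!x. x : points M ==> 0 : R1 x" "!!y. y : points N ==> 0 : R2 y"
 shows "weakly_in sg (prod_manifold M N) (pprod E F) (box_sum R1 R2) a b (%t. ((x t, y t), ((f1 t, f2 t), (e1 t, e2 t)))) \<longleftrightarrow>
  weakly_in sg M E R1 a b (%t. (x t, (f1 t, e1 t))) & weakly_in sg N F R2 a b (%t. (y t, (f2 t, e2 t)))"
  (is "weakly_in sg ?P ?EF _ _ _ ?\<xi> \<longleftrightarrow> weakly_in _ _ _ _ _ _ ?\<xi>1 & weakly_in _ _ _ _ _ _ ?\<xi>2")
proof -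
 note P = smooth_manifold_prod[OF M N]
 note BE = vector_bundle_dbl[OF M E] and BF = vector_bundle_dbl[OF N F]
 note BP = vector_bundle_dbl_pprod[OF M N E F]
 have L1: "?\<xi> : L1c ?P (dbl ?EF) a b \<longleftrightarrow> ?\<xi>1 : L1c M (dbl E) a b & ?\<xi>2 : L1c N (dbl F) a b"
  unfolding L1c_iff_creg[OF P BP ab] L1c_iff_creg[OF M BE ab] L1c_iff_creg[OF N BF ab] creg_dbl_pprod[OF M N E F] ..
 show ?thesis
 proof (cases "?\<xi>1 : L1c M (dbl E) a b & ?\<xi>2 : L1c N (dbl F) a b")
  case False then show ?thesis unfolding weakly_in_alt L1 by blast
 next
  case True
  then have c1: "creg Weak M (dbl E) a b ?\<xi>1" and c2: "creg Weak N (dbl F) a b ?\<xi>2"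
   unfolding L1c_iff_creg[OF M BE ab] L1c_iff_creg[OF N BF ab] by auto
  have xc: "path_on M a b x" and yc: "path_on N a b y"
   using creg_shadow[OF c1] creg_shadow[OF c2] by (simp_all add: comp_def)
  have m1: "x t : points M" "f1 t : fibre (vb E) (x t)" "e1 t : fibre (dvb E) (x t)" if "t : {a..b}" for t
   using creg_mem[OF c1 that] by (auto simp: dbl_def)
  have m2: "y t : points N" "f2 t : fibre (vb F) (y t)" "e2 t : fibre (dvb F) (y t)" if "t : {a..b}" for t
   using creg_mem[OF c2 that] by (auto simp: dbl_def)
  have ts: "test_section ?P (dbl ?EF) (box_sum R1 R2) a b (%t. (x t, y t)) (%t. ((x t, y t), ((\<phi>1 t, \<phi>2 t), (\<epsilon>1 t, \<epsilon>2 t)))) \<longleftrightarrow>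
    test_section M (dbl E) R1 a b x (%t. (x t, (\<phi>1 t, \<epsilon>1 t))) & test_section N (dbl F) R2 a b y (%t. (y t, (\<phi>2 t, \<epsilon>2 t)))"
   (is "?l \<longleftrightarrow> ?r") for \<phi>1 \<phi>2 \<epsilon>1 \<epsilon>2
  proof -
   have supp: "(EX K. compact K & K \<subseteq> {a<..<b} & (ALL t:{a..b} - K. Q t & Q' t)) \<longleftrightarrow>
     (EX K. compact K & K \<subseteq> {a<..<b} & (ALL t:{a..b} - K. Q t)) & (EX K. compact K & K \<subseteq> {a<..<b} & (ALL t:{a..b} - K. Q' t))" for Q Q'
   proof (intro iffI; elim exE conjE)
    fix K K' assume "compact K" "K \<subseteq> {a<..<b}" "ALL t:{a..b} - K. Q t" "compact K'" "K' \<subseteq> {a<..<b}" "ALL t:{a..b} - K'. Q' t"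
    then show "EX K. compact K & K \<subseteq> {a<..<b} & (ALL t:{a..b} - K. Q t & Q' t)"
     by (intro exI[of _ "K \<union> K'"]) auto
   qed blast
   have z: "((u, v), (w, q)) = 0 \<longleftrightarrow> (u, w) = 0 & (v, q) = 0" for u :: 'c and v :: 'e and w :: 'd and q :: 'f
    by (auto simp: zero_prod_def)
   show ?thesis
    unfolding test_section_def continuous_curve_iff_creg[OF P BP] continuous_curve_iff_creg[OF M BE]
     continuous_curve_iff_creg[OF N BF] creg_dbl_pprod[OF M N E F] fst_conv snd_conv z supp
    by (auto simp: box_sum_def)
  qed
  have pf: "pair_form sg ?EF ((f1 t, f2 t), (e1 t, e2 t)) ((\<phi>1, \<phi>2), (\<epsilon>1, \<epsilon>2)) =
    pair_form sg E (f1 t, e1 t) (\<phi>1, \<epsilon>1) + pair_form sg F (f2 t, e2 t) (\<phi>2, \<epsilon>2)" for t \<phi>1 \<phi>2 \<epsilon>1 \<epsilon>2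
   by (simp add: pair_form_def pprod_def algebra_simps)
  have z1: "pair_form sg E (f1 t, e1 t) (0, 0) = 0" and z2: "pair_form sg F (f2 t, e2 t) (0, 0) = 0" if "t : {a..b}" for t
   using dual_pair_zero(1,2)[OF E m1(1)[OF that]] dual_pair_zero(1,2)[OF F m2(1)[OF that]] m1[OF that] m2[OF that]
   by (simp_all add: pair_form_def)
  have ts0: "test_section M (dbl E) R1 a b x (%t. (x t, (0, 0)))" "test_section N (dbl F) R2 a b y (%t. (y t, (0, 0)))"
   unfolding test_section_def continuous_curve_iff_creg[OF M BE] continuous_curve_iff_creg[OF N BF]
   using creg_zero[OF BE xc] creg_zero[OF BF yc] R m1(1) m2(1) by (auto simp: zero_prod_def intro!: exI[of _ "{}"])
  \<comment> \<open>Off \<open>{a..b}\<close> the base point of a test section is arbitrary. It is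
    replaced by the shadow everywhere, so that sections of the two factors can be paired.\<close>
  have ts_eq: "test_section M' B' D' a b x' \<eta> \<longleftrightarrow> test_section M' B' D' a b x' (%t. (x' t, snd (\<eta> t)))"
   if "!!t. t : {a..b} ==> fst (\<eta> t) = x' t" "smooth_manifold M'" "vector_bundle M' B'" for M' and B' :: "('p, 'q::real_vector) vbundle" and D' x' \<eta>
  proof -
   have eq: "\<eta> t = (x' t, snd (\<eta> t))" if "t : {a..b}" for t using that \<open>!!t. t : {a..b} ==> fst (\<eta> t) = x' t\<close> by (auto simp: prod_eq_iff)
   have "creg Classical M' B' a b \<eta> \<longleftrightarrow> creg Classical M' B' a b (%t. (x' t, snd (\<eta> t)))"
    using creg_cong[of a b \<eta> "%t. (x' t, snd (\<eta> t))", OF eq] creg_cong[of a b "%t. (x' t, snd (\<eta> t))" \<eta>, OF eq[symmetric]] by blast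
   then show ?thesis unfolding test_section_def continuous_curve_iff_creg[OF that(2,3)] using that(1) by auto
  qed
  have cong: "has_bochner_integral (lebesgue_on {a..b}) h 0" if "has_bochner_integral (lebesgue_on {a..b}) h' 0"
   "!!t. t : {a..b} ==> h t = h' t" for h h' :: "real => real"
   using that by (subst has_bochner_integral_cong[OF refl _ refl, where g = h']) auto
  show ?thesis
  proof
   assume "weakly_in sg ?P ?EF (box_sum R1 R2) a b ?\<xi>"
   then have W: "has_bochner_integral (lebesgue_on {a..b}) (%t. pair_form sg ?EF ((f1 t, f2 t), (e1 t, e2 t)) (snd (\<eta> t))) 0"
    if "test_section ?P (dbl ?EF) (box_sum R1 R2) a b (%t. (x t, y t)) \<eta>" for \<eta>
    using that unfolding weakly_in_alt by blast
   have "has_bochner_integral (lebesgue_on {a..b}) (%t. pair_form sg E (f1 t, e1 t) (snd (\<eta> t))) 0"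
    if \<eta>: "test_section M (dbl E) R1 a b x \<eta>" for \<eta>
   proof -
    have "test_section M (dbl E) R1 a b x (%t. (x t, (fst (snd (\<eta> t)), snd (snd (\<eta> t)))))"
     using ts_eq[OF _ M BE, of \<eta> x R1] \<eta> unfolding test_section_def by auto
    then have "test_section ?P (dbl ?EF) (box_sum R1 R2) a b (%t. (x t, y t)) (%t. ((x t, y t), ((fst (snd (\<eta> t)), 0), (snd (snd (\<eta> t)), 0))))"
     using ts[of "%t. fst (snd (\<eta> t))" "%t. 0" "%t. snd (snd (\<eta> t))" "%t. 0"] ts0 by simp
    from W[OF this] show ?thesis by (rule cong) (simp add: pf z2)
   qed
   moreover have "has_bochner_integral (lebesgue_on {a..b}) (%t. pair_form sg F (f2 t, e2 t) (snd (\<eta> t))) 0"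
    if \<eta>: "test_section N (dbl F) R2 a b y \<eta>" for \<eta>
   proof -
    have "test_section N (dbl F) R2 a b y (%t. (y t, (fst (snd (\<eta> t)), snd (snd (\<eta> t)))))"
     using ts_eq[OF _ N BF, of \<eta> y R2] \<eta> unfolding test_section_def by auto
    then have "test_section ?P (dbl ?EF) (box_sum R1 R2) a b (%t. (x t, y t)) (%t. ((x t, y t), ((0, fst (snd (\<eta> t))), (0, snd (snd (\<eta> t))))))"
     using ts[of "%t. 0" "%t. fst (snd (\<eta> t))" "%t. 0" "%t. snd (snd (\<eta> t))"] ts0 by simp
    from W[OF this] show ?thesis by (rule cong) (simp add: pf z1)
   qed
   ultimately show "weakly_in sg M E R1 a b ?\<xi>1 & weakly_in sg N F R2 a b ?\<xi>2" unfolding weakly_in_alt using True by blast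
  next
   assume W: "weakly_in sg M E R1 a b ?\<xi>1 & weakly_in sg N F R2 a b ?\<xi>2"
   have "has_bochner_integral (lebesgue_on {a..b}) (%t. pair_form sg ?EF ((f1 t, f2 t), (e1 t, e2 t)) (snd (\<eta> t))) 0"
    if \<eta>: "test_section ?P (dbl ?EF) (box_sum R1 R2) a b (%t. (x t, y t)) \<eta>" for \<eta>
   proof -
    define \<phi>1 \<phi>2 \<epsilon>1 \<epsilon>2 where "\<phi>1 t = fst (fst (snd (\<eta> t)))" and "\<phi>2 t = snd (fst (snd (\<eta> t)))"
     and "\<epsilon>1 t = fst (snd (snd (\<eta> t)))" and "\<epsilon>2 t = snd (snd (snd (\<eta> t)))" for t
    have s: "snd (\<eta> t) = ((\<phi>1 t, \<phi>2 t), (\<epsilon>1 t, \<epsilon>2 t))" for t by (simp add: \<phi>1_def \<phi>2_def \<epsilon>1_def \<epsilon>2_def)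
    have "test_section ?P (dbl ?EF) (box_sum R1 R2) a b (%t. (x t, y t)) (%t. ((x t, y t), snd (\<eta> t)))"
     using ts_eq[OF _ P BP, of \<eta> "%t. (x t, y t)"] \<eta> unfolding test_section_def by auto
    then have "test_section M (dbl E) R1 a b x (%t. (x t, (\<phi>1 t, \<epsilon>1 t)))" "test_section N (dbl F) R2 a b y (%t. (y t, (\<phi>2 t, \<epsilon>2 t)))"
     unfolding s ts by auto
    with W have "has_bochner_integral (lebesgue_on {a..b}) (%t. pair_form sg E (f1 t, e1 t) (\<phi>1 t, \<epsilon>1 t)) 0"
     "has_bochner_integral (lebesgue_on {a..b}) (%t. pair_form sg F (f2 t, e2 t) (\<phi>2 t, \<epsilon>2 t)) 0"
     unfolding weakly_in_alt by fastforce+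
    from has_bochner_integral_add[OF this] show ?thesis unfolding s pf by simp
   qed
   then show "weakly_in sg ?P ?EF (box_sum R1 R2) a b ?\<xi>" unfolding weakly_in_alt L1 using True by blast
  qed
 qed
qed

section \<open>Maximality of the interconnection\<close>

text \<open>The velocity is kept as a separate curve \<open>v\<close>, since in the weak case it is
  only a representative of the weak derivative; this gives both behaviours the same form.\<close>

primrec derivative_along :: "behaviour_type => 'm manifold => real => real => (real => 'm) => (real => 'm tvec) => bool" where
 "derivative_along Classical M a b x v \<longleftrightarrow> C1_curve M a b x & (ALL t:{a..b}. v t = velocity M a b x t)"
| "derivative_along Weak M a b x v \<longleftrightarrow> creg Weak M (tangent M) a b (%t. (x t, v t)) & weak_derivative M a b x (%t. (x t, v t))"

lemma derivative_along_creg: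
 assumes M: "smooth_manifold M" and ab: "a < b" and v: "derivative_along \<tt> M a b x v"
 shows "creg \<tt> M (tangent M) a b (%t. (x t, v t))"
proof (cases \<tt>)
 case Classical
 then have "C1_curve M a b x" and eq: "!!t. t : {a..b} ==> velocity M a b x t = v t" using v by simp_all
 show ?thesis unfolding Classical
  by (rule creg_cong[OF _ C1_curve_velocity[OF M \<open>C1_curve M a b x\<close> ab]]) (simp add: eq)
qed (use v in simp)

lemma derivative_along_cong:
 assumes eq: "!!t. t : {a..b} ==> v t = v' t" and v: "derivative_along \<tt> M a b x v"
 shows "derivative_along \<tt> M a b x v'"
proof (cases \<tt>)
 case Weak
 have "creg Weak M (tangent M) a b (%t. (x t, v' t))"
  by (rule creg_cong[of a b "%t. (x t, v t)"]) (use v eq Weak in auto)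
 moreover have "weak_deriv_on {t : {a<..<b}. x t : fst c} (%t. snd c (x t) i) (%t. v' t c i) \<longleftrightarrow>
   weak_deriv_on {t : {a<..<b}. x t : fst c} (%t. snd c (x t) i) (%t. v t c i)" for c i
  by (rule weak_deriv_on_cong) (auto simp: eq)
 ultimately show ?thesis using v eq Weak by (simp add: weak_derivative_def)
qed (use v eq in simp)

lemma derivative_along_prod:
 assumes M: "smooth_manifold M" and N: "smooth_manifold N" and ab: "a < b"
  and v: "!!t. t : {a..b} ==> v t : tangent_space (prod_manifold M N) (x t, y t)"
 shows "derivative_along \<tt> (prod_manifold M N) a b (%t. (x t, y t)) v \<longleftrightarrow>
  derivative_along \<tt> M a b x (%t. proj1 M N (x t, y t) (v t)) &
  derivative_along \<tt> N a b y (%t. proj2 M N (x t, y t) (v t))"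
proof (cases \<tt>)
 case Weak
 then show ?thesis
  using creg_tangent_prod[OF M N v, where \<tt> = Weak] weak_derivative_prod[OF M N v] by auto
next
 case Classical
 let ?P = "prod_manifold M N"
 show ?thesis
 proof (cases "C1_curve M a b x & C1_curve N a b y")
  case True
  then have C1: "C1_curve ?P a b (%t. (x t, y t))" by (simp add: C1_curve_prod[OF M N])
  have "v t = velocity ?P a b (%t. (x t, y t)) t \<longleftrightarrow>
    proj1 M N (x t, y t) (v t) = velocity M a b x t & proj2 M N (x t, y t) (v t) = velocity N a b y t" if t: "t : {a..b}" for t
  proof -
   have m: "velocity ?P a b (%t. (x t, y t)) t : tangent_space ?P (x t, y t)" "x t : points M" "y t : points N"
    using creg_mem[OF C1_curve_velocity[OF smooth_manifold_prod[OF M N] C1 ab] t] by auto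
   show ?thesis
    using velocity_prod[OF M N C1 ab t] proj_inj[OF M N m(2,3) v[OF t] m(1)] by metis
  qed
  then show ?thesis using True C1 Classical by auto
 qed (use Classical in \<open>auto simp: C1_curve_prod[OF M N]\<close>)
qed

primrec resistive_along :: "behaviour_type => 'm manifold => ('m, 'r::real_vector, 'rd::real_vector) paired
  => ('m => ('r \<times> 'rd) set) => real => real => (real => 'm) => (real => 'r) => (real => 'rd) => bool" where
 "resistive_along Classical M E R a b x f e \<longleftrightarrow> (ALL t:{a..b}. (f t, e t) : R (x t))"
| "resistive_along Weak M E R a b x f e \<longleftrightarrow> weakly_in (- 1) M E R a b (%t. (x t, (f t, e t)))"

lemma resistive_along_prod:
 assumes M: "smooth_manifold M" and N: "smooth_manifold N" and E: "dual_pair M E" and F: "dual_pair N F" and ab: "a < b"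
  and R: "!!x. x : points M ==> 0 : R1 x" "!!y. y : points N ==> 0 : R2 y"
 shows "resistive_along \<tt> (prod_manifold M N) (pprod E F) (box_sum R1 R2) a b (%t. (x t, y t)) (%t. (f1 t, f2 t)) (%t. (e1 t, e2 t)) \<longleftrightarrow>
  resistive_along \<tt> M E R1 a b x f1 e1 & resistive_along \<tt> N F R2 a b y f2 e2"
proof (cases \<tt>)
 case Classical
 then show ?thesis by (auto simp: box_sum_def)
next
 case Weak
 then show ?thesis using weakly_in_box_sum[OF M N E F _ R, of a b] ab by simp
qed

lemma dual_pair_phs_space:
 assumes M: "smooth_manifold M" and "dual_pair M Er" "dual_pair M Ep"
 shows "dual_pair M (phs_space M Er Ep)"
 unfolding phs_space_def by (intro dual_pair_psum dual_pair_with_dual vector_bundle_tangent assms)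

lemma creg_dbl_phs_space:
 assumes M: "smooth_manifold M" and Er: "dual_pair M Er" and Ep: "dual_pair M Ep"
 shows "creg \<tt> M (dbl (phs_space M Er Ep)) a b (%t. (x t, ((v t, f t, y t), (\<alpha> t, e t, u t)))) \<longleftrightarrow>
  creg \<tt> M (tangent M) a b (%t. (x t, v t)) & creg \<tt> M (vb Er) a b (%t. (x t, f t)) & creg \<tt> M (vb Ep) a b (%t. (x t, y t)) &
  creg \<tt> M (dual_bundle (tangent M)) a b (%t. (x t, \<alpha> t)) & creg \<tt> M (dvb Er) a b (%t. (x t, e t)) &
  creg \<tt> M (dvb Ep) a b (%t. (x t, u t))"
 unfolding dbl_def phs_space_def psum_def with_dual_def paired.simps
 by (simp add: creg_dsum[OF M] vector_bundle_dsum[OF M] dual_pairD(1,2)[OF Er] dual_pairD(1,2)[OF Ep]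
   vector_bundle_tangent[OF M] vector_bundle_dual[OF M vector_bundle_tangent[OF M]])

lemma creg_port_bundle:
 assumes M: "smooth_manifold M" and Er: "dual_pair M Er" and Ep: "dual_pair M Ep"
 shows "creg \<tt> M (port_bundle Er Ep) a b (%t. (x t, f t, y t, e t, u t)) \<longleftrightarrow>
  creg \<tt> M (vb Er) a b (%t. (x t, f t)) & creg \<tt> M (vb Ep) a b (%t. (x t, y t)) &
  creg \<tt> M (dvb Er) a b (%t. (x t, e t)) & creg \<tt> M (dvb Ep) a b (%t. (x t, u t))"
 unfolding port_bundle_def
 by (simp add: creg_dsum[OF M] vector_bundle_dsum[OF M] dual_pairD(1,2)[OF Er] dual_pairD(1,2)[OF Ep])

text \<open>The common normal form of both behaviours, applied to the two component systems and to
  the interconnected one. The Dirac relation becomes a fibrewise condition under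
  \<open>holds\<close>; the resistive relation stays unevaluated, as it only has to be compared
  between product and factors.\<close>

lemma behaviour_iff:
 assumes M: "smooth_manifold M" and Er: "dual_pair M Er" and Ep: "dual_pair M Ep"
  and sub: "smooth_subbundle M (dbl (phs_space M Er Ep)) k D" and max: "maximal_isotropic 1 M (phs_space M Er Ep) D"
  and H: "smooth_fun_on M (points M) H" and ab: "a < b"
 shows "(%t. (x t, f t, y t, e t, u t)) : behaviour \<tt> M Er Ep D R H a b \<longleftrightarrow>
  creg \<tt> M (port_bundle Er Ep) a b (%t. (x t, f t, y t, e t, u t)) &
  (EX v. derivative_along \<tt> M a b x v &
   holds \<tt> {a..b} (%t. ((v t, f t, - y t), (differential M H (x t), e t, u t)) : D (x t))) &
  resistive_along \<tt> M Er R a b x f e"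
proof -
 note B = vector_bundle_dbl[OF M dual_pair_phs_space[OF M Er Ep]]
 have PB: "vector_bundle M (port_bundle Er Ep)"
  unfolding port_bundle_def by (intro vector_bundle_dsum M dual_pairD(1,2)[OF Er] dual_pairD(1,2)[OF Ep])
 show ?thesis
 proof (cases \<tt>)
  case Classical
  then show ?thesis
   by (auto simp: classical_behaviour_def continuous_curve_iff_creg[OF M PB] comp_def)
 next
  case Weak
  let ?\<xi> = "%t. (x t, f t, y t, e t, u t)"
  have L: "X : L1c M E a b \<longleftrightarrow> creg Weak M E a b X" if "vector_bundle M E" for X and E :: "('a, 'x::real_vector) vbundle"
   using L1c_iff_creg[OF M that] ab by simp
  \<comment> \<open>Regularity of the whole tuple follows from that of its parts, the differential
    being continuous along the shadow; hence \<open>weakly_in_iff\<close> reduces to membership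
    almost everywhere.\<close>
  have core: "weakly_in 1 M (phs_space M Er Ep) D a b (%t. (x t, ((v t, f t, - y t), (differential M H (x t), e t, u t)))) \<longleftrightarrow>
    holds Weak {a..b} (%t. ((v t, f t, - y t), (differential M H (x t), e t, u t)) : D (x t))"
   if cr: "creg Weak M (port_bundle Er Ep) a b ?\<xi>" and v: "creg Weak M (tangent M) a b (%t. (x t, v t))" for v
  proof -
   have xc: "path_on M a b x" using creg_shadow[OF v] by (simp add: comp_def)
   have "creg Weak M (dbl (phs_space M Er Ep)) a b (%t. (x t, ((v t, f t, - y t), (differential M H (x t), e t, u t))))"
    using cr v creg_differential[OF M H xc] creg_uminus[OF dual_pairD(1)[OF Ep]]
    unfolding creg_dbl_phs_space[OF M Er Ep] creg_port_bundle[OF M Er Ep] by blast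
   then show ?thesis
    using weakly_in_iff[OF M dual_pair_phs_space[OF M Er Ep] max sub ab,
      of x "%t. ((v t, f t, - y t), (differential M H (x t), e t, u t))"] by simp
  qed
  have "(EX X. X : L1c M (tangent M) a b & weak_derivative M a b x X &
    weakly_in 1 M (phs_space M Er Ep) D a b (%t. (x t, ((snd (X t), f t, - y t), (differential M H (x t), e t, u t))))) \<longleftrightarrow>
   (EX v. derivative_along Weak M a b x v & holds Weak {a..b} (%t. ((v t, f t, - y t), (differential M H (x t), e t, u t)) : D (x t)))"
   (is "?l \<longleftrightarrow> ?r") if cr: "creg Weak M (port_bundle Er Ep) a b ?\<xi>"
  proof
   assume ?l
   then obtain X where X: "creg Weak M (tangent M) a b X" "weak_derivative M a b x X"
    "weakly_in 1 M (phs_space M Er Ep) D a b (%t. (x t, ((snd (X t), f t, - y t), (differential M H (x t), e t, u t))))"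
    unfolding L[OF vector_bundle_tangent[OF M]] by blast
   have eq: "X t = (x t, snd (X t))" if "t : {a..b}" for t using X(2) that by (auto simp: weak_derivative_def prod_eq_iff)
   have v: "creg Weak M (tangent M) a b (%t. (x t, snd (X t)))" by (rule creg_cong[OF eq X(1)])
   have "weak_derivative M a b x (%t. (x t, snd (X t)))"
    using X(2) eq unfolding weak_derivative_def by auto
   then show ?r using v X(3)[unfolded core[OF cr v]] by (intro exI[of _ "%t. snd (X t)"]) simp
  next
   assume ?r
   then obtain v where v: "creg Weak M (tangent M) a b (%t. (x t, v t))" "weak_derivative M a b x (%t. (x t, v t))"
    "holds Weak {a..b} (%t. ((v t, f t, - y t), (differential M H (x t), e t, u t)) : D (x t))" by auto
   then show ?l using core[OF cr v(1)] L[OF vector_bundle_tangent[OF M]] by (intro exI[of _ "%t. (x t, v t)"]) simp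
  qed
  then show ?thesis
   unfolding Weak behaviour.simps weak_behaviour_def mem_Collect_eq prod.case comp_def fst_conv L[OF PB] resistive_along.simps by blast
 qed
qed

text \<open>Linear algebra behind the maximality of the interconnection: on \<open>S\<close>, the functional \<open>g\<close> is a
  combination of the functionals that cut out the vectors coupled by \<open>T\<close>.\<close>

lemma solve_coupling:
 assumes S: "subspace S" and g: "functional_on S g" and T: "is_frame n b T"
  and B1: "!!c. c : T ==> functional_on S (B c)" and B2: "!!s. s : S ==> functional_on T (%c. B c s)"
  and ker: "!!s. s : S ==> (!!c. c : T ==> B c s = 0) ==> g s = 0"
 shows "EX c:T. ALL s:S. g s + B c s = 0"
proof -
 have expand: "B (SUM i<n. a i *\<^sub>R b i) s = (SUM i<n. a i * B (b i) s)" if "s : S" for a s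
  using functional_on_sum[OF B2[OF that] is_frame_subspace[OF T], of "{..<n}" b a] is_frame_mem[OF T] by simp
 have "g s = 0" if s: "s : S" and z: "!!i. i < n ==> B (b i) s = 0" for s
 proof (rule ker[OF s])
  fix c assume "c : T"
  then show "B c s = 0" using expand[OF s, of "frame_coord n b c"] z by (simp add: sum_frame_coord[OF T])
 qed
 then obtain a where a: "!!s. s : S ==> g s = (SUM i<n. a i * B (b i) s)"
  using functional_in_span[OF S g, of n "%i. B (b i)"] B1 is_frame_mem[OF T] by blast
 show ?thesis
 proof (intro bexI ballI)
  show "(SUM i<n. (- a i) *\<^sub>R b i) : T" by (rule is_frame_sum_mem[OF T])
  show "g s + B (SUM i<n. (- a i) *\<^sub>R b i) s = 0" if "s : S" for s
   using a[OF that] expand[OF that, of "%i. - a i"] by (simp add: sum_negf)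
 qed
qed

lemma functional_on_compose:
 assumes "functional_on W h" "linear p" "!!s. s : S ==> p s : W"
 shows "functional_on S (%s. h (p s))"
 using assms(1,3) unfolding functional_on_def by (simp add: linear_add[OF assms(2)] linear_scale[OF assms(2)])

lemma dual_space_0: "\<alpha> : dual_space V ==> subspace V ==> \<alpha> 0 = 0"
 using functional_on_0[OF dual_space_functional] subspace_0 by blast

lemma interconnection_mem:
 "((v, (f1, f2), (\<eta>1, \<eta>2)), (\<alpha>, (e1, e2), (u1, u2))) : interconnection M1 M2 D1 D2 Dint (x, y) \<longleftrightarrow>
  v : tangent_space (prod_manifold M1 M2) (x, y) &
  (EX \<alpha>1 \<alpha>2 \<zeta>1 \<zeta>2 w1 w2. \<alpha> = covector_pair M1 M2 (x, y) \<alpha>1 \<alpha>2 & ((\<zeta>1, \<zeta>2), (w1, w2)) : Dint (x, y) &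
   ((proj1 M1 M2 (x, y) v, f1, (\<eta>1, \<zeta>1)), (\<alpha>1, e1, (u1, w1))) : D1 x &
   ((proj2 M1 M2 (x, y) v, f2, (\<eta>2, \<zeta>2)), (\<alpha>2, e2, (u2, w2))) : D2 y)"
 unfolding interconnection_def by (simp only: prod.case mem_Collect_eq prod.inject) blast

text \<open>Let \<open>U\<close> be orthogonal to the fibre. Wanted are internal variables
  \<open>c\<close> in \<open>Dint\<close> that complete \<open>U\<close> to elements of both Dirac
  structures. By their maximality this is a system of linear equations indexed by
  \<open>D1 x \<times> D2 y\<close>, and orthogonality of \<open>U\<close> is precisely its
  solvability condition.\<close>

lemma interconnection_maximal:
 fixes M1 :: "'m1 manifold" and M2 :: "'m2 manifold"
  and Er1 :: "('m1, 'r1::real_vector) vbundle" and Er2 :: "('m2, 'r2::real_vector) vbundle"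
  and Epi1 :: "('m1, 'pi1::real_vector) vbundle" and Epi2 :: "('m2, 'pi2::real_vector) vbundle"
  and Epe1 :: "('m1, 'pe1::real_vector) vbundle" and Epe2 :: "('m2, 'pe2::real_vector) vbundle"
  and D1 :: "('m1, 'r1, 'pi1, 'pe1) split_dirac" and D2 :: "('m2, 'r2, 'pi2, 'pe2) split_dirac"
  and Dint :: "('m1, 'm2, 'pe1, 'pe2) coupling"
 assumes M1: "smooth_manifold M1" and M2: "smooth_manifold M2"
  and E: "vector_bundle M1 Er1" "vector_bundle M2 Er2" "vector_bundle M1 Epi1" "vector_bundle M2 Epi2"
   "vector_bundle M1 Epe1" "vector_bundle M2 Epe2"
  and D1: "dirac_structure M1 (phs_space M1 (with_dual Er1) (psum (with_dual Epi1) (with_dual Epe1))) D1"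
  and D2: "dirac_structure M2 (phs_space M2 (with_dual Er2) (psum (with_dual Epi2) (with_dual Epe2))) D2"
  and Dint: "dirac_structure (prod_manifold M1 M2) (pprod (with_dual Epe1) (with_dual Epe2)) Dint"
 shows "maximal_isotropic 1 (prod_manifold M1 M2)
  (phs_space (prod_manifold M1 M2) (pprod (with_dual Er1) (with_dual Er2)) (pprod (with_dual Epi1) (with_dual Epi2)))
  (interconnection M1 M2 D1 D2 Dint)"
  (is "maximal_isotropic 1 ?P ?ph _")
 unfolding maximal_isotropic_def
proof (intro ballI)
 let ?ph1 = "phs_space M1 (with_dual Er1) (psum (with_dual Epi1) (with_dual Epe1))"
 let ?ph2 = "phs_space M2 (with_dual Er2) (psum (with_dual Epi2) (with_dual Epe2))"
 let ?C = "pprod (with_dual Epe1) (with_dual Epe2)"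
 let ?I = "interconnection M1 M2 D1 D2 Dint"
 note P = smooth_manifold_prod[OF M1 M2]
 have d1: "dual_pair M1 ?ph1" and d2: "dual_pair M2 ?ph2" and dC: "dual_pair ?P ?C"
  by (intro dual_pair_phs_space dual_pair_psum dual_pair_pprod dual_pair_with_dual M1 M2 E)+
 fix z U assume "z : points ?P" and U: "U : fibre (dbl ?ph) z"
 then obtain x y where z: "z = (x, y)" and x: "x : points M1" and y: "y : points M2" by (cases z) auto
 then have xy: "(x, y) : points ?P" by simp
 note fib = dbl_def phs_space_def psum_def pprod_def with_dual_def
 note max1 = dirac_structure_maximal[OF M1 d1 D1, unfolded maximal_isotropic_def, rule_format, OF x]
 note max2 = dirac_structure_maximal[OF M2 d2 D2, unfolded maximal_isotropic_def, rule_format, OF y]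
 note maxC = dirac_structure_maximal[OF P dC Dint, unfolded maximal_isotropic_def, rule_format, OF xy]
 have s1: "subspace (D1 x)" "D1 x \<subseteq> fibre (dbl ?ph1) x" and s2: "subspace (D2 y)" "D2 y \<subseteq> fibre (dbl ?ph2) y"
  and sC: "subspace (Dint (x, y))" "Dint (x, y) \<subseteq> fibre (dbl ?C) (x, y)"
  using D1 D2 Dint x y xy unfolding dirac_structure_def smooth_subbundle_def by blast+
 have sE: "subspace (fibre Epe1 x)" "subspace (fibre Epe2 y)"
  using vb_fibre_subspace[OF E(5) x] vb_fibre_subspace[OF E(6) y] .
 have f1: "pair_form 1 ?ph1 ((v, f, (\<eta>, \<zeta>)), (\<alpha>, e, (u, w))) ((v', f', (\<eta>', \<zeta>')), (\<alpha>', e', (u', w'))) =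
   (\<alpha>' v + e' f + u' \<eta> + \<alpha> v' + e f' + u \<eta>') + (w' \<zeta> + w \<zeta>')" for v f \<eta> \<zeta> \<alpha> e u w v' f' \<eta>' \<zeta>' \<alpha>' e' u' w'
  by (simp add: pair_form_def fib)
 have f2: "pair_form 1 ?ph2 ((v, f, (\<eta>, \<zeta>)), (\<alpha>, e, (u, w))) ((v', f', (\<eta>', \<zeta>')), (\<alpha>', e', (u', w'))) =
   (\<alpha>' v + e' f + u' \<eta> + \<alpha> v' + e f' + u \<eta>') + (w' \<zeta> + w \<zeta>')" for v f \<eta> \<zeta> \<alpha> e u w v' f' \<eta>' \<zeta>' \<alpha>' e' u' w'
  by (simp add: pair_form_def fib)
 have fC: "pair_form 1 ?C ((\<zeta>1, \<zeta>2), (w1, w2)) ((\<zeta>1', \<zeta>2'), (w1', w2')) = (w1' \<zeta>1 + w1 \<zeta>1') + (w2' \<zeta>2 + w2 \<zeta>2')"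
  for \<zeta>1 \<zeta>2 w1 w2 \<zeta>1' \<zeta>2' w1' w2' by (simp add: pair_form_def fib)
 have fP: "pair_form 1 ?ph ((v, (f1, f2), (\<eta>1, \<eta>2)), (covector_pair M1 M2 (x, y) \<alpha>1 \<alpha>2, (e1, e2), (u1, u2)))
    ((v', (f1', f2'), (\<eta>1', \<eta>2')), (covector_pair M1 M2 (x, y) \<alpha>1' \<alpha>2', (e1', e2'), (u1', u2'))) =
   (\<alpha>1' (proj1 M1 M2 (x, y) v) + e1' f1 + u1' \<eta>1 + \<alpha>1 (proj1 M1 M2 (x, y) v') + e1 f1' + u1 \<eta>1') +
   (\<alpha>2' (proj2 M1 M2 (x, y) v) + e2' f2 + u2' \<eta>2 + \<alpha>2 (proj2 M1 M2 (x, y) v') + e2 f2' + u2 \<eta>2')"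
  if "v : tangent_space ?P (x, y)" "v' : tangent_space ?P (x, y)"
  for v v' f1 f2 \<eta>1 \<eta>2 \<alpha>1 \<alpha>2 e1 e2 u1 u2 f1' f2' \<eta>1' \<eta>2' \<alpha>1' \<alpha>2' e1' e2' u1' u2'
  using that by (simp add: pair_form_def fib covector_pair_def)
 show "U : ?I z \<longleftrightarrow> (ALL d:?I z. pair_form 1 ?ph U d = 0)"
  unfolding z
 proof (intro iffI ballI)
  fix d assume UdI: "U : ?I (x, y)" "d : ?I (x, y)"
  obtain v f1 f2 \<eta>1 \<eta>2 \<alpha> e1 e2 u1 u2 where U_eq: "U = ((v, (f1, f2), (\<eta>1, \<eta>2)), (\<alpha>, (e1, e2), (u1, u2)))" by (metis surj_pair)
  obtain v' f1' f2' \<eta>1' \<eta>2' \<alpha>' e1' e2' u1' u2' where d_eq: "d = ((v', (f1', f2'), (\<eta>1', \<eta>2')), (\<alpha>', (e1', e2'), (u1', u2')))"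
   by (metis surj_pair)
  obtain \<alpha>1 \<alpha>2 \<zeta>1 \<zeta>2 w1 w2 \<alpha>1' \<alpha>2' \<zeta>1' \<zeta>2' w1' w2'
   where Ud: "\<alpha> = covector_pair M1 M2 (x, y) \<alpha>1 \<alpha>2" "\<alpha>' = covector_pair M1 M2 (x, y) \<alpha>1' \<alpha>2'"
    and v: "v : tangent_space ?P (x, y)" "v' : tangent_space ?P (x, y)"
    and C: "((\<zeta>1, \<zeta>2), (w1, w2)) : Dint (x, y)" "((\<zeta>1', \<zeta>2'), (w1', w2')) : Dint (x, y)"
    and A: "((proj1 M1 M2 (x, y) v, f1, (\<eta>1, \<zeta>1)), (\<alpha>1, e1, (u1, w1))) : D1 x"
     "((proj1 M1 M2 (x, y) v', f1', (\<eta>1', \<zeta>1')), (\<alpha>1', e1', (u1', w1'))) : D1 x"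
    and B: "((proj2 M1 M2 (x, y) v, f2, (\<eta>2, \<zeta>2)), (\<alpha>2, e2, (u2, w2))) : D2 y"
     "((proj2 M1 M2 (x, y) v', f2', (\<eta>2', \<zeta>2')), (\<alpha>2', e2', (u2', w2'))) : D2 y"
   using UdI unfolding U_eq d_eq interconnection_mem by blast
  have 1: "pair_form 1 ?ph1 ((proj1 M1 M2 (x, y) v, f1, (\<eta>1, \<zeta>1)), (\<alpha>1, e1, (u1, w1)))
    ((proj1 M1 M2 (x, y) v', f1', (\<eta>1', \<zeta>1')), (\<alpha>1', e1', (u1', w1'))) = 0" using max1 A s1(2) by blast
  have 2: "pair_form 1 ?ph2 ((proj2 M1 M2 (x, y) v, f2, (\<eta>2, \<zeta>2)), (\<alpha>2, e2, (u2, w2)))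
    ((proj2 M1 M2 (x, y) v', f2', (\<eta>2', \<zeta>2')), (\<alpha>2', e2', (u2', w2'))) = 0" using max2 B s2(2) by blast
  have 3: "pair_form 1 ?C ((\<zeta>1, \<zeta>2), (w1, w2)) ((\<zeta>1', \<zeta>2'), (w1', w2')) = 0" using maxC C sC(2) by blast
  \<comment> \<open>The external form is the sum of the forms of both systems minus that of the
    internal ports, and all three vanish by isotropy.\<close>
  show "pair_form 1 ?ph U d = 0" using 1 2 3 unfolding U_eq d_eq Ud fP[OF v] f1 f2 fC by linarith
 next
  assume perp: "ALL d:?I (x, y). pair_form 1 ?ph U d = 0"
  obtain v f1 f2 \<eta>1 \<eta>2 \<alpha> e1 e2 u1 u2 where U_eq: "U = ((v, (f1, f2), (\<eta>1, \<eta>2)), (\<alpha>, (e1, e2), (u1, u2)))"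
   by (metis surj_pair)
  have mem: "v : tangent_space ?P (x, y)" "\<alpha> : dual_space (tangent_space ?P (x, y))"
   "f1 : fibre Er1 x" "f2 : fibre Er2 y" "\<eta>1 : fibre Epi1 x" "\<eta>2 : fibre Epi2 y"
   "e1 : dual_space (fibre Er1 x)" "e2 : dual_space (fibre Er2 y)" "u1 : dual_space (fibre Epi1 x)" "u2 : dual_space (fibre Epi2 y)"
   using U unfolding U_eq z by (simp_all add: fib)
  obtain \<alpha>1 \<alpha>2 where \<alpha>: "\<alpha>1 : dual_space (tangent_space M1 x)" "\<alpha>2 : dual_space (tangent_space M2 y)"
   "\<alpha> = covector_pair M1 M2 (x, y) \<alpha>1 \<alpha>2" using covector_pair_surj[OF M1 M2 x y mem(2)] by blast
  define a1 where "a1 \<zeta> w = ((proj1 M1 M2 (x, y) v, f1, (\<eta>1, \<zeta>)), (\<alpha>1, e1, (u1, w)))" for \<zeta> :: 'pe1 and w :: "'pe1 => real"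
  define a2 where "a2 \<zeta> w = ((proj2 M1 M2 (x, y) v, f2, (\<eta>2, \<zeta>)), (\<alpha>2, e2, (u2, w)))" for \<zeta> :: 'pe2 and w :: "'pe2 => real"
  have a1: "a1 \<zeta> w : fibre (dbl ?ph1) x" if "\<zeta> : fibre Epe1 x" "w : dual_space (fibre Epe1 x)" for \<zeta> w
   using that mem \<alpha> proj_tangent(1)[OF M1 M2 x y mem(1)] by (simp add: a1_def fib)
  have a2: "a2 \<zeta> w : fibre (dbl ?ph2) y" if "\<zeta> : fibre Epe2 y" "w : dual_space (fibre Epe2 y)" for \<zeta> w
   using that mem \<alpha> proj_tangent(2)[OF M1 M2 x y mem(1)] by (simp add: a2_def fib)
  have z0: "0 : fibre Epe1 x" "0 : fibre Epe2 y" "0 : dual_space (fibre Epe1 x)" "0 : dual_space (fibre Epe2 y)"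
   using sE by (auto intro: subspace_0 simp: dual_space_def)
  \<comment> \<open>The pairing of \<open>U\<close> with a pair of elements of the Dirac structures
    when the internal ports of \<open>U\<close> are set to zero.\<close>
  define g where "g = (%(s1, s2). pair_form 1 ?ph1 (a1 0 0) s1 + pair_form 1 ?ph2 (a2 0 0) s2)"
  \<comment> \<open>The internal port variables of such a pair.\<close>
  define p where "p s = ((snd (snd (snd (fst (fst s)))), snd (snd (snd (fst (snd s))))), (snd (snd (snd (snd (fst s)))), snd (snd (snd (snd (snd s))))))"
   for s :: "(('m1 tvec \<times> 'r1 \<times> 'pi1 \<times> 'pe1) \<times> ('m1 tvec => real) \<times> ('r1 => real) \<times> ('pi1 => real) \<times> ('pe1 => real)) \<times>
    ('m2 tvec \<times> 'r2 \<times> 'pi2 \<times> 'pe2) \<times> ('m2 tvec => real) \<times> ('r2 => real) \<times> ('pi2 => real) \<times> ('pe2 => real)"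
  have lin: "linear p" by (auto simp: linear_iff p_def)
  have pC: "p s : fibre (dbl ?C) (x, y)" if "s : D1 x \<times> D2 y" for s
   using that s1(2) s2(2) by (cases s) (fastforce simp: p_def fib)
  obtain n b where b: "is_frame n b (Dint (x, y))"
   using Dint xy unfolding dirac_structure_def smooth_subbundle_def by blast
  have "EX c:Dint (x, y). ALL s:D1 x \<times> D2 y. g s + pair_form 1 ?C c (p s) = 0"
  proof (rule solve_coupling[OF subspace_Times[OF s1(1) s2(1)] _ b])
   show "functional_on (D1 x \<times> D2 y) g"
    unfolding g_def
    by (intro functional_on_times functional_on_subset[OF pair_form_functional(1)[OF d1 x a1[OF z0(1,3)]] s1(2)]
      functional_on_subset[OF pair_form_functional(1)[OF d2 y a2[OF z0(2,4)]] s2(2)])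
   show "functional_on (D1 x \<times> D2 y) (%s. pair_form 1 ?C c (p s))" if "c : Dint (x, y)" for c
    by (rule functional_on_compose[OF pair_form_functional(1)[OF dC xy] lin pC]) (use that sC(2) in auto)
   show "functional_on (Dint (x, y)) (%c. pair_form 1 ?C c (p s))" if "s : D1 x \<times> D2 y" for s
    by (rule functional_on_subset[OF pair_form_functional(2)[OF dC xy pC[OF that]] sC(2)])
   fix s assume s: "s : D1 x \<times> D2 y" and ps: "!!c. c : Dint (x, y) ==> pair_form 1 ?C c (p s) = 0"
   obtain v1' f1' \<eta>1' \<zeta>1' \<alpha>1' e1' u1' w1' v2' f2' \<eta>2' \<zeta>2' \<alpha>2' e2' u2' w2' where s_eq:
    "s = (((v1', f1', (\<eta>1', \<zeta>1')), (\<alpha>1', e1', (u1', w1'))), ((v2', f2', (\<eta>2', \<zeta>2')), (\<alpha>2', e2', (u2', w2'))))"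
    by (metis surj_pair)
   have "pair_form 1 ?C (p s) c = pair_form 1 ?C c (p s)" for c by (simp add: pair_form_def)
   \<comment> \<open>Maximality of \<open>Dint\<close>: internal variables orthogonal to all of
     \<open>Dint\<close> lie in it. So \<open>s\<close> is an admissible coupled pair and gives an
     element of the interconnection, to which \<open>U\<close> is orthogonal.\<close>
   then have "p s : Dint (x, y)" using maxC[OF pC[OF s]] ps by auto
   then have C: "((\<zeta>1', \<zeta>2'), (w1', w2')) : Dint (x, y)" by (simp add: p_def s_eq)
   have m: "v1' : tangent_space M1 x" "v2' : tangent_space M2 y" "w1' : dual_space (fibre Epe1 x)" "w2' : dual_space (fibre Epe2 y)"
    using s s1(2) s2(2) unfolding s_eq by (auto simp: fib dest!: subsetD)
   obtain v' where v': "v' : tangent_space ?P (x, y)" "proj1 M1 M2 (x, y) v' = v1'" "proj2 M1 M2 (x, y) v' = v2'"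
    using proj_surj[OF M1 M2 x y m(1,2)] by blast
   have "((v', (f1', f2'), (\<eta>1', \<eta>2')), (covector_pair M1 M2 (x, y) \<alpha>1' \<alpha>2', (e1', e2'), (u1', u2'))) : ?I (x, y)"
    using s C v' unfolding s_eq interconnection_mem by blast
   from bspec[OF perp this] show "g s = 0"
    unfolding U_eq \<alpha>(3) fP[OF mem(1) v'(1)] s_eq g_def prod.case a1_def a2_def f1 f2 v'(2,3)
    using dual_space_0[OF m(3) sE(1)] dual_space_0[OF m(4) sE(2)] by simp
  qed
  then obtain \<zeta>1 \<zeta>2 w1 w2 where c: "((\<zeta>1, \<zeta>2), (w1, w2)) : Dint (x, y)"
   and eq: "!!s. s : D1 x \<times> D2 y ==> g s + pair_form 1 ?C ((\<zeta>1, \<zeta>2), (w1, w2)) (p s) = 0" by (metis surj_pair)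
  have cm: "\<zeta>1 : fibre Epe1 x" "\<zeta>2 : fibre Epe2 y" "w1 : dual_space (fibre Epe1 x)" "w2 : dual_space (fibre Epe2 y)"
   using c sC(2) by (auto simp: fib dest!: subsetD)
  have zero: "pair_form 1 ?ph1 (a1 0 0) 0 = 0" "pair_form 1 ?ph2 (a2 0 0) 0 = 0"
   using functional_on_0[OF functional_on_subset[OF pair_form_functional(1)[OF d1 x a1[OF z0(1,3)]] s1(2)] subspace_0[OF s1(1)]]
    functional_on_0[OF functional_on_subset[OF pair_form_functional(1)[OF d2 y a2[OF z0(2,4)]] s2(2)] subspace_0[OF s2(1)]] .
  have "a1 \<zeta>1 w1 : D1 x"
   unfolding max1[OF a1[OF cm(1,3)]]
  proof
   fix s assume s: "s : D1 x"
   obtain v' f' \<eta>' \<zeta>' \<alpha>' e' u' w' where s_eq: "s = ((v', f', (\<eta>', \<zeta>')), (\<alpha>', e', (u', w')))" by (metis surj_pair)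
   have "w' : dual_space (fibre Epe1 x)" using s s1(2) unfolding s_eq by (auto simp: fib dest!: subsetD)
   then have "w' 0 = 0" "w2 0 = 0" using dual_space_0 sE cm by blast+
   \<comment> \<open>Pairs with zero second component decouple the equations and leave orthogonality
     to \<open>D1 x\<close> alone.\<close>
   moreover have "(s, 0) : D1 x \<times> D2 y" using s subspace_0[OF s2(1)] by simp
   from eq[OF this] have "pair_form 1 ?ph1 (a1 0 0) s + pair_form 1 ?C ((\<zeta>1, \<zeta>2), (w1, w2)) ((\<zeta>', 0), (w', 0)) = 0"
    by (simp add: g_def zero p_def s_eq)
   ultimately show "pair_form 1 ?ph1 (a1 \<zeta>1 w1) s = 0"
    unfolding s_eq a1_def f1 fC by simp
  qed
  moreover have "a2 \<zeta>2 w2 : D2 y"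
   unfolding max2[OF a2[OF cm(2,4)]]
  proof
   fix s assume s: "s : D2 y"
   obtain v' f' \<eta>' \<zeta>' \<alpha>' e' u' w' where s_eq: "s = ((v', f', (\<eta>', \<zeta>')), (\<alpha>', e', (u', w')))" by (metis surj_pair)
   have "w' : dual_space (fibre Epe2 y)" using s s2(2) unfolding s_eq by (auto simp: fib dest!: subsetD)
   then have "w' 0 = 0" "w1 0 = 0" using dual_space_0 sE cm by blast+
   moreover have "(0, s) : D1 x \<times> D2 y" using s subspace_0[OF s1(1)] by simp
   from eq[OF this] have "pair_form 1 ?ph2 (a2 0 0) s + pair_form 1 ?C ((\<zeta>1, \<zeta>2), (w1, w2)) ((0, \<zeta>'), (0, w')) = 0"
    by (simp add: g_def zero p_def s_eq)
   ultimately show "pair_form 1 ?ph2 (a2 \<zeta>2 w2) s = 0"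
    unfolding s_eq a2_def f2 fC by simp
  qed
  ultimately show "U : ?I (x, y)"
   unfolding U_eq \<alpha>(3) interconnection_mem a1_def a2_def using c mem(1) by blast
 qed
qed

section \<open>Behaviours of the interconnected system\<close>

text \<open>Turns the statement on \<open>dim\<close> in \<open>constant_rank\<close> into
  \<open>has_basis\<close>: the solution space lies in a fibre of finite rank.\<close>

lemma coupling_basis:
 assumes T: "is_frame n b T" and S: "subspace S" and lin: "linear j"
 shows "has_basis (dim {c : T. j c : S}) {c : T. j c : S}"
proof (rule has_basis_dim)
 have "{c : T. j c : S} = T \<inter> j -` S" by auto
 then show "subspace {c : T. j c : S}"
  using subspace_inter[OF is_frame_subspace[OF T] linear_subspace_vimage[OF lin S]] by simp
 show "{c : T. j c : S} \<subseteq> span (b ` {..<n})" using T by (auto simp: is_frame_def)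
qed simp

theorem proposition5p5:
  fixes M1 :: "'m1 manifold" and M2 :: "'m2 manifold"
    and Er1 :: "('m1, 'r1::real_vector) vbundle" and Er2 :: "('m2, 'r2::real_vector) vbundle"
    and Epi1 :: "('m1, 'pi1::real_vector) vbundle" and Epi2 :: "('m2, 'pi2::real_vector) vbundle"
    and Epe1 :: "('m1, 'pe1::real_vector) vbundle" and Epe2 :: "('m2, 'pe2::real_vector) vbundle"
    and D1 :: "('m1, 'r1, 'pi1, 'pe1) split_dirac" and D2 :: "('m2, 'r2, 'pi2, 'pe2) split_dirac"
    and Dint :: "('m1, 'm2, 'pe1, 'pe2) coupling"
    and R1 :: "'m1 \<Rightarrow> ('r1 \<times> ('r1 \<Rightarrow> real)) set" and R2 :: "'m2 \<Rightarrow> ('r2 \<times> ('r2 \<Rightarrow> real)) set"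
    and H1 :: "'m1 \<Rightarrow> real" and H2 :: "'m2 \<Rightarrow> real"
    and \<tt> :: behaviour_type and t0 t1 :: real
  assumes "smooth_manifold M1" and "smooth_manifold M2"
    and "vector_bundle M1 Er1" and "vector_bundle M2 Er2"
    and "vector_bundle M1 Epi1" and "vector_bundle M2 Epi2"
    and "vector_bundle M1 Epe1" and "vector_bundle M2 Epe2"
    and "dirac_structure M1
           (phs_space M1 (with_dual Er1) (psum (with_dual Epi1) (with_dual Epe1))) D1"
    and "dirac_structure M2
           (phs_space M2 (with_dual Er2) (psum (with_dual Epi2) (with_dual Epe2))) D2"
    and "lagrangian_subbundle M1 (with_dual Er1) R1" and "non_negative M1 (with_dual Er1) R1"
    and "lagrangian_subbundle M2 (with_dual Er2) R2" and "non_negative M2 (with_dual Er2) R2"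
    and "smooth_fun_on M1 (points M1) H1" and "smooth_fun_on M2 (points M2) H2"
    and "dirac_structure (prod_manifold M1 M2) (pprod (with_dual Epe1) (with_dual Epe2)) Dint"
    and "admissible M1 M2 Er1 Er2 Epi1 Epi2 D1 D2 Dint"
    and "constant_rank (prod_manifold M1 M2) (coupling_kernel D1 D2 Dint)"
    and "t0 < t1"
  shows "behavioural_interconnection t0 t1
           (behaviour \<tt> M1 (with_dual Er1) (psum (with_dual Epi1) (with_dual Epe1)) D1 R1 H1 t0 t1)
           (behaviour \<tt> M2 (with_dual Er2) (psum (with_dual Epi2) (with_dual Epe2)) D2 R2 H2 t0 t1)
           Dint
         = behaviour \<tt> (prod_manifold M1 M2)
             (pprod (with_dual Er1) (with_dual Er2)) (pprod (with_dual Epi1) (with_dual Epi2))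
             (interconnection M1 M2 D1 D2 Dint) (box_sum R1 R2) (\<lambda>(x1, x2). H1 x1 + H2 x2) t0 t1"
proof -
 let ?P = "prod_manifold M1 M2"
 let ?r1 = "with_dual Er1" and ?r2 = "with_dual Er2"
 let ?i1 = "with_dual Epi1" and ?i2 = "with_dual Epi2" and ?e1 = "with_dual Epe1" and ?e2 = "with_dual Epe2"
 let ?ph1 = "phs_space M1 ?r1 (psum ?i1 ?e1)" and ?ph2 = "phs_space M2 ?r2 (psum ?i2 ?e2)"
 let ?C = "pprod ?e1 ?e2" and ?I = "interconnection M1 M2 D1 D2 Dint"
 let ?H = "%(x1, x2). H1 x1 + H2 x2"
 note M1 = assms(1) and M2 = assms(2) and E = assms(3-8) and D1 = assms(9) and D2 = assms(10)
  and H = assms(15,16) and Dint = assms(17) and ab = assms(20)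
 note P = smooth_manifold_prod[OF M1 M2]
 have dr: "dual_pair M1 ?r1" "dual_pair M2 ?r2" and di: "dual_pair M1 ?i1" "dual_pair M2 ?i2"
  and de: "dual_pair M1 ?e1" "dual_pair M2 ?e2"
  by (intro dual_pair_with_dual M1 M2 E)+
 have dp: "dual_pair M1 (psum ?i1 ?e1)" "dual_pair M2 (psum ?i2 ?e2)"
  by (intro dual_pair_psum M1 M2 di de)+
 have dP: "dual_pair ?P (pprod ?r1 ?r2)" "dual_pair ?P (pprod ?i1 ?i2)" "dual_pair ?P ?C"
  by (intro dual_pair_pprod M1 M2 dr di de)+
 have d1: "dual_pair M1 ?ph1" and d2: "dual_pair M2 ?ph2"
  by (intro dual_pair_phs_space M1 M2 dr dp)+
 have sub1: "smooth_subbundle M1 (dbl ?ph1) (vrank (vb ?ph1)) D1" and sub2: "smooth_subbundle M2 (dbl ?ph2) (vrank (vb ?ph2)) D2"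
  and subC: "smooth_subbundle ?P (dbl ?C) (vrank (vb ?C)) Dint"
  using D1 D2 Dint by (auto simp: dirac_structure_def)
 obtain k where subI: "smooth_subbundle ?P (dbl (phs_space ?P (pprod ?r1 ?r2) (pprod ?i1 ?i2))) k ?I"
  using assms(18) unfolding admissible_def by blast
 have R0: "x : points M1 ==> 0 : R1 x" "y : points M2 ==> 0 : R2 y" for x y
  using assms(11,13) unfolding lagrangian_subbundle_def smooth_subbundle_def by (meson subspace_0)+
 note b1 = behaviour_iff[OF M1 dr(1) dp(1) sub1 dirac_structure_maximal[OF M1 d1 D1] H(1) ab]
 note b2 = behaviour_iff[OF M2 dr(2) dp(2) sub2 dirac_structure_maximal[OF M2 d2 D2] H(2) ab]
 note bP = behaviour_iff[OF P dP(1,2) subI interconnection_maximal[OF M1 M2 E D1 D2 Dint] smooth_fun_on_prod_sum[OF M1 M2 H] ab]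
 have fib: "dual_bundle E' = dvb (with_dual E')" "E' = vb (with_dual E')" for E' :: "('z, 'w::real_vector) vbundle" by (simp_all add: with_dual_def)
 \<comment> \<open>Regularity of port curves is split into that of single variables. The component
   systems then differ from the interconnected one only by the internal variables.\<close>
 have cp1: "creg \<tt> M1 (port_bundle ?r1 (psum ?i1 ?e1)) t0 t1 (%t. (x t, f t, (y t, z t), e t, (u t, w t))) \<longleftrightarrow>
   creg \<tt> M1 Er1 t0 t1 (%t. (x t, f t)) & (creg \<tt> M1 Epi1 t0 t1 (%t. (x t, y t)) & creg \<tt> M1 Epe1 t0 t1 (%t. (x t, z t))) &
   creg \<tt> M1 (dual_bundle Er1) t0 t1 (%t. (x t, e t)) &
   (creg \<tt> M1 (dual_bundle Epi1) t0 t1 (%t. (x t, u t)) & creg \<tt> M1 (dual_bundle Epe1) t0 t1 (%t. (x t, w t)))" for x f y z e u w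
  unfolding creg_port_bundle[OF M1 dr(1) dp(1)]
  by (simp add: psum_def with_dual_def creg_dsum[OF M1] vector_bundle_dual[OF M1] E)
 have cp2: "creg \<tt> M2 (port_bundle ?r2 (psum ?i2 ?e2)) t0 t1 (%t. (x t, f t, (y t, z t), e t, (u t, w t))) \<longleftrightarrow>
   creg \<tt> M2 Er2 t0 t1 (%t. (x t, f t)) & (creg \<tt> M2 Epi2 t0 t1 (%t. (x t, y t)) & creg \<tt> M2 Epe2 t0 t1 (%t. (x t, z t))) &
   creg \<tt> M2 (dual_bundle Er2) t0 t1 (%t. (x t, e t)) &
   (creg \<tt> M2 (dual_bundle Epi2) t0 t1 (%t. (x t, u t)) & creg \<tt> M2 (dual_bundle Epe2) t0 t1 (%t. (x t, w t)))" for x f y z e u w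
  unfolding creg_port_bundle[OF M2 dr(2) dp(2)]
  by (simp add: psum_def with_dual_def creg_dsum[OF M2] vector_bundle_dual[OF M2] E)
 have cpP: "creg \<tt> ?P (port_bundle (pprod ?r1 ?r2) (pprod ?i1 ?i2)) t0 t1 (%t. ((x1 t, x2 t), (f1 t, f2 t), (y1 t, y2 t), (e1 t, e2 t), (u1 t, u2 t))) \<longleftrightarrow>
   (creg \<tt> M1 Er1 t0 t1 (%t. (x1 t, f1 t)) & creg \<tt> M2 Er2 t0 t1 (%t. (x2 t, f2 t))) &
   (creg \<tt> M1 Epi1 t0 t1 (%t. (x1 t, y1 t)) & creg \<tt> M2 Epi2 t0 t1 (%t. (x2 t, y2 t))) &
   (creg \<tt> M1 (dual_bundle Er1) t0 t1 (%t. (x1 t, e1 t)) & creg \<tt> M2 (dual_bundle Er2) t0 t1 (%t. (x2 t, e2 t))) &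
   (creg \<tt> M1 (dual_bundle Epi1) t0 t1 (%t. (x1 t, u1 t)) & creg \<tt> M2 (dual_bundle Epi2) t0 t1 (%t. (x2 t, u2 t)))"
  for x1 x2 f1 f2 y1 y2 e1 e2 u1 u2
  unfolding creg_port_bundle[OF P dP(1,2)]
  by (simp add: pprod_def with_dual_def creg_ext_prod[OF M1 M2] vector_bundle_dual[OF M1] vector_bundle_dual[OF M2] E)
 \<comment> \<open>The equality for curves written out in components, which is the form in which
   \<open>behaviour_iff\<close> applies to all three systems.\<close>
 have iff: "(EX z1 z2 w1 w2. (ALL t:{t0..t1}. ((z1 t, z2 t), (w1 t, w2 t)) : Dint (x1 t, x2 t)) &
    (%t. (x1 t, f1 t, (y1 t, - z1 t), e1 t, (u1 t, w1 t))) : behaviour \<tt> M1 ?r1 (psum ?i1 ?e1) D1 R1 H1 t0 t1 &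
    (%t. (x2 t, f2 t, (y2 t, - z2 t), e2 t, (u2 t, w2 t))) : behaviour \<tt> M2 ?r2 (psum ?i2 ?e2) D2 R2 H2 t0 t1) \<longleftrightarrow>
   (%t. ((x1 t, x2 t), (f1 t, f2 t), (y1 t, y2 t), (e1 t, e2 t), (u1 t, u2 t))) :
    behaviour \<tt> ?P (pprod ?r1 ?r2) (pprod ?i1 ?i2) ?I (box_sum R1 R2) ?H t0 t1" (is "?L \<longleftrightarrow> ?R")
  for x1 x2 f1 f2 y1 y2 e1 e2 u1 u2
 proof
  assume ?L
  then obtain z1 z2 w1 w2 where C: "!!t. t : {t0..t1} ==> ((z1 t, z2 t), (w1 t, w2 t)) : Dint (x1 t, x2 t)"
   and B1: "(%t. (x1 t, f1 t, (y1 t, - z1 t), e1 t, (u1 t, w1 t))) : behaviour \<tt> M1 ?r1 (psum ?i1 ?e1) D1 R1 H1 t0 t1"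
   and B2: "(%t. (x2 t, f2 t, (y2 t, - z2 t), e2 t, (u2 t, w2 t))) : behaviour \<tt> M2 ?r2 (psum ?i2 ?e2) D2 R2 H2 t0 t1"
   by blast
  \<comment> \<open>The component behaviour has the output \<open>- z1\<close>; the minus sign in
    the Dirac relation turns it back into \<open>z1\<close>, the value required to lie in
    \<open>Dint\<close>.\<close>
  obtain v1 where v1: "derivative_along \<tt> M1 t0 t1 x1 v1"
   and h1: "holds \<tt> {t0..t1} (%t. ((v1 t, f1 t, - (y1 t, - z1 t)), (differential M1 H1 (x1 t), e1 t, (u1 t, w1 t))) : D1 (x1 t))"
   using B1 unfolding b1 by blast
  obtain v2 where v2: "derivative_along \<tt> M2 t0 t1 x2 v2"
   and h2: "holds \<tt> {t0..t1} (%t. ((v2 t, f2 t, - (y2 t, - z2 t)), (differential M2 H2 (x2 t), e2 t, (u2 t, w2 t))) : D2 (x2 t))"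
   using B2 unfolding b2 by blast
  have m: "x1 t : points M1" "v1 t : tangent_space M1 (x1 t)" "x2 t : points M2" "v2 t : tangent_space M2 (x2 t)"
   if "t : {t0..t1}" for t
   using creg_mem[OF derivative_along_creg[OF M1 ab v1] that] creg_mem[OF derivative_along_creg[OF M2 ab v2] that] by auto
  \<comment> \<open>The joint velocity is lifted pointwise; its regularity comes afterwards from
    \<open>derivative_along_prod\<close>, as the projections are known.\<close>
  have "ALL t:{t0..t1}. EX v. v : tangent_space ?P (x1 t, x2 t) & proj1 M1 M2 (x1 t, x2 t) v = v1 t & proj2 M1 M2 (x1 t, x2 t) v = v2 t"
   using proj_surj[OF M1 M2 m(1,3,2,4)] by blast
  then obtain v where v: "!!t. t : {t0..t1} ==> v t : tangent_space ?P (x1 t, x2 t)"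
   "!!t. t : {t0..t1} ==> proj1 M1 M2 (x1 t, x2 t) (v t) = v1 t" "!!t. t : {t0..t1} ==> proj2 M1 M2 (x1 t, x2 t) (v t) = v2 t"
   by metis
  have "derivative_along \<tt> ?P t0 t1 (%t. (x1 t, x2 t)) v"
  proof (rule iffD2[OF derivative_along_prod[OF M1 M2 ab]], rule v(1), assumption, rule conjI)
   show "derivative_along \<tt> M1 t0 t1 x1 (%t. proj1 M1 M2 (x1 t, x2 t) (v t))"
    by (rule derivative_along_cong[OF _ v1]) (simp add: v(2))
   show "derivative_along \<tt> M2 t0 t1 x2 (%t. proj2 M1 M2 (x1 t, x2 t) (v t))"
    by (rule derivative_along_cong[OF _ v2]) (simp add: v(3))
  qed
  moreover have "holds \<tt> {t0..t1} (%t. ((v t, (f1 t, f2 t), - (y1 t, y2 t)),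
    (differential ?P ?H (x1 t, x2 t), (e1 t, e2 t), (u1 t, u2 t))) : ?I (x1 t, x2 t))"
   \<comment> \<open>In the weak case the two exceptional null sets are united here.\<close>
   using conjI[OF h1 h2, folded holds_conj]
  proof (rule holds_mono)
   fix t assume t: "t : {t0..t1}"
    and h: "((v1 t, f1 t, - (y1 t, - z1 t)), (differential M1 H1 (x1 t), e1 t, (u1 t, w1 t))) : D1 (x1 t) &
     ((v2 t, f2 t, - (y2 t, - z2 t)), (differential M2 H2 (x2 t), e2 t, (u2 t, w2 t))) : D2 (x2 t)"
   show "((v t, (f1 t, f2 t), - (y1 t, y2 t)), (differential ?P ?H (x1 t, x2 t), (e1 t, e2 t), (u1 t, u2 t))) : ?I (x1 t, x2 t)"
    unfolding uminus_Pair interconnection_mem differential_prod[OF M1 M2 m(1,3)[OF t] H]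
    by (intro conjI v(1)[OF t] exI[of _ "differential M1 H1 (x1 t)"] exI[of _ "differential M2 H2 (x2 t)"]
      exI[of _ "z1 t"] exI[of _ "z2 t"] exI[of _ "w1 t"] exI[of _ "w2 t"])
     (use h C[OF t] v(2,3)[OF t] in auto)
  qed
  moreover have "resistive_along \<tt> ?P (pprod ?r1 ?r2) (box_sum R1 R2) t0 t1 (%t. (x1 t, x2 t)) (%t. (f1 t, f2 t)) (%t. (e1 t, e2 t))"
   using B1 B2 unfolding b1 b2 by (intro iffD2[OF resistive_along_prod[OF M1 M2 dr ab]] R0) auto
  ultimately show ?R
   unfolding bP cpP
   using B1 B2 ab unfolding b1 b2 cp1 cp2 by auto
 next
  assume R: ?R
  obtain v where v: "derivative_along \<tt> ?P t0 t1 (%t. (x1 t, x2 t)) v"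
   and h: "holds \<tt> {t0..t1} (%t. ((v t, (f1 t, f2 t), - (y1 t, y2 t)),
    (differential ?P ?H (x1 t, x2 t), (e1 t, e2 t), (u1 t, u2 t))) : ?I (x1 t, x2 t))"
   using R unfolding bP by blast
  note cv = derivative_along_creg[OF P ab v]
  have m: "x1 t : points M1" "x2 t : points M2" "v t : tangent_space ?P (x1 t, x2 t)" if "t : {t0..t1}" for t
   using creg_mem[OF cv that] by auto
  have zc: "path_on ?P t0 t1 (%t. (x1 t, x2 t))" using creg_shadow[OF cv] by (simp add: comp_def)
  then have xc: "path_on M1 t0 t1 x1" "path_on M2 t0 t1 x2"
   by (simp_all add: continuous_map_pairwise comp_def)
  define v1 v2 where "v1 t = proj1 M1 M2 (x1 t, x2 t) (v t)" and "v2 t = proj2 M1 M2 (x1 t, x2 t) (v t)" for t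
  have v12: "derivative_along \<tt> M1 t0 t1 x1 v1" "derivative_along \<tt> M2 t0 t1 x2 v2"
   using iffD1[OF derivative_along_prod[OF M1 M2 ab] v] m(3) by (simp_all add: v1_def[abs_def] v2_def[abs_def])
  \<comment> \<open>The external data of both systems with the internal slots at zero;
    \<open>j\<close> below inserts internal variables into these slots.\<close>
  define \<beta> where "\<beta> t = (((v1 t, f1 t, (- y1 t, 0 :: 'pe1)), (differential M1 H1 (x1 t), e1 t, (u1 t, 0 :: 'pe1 => real))),
    ((v2 t, f2 t, (- y2 t, 0 :: 'pe2)), (differential M2 H2 (x2 t), e2 t, (u2 t, 0 :: 'pe2 => real))))" for t
  define j where "j c = ((((0, 0, (0, fst (fst c))), (0, 0, (0, fst (snd c)))), ((0, 0, (0, snd (fst c))), (0, 0, (0, snd (snd c))))) ::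
    (('m1 tvec \<times> 'r1 \<times> 'pi1 \<times> 'pe1) \<times> ('m1 tvec => real) \<times> ('r1 => real) \<times> ('pi1 => real) \<times> ('pe1 => real)) \<times>
    ('m2 tvec \<times> 'r2 \<times> 'pi2 \<times> 'pe2) \<times> ('m2 tvec => real) \<times> ('r2 => real) \<times> ('pi2 => real) \<times> ('pe2 => real))"
   for c :: "('pe1 \<times> 'pe2) \<times> (('pe1 => real) \<times> ('pe2 => real))"
  have lin: "linear j" by (auto simp: linear_iff j_def)
  let ?B = "ext_prod (dbl ?ph1) (dbl ?ph2)" and ?S = "%z. D1 (fst z) \<times> D2 (snd z)"
  note B1 = vector_bundle_dbl[OF M1 d1] and B2 = vector_bundle_dbl[OF M2 d2]
  note BC = vector_bundle_dbl[OF P dP(3)]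
  have cph1: "creg \<tt>' M1 (dbl ?ph1) c d (%t. (x1 t, ((v t, f t, (y t, z t)), (\<alpha> t, e t, (u t, w t))))) \<longleftrightarrow>
    creg \<tt>' M1 (tangent M1) c d (%t. (x1 t, v t)) & creg \<tt>' M1 Er1 c d (%t. (x1 t, f t)) &
    (creg \<tt>' M1 Epi1 c d (%t. (x1 t, y t)) & creg \<tt>' M1 Epe1 c d (%t. (x1 t, z t))) &
    creg \<tt>' M1 (dual_bundle (tangent M1)) c d (%t. (x1 t, \<alpha> t)) & creg \<tt>' M1 (dual_bundle Er1) c d (%t. (x1 t, e t)) &
    (creg \<tt>' M1 (dual_bundle Epi1) c d (%t. (x1 t, u t)) & creg \<tt>' M1 (dual_bundle Epe1) c d (%t. (x1 t, w t)))"
   for \<tt>' c d v f y z \<alpha> e u w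
   unfolding creg_dbl_phs_space[OF M1 dr(1) dp(1)]
   by (simp add: psum_def with_dual_def creg_dsum[OF M1] vector_bundle_dual[OF M1] E)
  have cph2: "creg \<tt>' M2 (dbl ?ph2) c d (%t. (x2 t, ((v t, f t, (y t, z t)), (\<alpha> t, e t, (u t, w t))))) \<longleftrightarrow>
    creg \<tt>' M2 (tangent M2) c d (%t. (x2 t, v t)) & creg \<tt>' M2 Er2 c d (%t. (x2 t, f t)) &
    (creg \<tt>' M2 Epi2 c d (%t. (x2 t, y t)) & creg \<tt>' M2 Epe2 c d (%t. (x2 t, z t))) &
    creg \<tt>' M2 (dual_bundle (tangent M2)) c d (%t. (x2 t, \<alpha> t)) & creg \<tt>' M2 (dual_bundle Er2) c d (%t. (x2 t, e t)) &
    (creg \<tt>' M2 (dual_bundle Epi2) c d (%t. (x2 t, u t)) & creg \<tt>' M2 (dual_bundle Epe2) c d (%t. (x2 t, w t)))"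
   for \<tt>' c d v f y z \<alpha> e u w
   unfolding creg_dbl_phs_space[OF M2 dr(2) dp(2)]
   by (simp add: psum_def with_dual_def creg_dsum[OF M2] vector_bundle_dual[OF M2] E)
  have cC: "creg \<tt>' ?P (dbl ?C) c d (%t. ((x1 t, x2 t), ((z1 t, z2 t), (w1 t, w2 t)))) \<longleftrightarrow>
    (creg \<tt>' M1 Epe1 c d (%t. (x1 t, z1 t)) & creg \<tt>' M1 (dual_bundle Epe1) c d (%t. (x1 t, w1 t))) &
    (creg \<tt>' M2 Epe2 c d (%t. (x2 t, z2 t)) & creg \<tt>' M2 (dual_bundle Epe2) c d (%t. (x2 t, w2 t)))" for \<tt>' c d z1 z2 w1 w2
   unfolding creg_dbl_pprod[OF M1 M2 de]
   by (simp add: dbl_def with_dual_def creg_dsum[OF M1] creg_dsum[OF M2] vector_bundle_dual[OF M1] vector_bundle_dual[OF M2] E)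
  \<comment> \<open>Besides zeros \<open>j\<close> only rearranges components, so it preserves
    continuity.\<close>
  have jc: "creg Classical ?P ?B c d (%t. ((x1 t, x2 t), j (\<gamma> t)))"
   if cd: "t0 <= c" "d <= t1" and \<gamma>: "creg Classical ?P (dbl ?C) c d (%t. ((x1 t, x2 t), \<gamma> t))" for c d \<gamma>
  proof -
   have sub: "{c..d} \<subseteq> {t0..t1}" using cd by auto
   note x = continuous_map_from_subtopology_mono[OF xc(1) sub] continuous_map_from_subtopology_mono[OF xc(2) sub]
   note z0 = creg_zero[OF _ x(1)] creg_zero[OF _ x(2)]
   have "creg Classical ?P (dbl ?C) c d (%t. ((x1 t, x2 t), ((fst (fst (\<gamma> t)), snd (fst (\<gamma> t))), (fst (snd (\<gamma> t)), snd (snd (\<gamma> t))))))"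
    using \<gamma> by simp
   then show ?thesis
    unfolding j_def creg_ext_prod[OF M1 M2 B1 B2] cph1 cph2 cC
    by (simp add: z0 E vector_bundle_tangent vector_bundle_dual M1 M2)
  qed
  have cb: "creg \<tt> ?P ?B t0 t1 (%t. ((x1 t, x2 t), \<beta> t))"
   unfolding \<beta>_def creg_ext_prod[OF M1 M2 B1 B2] cph1 cph2
   using R derivative_along_creg[OF M1 ab v12(1)] derivative_along_creg[OF M2 ab v12(2)]
   unfolding bP cpP
   by (simp add: creg_zero xc E vector_bundle_dual M1 M2 creg_uminus creg_differential H)
  obtain r where r: "!!z. z : points ?P ==> dim (coupling_kernel D1 D2 Dint z) = r"
   using assms(19) unfolding constant_rank_def by blast
  have rank: "has_basis r {c : Dint (x1 t, x2 t). j c : ?S (x1 t, x2 t)}" if t: "t : {t0..t1}" for t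
  proof -
   \<comment> \<open>The homogeneous problem is exactly the fibre whose dimension is assumed
     constant.\<close>
   have "{c : Dint (x1 t, x2 t). j c : ?S (x1 t, x2 t)} = coupling_kernel D1 D2 Dint (x1 t, x2 t)"
    by (auto simp: coupling_kernel_def j_def)
   moreover obtain n b where "is_frame n b (Dint (x1 t, x2 t))"
    using subC m(1,2)[OF t] unfolding smooth_subbundle_def by (metis SigmaI prod_manifold_simps(1) topspace_prod_topology)
   moreover have "subspace (D1 (x1 t) \<times> D2 (x2 t))"
    using sub1 sub2 m(1,2)[OF t] unfolding smooth_subbundle_def by (auto intro: subspace_Times)
   ultimately show ?thesis using coupling_basis[OF _ _ lin, of n b "Dint (x1 t, x2 t)" "?S (x1 t, x2 t)"] r[of "(x1 t, x2 t)"] m(1,2)[OF t] by simp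
  qed
  have "EX \<gamma>. creg \<tt> ?P (dbl ?C) t0 t1 (%t. ((x1 t, x2 t), \<gamma> t)) & (ALL \<tau>:{t0..t1}. \<gamma> \<tau> : Dint (x1 \<tau>, x2 \<tau>) &
    ((EX c':Dint (x1 \<tau>, x2 \<tau>). \<beta> \<tau> + j c' : ?S (x1 \<tau>, x2 \<tau>)) --> \<beta> \<tau> + j (\<gamma> \<tau>) : ?S (x1 \<tau>, x2 \<tau>)))"
  proof (rule solve_along[OF P vector_bundle_ext_prod[OF M1 M2 B1 B2] BC
     framed_along_times[OF M1 M2 B1 B2 xc framed_along_subbundle[OF M1 B1 sub1 xc(1)] framed_along_subbundle[OF M2 B2 sub2 xc(2)]]
     framed_along_subbundle[OF P BC subC zc] _ _ zc lin jc rank cb])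
   fix t assume t: "t : {t0..t1}"
   show "subspace (?S (x1 t, x2 t))"
    using sub1 sub2 m(1,2)[OF t] unfolding smooth_subbundle_def by (auto intro: subspace_Times)
   show "subspace (Dint (x1 t, x2 t))" using subC m(1,2)[OF t] unfolding smooth_subbundle_def by auto
  qed (use ab in auto)
  then obtain \<gamma> where \<gamma>: "creg \<tt> ?P (dbl ?C) t0 t1 (%t. ((x1 t, x2 t), \<gamma> t))"
   and \<gamma>': "ALL \<tau>:{t0..t1}. \<gamma> \<tau> : Dint (x1 \<tau>, x2 \<tau>) &
    ((EX c':Dint (x1 \<tau>, x2 \<tau>). \<beta> \<tau> + j c' : ?S (x1 \<tau>, x2 \<tau>)) --> \<beta> \<tau> + j (\<gamma> \<tau>) : ?S (x1 \<tau>, x2 \<tau>))"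
   by (elim exE conjE) (rule that)
  \<comment> \<open>This holds at every time, as the behavioural interconnection demands, whereas
    the relations to \<open>D1\<close> and \<open>D2\<close> are obtained only where the
    interconnected relation holds.\<close>
  have \<gamma>C: "\<gamma> t : Dint (x1 t, x2 t)" if "t : {t0..t1}" for t using bspec[OF \<gamma>' that] by (rule conjunct1)
  have sol: "\<beta> t + j (\<gamma> t) : ?S (x1 t, x2 t)" if "t : {t0..t1}" "c : Dint (x1 t, x2 t)" "\<beta> t + j c : ?S (x1 t, x2 t)" for t c
   using conjunct2[OF bspec[OF \<gamma>' that(1)]] by (rule mp) (rule bexI[of _ c], fact that(3), fact that(2))
  define z1 z2 w1 w2 where "z1 t = fst (fst (\<gamma> t))" and "z2 t = snd (fst (\<gamma> t))" and "w1 t = fst (snd (\<gamma> t))" and "w2 t = snd (snd (\<gamma> t))" for t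
  have \<gamma>_eq: "\<gamma> t = ((z1 t, z2 t), (w1 t, w2 t))" for t by (simp add: z1_def z2_def w1_def w2_def)
  have bj: "\<beta> t + j ((\<zeta>1, \<zeta>2), (\<omega>1, \<omega>2)) : ?S (x1 t, x2 t) \<longleftrightarrow>
    ((v1 t, f1 t, (- y1 t, \<zeta>1)), (differential M1 H1 (x1 t), e1 t, (u1 t, \<omega>1))) : D1 (x1 t) &
    ((v2 t, f2 t, (- y2 t, \<zeta>2)), (differential M2 H2 (x2 t), e2 t, (u2 t, \<omega>2))) : D2 (x2 t)" for t \<zeta>1 \<zeta>2 \<omega>1 \<omega>2
   by (simp add: \<beta>_def j_def)
  have hold: "holds \<tt> {t0..t1} (%t. ((v1 t, f1 t, (- y1 t, z1 t)), (differential M1 H1 (x1 t), e1 t, (u1 t, w1 t))) : D1 (x1 t) &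
    ((v2 t, f2 t, (- y2 t, z2 t)), (differential M2 H2 (x2 t), e2 t, (u2 t, w2 t))) : D2 (x2 t))"
   using h
  proof (rule holds_mono)
   fix t assume t: "t : {t0..t1}" and mem: "((v t, (f1 t, f2 t), - (y1 t, y2 t)),
    (differential ?P ?H (x1 t, x2 t), (e1 t, e2 t), (u1 t, u2 t))) : ?I (x1 t, x2 t)"
   obtain \<alpha>1 \<alpha>2 \<zeta>1 \<zeta>2 \<omega>1 \<omega>2 where \<alpha>: "differential ?P ?H (x1 t, x2 t) = covector_pair M1 M2 (x1 t, x2 t) \<alpha>1 \<alpha>2"
    and c: "((\<zeta>1, \<zeta>2), (\<omega>1, \<omega>2)) : Dint (x1 t, x2 t)"
    and D: "((v1 t, f1 t, (- y1 t, \<zeta>1)), (\<alpha>1, e1 t, (u1 t, \<omega>1))) : D1 (x1 t)"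
     "((v2 t, f2 t, (- y2 t, \<zeta>2)), (\<alpha>2, e2 t, (u2 t, \<omega>2))) : D2 (x2 t)"
    using mem unfolding uminus_Pair interconnection_mem v1_def v2_def by blast
   \<comment> \<open>The covector components hidden in the interconnection are covectors of the
     factors, hence by injectivity the differentials of \<open>H1\<close> and \<open>H2\<close>,
     which are the entries of \<open>\<beta>\<close>.\<close>
   have "\<alpha>1 : dual_space (tangent_space M1 (x1 t))" "\<alpha>2 : dual_space (tangent_space M2 (x2 t))"
    using D sub1 sub2 m(1,2)[OF t] unfolding smooth_subbundle_def
    by (fastforce simp: dbl_def phs_space_def psum_def with_dual_def)+
   from covector_pair_inj[OF M1 M2 m(1,2)[OF t] this differential_dual[OF M1 m(1)[OF t]] differential_dual[OF M2 m(2)[OF t]]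
     \<alpha>[unfolded differential_prod[OF M1 M2 m(1,2)[OF t] H], symmetric]]
   have "\<alpha>1 = differential M1 H1 (x1 t)" "\<alpha>2 = differential M2 H2 (x2 t)" .
   then show "((v1 t, f1 t, (- y1 t, z1 t)), (differential M1 H1 (x1 t), e1 t, (u1 t, w1 t))) : D1 (x1 t) &
    ((v2 t, f2 t, (- y2 t, z2 t)), (differential M2 H2 (x2 t), e2 t, (u2 t, w2 t))) : D2 (x2 t)"
    using sol[OF t c] D unfolding \<gamma>_eq bj by blast
  qed
  have res: "resistive_along \<tt> M1 ?r1 R1 t0 t1 x1 f1 e1 & resistive_along \<tt> M2 ?r2 R2 t0 t1 x2 f2 e2"
   using R unfolding bP by (intro iffD1[OF resistive_along_prod[OF M1 M2 dr ab]] R0) auto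
  have cz: "creg \<tt> M1 Epe1 t0 t1 (%t. (x1 t, - z1 t))" "creg \<tt> M2 Epe2 t0 t1 (%t. (x2 t, - z2 t))"
   "creg \<tt> M1 (dual_bundle Epe1) t0 t1 (%t. (x1 t, w1 t))" "creg \<tt> M2 (dual_bundle Epe2) t0 t1 (%t. (x2 t, w2 t))"
   using \<gamma> unfolding \<gamma>_eq cC by (auto intro: creg_uminus E)
  show ?L
  proof (intro exI conjI ballI)
   show "((z1 t, z2 t), (w1 t, w2 t)) : Dint (x1 t, x2 t)" if "t : {t0..t1}" for t
    using \<gamma>C[OF that] unfolding \<gamma>_eq .
   show "(%t. (x1 t, f1 t, (y1 t, - z1 t), e1 t, (u1 t, w1 t))) : behaviour \<tt> M1 ?r1 (psum ?i1 ?e1) D1 R1 H1 t0 t1"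
    unfolding b1 cp1 using R res cz v12(1) hold[unfolded holds_conj] unfolding bP cpP
    by (intro conjI exI[of _ v1]) auto
   show "(%t. (x2 t, f2 t, (y2 t, - z2 t), e2 t, (u2 t, w2 t))) : behaviour \<tt> M2 ?r2 (psum ?i2 ?e2) D2 R2 H2 t0 t1"
    unfolding b2 cp2 using R res cz v12(2) hold[unfolded holds_conj] unfolding bP cpP
    by (intro conjI exI[of _ v2]) auto
  qed
 qed
 show ?thesis
 proof (rule set_eqI)
  fix \<xi> :: "real => ('m1 \<times> 'm2) \<times> ('r1 \<times> 'r2) \<times> ('pi1 \<times> 'pi2) \<times> (('r1 => real) \<times> ('r2 => real)) \<times> (('pi1 => real) \<times> ('pi2 => real))"
  let ?c = "%t. fst (snd (\<xi> t))" and ?y = "%t. fst (snd (snd (\<xi> t)))"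
   and ?e = "%t. fst (snd (snd (snd (\<xi> t))))" and ?u = "%t. snd (snd (snd (snd (\<xi> t))))"
  have \<xi>: "\<xi> = (%t. ((fst (fst (\<xi> t)), snd (fst (\<xi> t))), (fst (?c t), snd (?c t)), (fst (?y t), snd (?y t)),
    (fst (?e t), snd (?e t)), (fst (?u t), snd (?u t))))" by simp
  \<comment> \<open>A curve of quadruples is the same as four curves; this matches the quantifiers
    of \<open>iff\<close>.\<close>
  have ex: "(EX \<eta>. Q \<eta>) \<longleftrightarrow> (EX z1 z2 w1 w2. Q (%t. ((z1 t, z2 t), (w1 t, w2 t))))"
   for Q :: "(real => ('pe1 \<times> 'pe2) \<times> (('pe1 => real) \<times> ('pe2 => real))) => bool"
  proof
   assume "EX \<eta>. Q \<eta>"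
   then obtain \<eta> where "Q (%t. ((fst (fst (\<eta> t)), snd (fst (\<eta> t))), (fst (snd (\<eta> t)), snd (snd (\<eta> t)))))" by auto
   then show "EX z1 z2 w1 w2. Q (%t. ((z1 t, z2 t), (w1 t, w2 t)))"
    by (intro exI[of _ "%t. fst (fst (\<eta> t))"] exI[of _ "%t. snd (fst (\<eta> t))"]
      exI[of _ "%t. fst (snd (\<eta> t))"] exI[of _ "%t. snd (snd (\<eta> t))"])
  qed blast
  show "\<xi> : behavioural_interconnection t0 t1
      (behaviour \<tt> M1 ?r1 (psum ?i1 ?e1) D1 R1 H1 t0 t1) (behaviour \<tt> M2 ?r2 (psum ?i2 ?e2) D2 R2 H2 t0 t1) Dint \<longleftrightarrow>
     \<xi> : behaviour \<tt> ?P (pprod ?r1 ?r2) (pprod ?i1 ?i2) ?I (box_sum R1 R2) ?H t0 t1"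
   by (subst (1 2) \<xi>) (simp only: behavioural_interconnection_def mem_Collect_eq ex prod.case fst_conv iff)
 qed
qed

end
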